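(* Assume that the initial curve $\gamma_0:S^1\to\mathbb R^n$ has a one-to-one convex projection onto the $xy$-plane and that its curve shortening flow $\gamma(\cdot,t)$ develops a Type II singularity as $t\to T$. Then for any limit line $L_1$, there exists another limit line $L_2$ such that $P_{xy}L_1\perp P_{xy}L_2$. Thus the tangent flows are non-unique.
   Context: $S^1=\mathbb R/2\pi\mathbb Z$. A curve shortening flow (CSF) in $\mathbb R^n$ is a smooth map $\gamma:S^1\times[0,T)\to\mathbb R^n$ with each $\gamma(\cdot,t)$ an immersion and $\gamma_t=\gamma_{ss}$, $\partial_s=|\gamma_u|^{-1}\partial_u$; $T$ is the maximal existence time. $P_{xy}$ is the orthogonal projection of $\mathbb R^n=\mathbb R^2\times\mathbb R^{n-2}$ onto the first two coordinates $x,y$. A smooth closed immersed curve $\gamma$ has a one-to-one convex projection (onto the $xy$-plane) if $P_{xy}|_\gamma$ is injective and $P_{xy}(\gamma)$ is a convex curve. The CSF develops a Type I singularity as $t\to T$ if $\limsup_{t\to T}\sup_{u}k^2(u,t)(T-t)<+\infty$ ($k$ the curvature), and a Type II singularity otherwise. It is a known earlier result that a CSF starting from a curve with a one-to-one convex projection keeps this property and shrinks to a point as $t\to T$; this point is assumed to be the origin. The rescaled CSF is $\Gamma(u,\tau):=\gamma(u,t)/\sqrt{2T-2t}$, $\tau:=-\tfrac12\log(T-t)$, with arc-length parameter $\sigma$. For a sequence $\tau_j\to+\infty$, the $j$-th rescaled CSF is $\Gamma_j(\sigma,\tau):=\Gamma(\sigma,\tau_j+\tau)$. $\Gamma_j$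 locally smoothly converges to a rescaled flow $\Gamma_\infty$ if for any real $a<b$ and $R>0$ there are a finite union of closed intervals $I=\cup I_\alpha$, an integer $J$ and smooth time-dependent reparameterizations $\phi_j$ such that for $j\ge J$, $\Gamma_j(\phi_j(u,\tau),\tau)$, $u\in I$, reparameterizes all the arcs $\Gamma_j(\cdot,\tau)\cap\overline{B_R(0)}$ for every $\tau\in[a,b]$, and $\Gamma_j(\phi_j(u,\tau),\tau)\to\Gamma_\infty(u,\tau)$ as smooth functions on $I\times[a,b]$. A (parameterized) tangent flow is a rescaled flow $\Gamma_\infty$ that is such a limit for some sequence $\tau_j\to+\infty$. For a unit vector $\vec v$, the flow $(\mathbb R\sqcup\mathbb R)\times\mathbb R\to\mathbb R^n$, $(\lambda,\tau)\mapsto\lambda\vec v$, is called a stationary line of multiplicity two. Under the hypotheses of the claim, every sequence $\tau_j\to+\infty$ has a subsequence along which $\Gamma_j$ locally smoothly converges to a stationary line $L$ of multiplicity two, with $L$ not perpendicular to the $xy$-plane; a limit line is a line $L$ obtained in this way for some sequence $\tau_j\to+\infty$. *)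

theory Defs
  imports "HOL-Analysis.Analysis" "HOL-Library.Real_Mod"
begin

section \<open>Smooth functions of two real variables\<close>

text \<open>
  A map \<open>f u t\<close> is handled on a product \<open>U \<times> V\<close> of nondegenerate intervals (or finite unions of
  such). \<open>D m l\<close> is the mixed partial derivative of order \<open>m\<close> in \<open>u\<close> and \<open>l\<close> in \<open>t\<close>, one-sided at
  end points; \<open>D\<close> is determined by \<open>f\<close> on \<open>U \<times> V\<close>.
\<close>

definition partials_on ::
  "real set \<Rightarrow> real set \<Rightarrow> (real \<Rightarrow> real \<Rightarrow> 'a::real_normed_vector)
    \<Rightarrow> (nat \<Rightarrow> nat \<Rightarrow> real \<Rightarrow> real \<Rightarrow> 'a) \<Rightarrow> bool" where
  "partials_on U V f D \<longleftrightarrow>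
     (\<forall>u\<in>U. \<forall>t\<in>V. D 0 0 u t = f u t) \<and>
     (\<forall>m l. continuous_on (U \<times> V) (\<lambda>(u, t). D m l u t)) \<and>
     (\<forall>m l. \<forall>u\<in>U. \<forall>t\<in>V.
        ((\<lambda>x. D m l x t) has_vector_derivative D (Suc m) l u t) (at u within U) \<and>
        ((\<lambda>s. D m l u s) has_vector_derivative D m (Suc l) u t) (at t within V))"

definition smooth_on2 ::
  "real set \<Rightarrow> real set \<Rightarrow> (real \<Rightarrow> real \<Rightarrow> 'a::real_normed_vector) \<Rightarrow> bool" where
  "smooth_on2 U V f \<longleftrightarrow> (\<exists>D. partials_on U V f D)"

definition smooth_limit ::
  "real set \<Rightarrow> real set \<Rightarrow> (nat \<Rightarrow> real \<Rightarrow> real \<Rightarrow> 'a::real_normed_vector)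
    \<Rightarrow> (real \<Rightarrow> real \<Rightarrow> 'a) \<Rightarrow> bool" where
  "smooth_limit U V f g \<longleftrightarrow>
     (\<exists>Df Dg. (\<forall>\<^sub>F j in sequentially. partials_on U V (f j) (Df j)) \<and> partials_on U V g Dg \<and>
        (\<forall>m l. uniform_limit (U \<times> V) (\<lambda>j (u, t). Df j m l u t) (\<lambda>(u, t). Dg m l u t)
                 sequentially))"

section \<open>Curve shortening flow\<close>

text \<open>Maps on the circle are \<open>2 * pi\<close>-periodic maps on the real line.\<close>

definition u_deriv :: "(real \<Rightarrow> real \<Rightarrow> 'a::real_normed_vector) \<Rightarrow> real \<Rightarrow> real \<Rightarrow> 'a" where
  "u_deriv f u t = vector_derivative (\<lambda>x. f x t) (at u)"

definition s_deriv ::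
  "(real \<Rightarrow> real \<Rightarrow> 'a::real_normed_vector) \<Rightarrow> (real \<Rightarrow> real \<Rightarrow> 'b::real_normed_vector)
    \<Rightarrow> real \<Rightarrow> real \<Rightarrow> 'b" where
  "s_deriv \<gamma> f u t = u_deriv f u t /\<^sub>R norm (u_deriv \<gamma> u t)"

definition csf :: "(real \<Rightarrow> real \<Rightarrow> 'a::real_normed_vector) \<Rightarrow> real \<Rightarrow> bool" where
  "csf \<gamma> T \<longleftrightarrow>
     T > 0 \<and>
     smooth_on2 UNIV {0..<T} \<gamma> \<and>
     (\<forall>t\<in>{0..<T}. \<forall>u.
        \<gamma> (u + 2 * pi) t = \<gamma> u t \<and>
        u_deriv \<gamma> u t \<noteq> 0 \<and>
        ((\<lambda>s. \<gamma> u s) has_vector_derivative s_deriv \<gamma> (s_deriv \<gamma> \<gamma>) u t) (at t within {0..<T}))"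

definition maximal_csf :: "(real \<Rightarrow> real \<Rightarrow> 'a::real_normed_vector) \<Rightarrow> real \<Rightarrow> bool" where
  "maximal_csf \<gamma> T \<longleftrightarrow>
     csf \<gamma> T \<and> \<not> (\<exists>T' \<beta>. T < T' \<and> csf \<beta> T' \<and> (\<forall>u. \<forall>t\<in>{0..<T}. \<beta> u t = \<gamma> u t))"

definition curvature :: "(real \<Rightarrow> real \<Rightarrow> 'a::real_normed_vector) \<Rightarrow> real \<Rightarrow> real \<Rightarrow> real" where
  "curvature \<gamma> u t = norm (s_deriv \<gamma> (s_deriv \<gamma> \<gamma>) u t)"

definition type_I :: "(real \<Rightarrow> real \<Rightarrow> 'a::real_normed_vector) \<Rightarrow> real \<Rightarrow> bool" where
  "type_I \<gamma> T \<longleftrightarrow>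
     Limsup (at_left T) (\<lambda>t. SUP u. ereal ((curvature \<gamma> u t)\<^sup>2 * (T - t))) < \<infinity>"

definition type_II :: "(real \<Rightarrow> real \<Rightarrow> 'a::real_normed_vector) \<Rightarrow> real \<Rightarrow> bool" where
  "type_II \<gamma> T \<longleftrightarrow> \<not> type_I \<gamma> T"

section \<open>Projection onto the xy-plane\<close>

text \<open>The two distinguished coordinates of \<open>real^'n\<close> are named by two distinct indices \<open>ix\<close>, \<open>iy\<close>.\<close>

definition Pxy :: "'n \<Rightarrow> 'n \<Rightarrow> real^'n \<Rightarrow> real^2" where
  "Pxy ix iy w = vector [w $ ix, w $ iy]"

definition one_to_one_convex_projection :: "'n \<Rightarrow> 'n \<Rightarrow> (real \<Rightarrow> real^'n) \<Rightarrow> bool" where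
  "one_to_one_convex_projection ix iy c \<longleftrightarrow>
     (\<forall>u v. Pxy ix iy (c u) = Pxy ix iy (c v) \<longrightarrow> [u = v] (rmod (2 * pi))) \<and>
     (\<exists>C. compact C \<and> convex C \<and> interior C \<noteq> {} \<and> range (\<lambda>u. Pxy ix iy (c u)) = frontier C)"

section \<open>Rescaled flow, local smooth convergence, tangent flows\<close>

text \<open>The original time is \<open>t = T - exp (-2 * \<tau>)\<close>, obtained by solving \<open>\<tau> = - ln (T - t) / 2\<close>.\<close>

definition rescaled :: "(real \<Rightarrow> real \<Rightarrow> 'a::real_normed_vector) \<Rightarrow> real \<Rightarrow> real \<Rightarrow> real \<Rightarrow> 'a" where
  "rescaled \<gamma> T u \<tau> = (let t = T - exp (- 2 * \<tau>) in \<gamma> u t /\<^sub>R sqrt (2 * T - 2 * t))"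

text \<open>
  The flows occurring as limits live on a disjoint union of components indexed by \<open>K\<close>: component \<open>k\<close>
  is the real line modulo \<open>p k\<close>, that is, a line if \<open>p k = 0\<close> and a circle if \<open>p k > 0\<close>
  (\<open>[u = v] (rmod 0)\<close> means \<open>u = v\<close>). Only the normal part of the equation
  \<open>\<Gamma>\<^sub>\<tau> = \<Gamma>\<^sub>\<sigma>\<^sub>\<sigma> + \<Gamma>\<close> is imposed, since limits are taken modulo time-dependent
  reparameterizations; a stationary line \<open>\<lambda> *\<^sub>R v\<close> moves tangentially under the full equation.
\<close>

definition rescaled_flow ::
  "nat set \<Rightarrow> (nat \<Rightarrow> real) \<Rightarrow> (nat \<Rightarrow> real \<Rightarrow> real \<Rightarrow> 'a::real_normed_vector) \<Rightarrow> bool" where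
  "rescaled_flow K p F \<longleftrightarrow>
     K \<noteq> {} \<and>
     (\<forall>k\<in>K. p k \<ge> 0 \<and> smooth_on2 UNIV UNIV (F k) \<and>
       (\<forall>u \<tau>. F k (u + p k) \<tau> = F k u \<tau> \<and> u_deriv (F k) u \<tau> \<noteq> 0 \<and>
          (\<exists>c. vector_derivative (\<lambda>s. F k u s) (at \<tau>) =
                 s_deriv (F k) (s_deriv (F k) (F k)) u \<tau> + F k u \<tau> + c *\<^sub>R u_deriv (F k) u \<tau>)))"

definition finite_interval_union :: "real set \<Rightarrow> bool" where
  "finite_interval_union A \<longleftrightarrow>
     (\<exists>\<I>. finite \<I> \<and> A = \<Union>\<I> \<and> (\<forall>B\<in>\<I>. \<exists>c d. c < d \<and> B = {c..d}))"

text \<open>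
  The map \<open>(k, u) \<mapsto> \<phi> k u \<tau>\<close>, \<open>u \<in> I k\<close>, is an injective immersion into the circle whose image
  contains every parameter at which the curve \<open>\<Gamma>\<close> is in the closed ball of radius \<open>R\<close>. The image
  may extend beyond the ball, because the part of a curve inside the closed ball need not be a
  finite union of arcs when the curve touches the sphere.
\<close>

definition reparameterizes_arcs ::
  "(nat \<Rightarrow> real) \<Rightarrow> (nat \<Rightarrow> real set) \<Rightarrow> real \<Rightarrow> real \<Rightarrow> real \<Rightarrow> (nat \<Rightarrow> real \<Rightarrow> real \<Rightarrow> real)
    \<Rightarrow> (real \<Rightarrow> real \<Rightarrow> 'a::real_normed_vector) \<Rightarrow> bool" where
  "reparameterizes_arcs p I a b R \<phi> \<Gamma> \<longleftrightarrow>
     (\<forall>k. smooth_on2 (I k) {a..b} (\<phi> k)) \<and>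
     (\<forall>\<tau>\<in>{a..b}.
        (\<forall>k. \<forall>u\<in>I k. \<exists>d. d \<noteq> 0 \<and> ((\<lambda>x. \<phi> k x \<tau>) has_real_derivative d) (at u within I k)) \<and>
        (\<forall>k l. \<forall>u\<in>I k. \<forall>v\<in>I l. [\<phi> k u \<tau> = \<phi> l v \<tau>] (rmod (2 * pi)) \<longleftrightarrow>
            k = l \<and> [u = v] (rmod (p k))) \<and>
        (\<forall>q. norm (\<Gamma> q \<tau>) \<le> R \<longrightarrow> (\<exists>k. \<exists>u\<in>I k. [q = \<phi> k u \<tau>] (rmod (2 * pi)))))"

text \<open>
  \<open>I k\<close> is the part of \<open>I\<close> in component \<open>k\<close>. The requirement that \<open>I\<close> contains all parameters at
  which the limit \<open>F\<close> lies in the ball makes the limit carry its multiplicity: without it a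
  sequence of single arcs would also converge to a line of multiplicity two.
\<close>

definition locally_smoothly_converges ::
  "(nat \<Rightarrow> real \<Rightarrow> real \<Rightarrow> 'a::real_normed_vector) \<Rightarrow> nat set \<Rightarrow> (nat \<Rightarrow> real)
    \<Rightarrow> (nat \<Rightarrow> real \<Rightarrow> real \<Rightarrow> 'a) \<Rightarrow> bool" where
  "locally_smoothly_converges \<Gamma> K p F \<longleftrightarrow>
     (\<forall>a b R. a < b \<and> R > 0 \<longrightarrow>
       (\<exists>I J \<phi>.
          finite {k. I k \<noteq> {}} \<and> {k. I k \<noteq> {}} \<subseteq> K \<and> (\<forall>k. finite_interval_union (I k)) \<and>
          (\<forall>j\<ge>J. reparameterizes_arcs p I a b R (\<phi> j) (\<Gamma> j)) \<and>
          (\<forall>\<tau>\<in>{a..b}. \<forall>k\<in>K. \<forall>u. norm (F k u \<tau>) \<le> R \<longrightarrow> (\<exists>v\<in>I k. [u = v] (rmod (p k)))) \<and>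
          (\<forall>k\<in>K. smooth_limit (I k) {a..b} (\<lambda>j u \<tau>. \<Gamma> j (\<phi> j k u \<tau>) \<tau>) (F k))))"

definition limit_of_rescalings ::
  "(real \<Rightarrow> real \<Rightarrow> 'a::real_normed_vector) \<Rightarrow> real \<Rightarrow> nat set \<Rightarrow> (nat \<Rightarrow> real)
    \<Rightarrow> (nat \<Rightarrow> real \<Rightarrow> real \<Rightarrow> 'a) \<Rightarrow> bool" where
  "limit_of_rescalings \<gamma> T K p F \<longleftrightarrow>
     (\<exists>\<tau>s. filterlim \<tau>s at_top sequentially \<and>
        locally_smoothly_converges (\<lambda>j u \<tau>. rescaled \<gamma> T u (\<tau>s j + \<tau>)) K p F)"

definition tangent_flow ::
  "(real \<Rightarrow> real \<Rightarrow> 'a::real_normed_vector) \<Rightarrow> real \<Rightarrow> nat set \<Rightarrow> (nat \<Rightarrow> real)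
    \<Rightarrow> (nat \<Rightarrow> real \<Rightarrow> real \<Rightarrow> 'a) \<Rightarrow> bool" where
  "tangent_flow \<gamma> T K p F \<longleftrightarrow> rescaled_flow K p F \<and> limit_of_rescalings \<gamma> T K p F"

text \<open>
  Two parameterized tangent flows are told apart by the sets they trace out, so that a mere
  reparameterization does not count as a different flow.
\<close>

definition tangent_flows_nonunique ::
  "(real \<Rightarrow> real \<Rightarrow> 'a::real_normed_vector) \<Rightarrow> real \<Rightarrow> bool" where
  "tangent_flows_nonunique \<gamma> T \<longleftrightarrow>
     (\<exists>K p F K' p' F'. tangent_flow \<gamma> T K p F \<and> tangent_flow \<gamma> T K' p' F' \<and>
        (\<exists>\<tau>. (\<Union>k\<in>K. range (\<lambda>u. F k u \<tau>)) \<noteq> (\<Union>k\<in>K'. range (\<lambda>u. F' k u \<tau>))))"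

section \<open>Limit lines\<close>

definition perpendicular_to_xy :: "'n \<Rightarrow> 'n \<Rightarrow> (real^'n::finite) set \<Rightarrow> bool" where
  "perpendicular_to_xy ix iy L \<longleftrightarrow>
     (\<forall>w\<in>L. orthogonal w (axis ix 1) \<and> orthogonal w (axis iy 1))"

text \<open>The stationary line of multiplicity two consists of two components \<open>0\<close>, \<open>1\<close>, both lines.\<close>

definition limit_line ::
  "'n \<Rightarrow> 'n \<Rightarrow> (real \<Rightarrow> real \<Rightarrow> real^'n::finite) \<Rightarrow> real \<Rightarrow> (real^'n) set \<Rightarrow> bool" where
  "limit_line ix iy \<gamma> T L \<longleftrightarrow>
     (\<exists>v. norm v = 1 \<and> L = range (\<lambda>x. x *\<^sub>R v) \<and>
        limit_of_rescalings \<gamma> T {0, 1} (\<lambda>_. 0) (\<lambda>_ x _. x *\<^sub>R v)) \<and>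
     \<not> perpendicular_to_xy ix iy L"

end

theory Submission
  imports Defs
begin

text \<open>
  The hypotheses exclude each other: a flow that starts from a curve with a one-to-one convex
  projection is of Type I. Any linear function \<open>w\<close> of the position satisfies \<open>w\<^sub>t = w\<^sub>s\<^sub>s\<close>, so
  the number of its sign changes along the curve does not grow. For functions of the
  projected coordinates \<open>x, y\<close> it is two initially, hence always; this makes the projection an
  immersed convex curve. Counting the sign changes of \<open>(z - a x - b y)\<^sub>s\<close> for a further coordinate
  \<open>z\<close> and large \<open>(a, b)\<close> bounds \<open>x\<^sub>s\<^sup>2 + y\<^sub>s\<^sup>2\<close> from below, so that the projection evolves by a
  uniformly parabolic equation with coefficient between \<open>\<rho>\<close> and \<open>1\<close>.

  The convex hulls of the projections are nested. If a hull is very thin, barriers (grim reapers at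
  the tips, Angenent ovals inside, parabolas over chords) show that its length shrinks much
  faster than its height, so that the ratio of inner radius to diameter is bounded below for all
  times. An interior disc of size comparable to the diameter then survives for a time comparable
  to \<open>T - t\<close>, and Tso's maximum principle argument for the quotient of the squared curvature and
  the squared support function about its centre gives \<open>k\<^sup>2 (T - t) \<le> C\<close>.
\<close>

section \<open>Smooth functions of parameter and time\<close>

text \<open>The projection does not move by its own curvature: its normal velocity is its planar
  curvature times \<open>r2\<close>, the squared speed of the projection relative to arclength in
  space, and \<open>r2\<close> depends on the coordinates that the projection forgets. Monotone
  quantities of the planar flow are therefore out of reach, and every comparison has to survive an
  unknown factor between \<open>\<rho>\<close> and 1. This is why the reapers are slowed down by
  \<open>\<rho>\<close>, why the ovals are run too fast, and why the shape is controlled by a crude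
  dichotomy instead of a monotone ratio: over a step, the ratio of area to squared diameter either
  keeps a fixed fraction of its value or doubles somewhere on the way. Starting from the last time
  at which a threshold held excludes the doubling, so the loss occurs only once. Zeros are never
  counted: a sign change carries a margin that decays at a controlled rate, which turns Sturm's
  theorem into a maximum principle at four extrema.\<close>

definition du :: "real set \<Rightarrow> (real \<Rightarrow> real \<Rightarrow> real) \<Rightarrow> real \<Rightarrow> real \<Rightarrow> real" where
  "du I f u t = (if t \<in> I then deriv (\<lambda>x. f x t) u else 0)"

definition dt :: "real set \<Rightarrow> (real \<Rightarrow> real \<Rightarrow> real) \<Rightarrow> real \<Rightarrow> real \<Rightarrow> real" where
  "dt I f u t = (if t \<in> I then deriv (\<lambda>s. f u s) t else 0)"

text \<open>In the composition rule \<open>\<phi> k\<close> is the \<open>k\<close>-th derivative of the outer function.\<close>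

inductive_set jets :: "(real \<Rightarrow> real \<Rightarrow> real) set \<Rightarrow> real set \<Rightarrow> (real \<Rightarrow> real \<Rightarrow> real) set"
  for B :: "(real \<Rightarrow> real \<Rightarrow> real) set" and I :: "real set" where
  jets_base: "f \<in> B \<Longrightarrow> f \<in> jets B I"
| jets_const: "(\<lambda>u t. c) \<in> jets B I"
| jets_time: "(\<lambda>u t. t) \<in> jets B I"
| jets_add: "f \<in> jets B I \<Longrightarrow> g \<in> jets B I \<Longrightarrow> (\<lambda>u t. f u t + g u t) \<in> jets B I"
| jets_mult: "f \<in> jets B I \<Longrightarrow> g \<in> jets B I \<Longrightarrow> (\<lambda>u t. f u t * g u t) \<in> jets B I"
| jets_comp: "f \<in> jets B I \<Longrightarrow>
    (\<And>k u t. t \<in> I \<Longrightarrow> (\<phi> k has_real_derivative \<phi> (Suc k) (f u t)) (at (f u t))) \<Longrightarrow>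
    (\<lambda>u t. \<phi> (0::nat) (f u t)) \<in> jets B I"
| jets_cong: "f \<in> jets B I \<Longrightarrow> (\<And>u t. t \<in> I \<Longrightarrow> g u t = f u t) \<Longrightarrow> g \<in> jets B I"

text \<open>The same \<open>fut\<close> in both mixed positions carries the symmetry of second
  derivatives through the induction, so no theorem on mixed partials is invoked. Only the first
  derivatives have to lie in \<open>A\<close>; higher ones are reached by iteration.\<close>

definition jet2 :: "real set \<Rightarrow> (real \<Rightarrow> real \<Rightarrow> real) set \<Rightarrow> (real \<Rightarrow> real \<Rightarrow> real) \<Rightarrow> bool" where
  "jet2 I A f \<longleftrightarrow> continuous_on (UNIV \<times> I) (\<lambda>(u, t). f u t) \<and>
    (\<exists>fu\<in>A. \<exists>ft\<in>A. \<exists>fut. \<forall>u. \<forall>t\<in>I.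
      ((\<lambda>x. f x t) has_real_derivative fu u t) (at u) \<and>
      ((\<lambda>s. f u s) has_real_derivative ft u t) (at t) \<and>
      ((\<lambda>s. fu u s) has_real_derivative fut u t) (at t) \<and>
      ((\<lambda>x. ft x t) has_real_derivative fut u t) (at u))"

lemma jet2I:
  assumes "continuous_on (UNIV \<times> I) (\<lambda>(u, t). f u t)" "fu \<in> A" "ft \<in> A"
    and "\<And>u t. t \<in> I \<Longrightarrow> ((\<lambda>x. f x t) has_real_derivative fu u t) (at u)"
    and "\<And>u t. t \<in> I \<Longrightarrow> ((\<lambda>s. f u s) has_real_derivative ft u t) (at t)"
    and "\<And>u t. t \<in> I \<Longrightarrow> ((\<lambda>s. fu u s) has_real_derivative fut u t) (at t)"
    and "\<And>u t. t \<in> I \<Longrightarrow> ((\<lambda>x. ft x t) has_real_derivative fut u t) (at u)"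
  shows "jet2 I A f"
  unfolding jet2_def using assms by blast

locale jet_algebra =
  fixes B :: "(real \<Rightarrow> real \<Rightarrow> real) set" and I :: "real set"
  assumes openI: "open I"
    and base: "f \<in> B \<Longrightarrow> jet2 I B f"
begin

abbreviation "J \<equiv> jets B I"

text \<open>Each closure rule differentiates into expressions built by the same rules. For
  compositions this is why the rule asks for a whole sequence of derivatives: dropping its first
  member leaves an admissible sequence for the derivative.\<close>

lemma jet2_J:
  assumes "f \<in> J"
  shows "jet2 I J f"
  using assms
proof induction
  case (jets_base f)
  then show ?case
    using base[OF jets_base] unfolding jet2_def by (meson jets.jets_base)
next
  case (jets_const c)
  have "(\<lambda>u t. 0) \<in> J" by (rule jets.jets_const)
  then show ?case
    by (intro jet2I[where fu = "\<lambda>u t. 0" and ft = "\<lambda>u t. 0" and fut = "\<lambda>u t. 0"])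
       (auto intro!: continuous_intros derivative_eq_intros simp: case_prod_unfold)
next
  case jets_time
  have "(\<lambda>u t. 0) \<in> J" "(\<lambda>u t. 1) \<in> J" by (rule jets.jets_const)+
  then show ?case
    by (intro jet2I[where fu = "\<lambda>u t. 0" and ft = "\<lambda>u t. 1" and fut = "\<lambda>u t. 0"])
       (auto intro!: continuous_intros derivative_eq_intros simp: case_prod_unfold)
next
  case (jets_add f g)
  obtain fu ft fut where f: "fu \<in> J" "ft \<in> J" "\<And>u t. t \<in> I \<Longrightarrow>
      ((\<lambda>x. f x t) has_real_derivative fu u t) (at u) \<and>
      ((\<lambda>s. f u s) has_real_derivative ft u t) (at t) \<and>
      ((\<lambda>s. fu u s) has_real_derivative fut u t) (at t) \<and>
      ((\<lambda>x. ft x t) has_real_derivative fut u t) (at u)"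
    using jets_add.IH(1) unfolding jet2_def by blast
  obtain gu gt gut where g: "gu \<in> J" "gt \<in> J" "\<And>u t. t \<in> I \<Longrightarrow>
      ((\<lambda>x. g x t) has_real_derivative gu u t) (at u) \<and>
      ((\<lambda>s. g u s) has_real_derivative gt u t) (at t) \<and>
      ((\<lambda>s. gu u s) has_real_derivative gut u t) (at t) \<and>
      ((\<lambda>x. gt x t) has_real_derivative gut u t) (at u)"
    using jets_add.IH(2) unfolding jet2_def by blast
  have c: "continuous_on (UNIV \<times> I) (\<lambda>(u, t). f u t + g u t)"
    using jets_add.IH unfolding jet2_def by (auto intro!: continuous_intros simp: case_prod_unfold)
  show ?case
    using f g c
    by (intro jet2I[where fu = "\<lambda>u t. fu u t + gu u t" and ft = "\<lambda>u t. ft u t + gt u t"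
          and fut = "\<lambda>u t. fut u t + gut u t"])
       (auto intro!: jets.jets_add derivative_eq_intros)
next
  case (jets_mult f g)
  obtain fu ft fut where f: "fu \<in> J" "ft \<in> J" "\<And>u t. t \<in> I \<Longrightarrow>
      ((\<lambda>x. f x t) has_real_derivative fu u t) (at u) \<and>
      ((\<lambda>s. f u s) has_real_derivative ft u t) (at t) \<and>
      ((\<lambda>s. fu u s) has_real_derivative fut u t) (at t) \<and>
      ((\<lambda>x. ft x t) has_real_derivative fut u t) (at u)"
    using jets_mult.IH(1) unfolding jet2_def by blast
  obtain gu gt gut where g: "gu \<in> J" "gt \<in> J" "\<And>u t. t \<in> I \<Longrightarrow>
      ((\<lambda>x. g x t) has_real_derivative gu u t) (at u) \<and>
      ((\<lambda>s. g u s) has_real_derivative gt u t) (at t) \<and>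
      ((\<lambda>s. gu u s) has_real_derivative gut u t) (at t) \<and>
      ((\<lambda>x. gt x t) has_real_derivative gut u t) (at u)"
    using jets_mult.IH(2) unfolding jet2_def by blast
  have c: "continuous_on (UNIV \<times> I) (\<lambda>(u, t). f u t * g u t)"
    using jets_mult.IH unfolding jet2_def by (auto intro!: continuous_intros simp: case_prod_unfold)
  show ?case
  proof (rule jet2I[where fu = "\<lambda>u t. fu u t * g u t + f u t * gu u t"
      and ft = "\<lambda>u t. ft u t * g u t + f u t * gt u t"
      and fut = "\<lambda>u t. fut u t * g u t + fu u t * gt u t + ft u t * gu u t + f u t * gut u t"])
    show "(\<lambda>u t. fu u t * g u t + f u t * gu u t) \<in> J"
      "(\<lambda>u t. ft u t * g u t + f u t * gt u t) \<in> J"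
      using f g jets_mult.hyps by (auto intro!: jets.jets_add jets.jets_mult)
  qed (use f g c in \<open>auto intro!: derivative_eq_intros simp: algebra_simps\<close>)
next
  case (jets_comp f \<phi>)
  obtain fu ft fut where f: "fu \<in> J" "ft \<in> J" "\<And>u t. t \<in> I \<Longrightarrow>
      ((\<lambda>x. f x t) has_real_derivative fu u t) (at u) \<and>
      ((\<lambda>s. f u s) has_real_derivative ft u t) (at t) \<and>
      ((\<lambda>s. fu u s) has_real_derivative fut u t) (at t) \<and>
      ((\<lambda>x. ft x t) has_real_derivative fut u t) (at u)"
    using jets_comp.IH unfolding jet2_def by blast
  have d: "(\<phi> k has_real_derivative \<phi> (Suc k) (f u t)) (at (f u t))" if "t \<in> I" for k u t
    using jets_comp.hyps(2) that by blast
  have chain: "((\<lambda>x. \<phi> k (h x)) has_real_derivative \<phi> (Suc k) (h y) * h') (at y)"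
    if "(h has_real_derivative h') (at y)" "(\<phi> k has_real_derivative \<phi> (Suc k) (h y)) (at (h y))"
    for k h h' y
    using DERIV_chain2[OF that(2) that(1)] .
  have c: "continuous_on (UNIV \<times> I) (\<lambda>(u, t). \<phi> 0 (f u t))"
  proof -
    have "isCont (\<phi> 0) (f u t)" if "t \<in> I" for u t
      using d[OF that] DERIV_isCont by blast
    then have "continuous_on ((\<lambda>(u, t). f u t) ` (UNIV \<times> I)) (\<phi> 0)"
      by (intro continuous_at_imp_continuous_on) auto
    moreover have "continuous_on (UNIV \<times> I) (\<lambda>(u, t). f u t)"
      using jets_comp.IH unfolding jet2_def by blast
    ultimately have "continuous_on (UNIV \<times> I) (\<phi> 0 \<circ> (\<lambda>(u, t). f u t))"
      by (intro continuous_on_compose)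
    then show ?thesis by (simp add: o_def case_prod_unfold)
  qed
  have phi1: "(\<lambda>u t. \<phi> (Suc 0) (f u t)) \<in> J"
    using jets.jets_comp[OF jets_comp.hyps(1), of "\<lambda>k. \<phi> (Suc k)"] d by simp
  show ?case
  proof (rule jet2I[where fu = "\<lambda>u t. \<phi> (Suc 0) (f u t) * fu u t"
      and ft = "\<lambda>u t. \<phi> (Suc 0) (f u t) * ft u t"
      and fut = "\<lambda>u t. \<phi> (Suc (Suc 0)) (f u t) * ft u t * fu u t + \<phi> (Suc 0) (f u t) * fut u t"])
    show "(\<lambda>u t. \<phi> (Suc 0) (f u t) * fu u t) \<in> J" "(\<lambda>u t. \<phi> (Suc 0) (f u t) * ft u t) \<in> J"
      using f phi1 by (auto intro!: jets.jets_mult)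
    show "continuous_on (UNIV \<times> I) (\<lambda>(u, t). \<phi> 0 (f u t))" by (rule c)
  next
    fix u t assume t: "t \<in> I"
    show "((\<lambda>x. \<phi> 0 (f x t)) has_real_derivative \<phi> (Suc 0) (f u t) * fu u t) (at u)"
      "((\<lambda>s. \<phi> 0 (f u s)) has_real_derivative \<phi> (Suc 0) (f u t) * ft u t) (at t)"
      using f(3)[OF t] d[OF t] by (auto intro!: chain)
    show "((\<lambda>s. \<phi> (Suc 0) (f u s) * fu u s) has_real_derivative
        \<phi> (Suc (Suc 0)) (f u t) * ft u t * fu u t + \<phi> (Suc 0) (f u t) * fut u t) (at t)"
      using f(3)[OF t, of u] d[OF t] by (auto intro!: derivative_eq_intros chain simp: algebra_simps)
    show "((\<lambda>x. \<phi> (Suc 0) (f x t) * ft x t) has_real_derivative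
        \<phi> (Suc (Suc 0)) (f u t) * ft u t * fu u t + \<phi> (Suc 0) (f u t) * fut u t) (at u)"
      using f(3)[OF t, of u] d[OF t] by (auto intro!: derivative_eq_intros chain simp: algebra_simps)
  qed
next
  case (jets_cong f g)
  obtain fu ft fut where f: "fu \<in> J" "ft \<in> J" "\<And>u t. t \<in> I \<Longrightarrow>
      ((\<lambda>x. f x t) has_real_derivative fu u t) (at u) \<and>
      ((\<lambda>s. f u s) has_real_derivative ft u t) (at t) \<and>
      ((\<lambda>s. fu u s) has_real_derivative fut u t) (at t) \<and>
      ((\<lambda>x. ft x t) has_real_derivative fut u t) (at u)"
    using jets_cong.IH unfolding jet2_def by blast
  have c: "continuous_on (UNIV \<times> I) (\<lambda>(u, t). g u t)"
    using jets_cong unfolding jet2_def by (auto cong: continuous_on_cong_simp simp: case_prod_unfold mem_Times_iff)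
  have gu: "((\<lambda>x. g x t) has_real_derivative fu u t) (at u)" if "t \<in> I" for u t
    using f(3)[OF that] jets_cong.hyps(2)[OF that] by simp
  have gt: "((\<lambda>s. g u s) has_real_derivative ft u t) (at t)" if "t \<in> I" for u t
    using f(3)[OF that] jets_cong.hyps(2) that openI
    by (metis has_field_derivative_transform_within_open)
  show ?case unfolding jet2_def
    using f c gu gt by blast
qed

lemma
  assumes "f \<in> J"
  shows J_cont: "continuous_on (UNIV \<times> I) (\<lambda>(u, t). f u t)"
    and J_du: "t \<in> I \<Longrightarrow> ((\<lambda>x. f x t) has_real_derivative du I f u t) (at u)"
    and J_dt: "t \<in> I \<Longrightarrow> ((\<lambda>s. f u s) has_real_derivative dt I f u t) (at t)"
    and du_J: "du I f \<in> J"
    and dt_J: "dt I f \<in> J"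
    and dt_du: "dt I (du I f) = du I (dt I f)"
proof -
  obtain fu ft fut where f: "fu \<in> J" "ft \<in> J" "\<And>u t. t \<in> I \<Longrightarrow>
      ((\<lambda>x. f x t) has_real_derivative fu u t) (at u) \<and>
      ((\<lambda>s. f u s) has_real_derivative ft u t) (at t) \<and>
      ((\<lambda>s. fu u s) has_real_derivative fut u t) (at t) \<and>
      ((\<lambda>x. ft x t) has_real_derivative fut u t) (at u)"
    and c: "continuous_on (UNIV \<times> I) (\<lambda>(u, t). f u t)"
    using jet2_J[OF assms] unfolding jet2_def by blast
  show "continuous_on (UNIV \<times> I) (\<lambda>(u, t). f u t)" by (rule c)
  have u: "du I f u t = fu u t" and t: "dt I f u t = ft u t" if "t \<in> I" for u t
    using f(3)[OF that] that unfolding du_def dt_def by (auto dest: DERIV_imp_deriv)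
  show "((\<lambda>x. f x t) has_real_derivative du I f u t) (at u)" if "t \<in> I" for u t
    using f(3) u that by metis
  show "((\<lambda>s. f u s) has_real_derivative dt I f u t) (at t)" if "t \<in> I" for u t
    using f(3) t that by metis
  show "du I f \<in> J" "dt I f \<in> J"
    using jets_cong[OF f(1)] jets_cong[OF f(2)] u t by blast+
  have "((\<lambda>s. du I f u s) has_real_derivative fut u t) (at t)" if "t \<in> I" for u t
    using f(3)[OF that] u that openI by (metis has_field_derivative_transform_within_open)
  moreover have "((\<lambda>x. dt I f x t) has_real_derivative fut u t) (at u)" if "t \<in> I" for u t
    using f(3)[OF that] t[OF that] by simp
  ultimately have "deriv (\<lambda>s. du I f u s) t = fut u t \<and> deriv (\<lambda>x. dt I f x t) u = fut u t"
    if "t \<in> I" for u t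
    using that DERIV_imp_deriv by blast
  then have "dt I (du I f) u t = du I (dt I f) u t" for u t
    unfolding du_def[of I "dt I f"] dt_def[of I "du I f"] by auto
  then show "dt I (du I f) = du I (dt I f)" by blast
qed

lemma J_periodic:
  assumes "f \<in> J" "\<And>f u t. f \<in> B \<Longrightarrow> t \<in> I \<Longrightarrow> f (u + p) t = f u t" "t \<in> I"
  shows "f (u + p) t = f u t"
  using assms(1,3) by (induction arbitrary: u t) (auto simp: assms(2))

text \<open>The value 0 off \<open>I\<close> is what turns pointwise rules into equations between
  functions, which can then be rewritten under further derivatives.\<close>

lemma du_eqI: "(\<And>u t. t \<in> I \<Longrightarrow> ((\<lambda>x. f x t) has_real_derivative g u t) (at u)) \<Longrightarrow>
    (\<And>u t. t \<notin> I \<Longrightarrow> g u t = 0) \<Longrightarrow> du I f = g"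
  by (intro ext) (auto simp: du_def dest: DERIV_imp_deriv)

lemma dt_eqI: "(\<And>u t. t \<in> I \<Longrightarrow> ((\<lambda>s. f u s) has_real_derivative g u t) (at t)) \<Longrightarrow>
    (\<And>u t. t \<notin> I \<Longrightarrow> g u t = 0) \<Longrightarrow> dt I f = g"
  by (intro ext) (auto simp: dt_def dest: DERIV_imp_deriv)

lemma du_out: "t \<notin> I \<Longrightarrow> du I f u t = 0" and dt_out: "t \<notin> I \<Longrightarrow> dt I f u t = 0"
  by (simp_all add: du_def dt_def)

lemma J_diff: "f \<in> J \<Longrightarrow> g \<in> J \<Longrightarrow> (\<lambda>u t. f u t - g u t) \<in> J"
  using jets_add[OF _ jets_mult[OF jets_const[of "-1"]], of f B I g] by simp

lemma J_minus: "f \<in> J \<Longrightarrow> (\<lambda>u t. - f u t) \<in> J"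
  using jets_mult[OF jets_const[of "-1"], of f B I] by simp

lemma J_power: "f \<in> J \<Longrightarrow> (\<lambda>u t. f u t ^ n) \<in> J"
  by (induction n) (auto intro: jets_const jets_mult)

lemma J_sum: "(\<And>i. i \<in> K \<Longrightarrow> f i \<in> J) \<Longrightarrow> (\<lambda>u t. \<Sum>i\<in>K. f i u t) \<in> J"
  by (induction K rule: infinite_finite_induct) (auto intro: jets_const jets_add)

lemma J_exp: "f \<in> J \<Longrightarrow> (\<lambda>u t. exp (f u t)) \<in> J"
  using jets_comp[of f B I "\<lambda>k. exp"] by (auto intro: DERIV_exp)

lemma J_cos: "f \<in> J \<Longrightarrow> (\<lambda>u t. cos (f u t)) \<in> J"
proof -
  assume f: "f \<in> J"
  \<comment> \<open>The k-th derivative of the cosine is a shift by k quarter periods.\<close>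
  have "((\<lambda>x. cos (x + real k * (pi / 2))) has_real_derivative cos (y + real (Suc k) * (pi / 2))) (at y)" for k y
  proof -
    have "cos (y + real (Suc k) * (pi / 2)) = cos ((y + real k * (pi / 2)) + pi / 2)"
      by (simp add: field_simps)
    also have "\<dots> = - sin (y + real k * (pi / 2))"
      by (simp only: cos_add) simp
    finally show ?thesis
      by (auto intro!: derivative_eq_intros)
  qed
  then show ?thesis
    using jets_comp[OF f, of "\<lambda>k x. cos (x + real k * (pi / 2))"] by simp
qed

lemma J_sin: "f \<in> J \<Longrightarrow> (\<lambda>u t. sin (f u t)) \<in> J"
  using J_cos[of "\<lambda>u t. f u t - pi / 2"] J_diff[of f "\<lambda>_ _. pi / 2"] jets_const[of "pi / 2" B I]
  by (simp add: cos_diff)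

lemma J_inverse_sqrt:
  assumes f: "f \<in> J" and pos: "\<And>u t. t \<in> I \<Longrightarrow> f u t > 0"
  shows "(\<lambda>u t. f u t powr (- 1 / 2)) \<in> J"
proof -
  \<comment> \<open>The product of the exponents that k differentiations of the power -1/2 bring
    down.\<close>
  define c where "c = rec_nat 1 (\<lambda>k a. a * (- 1 / 2 - real k))"
  have c: "c 0 = 1" "\<And>k. c (Suc k) = c k * (- 1 / 2 - real k)" by (simp_all add: c_def)
  have "((\<lambda>x. c k * x powr (- 1 / 2 - real k)) has_real_derivative
      c (Suc k) * y powr (- 1 / 2 - real (Suc k))) (at y)" if "y > 0" for k y
    using that by (auto intro!: derivative_eq_intros simp: c algebra_simps)
  then show ?thesis
    using jets_comp[OF f, of "\<lambda>k x. c k * x powr (- 1 / 2 - real k)"] pos c(1) by simp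
qed

lemma du_const: "du I (\<lambda>u t. c) = (\<lambda>u t. 0)"
  by (rule du_eqI) auto

lemma dt_const: "dt I (\<lambda>u t. c) = (\<lambda>u t. 0)"
  by (rule dt_eqI) auto

lemma du_add: "f \<in> J \<Longrightarrow> g \<in> J \<Longrightarrow> du I (\<lambda>u t. f u t + g u t) = (\<lambda>u t. du I f u t + du I g u t)"
  by (rule du_eqI) (auto intro!: derivative_eq_intros J_du simp: du_out)

lemma dt_add: "f \<in> J \<Longrightarrow> g \<in> J \<Longrightarrow> dt I (\<lambda>u t. f u t + g u t) = (\<lambda>u t. dt I f u t + dt I g u t)"
  by (rule dt_eqI) (auto intro!: derivative_eq_intros J_dt simp: dt_out)

lemma du_mult: "f \<in> J \<Longrightarrow> g \<in> J \<Longrightarrow>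
    du I (\<lambda>u t. f u t * g u t) = (\<lambda>u t. du I f u t * g u t + f u t * du I g u t)"
  by (rule du_eqI) (auto intro!: derivative_eq_intros J_du simp: du_out)

lemma dt_mult: "f \<in> J \<Longrightarrow> g \<in> J \<Longrightarrow>
    dt I (\<lambda>u t. f u t * g u t) = (\<lambda>u t. dt I f u t * g u t + f u t * dt I g u t)"
  by (rule dt_eqI) (auto intro!: derivative_eq_intros J_dt simp: dt_out)

lemma du_comp: "f \<in> J \<Longrightarrow> (\<And>x. (\<phi> has_real_derivative \<phi>' x) (at x)) \<Longrightarrow>
    du I (\<lambda>u t. \<phi> (f u t)) = (\<lambda>u t. \<phi>' (f u t) * du I f u t)"
  by (rule du_eqI) (auto intro: DERIV_chain2[OF _ J_du] simp: du_out)

lemma dt_comp: "f \<in> J \<Longrightarrow> (\<And>x. (\<phi> has_real_derivative \<phi>' x) (at x)) \<Longrightarrow>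
    dt I (\<lambda>u t. \<phi> (f u t)) = (\<lambda>u t. \<phi>' (f u t) * dt I f u t)"
  by (rule dt_eqI) (auto intro: DERIV_chain2[OF _ J_dt] simp: dt_out)

lemma dt_time: "dt I (\<lambda>u t. h t) u t = h' " if "(h has_real_derivative h') (at t)" "t \<in> I"
  using that by (auto simp: dt_def DERIV_imp_deriv)

lemma du_time: "du I (\<lambda>u t. h t) = (\<lambda>u t. 0)"
  by (rule du_eqI) auto

lemma dt_cong: "(\<And>u t. t \<in> I \<Longrightarrow> f u t = g u t) \<Longrightarrow> dt I f = dt I g"
  unfolding dt_def using openI
  by (intro ext if_cong refl deriv_cong_ev) (auto simp: eventually_nhds)

lemma du_cong: "(\<And>u t. t \<in> I \<Longrightarrow> f u t = g u t) \<Longrightarrow> du I f = du I g"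
  unfolding du_def by (intro ext) auto

end

section \<open>Curve shortening flow and its invariants\<close>

text \<open>The partials \<open>D\<close> are fixed so that the algebra of smooth functions can be
  generated from explicit derivatives. Derivatives are taken on the open interval \<open>I\<close>;
  time 0 enters later, through continuity.\<close>

locale csf_flow =
  fixes \<gamma> :: "real \<Rightarrow> real \<Rightarrow> real^'n::finite" and T :: real
    and D :: "nat \<Rightarrow> nat \<Rightarrow> real \<Rightarrow> real \<Rightarrow> real^'n"
  assumes csf: "csf \<gamma> T" and partials: "partials_on UNIV {0..<T} \<gamma> D"
begin

abbreviation I :: "real set" where "I \<equiv> {0<..<T}"

text \<open>The cosines serve as bump functions in the strong maximum principle.\<close>

definition B :: "(real \<Rightarrow> real \<Rightarrow> real) set" where
  "B = {f. \<exists>m l i. f = (\<lambda>u t. D m l u t $ i)} \<union> {f. \<exists>a. f = (\<lambda>u t. cos (u + a))} \<union> {\<lambda>u t. 0}"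

lemma T_pos: "T > 0" using csf by (simp add: csf_def)

lemma D0: "t \<in> {0..<T} \<Longrightarrow> D 0 0 u t = \<gamma> u t"
  using partials by (simp add: partials_on_def)

lemma D_cont: "continuous_on (UNIV \<times> {0..<T}) (\<lambda>(u, t). D m l u t)"
  using partials by (simp add: partials_on_def)

lemma D_u: "t \<in> {0..<T} \<Longrightarrow> ((\<lambda>x. D m l x t) has_vector_derivative D (Suc m) l u t) (at u)"
  using partials by (auto simp: partials_on_def)

lemma D_t: "t \<in> I \<Longrightarrow> ((\<lambda>s. D m l u s) has_vector_derivative D m (Suc l) u t) (at t)"
proof -
  assume t: "t \<in> I"
  have "((\<lambda>s. D m l u s) has_vector_derivative D m (Suc l) u t) (at t within {0..<T})"
    using partials t by (auto simp: partials_on_def)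
  then show ?thesis
    using t has_vector_derivative_within_subset[of _ _ t "{0..<T}" I]
    by (metis (no_types, lifting) atLeastLessThan_iff
      greaterThanLessThan_iff has_vector_derivative_within_open less_imp_le open_greaterThanLessThan subsetI)
qed

lemma has_real_derivative_nth:
  "(f has_vector_derivative f') (at x) \<Longrightarrow> ((\<lambda>x. f x $ i) has_real_derivative f' $ i) (at x)"
  using bounded_linear.has_vector_derivative[OF bounded_linear_vec_nth]
  by (auto simp: has_real_derivative_iff_has_vector_derivative)

sublocale jet_algebra B I
proof
  show "open I" by simp
next
  fix f assume "f \<in> B"
  then consider m l i where "f = (\<lambda>u t. D m l u t $ i)" | a where "f = (\<lambda>u t. cos (u + a))"
    | "f = (\<lambda>u t. 0)"
    by (auto simp: B_def)
  then show "jet2 I B f"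
  proof cases
    case f: (1 m l i)
    show ?thesis
    proof (rule jet2I[where fu = "\<lambda>u t. D (Suc m) l u t $ i" and ft = "\<lambda>u t. D m (Suc l) u t $ i"
        and fut = "\<lambda>u t. D (Suc m) (Suc l) u t $ i"])
    have "continuous_on (UNIV \<times> {0..<T}) (\<lambda>(u, t). D m l u t $ i)"
      using continuous_on_component[OF D_cont] by (simp add: case_prod_unfold)
    then show "continuous_on (UNIV \<times> I) (\<lambda>(u, t). f u t)"
      unfolding f by (rule continuous_on_subset) auto
  qed (auto simp: f B_def intro!: has_real_derivative_nth D_u D_t)
  next
    case f: (2 a)
    have c: "cos (x + (a + pi / 2)) = - sin (x + a)" for x
      by (simp only: add.assoc[symmetric] cos_add[of "x + a"]) simp
    show ?thesis
      unfolding f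
      by (rule jet2I[where fu = "\<lambda>u t. cos (u + (a + pi / 2))" and ft = "\<lambda>u t. 0" and fut = "\<lambda>u t. 0"])
        (auto simp: B_def case_prod_unfold intro!: continuous_intros derivative_eq_intros, auto simp: c)
  next
    case f: 3
    show ?thesis
      unfolding f
      by (rule jet2I[where fu = "\<lambda>u t. 0" and ft = "\<lambda>u t. 0" and fut = "\<lambda>u t. 0"])
        (auto simp: B_def case_prod_unfold intro!: derivative_eq_intros)
  qed
qed

lemma \<gamma>_periodic: "t \<in> {0..<T} \<Longrightarrow> \<gamma> (u + 2 * pi) t = \<gamma> u t"
  using csf by (simp add: csf_def)

lemma D_periodic: "t \<in> I \<Longrightarrow> D m l (u + 2 * pi) t = D m l u t"
proof (induction l arbitrary: m u t)
  case 0
  then show ?case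
  proof (induction m arbitrary: u)
    case 0
    then show ?case using D0[of t] \<gamma>_periodic[of t] by auto
  next
    case (Suc m)
    have "((\<lambda>x. x + 2 * pi) has_vector_derivative 1) (at u)"
      by (auto intro!: derivative_eq_intros simp: has_real_derivative_iff_has_vector_derivative[symmetric])
    from vector_diff_chain_at[OF this D_u[of t m 0 "u + 2 * pi"]]
    have "((\<lambda>x. D m 0 (x + 2 * pi) t) has_vector_derivative D (Suc m) 0 (u + 2 * pi) t) (at u)"
      using Suc.prems by (simp add: o_def)
    then have "((\<lambda>x. D m 0 x t) has_vector_derivative D (Suc m) 0 (u + 2 * pi) t) (at u)"
      using Suc by simp
    then show ?case
      using D_u[of t m 0 u] Suc.prems by (auto dest: vector_derivative_unique_at)
  qed
next
  case (Suc l)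
  have "((\<lambda>s. D m l (u + 2 * pi) s) has_vector_derivative D m (Suc l) (u + 2 * pi) t) (at t)"
    using D_t Suc.prems by blast
  then have "((\<lambda>s. D m l u s) has_vector_derivative D m (Suc l) (u + 2 * pi) t) (at t)"
    using Suc by (auto elim!: has_vector_derivative_transform_within_open[of _ _ _ I])
  then show ?case
    using D_t[of t m l u] Suc.prems by (auto dest: vector_derivative_unique_at)
qed

lemma periodic: "f \<in> J \<Longrightarrow> t \<in> I \<Longrightarrow> f (u + 2 * pi) t = f u t"
proof (rule J_periodic)
  fix f u t assume "f \<in> B" "t \<in> I"
  then show "f (u + 2 * pi) t = f u t"
    using D_periodic[of t _ _ u] cos_periodic[of "u + a" for a]
    by (auto simp: B_def add.assoc add.commute[of _ "2 * pi"] add.left_commute[of _ "2 * pi"])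
qed

definition X :: "'n \<Rightarrow> real \<Rightarrow> real \<Rightarrow> real" where "X i u t = \<gamma> u t $ i"

lemma X_J [simp]: "X i \<in> J"
  by (rule jets_cong[of "\<lambda>u t. D 0 0 u t $ i"]) (auto simp: X_def D0 B_def intro!: jets_base)

definition speed_sq :: "real \<Rightarrow> real \<Rightarrow> real" where
  "speed_sq u t = (\<Sum>i\<in>UNIV. (du I (X i) u t)\<^sup>2)"

lemma u_deriv_\<gamma>: "t \<in> I \<Longrightarrow> u_deriv \<gamma> u t = (\<chi> i. du I (X i) u t)"
proof -
  assume t: "t \<in> I"
  have "((\<lambda>x. \<gamma> x t) has_vector_derivative D 1 0 u t) (at u)"
    using D_u[of t 0 0 u] t D0[of t] by auto
  then have 1: "u_deriv \<gamma> u t = D 1 0 u t" and "\<And>i. ((\<lambda>x. X i x t) has_real_derivative D 1 0 u t $ i) (at u)"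
    unfolding u_deriv_def X_def by (auto intro: vector_derivative_at has_real_derivative_nth)
  then have "du I (X i) u t = D 1 0 u t $ i" for i
    using t DERIV_imp_deriv[of "\<lambda>x. X i x t"] by (simp add: du_def)
  then show ?thesis
    by (simp add: 1 vec_eq_iff)
qed

lemma speed_sq_eq: "t \<in> I \<Longrightarrow> speed_sq u t = (norm (u_deriv \<gamma> u t))\<^sup>2"
  by (simp add: u_deriv_\<gamma> speed_sq_def norm_vec_def L2_set_def sum_nonneg)

lemma speed_sq_pos: "t \<in> I \<Longrightarrow> speed_sq u t > 0"
  using csf by (simp add: speed_sq_eq csf_def)

lemma speed_sq_J: "speed_sq \<in> J"
  unfolding speed_sq_def[abs_def] by (intro J_sum J_power du_J X_J)

text \<open>The reciprocal of the speed of the parameterization, with the same convention off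
  \<open>I\<close> as for \<open>du\<close>.\<close>

definition slow :: "real \<Rightarrow> real \<Rightarrow> real" where
  "slow u t = (if t \<in> I then inverse (norm (u_deriv \<gamma> u t)) else 0)"

lemma slow_eq: "t \<in> I \<Longrightarrow> slow u t = speed_sq u t powr (- 1 / 2)"
  using csf by (simp add: slow_def speed_sq_eq powr_minus powr_half_sqrt csf_def)

lemma slow_pos: "t \<in> I \<Longrightarrow> slow u t > 0"
  using csf by (simp add: slow_def csf_def)

lemma slow_J: "slow \<in> J"
  using jets_cong[OF J_inverse_sqrt[OF speed_sq_J speed_sq_pos]] slow_eq by auto

text \<open>Derivative with respect to arclength of the space curve, also when applied to functions
  of the projection.\<close>

definition S :: "(real \<Rightarrow> real \<Rightarrow> real) \<Rightarrow> real \<Rightarrow> real \<Rightarrow> real" where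
  "S f = (\<lambda>u t. slow u t * du I f u t)"

abbreviation Dt :: "(real \<Rightarrow> real \<Rightarrow> real) \<Rightarrow> real \<Rightarrow> real \<Rightarrow> real" where
  "Dt \<equiv> dt I"

lemma S_J: "f \<in> J \<Longrightarrow> S f \<in> J"
  unfolding S_def by (intro jets_mult slow_J du_J)

lemmas J_intros = jets_const jets_add jets_mult J_diff J_minus J_power J_sum S_J dt_J X_J

lemma S_const: "S (\<lambda>u t. c) = (\<lambda>u t. 0)"
  by (simp add: S_def du_const)

lemma S_add: "f \<in> J \<Longrightarrow> g \<in> J \<Longrightarrow> S (\<lambda>u t. f u t + g u t) = (\<lambda>u t. S f u t + S g u t)"
  by (simp add: S_def du_add algebra_simps)

lemma S_mult: "f \<in> J \<Longrightarrow> g \<in> J \<Longrightarrow>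
    S (\<lambda>u t. f u t * g u t) = (\<lambda>u t. S f u t * g u t + f u t * S g u t)"
  by (simp add: S_def du_mult algebra_simps)

lemma S_cmult: "f \<in> J \<Longrightarrow> S (\<lambda>u t. c * f u t) = (\<lambda>u t. c * S f u t)"
  using S_mult[of "\<lambda>_ _. c" f] by (simp add: S_const jets_const)

lemma S_minus: "f \<in> J \<Longrightarrow> S (\<lambda>u t. - f u t) = (\<lambda>u t. - S f u t)"
  using S_cmult[of f "-1"] by simp

lemma S_diff: "f \<in> J \<Longrightarrow> g \<in> J \<Longrightarrow> S (\<lambda>u t. f u t - g u t) = (\<lambda>u t. S f u t - S g u t)"
  using S_add[OF _ J_minus, of f g] by (simp add: S_minus)

lemma S_sum: "(\<And>i. i \<in> K \<Longrightarrow> f i \<in> J) \<Longrightarrow>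
    S (\<lambda>u t. \<Sum>i\<in>K. f i u t) = (\<lambda>u t. \<Sum>i\<in>K. S (f i) u t)"
  by (induction K rule: infinite_finite_induct) (auto simp: S_const S_add J_sum)

lemma S_power2: "f \<in> J \<Longrightarrow> S (\<lambda>u t. (f u t)\<^sup>2) = (\<lambda>u t. 2 * f u t * S f u t)"
  by (simp add: power2_eq_square S_mult algebra_simps)

lemma S_comp: "f \<in> J \<Longrightarrow> (\<And>x. (\<phi> has_real_derivative \<phi>' x) (at x)) \<Longrightarrow>
    S (\<lambda>u t. \<phi> (f u t)) = (\<lambda>u t. \<phi>' (f u t) * S f u t)"
  unfolding S_def by (subst du_comp[of f \<phi> \<phi>']) (simp_all add: mult.left_commute)

lemma Dt_cmult: "f \<in> J \<Longrightarrow> Dt (\<lambda>u t. c * f u t) = (\<lambda>u t. c * Dt f u t)"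
  using dt_mult[of "\<lambda>_ _. c" f] by (simp add: dt_const jets_const)

lemma Dt_minus: "f \<in> J \<Longrightarrow> Dt (\<lambda>u t. - f u t) = (\<lambda>u t. - Dt f u t)"
  using Dt_cmult[of f "-1"] by simp

lemma Dt_diff: "f \<in> J \<Longrightarrow> g \<in> J \<Longrightarrow> Dt (\<lambda>u t. f u t - g u t) = (\<lambda>u t. Dt f u t - Dt g u t)"
  using dt_add[OF _ J_minus, of f g] by (simp add: Dt_minus)

lemma Dt_sum: "(\<And>i. i \<in> K \<Longrightarrow> f i \<in> J) \<Longrightarrow>
    Dt (\<lambda>u t. \<Sum>i\<in>K. f i u t) = (\<lambda>u t. \<Sum>i\<in>K. Dt (f i) u t)"
  by (induction K rule: infinite_finite_induct) (auto simp: dt_const dt_add J_sum)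

lemma Dt_power2: "f \<in> J \<Longrightarrow> Dt (\<lambda>u t. (f u t)\<^sup>2) = (\<lambda>u t. 2 * f u t * Dt f u t)"
  by (simp add: power2_eq_square dt_mult algebra_simps)

lemmas S_simps = S_const S_add S_mult S_minus S_diff S_sum S_power2
lemmas Dt_simps = dt_const dt_add dt_mult Dt_minus Dt_diff Dt_sum Dt_power2

lemma S_out: "t \<notin> I \<Longrightarrow> S f u t = 0"
  by (auto simp: S_def slow_def)

lemma S_cong: "(\<And>u t. t \<in> I \<Longrightarrow> f u t = g u t) \<Longrightarrow> S f = S g"
  unfolding S_def using du_cong[of f g] by simp

lemma unit_tangent: "t \<in> I \<Longrightarrow> (\<Sum>i\<in>UNIV. (S (X i) u t)\<^sup>2) = 1"
proof -
  assume t: "t \<in> I"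
  have "(\<Sum>i\<in>UNIV. (S (X i) u t)\<^sup>2) = (slow u t)\<^sup>2 * speed_sq u t"
    by (simp add: S_def speed_sq_def power_mult_distrib sum_distrib_left)
  then show ?thesis
    using t csf by (simp add: slow_def speed_sq_eq csf_def power_inverse)
qed

lemma s_deriv_\<gamma>: "t \<in> I \<Longrightarrow> s_deriv \<gamma> \<gamma> u t = (\<chi> i. S (X i) u t)"
  by (simp add: s_deriv_def u_deriv_\<gamma> S_def slow_def vec_eq_iff)

lemma s_deriv2_\<gamma>: "t \<in> I \<Longrightarrow> s_deriv \<gamma> (s_deriv \<gamma> \<gamma>) u t = (\<chi> i. S (S (X i)) u t)"
proof -
  assume t: "t \<in> I"
  have "((\<lambda>x. \<chi> i. S (X i) x t) has_vector_derivative (\<chi> i. du I (S (X i)) u t)) (at u)"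
    unfolding has_vector_derivative_def
    using J_du[OF S_J[OF X_J] t]
    by (subst has_derivative_componentwise_within)
       (auto simp: Basis_vec_def inner_axis has_field_derivative_def mult_commute_abs)
  then have "u_deriv (s_deriv \<gamma> \<gamma>) u t = (\<chi> i. du I (S (X i)) u t)"
    unfolding u_deriv_def using t by (simp add: s_deriv_\<gamma> vector_derivative_at)
  then show ?thesis
    using t by (simp add: s_deriv_def[of \<gamma> "s_deriv \<gamma> \<gamma>"] S_def slow_def vec_eq_iff)
qed

text \<open>The squared curvature, see \<open>curvature_sq\<close>; the square is kept because the
  curvature itself is not smooth where it vanishes.\<close>

definition q :: "real \<Rightarrow> real \<Rightarrow> real" where
  "q u t = (\<Sum>i\<in>UNIV. (S (S (X i)) u t)\<^sup>2)"

lemma q_J: "q \<in> J"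
  unfolding q_def[abs_def] by (intro J_intros)

lemma q_nonneg: "q u t \<ge> 0"
  by (simp add: q_def sum_nonneg)

lemma curvature_sq: "t \<in> I \<Longrightarrow> (curvature \<gamma> u t)\<^sup>2 = q u t"
  by (simp add: curvature_def s_deriv2_\<gamma> q_def norm_vec_def L2_set_def sum_nonneg)

lemma heat: "Dt (X i) = S (S (X i))"
proof (intro ext)
  fix u t
  show "Dt (X i) u t = S (S (X i)) u t"
  proof (cases "t \<in> I")
    case True
    have "((\<lambda>s. \<gamma> u s) has_vector_derivative s_deriv \<gamma> (s_deriv \<gamma> \<gamma>) u t) (at t within {0..<T})"
      using csf True by (auto simp: csf_def)
    then have "((\<lambda>s. \<gamma> u s) has_vector_derivative s_deriv \<gamma> (s_deriv \<gamma> \<gamma>) u t) (at t)"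
      using True has_vector_derivative_within_subset[of _ _ t "{0..<T}" I]
      by (metis (no_types, lifting) atLeastLessThan_iff
      greaterThanLessThan_iff has_vector_derivative_within_open less_imp_le open_greaterThanLessThan subsetI)
    from DERIV_imp_deriv[OF has_real_derivative_nth[OF this, of i]]
    show ?thesis
      using True by (simp add: dt_def X_def[abs_def] s_deriv2_\<gamma>)
  qed (simp add: dt_out S_out)
qed

lemma tangent_normal: "(\<Sum>i\<in>UNIV. S (X i) u t * S (S (X i)) u t) = 0"
proof -
  have "S (\<lambda>u t. \<Sum>i\<in>UNIV. (S (X i) u t)\<^sup>2) = S (\<lambda>u t. 1)"
    by (rule S_cong) (rule unit_tangent)
  then have "(\<Sum>i\<in>UNIV. 2 * S (X i) u t * S (S (X i)) u t) = 0"
    by (simp add: S_simps J_intros fun_eq_iff)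
  then show ?thesis
    by (simp add: sum_distrib_left[symmetric] mult.assoc)
qed

lemma tangent_third: "(\<Sum>i\<in>UNIV. S (X i) u t * S (S (S (X i))) u t) = - q u t"
proof -
  have "S (\<lambda>u t. \<Sum>i\<in>UNIV. S (X i) u t * S (S (X i)) u t) = S (\<lambda>u t. 0)"
    by (simp add: tangent_normal)
  then have "(\<Sum>i\<in>UNIV. S (S (X i)) u t * S (S (X i)) u t + S (X i) u t * S (S (S (X i))) u t) = 0"
    by (simp add: S_simps J_intros fun_eq_iff)
  then show ?thesis
    by (simp add: sum.distrib q_def power2_eq_square)
qed

text \<open>Differentiating the unit length of the tangent in time isolates \<open>Dt slow\<close>,
  because the tangential part of the third arclength derivative is \<open>- q\<close>.\<close>

lemma Dt_slow: "Dt slow = (\<lambda>u t. q u t * slow u t)"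
proof (intro ext)
  fix u t
  show "Dt slow u t = q u t * slow u t"
  proof (cases "t \<in> I")
    case t: True
    have a: "Dt (S (X i)) u t = Dt slow u t * du I (X i) u t + S (S (S (X i))) u t" for i
      unfolding S_def[of "X i"]
      by (simp add: dt_mult slow_J du_J dt_du heat)
         (simp add: S_def)
    have "Dt (\<lambda>u t. \<Sum>i\<in>UNIV. (S (X i) u t)\<^sup>2) = Dt (\<lambda>u t. 1)"
      by (rule dt_cong) (rule unit_tangent)
    then have "(\<Sum>i\<in>UNIV. 2 * S (X i) u t * Dt (S (X i)) u t) = 0"
      by (simp add: Dt_simps J_intros fun_eq_iff)
    then have "0 = (\<Sum>i\<in>UNIV. S (X i) u t * Dt (S (X i)) u t)"
      by (simp add: sum_distrib_left[symmetric] mult.assoc)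
    also have "\<dots> = Dt slow u t * (\<Sum>i\<in>UNIV. S (X i) u t * du I (X i) u t) - q u t"
      unfolding a by (simp add: algebra_simps sum.distrib sum_distrib_left tangent_third)
    also have "(\<Sum>i\<in>UNIV. S (X i) u t * du I (X i) u t) = slow u t * speed_sq u t"
      by (simp add: S_def speed_sq_def power2_eq_square sum_distrib_left mult.assoc)
    also have "slow u t * speed_sq u t = inverse (slow u t)"
      using t csf by (simp add: slow_def speed_sq_eq csf_def power2_eq_square)
    finally show ?thesis
      using slow_pos[OF t, of u] by (simp add: field_simps)
  qed (auto simp: dt_out slow_def)
qed

text \<open>Arclength contracts at rate \<open>q\<close>, hence this commutator. It gives the
  derivative of a caloric function a linear equation with zeroth-order coefficient
  \<open>q\<close>.\<close>

lemma Dt_S: "f \<in> J \<Longrightarrow> Dt (S f) = (\<lambda>u t. S (Dt f) u t + q u t * S f u t)"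
  by (simp add: S_def dt_mult slow_J du_J dt_du Dt_slow algebra_simps)

lemma cos_J: "(\<lambda>u t. cos (u + a)) \<in> J"
  by (rule jets_base) (auto simp: B_def)

declare J_intros [simp]

end

section \<open>Maximum principles\<close>

lemma periodic_int:
  fixes f :: "real \<Rightarrow> 'a"
  assumes "\<And>u. f (u + p) = f u"
  shows "f (u + of_int n * p) = f u"
proof -
  have nat: "f (u + of_nat k * p) = f u" for k u
    by (induction k) (use assms in \<open>simp_all add: distrib_right add.assoc[symmetric] add.commute[of p]\<close>)
  show ?thesis
  proof (cases "n \<ge> 0")
    case True
    then show ?thesis using nat[of u "nat n"] by simp
  next
    case False
    then show ?thesis using nat[of "u + of_int n * p" "nat (- n)"] by (simp add: algebra_simps)
  qed
qed

lemma periodic_reduce: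
  fixes u p :: real
  assumes "p > 0"
  obtains n :: int where "a \<le> u + of_int n * p" "u + of_int n * p < a + p"
proof -
  have "of_int \<lfloor>(u - a) / p\<rfloor> \<le> (u - a) / p" "(u - a) / p < of_int \<lfloor>(u - a) / p\<rfloor> + 1"
    by linarith+
  then have "of_int \<lfloor>(u - a) / p\<rfloor> * p \<le> u - a" "u - a < (of_int \<lfloor>(u - a) / p\<rfloor> + 1) * p"
    using assms by (simp_all only: pos_le_divide_eq pos_divide_less_eq)
  then show ?thesis
    by (intro that[of "- \<lfloor>(u - a) / p\<rfloor>"]) (simp_all add: algebra_simps)
qed

text \<open>\<open>G\<close> describes the domain. By periodicity the bad points can be sought in a
  compact set, which has one of least time; \<open>bdry\<close> puts it in the open set
  \<open>G > 0\<close>, so a whole backward neighbourhood lies in the domain, where \<open>F\<close>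
  was negative before.\<close>

lemma first_touch:
  fixes F G :: "real \<Rightarrow> real \<Rightarrow> real"
  assumes contF: "continuous_on (UNIV \<times> {t0..t1}) (\<lambda>(u, t). F u t)"
    and contG: "continuous_on (UNIV \<times> {t0..t1}) (\<lambda>(u, t). G u t)"
    and per: "p > 0" "\<And>u t. t \<in> {t0..t1} \<Longrightarrow> F (u + p) t = F u t"
      "\<And>u t. t \<in> {t0..t1} \<Longrightarrow> G (u + p) t = G u t"
    and init: "\<And>u. G u t0 \<ge> 0 \<Longrightarrow> F u t0 < 0"
    and bdry: "\<And>u t. t \<in> {t0..t1} \<Longrightarrow> G u t = 0 \<Longrightarrow> F u t < 0"
    and bad: "G u' t' \<ge> 0" "F u' t' \<ge> 0" "t' \<in> {t0..t1}"
  obtains u t \<delta> where "t0 < t" "t \<le> t1" "G u t > 0" "F u t = 0" "\<delta> > 0"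
    "\<And>v s. \<bar>v - u\<bar> < \<delta> \<Longrightarrow> t - \<delta> < s \<Longrightarrow> s \<le> t \<Longrightarrow> F v s \<le> 0"
proof -
  define A where "A = {x \<in> {0..p} \<times> {t0..t1}. 0 \<le> (\<lambda>(u, t). G u t) x} \<inter>
    {x \<in> {0..p} \<times> {t0..t1}. 0 \<le> (\<lambda>(u, t). F u t) x}"
  have "closed A"
    unfolding A_def
    by (intro closed_Int continuous_on_closed_Collect_le continuous_intros closed_Times
        continuous_on_subset[OF contF] continuous_on_subset[OF contG]) auto
  moreover have "bounded A"
    by (rule bounded_subset[of "{0..p} \<times> {t0..t1}"]) (auto simp: A_def bounded_Times)
  ultimately have "compact A" by (simp add: compact_eq_bounded_closed)
  moreover obtain n :: int where n: "0 \<le> u' + of_int n * p" "u' + of_int n * p < 0 + p"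
    using periodic_reduce[OF per(1)] by blast
  have per_int: "F (u + of_int n * p) t = F u t \<and> G (u + of_int n * p) t = G u t"
    if "t \<in> {t0..t1}" for u t n
    using periodic_int[of "\<lambda>u. F u t" p u n] periodic_int[of "\<lambda>u. G u t" p u n] per that by blast
  have "(u' + of_int n * p, t') \<in> A"
    using n bad per_int by (auto simp: A_def)
  moreover have "continuous_on A snd" by (intro continuous_intros)
  ultimately obtain z where z: "z \<in> A" "\<forall>y\<in>A. snd z \<le> snd y"
    using continuous_attains_inf[of A snd] by blast
  obtain u t where ut: "z = (u, t)" by (cases z)
  have t: "t \<in> {t0..t1}" and Gu: "G u t \<ge> 0" and Fu: "F u t \<ge> 0"
    using z(1) by (auto simp: A_def ut)
  have Gpos: "G u t > 0" using bdry[OF t, of u] Gu Fu by linarith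
  have t0: "t0 < t" using init[of u] Gu Fu t by (cases "t = t0") auto
  have before: "F v s < 0" if "t0 \<le> s" "s < t" "G v s \<ge> 0" for v s
  proof (rule ccontr)
    assume F: "\<not> F v s < 0"
    obtain n :: int where n: "0 \<le> v + of_int n * p" "v + of_int n * p < 0 + p"
      using periodic_reduce[OF per(1)] by blast
    have "(v + of_int n * p, s) \<in> A"
      using n that F t per_int by (auto simp: A_def)
    then show False using z that by (force simp: ut)
  qed
  obtain e where e: "e > 0" and e': "\<forall>x\<in>UNIV \<times> {t0..t1}. dist x (u, t) < e \<longrightarrow>
      dist ((\<lambda>(u, t). G u t) x) ((\<lambda>(u, t). G u t) (u, t)) < G u t"
    using contG Gpos t unfolding continuous_on_iff by (metis SigmaI UNIV_I)
  have e2: "G v s > 0" if "s \<in> {t0..t1}" "dist (v, s) (u, t) < e" for v s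
    using bspec[OF e', of "(v, s)"] that by (auto simp: dist_real_def)
  define \<delta> where "\<delta> = min (e / 2) (t - t0)"
  have d: "\<delta> > 0" using e t0 by (simp add: \<delta>_def)
  have near: "G v s > 0 \<and> t0 < s" if "\<bar>v - u\<bar> < \<delta>" "t - \<delta> < s" "s \<le> t" for v s
  proof -
    have "dist (v, s) (u, t) \<le> dist v u + dist s t"
      by (simp add: dist_Pair_Pair sqrt_sum_squares_le_sum)
    also have "\<dots> < e"
    proof -
      have "\<delta> \<le> e / 2" by (simp only: \<delta>_def min.cobounded1)
      moreover have "dist v u < \<delta>" "dist s t < \<delta>" using that by (auto simp: dist_real_def)
      ultimately show ?thesis by linarith
    qed
    finally show ?thesis using e2[of s v] that t by (auto simp: \<delta>_def)
  qed
  \<comment> \<open>Strict negativity is known only before time \<open>t\<close>; at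
    \<open>t\<close> itself it weakens to \<open>\<le>\<close> by a limit from the left.\<close>
  have lt: "F v s \<le> 0" if "\<bar>v - u\<bar> < \<delta>" "t - \<delta> < s" "s \<le> t" for v s
  proof (cases "s < t")
    case True
    then show ?thesis using before[of s v] near[OF that] by simp
  next
    case False
    then have s: "s = t" using that by simp
    have "continuous_on {t0..t1} (\<lambda>r. (\<lambda>(u, t). F u t) (v, r))"
      by (rule continuous_on_compose2[OF contF]) (auto intro!: continuous_intros)
    then have "((\<lambda>r. F v r) \<longlongrightarrow> F v t) (at t within {t0..t1})"
      using t by (simp add: continuous_on_def)
    then have "((\<lambda>r. F v r) \<longlongrightarrow> F v t) (at t within {t0..t})"
      by (rule tendsto_within_subset) (use t in auto)
    then have lim: "((\<lambda>r. F v r) \<longlongrightarrow> F v t) (at_left t)"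
      by (simp add: at_within_Icc_at_left[OF t0])
    have "\<forall>\<^sub>F r in at_left t. F v r \<le> 0"
      unfolding eventually_at_left_field
    proof (intro exI[of _ "t - \<delta>"] conjI allI impI)
      fix r assume "t - \<delta> < r" "r < t"
      then show "F v r \<le> 0"
        using before[of r v] near[of v r] that(1) by auto
    qed (use d in simp)
    then show ?thesis
      unfolding s using tendsto_upperbound[OF lim] by simp
  qed
  moreover have "F u t = 0" using lt[of u t] Fu d by simp
  ultimately show ?thesis using that[of t u \<delta>] t0 t Gpos d by auto
qed

context csf_flow
begin

lemma slow_du: "t \<in> I \<Longrightarrow> du I f u t = S f u t / slow u t"
  using slow_pos[of t u] by (simp add: S_def)

text \<open>The arclength derivative is a positive multiple of the parameter derivative, so the
  usual test survives: a positive \<open>S (S F)\<close> would make \<open>S F\<close>, and hence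
  the slope, positive just to the right of the critical point.\<close>

lemma local_max_conditions:
  assumes F: "F \<in> J" and t: "t \<in> I" and d: "\<delta> > 0"
    and max: "\<And>v. \<bar>v - u\<bar> < \<delta> \<Longrightarrow> F v t \<le> F u t"
  shows "S F u t = 0" "S (S F) u t \<le> 0"
proof -
  have d1: "((\<lambda>x. F x t) has_real_derivative du I F x t) (at x)" for x
    by (rule J_du[OF F t])
  have z: "du I F u t = 0"
    by (rule DERIV_local_max[OF d1 d]) (use max in \<open>simp add: abs_minus_commute\<close>)
  then show S0: "S F u t = 0" by (simp add: S_def)
  show "S (S F) u t \<le> 0"
  proof (rule ccontr)
    assume "\<not> S (S F) u t \<le> 0"
    then have "S (S F) u t > 0" by simp
    then have "du I (S F) u t > 0"
      using slow_pos[OF t, of u] by (simp add: S_def zero_less_mult_iff)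
    then obtain e where e: "e > 0" "\<And>h. 0 < h \<Longrightarrow> h < e \<Longrightarrow> S F u t < S F (u + h) t"
      using DERIV_pos_inc_right[OF J_du[OF S_J[OF F] t]] by metis
    define h where "h = min e \<delta> / 2"
    have h: "h > 0" "h < e" "h < \<delta>" using e d by (auto simp: h_def)
    have "\<exists>z>u. z < u + h \<and> F (u + h) t - F u t = (u + h - u) * du I F z t"
      by (rule MVT2) (use h d1 in auto)
    then obtain z where z: "u < z" "z < u + h" "F (u + h) t - F u t = h * du I F z t"
      by auto
    have "S F z t > 0" using e(2)[of "z - u"] z h S0 by simp
    then have "du I F z t > 0"
      using slow_pos[OF t, of z] by (simp add: S_def zero_less_mult_iff)
    then have "F (u + h) t > F u t" using z h by (simp add: algebra_simps)
    then show False using max[of "u + h"] h by simp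
  qed
qed

lemma local_min_conditions:
  assumes F: "F \<in> J" and t: "t \<in> I" and d: "\<delta> > 0"
    and min: "\<And>v. \<bar>v - u\<bar> < \<delta> \<Longrightarrow> F v t \<ge> F u t"
  shows "S F u t = 0" "S (S F) u t \<ge> 0"
  using local_max_conditions[of "\<lambda>u t. - F u t" t \<delta> u] assms
  by (simp_all add: S_minus)

lemma time_max_condition:
  assumes F: "F \<in> J" and t: "t \<in> I" and d: "\<delta> > 0"
    and max: "\<And>s. t - \<delta> < s \<Longrightarrow> s \<le> t \<Longrightarrow> F u s \<le> F u t"
  shows "Dt F u t \<ge> 0"
proof (rule ccontr)
  assume "\<not> Dt F u t \<ge> 0"
  then have "Dt F u t < 0" by simp
  then obtain e where e: "e > 0" "\<And>h. 0 < h \<Longrightarrow> h < e \<Longrightarrow> F u t < F u (t - h)"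
    using DERIV_neg_dec_left[OF J_dt[OF F t]] by metis
  define h where "h = min e \<delta> / 2"
  have h: "h > 0" "h < e" "h < \<delta>" using e d by (auto simp: h_def)
  show False
    using e(2)[of h] max[of "t - h"] h by simp
qed

lemma J_cont_on: "F \<in> J \<Longrightarrow> A \<subseteq> I \<Longrightarrow> continuous_on (UNIV \<times> A) (\<lambda>(u, t). F u t)"
  by (rule continuous_on_subset[OF J_cont]) auto

text \<open>The lateral boundary \<open>G = 0\<close> may move with time. The evolution equation
  enters only at a first contact, where all derivative tests are at hand.\<close>

lemma max_principle_strict:
  assumes J: "F \<in> J" "G \<in> J" and t: "0 < t0" "t1 < T"
    and init: "\<And>u. G u t0 \<ge> 0 \<Longrightarrow> F u t0 < 0"
    and bdry: "\<And>u t. t \<in> {t0..t1} \<Longrightarrow> G u t = 0 \<Longrightarrow> F u t < 0"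
    and step: "\<And>u t. t0 < t \<Longrightarrow> t \<le> t1 \<Longrightarrow> G u t > 0 \<Longrightarrow> F u t = 0 \<Longrightarrow> S F u t = 0 \<Longrightarrow>
      S (S F) u t \<le> 0 \<Longrightarrow> Dt F u t \<ge> 0 \<Longrightarrow> False"
    and ut: "t \<in> {t0..t1}" "G u t \<ge> 0"
  shows "F u t < 0"
proof (rule ccontr)
  assume neg: "\<not> F u t < 0"
  have sub: "{t0..t1} \<subseteq> I" using t by auto
  obtain v s \<delta> where v: "t0 < s" "s \<le> t1" "G v s > 0" "F v s = 0" "\<delta> > 0"
    "\<And>x r. \<bar>x - v\<bar> < \<delta> \<Longrightarrow> s - \<delta> < r \<Longrightarrow> r \<le> s \<Longrightarrow> F x r \<le> 0"
  proof (rule first_touch[OF J_cont_on[OF J(1) sub] J_cont_on[OF J(2) sub], of "2 * pi" u t])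
    show "F (u + 2 * pi) t = F u t" "G (u + 2 * pi) t = G u t" if "t \<in> {t0..t1}" for u t
      using sub that by (intro periodic J; blast)+
  next
    fix v s \<delta>
    assume a: "t0 < s" "s \<le> t1" "G v s > 0" "F v s = 0" "\<delta> > 0"
      "\<And>x r. \<bar>x - v\<bar> < \<delta> \<Longrightarrow> s - \<delta> < r \<Longrightarrow> r \<le> s \<Longrightarrow> F x r \<le> 0"
    show thesis by (rule that[OF a(1-5)]) (rule a(6))
  next
    show "F u t0 < 0" if "G u t0 \<ge> 0" for u by (rule init[OF that])
    show "F u t < 0" if "t \<in> {t0..t1}" "G u t = 0" for u t by (rule bdry[OF that])
    show "0 \<le> F u t" using neg by simp
  qed (simp, rule ut, rule ut)
  have s: "s \<in> I" using v t by auto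
  have m: "F x s \<le> F v s" if "\<bar>x - v\<bar> < \<delta>" for x
    using v(6)[OF that, of s] v(4,5) by simp
  have m': "F v r \<le> F v s" if "s - \<delta> < r" "r \<le> s" for r
    using v(6)[of v r] that v(4,5) by simp
  have "S F v s = 0" "S (S F) v s \<le> 0"
    by (rule local_max_conditions[OF J(1) s v(5)], rule m, assumption)+
  moreover have "Dt F v s \<ge> 0"
    by (rule time_max_condition[OF J(1) s v(5)], rule m')
  ultimately show False
    by (rule step[OF v(1-4)])
qed

lemma time_J: "(\<lambda>u t. t) \<in> J" by (rule jets_time)

lemma max_principle:
  assumes J: "F \<in> J" "G \<in> J" and t: "0 < t0" "t1 < T"
    and init: "\<And>u. G u t0 \<ge> 0 \<Longrightarrow> F u t0 \<le> 0"
    and bdry: "\<And>u t. t \<in> {t0..t1} \<Longrightarrow> G u t = 0 \<Longrightarrow> F u t \<le> 0"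
    and step: "\<And>u t. t0 < t \<Longrightarrow> t \<le> t1 \<Longrightarrow> G u t > 0 \<Longrightarrow> F u t > 0 \<Longrightarrow> S F u t = 0 \<Longrightarrow>
      S (S F) u t \<le> 0 \<Longrightarrow> Dt F u t > 0 \<Longrightarrow> False"
    and ut: "t \<in> {t0..t1}" "G u t \<ge> 0"
  shows "F u t \<le> 0"
proof (rule field_le_epsilon)
  fix e :: real assume e: "e > 0"
  \<comment> \<open>Subtracting \<open>\<epsilon> * (1 + (t - t0))\<close> gives strictness: the
    constant part initially and on the boundary, the growing part in the time derivative. The
    divisor bounds the total by \<open>e\<close>.\<close>
  define \<epsilon> where "\<epsilon> = e / (1 + (t1 - t0))"
  have eps: "\<epsilon> > 0" using e ut by (simp add: \<epsilon>_def)
  define H where "H = (\<lambda>u t. F u t - \<epsilon> * (1 + (t - t0)))"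
  have hJ: "(\<lambda>u t. \<epsilon> * (1 + (t - t0))) \<in> J" using time_J by simp
  have HJ: "H \<in> J" using J hJ by (simp add: H_def)
  have SH: "S H = S F"
    unfolding H_def using S_diff[OF J(1) hJ] du_time[of "\<lambda>t. \<epsilon> * (1 + (t - t0))"]
    by (simp add: S_def)
  have d: "Dt (\<lambda>u t. \<epsilon> * (1 + (t - t0))) u t = \<epsilon>" if "t \<in> I" for u t
    by (rule dt_time) (use that in \<open>auto intro!: derivative_eq_intros\<close>)
  have DH: "Dt H u t = Dt F u t - \<epsilon>" if "t \<in> I" for u t
    using d[OF that, of u] by (simp only: H_def Dt_diff[OF J(1) hJ])
  have "H u t < 0"
  proof (rule max_principle_strict[OF HJ J(2) t])
    show "H u t0 < 0" if "G u t0 \<ge> 0" for u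
      using init[OF that] eps by (simp add: H_def)
    show "H u t < 0" if "t \<in> {t0..t1}" "G u t = 0" for u t
    proof -
      have "0 < \<epsilon> * (1 + (t - t0))" using eps that by (intro mult_pos_pos) auto
      then show ?thesis using bdry[OF that] by (simp add: H_def)
    qed
    fix u t assume 1: "t0 < t" "t \<le> t1" "G u t > 0" "H u t = 0" "S H u t = 0"
      "S (S H) u t \<le> 0" "Dt H u t \<ge> 0"
    have "F u t = \<epsilon> * (1 + (t - t0))" using 1 by (simp add: H_def)
    then have "F u t > 0" using eps 1 by simp
    moreover have "Dt F u t > 0" using DH[of t u] 1 t eps by auto
    ultimately show False using step[of t u] 1 by (simp add: SH)
  qed (use ut in auto)
  then have "F u t < \<epsilon> * (1 + (t - t0))" by (simp add: H_def)
  also have "\<dots> \<le> \<epsilon> * (1 + (t1 - t0))" using ut eps by (intro mult_left_mono) auto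
  also have "\<dots> = e" using ut by (simp add: \<epsilon>_def)
  finally show "F u t \<le> 0 + e" by simp
qed

lemma J_one: "(\<lambda>u t. 1) \<in> J" by simp

lemmas global_max_principle = max_principle[OF _ J_one, simplified]

end

section \<open>Sign changes along the curve\<close>

text \<open>A margin \<open>\<epsilon>\<close> in place of bare signs makes the set of alternating
  times closed, which it would not be for a count of zeros.\<close>

definition alternates :: "real \<Rightarrow> (real \<Rightarrow> real) \<Rightarrow> bool" where
  "alternates \<epsilon> g \<longleftrightarrow> (\<exists>a b c d. a < b \<and> b < c \<and> c < d \<and> d < a + 2 * pi \<and>
     \<epsilon> \<le> g a \<and> g b \<le> - \<epsilon> \<and> \<epsilon> \<le> g c \<and> g d \<le> - \<epsilon>)"

lemma argmax_between:
  fixes g :: "real \<Rightarrow> real"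
  assumes "continuous_on UNIV g" "a < b" "b < c" "g a < g b" "g c < g b"
  obtains m where "a < m" "m < c" "g b \<le> g m" "\<And>v. a \<le> v \<Longrightarrow> v \<le> c \<Longrightarrow> g v \<le> g m"
proof -
  have "\<exists>m\<in>{a..c}. \<forall>v\<in>{a..c}. g v \<le> g m"
    by (rule continuous_attains_sup) (use assms in \<open>auto intro: continuous_on_subset\<close>)
  then obtain m where m: "m \<in> {a..c}" "\<forall>v\<in>{a..c}. g v \<le> g m" by blast
  then have "g b \<le> g m" using assms by auto
  moreover have "m \<noteq> a" "m \<noteq> c" using calculation assms by auto
  ultimately show ?thesis using that[of m] m by auto
qed

lemma argmin_between:
  fixes g :: "real \<Rightarrow> real"
  assumes "continuous_on UNIV g" "a < b" "b < c" "g a > g b" "g c > g b"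
  obtains m where "a < m" "m < c" "g b \<ge> g m" "\<And>v. a \<le> v \<Longrightarrow> v \<le> c \<Longrightarrow> g v \<ge> g m"
proof -
  have "continuous_on UNIV (\<lambda>x. - g x)" using assms by (intro continuous_intros)
  from argmax_between[OF this, of a b c] assms that show ?thesis by auto
qed

text \<open>Each of the four points can be moved to an extremum between its neighbours without
  losing the margin: maxima first, then minima between them, with one shift by a period to close the
  cyclic order.\<close>

lemma alternates_extrema:
  assumes g: "continuous_on UNIV g" "\<And>u. g (u + 2 * pi) = g u" and "alternates \<epsilon> g" "\<epsilon> > 0"
  obtains a b c d where "a < b" "b < c" "c < d" "d < a + 2 * pi"
    "\<epsilon> \<le> g a" "g b \<le> - \<epsilon>" "\<epsilon> \<le> g c" "g d \<le> - \<epsilon>"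
    "\<exists>\<delta>>0. \<forall>v. \<bar>v - a\<bar> < \<delta> \<longrightarrow> g v \<le> g a" "\<exists>\<delta>>0. \<forall>v. \<bar>v - c\<bar> < \<delta> \<longrightarrow> g v \<le> g c"
    "\<exists>\<delta>>0. \<forall>v. \<bar>v - b\<bar> < \<delta> \<longrightarrow> g v \<ge> g b" "\<exists>\<delta>>0. \<forall>v. \<bar>v - d\<bar> < \<delta> \<longrightarrow> g v \<ge> g d"
proof -
  obtain a b c d where o: "a < b" "b < c" "c < d" "d < a + 2 * pi"
    "\<epsilon> \<le> g a" "g b \<le> - \<epsilon>" "\<epsilon> \<le> g c" "g d \<le> - \<epsilon>"
    using assms(3) unfolding alternates_def by blast
  have d': "g (d - 2 * pi) = g d" using g(2)[of "d - 2 * pi"] by simp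
  obtain a' where a': "d - 2 * pi < a'" "a' < b" "g a \<le> g a'"
    "\<And>v. d - 2 * pi \<le> v \<Longrightarrow> v \<le> b \<Longrightarrow> g v \<le> g a'"
    by (rule argmax_between[OF g(1), of "d - 2 * pi" a b]) (use o d' assms(4) in auto)
  obtain c' where c': "b < c'" "c' < d" "g c \<le> g c'" "\<And>v. b \<le> v \<Longrightarrow> v \<le> d \<Longrightarrow> g v \<le> g c'"
    by (rule argmax_between[OF g(1), of b c d]) (use o assms(4) in auto)
  have ac': "\<epsilon> \<le> g a'" "\<epsilon> \<le> g c'" using a'(3) c'(3) o by linarith+
  have less: "g b < g a'" "g b < g c'" "g d < g a'" "g d < g c'" using ac' o assms(4) by linarith+
  obtain b' where b': "a' < b'" "b' < c'" "g b \<ge> g b'" "\<And>v. a' \<le> v \<Longrightarrow> v \<le> c' \<Longrightarrow> g v \<ge> g b'"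
    by (rule argmin_between[OF g(1), of a' b c']) (use a' c' less in auto)
  have a'': "g (a' + 2 * pi) = g a'" using g(2) by simp
  obtain d'' where d'': "c' < d''" "d'' < a' + 2 * pi" "g d \<ge> g d''"
    "\<And>v. c' \<le> v \<Longrightarrow> v \<le> a' + 2 * pi \<Longrightarrow> g v \<ge> g d''"
    by (rule argmin_between[OF g(1), of c' d "a' + 2 * pi"]) (use o a' c' a'' less in auto)
  have nb: "\<exists>\<delta>>0. \<forall>v. \<bar>v - m\<bar> < \<delta> \<longrightarrow> P v" if "l < m" "m < r" "\<And>v. l \<le> v \<Longrightarrow> v \<le> r \<Longrightarrow> P v"
    for l m r and P :: "real \<Rightarrow> bool"
    by (rule exI[of _ "min (m - l) (r - m)"]) (use that in auto)
  have n: "\<exists>\<delta>>0. \<forall>v. \<bar>v - a'\<bar> < \<delta> \<longrightarrow> g v \<le> g a'" "\<exists>\<delta>>0. \<forall>v. \<bar>v - c'\<bar> < \<delta> \<longrightarrow> g v \<le> g c'"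
      "\<exists>\<delta>>0. \<forall>v. \<bar>v - b'\<bar> < \<delta> \<longrightarrow> g v \<ge> g b'" "\<exists>\<delta>>0. \<forall>v. \<bar>v - d''\<bar> < \<delta> \<longrightarrow> g v \<ge> g d''"
    using nb[OF a'(1,2), of "\<lambda>v. g v \<le> g a'"] nb[OF c'(1,2), of "\<lambda>v. g v \<le> g c'"]
      nb[OF b'(1,2), of "\<lambda>v. g v \<ge> g b'"] nb[OF d''(1,2), of "\<lambda>v. g v \<ge> g d''"]
      a'(4) b'(4) c'(4) d''(4) by blast+
  have bd: "g b' \<le> - \<epsilon>" "g d'' \<le> - \<epsilon>" using b'(3) d''(3) o by linarith+
  show ?thesis
    by (rule that[OF b'(1,2) d''(1,2) ac'(1) bd(1) ac'(2) bd(2) n])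
qed

lemma alternates_shift:
  assumes g: "\<And>u. g (u + 2 * pi) = g u" and "alternates \<epsilon> g"
  shows "\<exists>a b c d. 0 \<le> a \<and> a \<le> 2 * pi \<and> a \<le> b \<and> b \<le> c \<and> c \<le> d \<and> d \<le> a + 2 * pi \<and>
     \<epsilon> \<le> g a \<and> g b \<le> - \<epsilon> \<and> \<epsilon> \<le> g c \<and> g d \<le> - \<epsilon>"
proof -
  obtain a b c d where o: "a < b" "b < c" "c < d" "d < a + 2 * pi"
    "\<epsilon> \<le> g a" "g b \<le> - \<epsilon>" "\<epsilon> \<le> g c" "g d \<le> - \<epsilon>"
    using assms(2) unfolding alternates_def by blast
  obtain n :: int where n: "0 \<le> a + of_int n * (2 * pi)" "a + of_int n * (2 * pi) < 0 + 2 * pi"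
    using periodic_reduce[of "2 * pi" 0 a] by auto
  have "g (u + of_int n * (2 * pi)) = g u" for u
    by (rule periodic_int) (rule g)
  then show ?thesis
    using o n
    by (intro exI[of _ "a + of_int n * (2 * pi)"] exI[of _ "b + of_int n * (2 * pi)"]
        exI[of _ "c + of_int n * (2 * pi)"] exI[of _ "d + of_int n * (2 * pi)"]) auto
qed

text \<open>With the first point reduced to one period and the order relaxed to
  \<open>\<le>\<close>, the alternating quadruples form a compact set, and its projection to time is
  closed. Relaxing the order admits nothing new: the values differ by \<open>l t > 0\<close> in
  sign, so no two neighbours coincide.\<close>

lemma alternates_closed:
  fixes f :: "real \<Rightarrow> real \<Rightarrow> real" and l :: "real \<Rightarrow> real"
  assumes f: "continuous_on (UNIV \<times> {t0..t1}) (\<lambda>(u, t). f u t)"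
    and l: "continuous_on {t0..t1} l"
    and per: "\<And>u t. t \<in> {t0..t1} \<Longrightarrow> f (u + 2 * pi) t = f u t"
    and pos: "\<And>t. t \<in> {t0..t1} \<Longrightarrow> l t > 0"
  shows "closed {t \<in> {t0..t1}. alternates (l t) (\<lambda>u. f u t)}"
proof -
  define Q where "Q = {t0..t1} \<times> {0..2*pi} \<times> {0..4*pi} \<times> {0..4*pi} \<times> {0..4*pi}"
  have "compact Q" unfolding Q_def by (intro compact_Times compact_Icc)
  have cont: "continuous_on Q (\<lambda>x. f (h x) (fst x))" if "continuous_on Q h" for h
  proof -
    have "continuous_on Q (\<lambda>x. (\<lambda>(u, t). f u t) (h x, fst x))"
      by (rule continuous_on_compose2[OF f]) (use that in \<open>auto simp: Q_def intro!: continuous_intros\<close>)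
    then show ?thesis by simp
  qed
  have contl: "continuous_on Q (\<lambda>x. l (fst x))"
    by (rule continuous_on_compose2[OF l]) (auto simp: Q_def intro!: continuous_intros)
  have closedQ: "closed Q" using \<open>compact Q\<close> compact_imp_closed by blast
  define A where "A = {x \<in> Q. fst (snd x) \<le> fst (snd (snd x))} \<inter>
    {x \<in> Q. fst (snd (snd x)) \<le> fst (snd (snd (snd x)))} \<inter>
    {x \<in> Q. fst (snd (snd (snd x))) \<le> snd (snd (snd (snd x)))} \<inter>
    {x \<in> Q. snd (snd (snd (snd x))) \<le> fst (snd x) + 2 * pi} \<inter>
    {x \<in> Q. l (fst x) \<le> f (fst (snd x)) (fst x)} \<inter>
    {x \<in> Q. f (fst (snd (snd x))) (fst x) \<le> - l (fst x)} \<inter>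
    {x \<in> Q. l (fst x) \<le> f (fst (snd (snd (snd x)))) (fst x)} \<inter>
    {x \<in> Q. f (snd (snd (snd (snd x)))) (fst x) \<le> - l (fst x)}"
  have "closed A"
    unfolding A_def
    by (intro closed_Int continuous_on_closed_Collect_le closedQ cont contl continuous_intros)
  then have "compact (A \<inter> Q)" using \<open>compact Q\<close> by (rule closed_Int_compact)
  then have "compact (fst ` (A \<inter> Q))"
    by (rule compact_continuous_image[rotated]) (intro continuous_intros)
  moreover have "fst ` (A \<inter> Q) = {t \<in> {t0..t1}. alternates (l t) (\<lambda>u. f u t)}"
  proof (intro equalityI subsetI)
    fix t assume "t \<in> fst ` (A \<inter> Q)"
    then obtain a b c d where x: "(t, a, b, c, d) \<in> A" "(t, a, b, c, d) \<in> Q" by auto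
    then have t: "t \<in> {t0..t1}" by (auto simp: Q_def)
    have o: "a \<le> b" "b \<le> c" "c \<le> d" "d \<le> a + 2 * pi" "l t \<le> f a t" "f b t \<le> - l t" "l t \<le> f c t"
      "f d t \<le> - l t" using x by (auto simp: A_def)
    have "a \<noteq> b" "b \<noteq> c" "c \<noteq> d" "d \<noteq> a + 2 * pi"
      using o pos[OF t] per[OF t, of a] by auto
    then have "alternates (l t) (\<lambda>u. f u t)"
      unfolding alternates_def using o by (intro exI[of _ a] exI[of _ b] exI[of _ c] exI[of _ d]) auto
    then show "t \<in> {t \<in> {t0..t1}. alternates (l t) (\<lambda>u. f u t)}" using t by auto
  next
    fix t assume t: "t \<in> {t \<in> {t0..t1}. alternates (l t) (\<lambda>u. f u t)}"
    then obtain a b c d where "0 \<le> a" "a \<le> 2 * pi" "a \<le> b" "b \<le> c" "c \<le> d" "d \<le> a + 2 * pi"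
       "l t \<le> f a t" "f b t \<le> - l t" "l t \<le> f c t" "f d t \<le> - l t"
      using alternates_shift[of "\<lambda>u. f u t" "l t"] per by blast
    then have "(t, a, b, c, d) \<in> A \<inter> Q" using t by (auto simp: A_def Q_def)
    then show "t \<in> fst ` (A \<inter> Q)" by force
  qed
  ultimately show ?thesis using compact_imp_closed by metis
qed

text \<open>Continuity induction backwards from \<open>t1\<close>: the infimum of the times from
  which on \<open>L\<close> is filled belongs to \<open>L\<close> by closedness, and
  \<open>left\<close> could lower it further.\<close>

lemma left_open_closed_induct:
  fixes L :: "real set"
  assumes "closed L" "t1 \<in> L" "t0 \<le> t1"
    and left: "\<And>t. t \<in> L \<Longrightarrow> t0 < t \<Longrightarrow> t \<le> t1 \<Longrightarrow> \<exists>\<delta>>0. \<forall>s. t - \<delta> < s \<longrightarrow> s < t \<longrightarrow> t0 \<le> s \<longrightarrow> s \<in> L"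
  shows "t0 \<in> L"
proof (rule ccontr)
  assume n: "t0 \<notin> L"
  define c where "c = Inf {t \<in> {t0..t1}. {t..t1} \<subseteq> L}"
  let ?A = "{t \<in> {t0..t1}. {t..t1} \<subseteq> L}"
  have A: "t1 \<in> ?A" "bdd_below ?A" using assms by (auto intro: bdd_belowI[of _ t0])
  have c1: "t0 \<le> c" "c \<le> t1"
  proof -
    have "?A \<noteq> {}" using A(1) by blast
    then show "t0 \<le> c" unfolding c_def by (rule cInf_greatest) auto
    show "c \<le> t1" unfolding c_def by (rule cInf_lower[OF A])
  qed
  have gt: "s \<in> L" if s: "c < s" "s \<le> t1" for s
  proof -
    have "?A \<noteq> {}" using A(1) by blast
    then obtain t where "t \<in> ?A" "t < s" using cInf_lessD[of ?A s] s unfolding c_def by blast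
    then show ?thesis using s by auto
  qed
  have cL: "c \<in> L"
  proof (cases "c = t1")
    case False
    then have lt: "c < t1" using c1 by simp
    have "\<forall>\<^sub>F s in at_right c. s \<in> L"
      using eventually_at_right_real[OF lt] by eventually_elim (use gt in auto)
    then show ?thesis
      using closed_sequentially[of L] assms(1) Lim_in_closed_set[OF assms(1), of "\<lambda>s. s" "at_right c" c]
      by (auto intro: tendsto_ident_at)
  qed (use assms in auto)
  then have "t0 < c" using n c1 by (cases "c = t0") auto
  then obtain \<delta> where d: "\<delta> > 0" "\<forall>s. c - \<delta> < s \<longrightarrow> s < c \<longrightarrow> t0 \<le> s \<longrightarrow> s \<in> L"
    using left[OF cL _ c1(2)] by blast
  define s where "s = max t0 (c - \<delta> / 2)"
  have s: "t0 \<le> s" "s < c" "c - \<delta> < s" using d \<open>t0 < c\<close> by (auto simp: s_def)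
  have "r \<in> L" if "s \<le> r" "r \<le> t1" for r
    using gt[of r] d s cL that by (cases "r < c"; cases "r = c") auto
  then have "s \<in> ?A" using s c1 by auto
  then have "c \<le> s" unfolding c_def using A(2) by (intro cInf_lower) auto
  then show False using s by simp
qed

context csf_flow
begin

lemma J_cont_u: "f \<in> J \<Longrightarrow> t \<in> I \<Longrightarrow> continuous_on UNIV (\<lambda>u. f u t)"
  using J_du by (intro continuous_at_imp_continuous_on) (auto intro!: DERIV_isCont)

text \<open>The margin \<open>l\<close> shrinks backwards at rate \<open>C + 1\<close>. At an
  extremum whose value is exactly \<open>l\<close>, the equation bounds the time derivative by
  \<open>C * l\<close>, which is less than that of \<open>l\<close>; slightly earlier the value
  therefore exceeds the margin. The extra 1 provides the strictness.\<close>

lemma alternates_backward: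
  assumes f: "f \<in> J" and t: "0 < t0" "t0 \<le> t1" "t1 < T"
    and eq: "\<And>u t. t \<in> {t0..t1} \<Longrightarrow> \<bar>Dt f u t - S (S f) u t\<bar> \<le> C * \<bar>f u t\<bar>"
    and eps: "\<epsilon> > 0" and alt: "alternates \<epsilon> (\<lambda>u. f u t1)"
  shows "alternates (\<epsilon> * exp ((C + 1) * (t0 - t1))) (\<lambda>u. f u t0)"
proof -
  define l where "l t = \<epsilon> * exp ((C + 1) * (t - t1))" for t
  have lpos: "l t > 0" for t using eps by (simp add: l_def)
  have l1: "l t1 = \<epsilon>" by (simp add: l_def)
  have dl: "(l has_real_derivative (C + 1) * l t) (at t)" for t
    unfolding l_def by (auto intro!: derivative_eq_intros)
  define L where "L = {t \<in> {t0..t1}. alternates (l t) (\<lambda>u. f u t)}"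
  have sub: "{t0..t1} \<subseteq> I" using t by auto
  have "t0 \<in> L"
  proof (rule left_open_closed_induct)
    show "closed L" unfolding L_def
      by (rule alternates_closed[OF J_cont_on[OF f sub]])
        (use lpos periodic[OF f] sub in \<open>auto simp: l_def intro!: continuous_intros\<close>)
    show "t1 \<in> L" using alt t l1 by (simp add: L_def)
    fix t assume tL: "t \<in> L" "t0 < t" "t \<le> t1"
    then have tI: "t \<in> I" using tL(2,3) t by auto
    obtain a b c d where o: "a < b" "b < c" "c < d" "d < a + 2 * pi"
      "l t \<le> f a t" "f b t \<le> - l t" "l t \<le> f c t" "f d t \<le> - l t"
      and ex: "\<exists>\<delta>>0. \<forall>v. \<bar>v - a\<bar> < \<delta> \<longrightarrow> f v t \<le> f a t" "\<exists>\<delta>>0. \<forall>v. \<bar>v - c\<bar> < \<delta> \<longrightarrow> f v t \<le> f c t"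
      "\<exists>\<delta>>0. \<forall>v. \<bar>v - b\<bar> < \<delta> \<longrightarrow> f v t \<ge> f b t" "\<exists>\<delta>>0. \<forall>v. \<bar>v - d\<bar> < \<delta> \<longrightarrow> f v t \<ge> f d t"
      by (rule alternates_extrema[of "\<lambda>u. f u t" "l t"])
        (use tL lpos J_cont_u[OF f tI] periodic[OF f tI] in \<open>auto simp: L_def\<close>)
    \<comment> \<open>A positive \<open>y\<close> stays positive for a moment; a vanishing
      \<open>y\<close> with negative derivative was positive just before \<open>t\<close>.\<close>
    have dec: "\<exists>\<delta>>0. \<forall>h. 0 < h \<longrightarrow> h < \<delta> \<longrightarrow> 0 < y (t - h)"
      if y: "(y has_real_derivative y') (at t)" "y t \<ge> 0" "y t = 0 \<Longrightarrow> y' < 0" for y y'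
    proof (cases "y t = 0")
      case True
      then show ?thesis using DERIV_neg_dec_left[OF y(1)] y(3) by auto
    next
      case False
      then have "y t > 0" using y by simp
      moreover have "(y \<longlongrightarrow> y t) (at t)" using DERIV_isCont[OF y(1)] by (simp add: isCont_def)
      ultimately have "\<forall>\<^sub>F s in at t. 0 < y s" by (simp add: order_tendstoD)
      then obtain \<delta> where "\<delta> > 0" "\<forall>s. s \<noteq> t \<longrightarrow> dist s t < \<delta> \<longrightarrow> 0 < y s"
        by (auto simp: eventually_at)
      then show ?thesis by (intro exI[of _ \<delta>]) (auto simp: dist_real_def)
    qed
    have up: "\<exists>\<delta>>0. \<forall>h. 0 < h \<longrightarrow> h < \<delta> \<longrightarrow> 0 < f m (t - h) - l (t - h)"
      if m: "l t \<le> f m t" "\<exists>\<delta>>0. \<forall>v. \<bar>v - m\<bar> < \<delta> \<longrightarrow> f v t \<le> f m t" for m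
    proof (rule dec)
      show "((\<lambda>s. f m s - l s) has_real_derivative Dt f m t - (C + 1) * l t) (at t)"
        by (intro derivative_intros dl J_dt[OF f tI])
      assume "f m t - l t = 0"
      then have e: "f m t = l t" by simp
      obtain \<delta> where \<delta>: "\<delta> > 0" "\<And>v. \<bar>v - m\<bar> < \<delta> \<Longrightarrow> f v t \<le> f m t" using m(2) by blast
      have "S (S f) m t \<le> 0" using local_max_conditions(2)[OF f tI \<delta>] .
      moreover have "Dt f m t - S (S f) m t \<le> C * l t"
        using eq[of t m] tL e lpos[of t] by (auto simp: abs_le_iff)
      ultimately show "Dt f m t - (C + 1) * l t < 0"
        using lpos[of t] by (simp add: algebra_simps)
    qed (use m in simp)
    have down: "\<exists>\<delta>>0. \<forall>h. 0 < h \<longrightarrow> h < \<delta> \<longrightarrow> 0 < - f m (t - h) - l (t - h)"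
      if m: "f m t \<le> - l t" "\<exists>\<delta>>0. \<forall>v. \<bar>v - m\<bar> < \<delta> \<longrightarrow> f v t \<ge> f m t" for m
    proof (rule dec)
      show "((\<lambda>s. - f m s - l s) has_real_derivative - Dt f m t - (C + 1) * l t) (at t)"
        by (intro derivative_intros dl J_dt[OF f tI])
      assume "- f m t - l t = 0"
      then have e: "f m t = - l t" by simp
      obtain \<delta> where \<delta>: "\<delta> > 0" "\<And>v. \<bar>v - m\<bar> < \<delta> \<Longrightarrow> f v t \<ge> f m t" using m(2) by blast
      have "S (S f) m t \<ge> 0" using local_min_conditions(2)[OF f tI \<delta>] .
      moreover have "- (Dt f m t - S (S f) m t) \<le> C * l t"
        using eq[of t m] tL e lpos[of t] by (auto simp: abs_le_iff)
      ultimately show "- Dt f m t - (C + 1) * l t < 0"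
        using lpos[of t] by (simp add: algebra_simps)
    qed (use m in simp)
    obtain d1 d2 d3 d4 where d: "d1 > 0" "d2 > 0" "d3 > 0" "d4 > 0"
      "\<And>h. 0 < h \<Longrightarrow> h < d1 \<Longrightarrow> 0 < f a (t - h) - l (t - h)"
      "\<And>h. 0 < h \<Longrightarrow> h < d2 \<Longrightarrow> 0 < - f b (t - h) - l (t - h)"
      "\<And>h. 0 < h \<Longrightarrow> h < d3 \<Longrightarrow> 0 < f c (t - h) - l (t - h)"
      "\<And>h. 0 < h \<Longrightarrow> h < d4 \<Longrightarrow> 0 < - f d (t - h) - l (t - h)"
      using up[OF o(5) ex(1)] down[OF o(6) ex(3)] up[OF o(7) ex(2)] down[OF o(8) ex(4)] by blast
    show "\<exists>\<delta>>0. \<forall>s. t - \<delta> < s \<longrightarrow> s < t \<longrightarrow> t0 \<le> s \<longrightarrow> s \<in> L"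
    proof (intro exI[of _ "min (min d1 d2) (min d3 d4)"] conjI allI impI)
      fix s assume s: "t - min (min d1 d2) (min d3 d4) < s" "s < t" "t0 \<le> s"
      have "t - s < min (min d1 d2) (min d3 d4)" using s by linarith
      then have "t - s < d1" "t - s < d2" "t - s < d3" "t - s < d4" by simp_all
      then have "l s \<le> f a s" "f b s \<le> - l s" "l s \<le> f c s" "f d s \<le> - l s"
        using d(5)[of "t - s"] d(6)[of "t - s"] d(7)[of "t - s"] d(8)[of "t - s"] s by simp_all
      then have "alternates (l s) (\<lambda>u. f u s)"
        unfolding alternates_def using o by blast
      then show "s \<in> L" using s tL by (simp add: L_def)
    qed (use d in simp)
  qed (use t in simp)
  then show ?thesis by (simp add: L_def l_def)
qed

end

section \<open>The strong maximum principle\<close>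

lemma cos_ge_imp_near:
  assumes "0 \<le> \<rho>" "\<rho> \<le> pi" "cos x \<ge> cos \<rho>"
  obtains n :: int where "\<bar>x + of_int n * (2 * pi)\<bar> \<le> \<rho>"
proof -
  obtain n :: int where n: "- pi \<le> x + of_int n * (2 * pi)" "x + of_int n * (2 * pi) < - pi + 2 * pi"
    using periodic_reduce[of "2 * pi" "- pi" x] by auto
  have "cos (x + of_int n * (2 * pi)) = cos x"
    by (rule periodic_int) simp
  then have "cos \<bar>x + of_int n * (2 * pi)\<bar> \<ge> cos \<rho>"
    using assms by (simp only: cos_abs_real)
  then have "\<bar>x + of_int n * (2 * pi)\<bar> \<le> \<rho>"
    using assms n by (subst (asm) cos_mono_le_eq) auto
  then show ?thesis by (rule that)
qed

context csf_flow
begin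

lemma periodic_of_int: "f \<in> J \<Longrightarrow> t \<in> I \<Longrightarrow> f (u + of_int n * (2 * pi)) t = f u t"
  by (rule periodic_int) (rule periodic)

lemma J_attains_sup:
  assumes f: "f \<in> J" and "t0 \<le> t1" "{t0..t1} \<subseteq> I"
  obtains u s where "s \<in> {t0..t1}" "\<And>v t. t \<in> {t0..t1} \<Longrightarrow> f v t \<le> f u s"
proof -
  have "\<exists>x\<in>{0..2*pi} \<times> {t0..t1}. \<forall>y\<in>{0..2*pi} \<times> {t0..t1}.
      (\<lambda>(u, t). f u t) y \<le> (\<lambda>(u, t). f u t) x"
    by (rule continuous_attains_sup)
      (use assms in \<open>auto intro!: compact_Times continuous_on_subset[OF J_cont_on[OF f]]\<close>)
  then obtain z where z: "z \<in> {0..2*pi} \<times> {t0..t1}"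
    "\<And>y. y \<in> {0..2*pi} \<times> {t0..t1} \<Longrightarrow> (\<lambda>(u, t). f u t) y \<le> (\<lambda>(u, t). f u t) z" by blast
  obtain u s where zus: "z = (u, s)" by (cases z)
  have us: "s \<in> {t0..t1}"
    "\<And>v t. v \<in> {0..2*pi} \<Longrightarrow> t \<in> {t0..t1} \<Longrightarrow> f v t \<le> f u s"
    using z(1) z(2)[of "(v, t)" for v t] by (auto simp: zus)
  have "f v t \<le> f u s" if t: "t \<in> {t0..t1}" for v t
  proof -
    obtain n :: int where n: "0 \<le> v + of_int n * (2 * pi)" "v + of_int n * (2 * pi) < 0 + 2 * pi"
      using periodic_reduce[of "2 * pi" 0 v] by auto
    have "f v t = f (v + of_int n * (2 * pi)) t"
      using periodic_of_int[OF f, of t v n] t assms by auto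
    then show ?thesis using us(2)[OF _ t, of "v + of_int n * (2 * pi)"] n by auto
  qed
  then show ?thesis using that us by blast
qed

lemma J_bounded:
  assumes f: "f \<in> J" and "{t0..t1} \<subseteq> I"
  obtains M where "M \<ge> 0" "\<And>u t. t \<in> {t0..t1} \<Longrightarrow> \<bar>f u t\<bar> \<le> M"
proof (cases "t0 \<le> t1")
  case True
  obtain u s where 1: "\<And>v t. t \<in> {t0..t1} \<Longrightarrow> (\<lambda>u t. f u t * f u t) v t \<le> (\<lambda>u t. f u t * f u t) u s"
    using J_attains_sup[OF jets_mult[OF f f] True assms(2)] by metis
  show ?thesis
  proof (rule that[of "\<bar>f u s\<bar>"])
    fix v t assume "t \<in> {t0..t1}"
    then have "(f v t)\<^sup>2 \<le> (f u s)\<^sup>2" using 1 by (simp add: power2_eq_square)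
    then show "\<bar>f v t\<bar> \<le> \<bar>f u s\<bar>" by (simp add: abs_le_square_iff)
  qed simp
qed (use that[of 0] in auto)

lemma J_lower_bound:
  assumes f: "f \<in> J" and "t0 \<le> t1" "{t0..t1} \<subseteq> I" and pos: "\<And>u t. t \<in> {t0..t1} \<Longrightarrow> f u t > 0"
  obtains m where "m > 0" "\<And>u t. t \<in> {t0..t1} \<Longrightarrow> m \<le> f u t"
proof -
  have "(\<lambda>u t. - f u t) \<in> J" using f by simp
  from J_attains_sup[OF this assms(2,3)] obtain u s where
    "s \<in> {t0..t1}" "\<And>v t. t \<in> {t0..t1} \<Longrightarrow> - f v t \<le> - f u s" by metis
  then show ?thesis using that[of "f u s"] pos by simp
qed

text \<open>The barrier is a bump that travels from \<open>(us, t0)\<close> to \<open>(u1, t1)\<close>.\<close>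

lemma strong_max_principle:
  assumes p: "p \<in> J" and t: "0 < t0" "t0 < t1" "t1 < T"
    and u: "ua < us" "us < ub" "ua < u1" "u1 < ub" and C: "C \<ge> 0"
    and nonneg: "\<And>u t. t \<in> {t0..t1} \<Longrightarrow> ua \<le> u \<Longrightarrow> u \<le> ub \<Longrightarrow> p u t \<ge> 0"
    and eq: "\<And>u t. t \<in> {t0..t1} \<Longrightarrow> ua \<le> u \<Longrightarrow> u \<le> ub \<Longrightarrow>
      Dt p u t \<ge> S (S p) u t - C * \<bar>S p u t\<bar> - C * p u t"
    and pos: "p us t0 > 0"
  shows "p u1 t1 > 0"
proof -
  have sub: "{t0..t1} \<subseteq> I" and t0I: "t0 \<in> I" using t by auto
  define v where "v = (u1 - us) / (t1 - t0)"
  define w where "w = (\<lambda>t. us + (t - t0) * v)"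
  have w0: "w t0 = us" and w1: "w t1 = u1" using t by (simp_all add: w_def v_def)
  have "isCont (\<lambda>u. p u t0) us"
    using J_cont_u[OF p t0I] by (simp add: continuous_on_eq_continuous_at)
  then have "\<forall>\<^sub>F u in at us. p us t0 / 2 < p u t0"
    using pos by (intro order_tendstoD) (auto simp: isCont_def)
  then obtain d where d: "d > 0" and d0: "\<And>u. u \<noteq> us \<Longrightarrow> \<bar>u - us\<bar> < d \<Longrightarrow> p us t0 / 2 < p u t0"
    unfolding eventually_at dist_real_def by blast
  have d2: "p us t0 / 2 < p u t0" if "\<bar>u - us\<bar> < d" for u
    using d0[OF _ that] pos by (cases "u = us") auto
  \<comment> \<open>The radius keeps the moving bump inside \<open>[ua, ub]\<close>, its initial
    support inside the region where \<open>p\<close> exceeds half of \<open>p us t0\<close>, and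
    \<open>cos \<rho>\<close> nonnegative.\<close>
  define \<rho> where "\<rho> = min (min (min (us - ua) (ub - us)) (min (u1 - ua) (ub - u1))) (min (d / 2) (pi / 2))"
  have \<rho>: "\<rho> > 0" "\<rho> \<le> us - ua" "\<rho> \<le> ub - us" "\<rho> \<le> u1 - ua" "\<rho> \<le> ub - u1" "\<rho> \<le> d / 2" "\<rho> \<le> pi / 2"
    using u d pi_gt_zero by (auto simp: \<rho>_def min_def)
  have range: "ua \<le> w t - \<rho>" "w t + \<rho> \<le> ub" if "t \<in> {t0..t1}" for t
  proof -
    define x where "x = (t - t0) / (t1 - t0)"
    have x: "0 \<le> x" "x \<le> 1" using that t by (auto simp: x_def)
    have wx: "w t = (1 - x) * us + x * u1"
    proof -
      have "t - t0 = x * (t1 - t0)" using t by (simp add: x_def)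
      then have "w t = us + x * (u1 - us)" using t by (simp add: w_def v_def)
      then show ?thesis by (simp add: algebra_simps)
    qed
    have "(1 - x) * (us - \<rho> - ua) + x * (u1 - \<rho> - ua) \<ge> 0" "(1 - x) * (ub - us - \<rho>) + x * (ub - u1 - \<rho>) \<ge> 0"
      using x \<rho> by (intro add_nonneg_nonneg mult_nonneg_nonneg; simp)+
    then show "ua \<le> w t - \<rho>" "w t + \<rho> \<le> ub" by (simp_all add: wx algebra_simps)
  qed
  \<comment> \<open>Positive exactly within distance \<open>\<rho>\<close> of \<open>w t\<close>
    modulo the period; being periodic, it belongs to the algebra.\<close>
  define \<eta> where "\<eta> = (\<lambda>u t. cos (u - w t) - cos \<rho>)"
  have wJ: "(\<lambda>u t. w t) \<in> J" unfolding w_def using time_J by simp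
  have \<eta>J: "\<eta> \<in> J"
  proof -
    have "(\<lambda>u t. cos (u + 0) * cos (w t) + cos (u + (- pi / 2)) * sin (w t) - cos \<rho>) \<in> J"
      by (intro J_diff jets_add jets_mult cos_J J_cos J_sin wJ jets_const)
    then show ?thesis
      by (simp add: \<eta>_def cos_diff cos_add)
  qed
  have S\<eta>: "S \<eta> u t = - (slow u t * sin (u - w t))" if "t \<in> I" for u t
  proof -
    have "((\<lambda>x. \<eta> x t) has_real_derivative - sin (u - w t)) (at u)"
      unfolding \<eta>_def by (auto intro!: derivative_eq_intros)
    then show ?thesis using that by (auto simp: S_def du_def dest: DERIV_imp_deriv)
  qed
  have D\<eta>: "Dt \<eta> u t = sin (u - w t) * v" if "t \<in> I" for u t
  proof -
    have "((\<lambda>s. \<eta> u s) has_real_derivative sin (u - w t) * v) (at t)"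
      unfolding \<eta>_def w_def by (auto intro!: derivative_eq_intros)
    then show ?thesis using that by (auto simp: dt_def dest: DERIV_imp_deriv)
  qed
  have \<eta>_le: "\<eta> u t \<le> 1" for u t
  proof -
    have "cos \<rho> \<ge> 0" using \<rho> by (intro cos_ge_zero) auto
    then show ?thesis unfolding \<eta>_def using cos_le_one[of "u - w t"] by linarith
  qed
  obtain M1 where M1: "M1 \<ge> 0" "\<And>u t. t \<in> {t0..t1} \<Longrightarrow> \<bar>S \<eta> u t\<bar> \<le> M1"
    using J_bounded[OF S_J[OF \<eta>J] sub] by metis
  obtain M2 where M2: "M2 \<ge> 0" "\<And>u t. t \<in> {t0..t1} \<Longrightarrow> \<bar>S (S \<eta>) u t\<bar> \<le> M2"
    using J_bounded[OF S_J[OF S_J[OF \<eta>J]] sub] by metis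
  obtain \<sigma> where \<sigma>: "\<sigma> > 0" "\<And>u t. t \<in> {t0..t1} \<Longrightarrow> \<sigma> \<le> slow u t"
    using J_lower_bound[OF slow_J less_imp_le[OF t(2)] sub] slow_pos sub by (metis subsetD)
  define s2 where "s2 = (sin \<rho>)\<^sup>2"
  have "sin \<rho> > 0" by (rule sin_gt_zero) (use \<rho> pi_gt_zero in linarith)+
  then have s2: "s2 > 0" by (simp add: s2_def)
  \<comment> \<open>\<open>K\<close> collects the terms linear in \<open>\<eta>\<close>;
    \<open>\<Lambda>\<close> is chosen so that the quadratic in \<open>key\<close> is a positive
    multiple of a perfect square.\<close>
  define K where "K = 2 * \<bar>v\<bar> + 2 * M2 + 2 * C * M1 + 6 * \<sigma>\<^sup>2"
  define \<Lambda> where "\<Lambda> = C + K\<^sup>2 / (8 * \<sigma>\<^sup>2 * s2)"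
  have key: "(\<Lambda> - C) * y\<^sup>2 - K * y + 2 * \<sigma>\<^sup>2 * s2 \<ge> 0" for y
  proof -
    have "8 * \<sigma>\<^sup>2 * s2 * ((\<Lambda> - C) * y\<^sup>2 - K * y + 2 * \<sigma>\<^sup>2 * s2) = (K * y - 4 * \<sigma>\<^sup>2 * s2)\<^sup>2"
      using s2 \<sigma> by (simp add: \<Lambda>_def power2_eq_square field_simps)
    then have "8 * \<sigma>\<^sup>2 * s2 * ((\<Lambda> - C) * y\<^sup>2 - K * y + 2 * \<sigma>\<^sup>2 * s2) \<ge> 0" by simp
    moreover have "8 * \<sigma>\<^sup>2 * s2 > 0" using s2 \<sigma>(1) by simp
    ultimately show ?thesis by (metis mult_pos_neg not_le)
  qed
  define E where "E = (\<lambda>(u::real) t. exp (- (\<Lambda> * (t - t0))))"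
  have EJ: "E \<in> J" unfolding E_def using time_J by (intro J_exp) simp
  have SE: "S E = (\<lambda>u t. 0)"
    using du_time[of "\<lambda>t. exp (- (\<Lambda> * (t - t0)))"] by (simp add: S_def E_def)
  have DE: "Dt E u t = - \<Lambda> * E u t" if "t \<in> I" for u t
    unfolding E_def by (rule dt_time[OF _ that]) (auto intro!: derivative_eq_intros)
  define \<epsilon> where "\<epsilon> = p us t0 / 2"
  have eps: "\<epsilon> > 0" using pos by (simp add: \<epsilon>_def)
  \<comment> \<open>The bump is squared: near its edge the term
    \<open>2 * (S \<eta>)\<^sup>2\<close> in its second derivative is bounded below and wins, and
    away from the edge the decay rate \<open>\<Lambda>\<close> does.\<close>
  define F where "F = (\<lambda>u t. \<epsilon> * (E u t * (\<eta> u t * \<eta> u t)) - p u t)"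
  have FJ: "F \<in> J" unfolding F_def using EJ \<eta>J p by simp
  have SF: "S F = (\<lambda>u t. \<epsilon> * (E u t * (2 * \<eta> u t * S \<eta> u t)) - S p u t)"
    unfolding F_def using EJ \<eta>J p by (simp add: S_simps SE fun_eq_iff)
  have SSF: "S (S F) = (\<lambda>u t. \<epsilon> * (E u t * (2 * S \<eta> u t * S \<eta> u t + 2 * \<eta> u t * S (S \<eta>) u t)) - S (S p) u t)"
    unfolding SF using EJ \<eta>J p by (simp add: S_simps SE fun_eq_iff)
  have DF: "Dt F u t = \<epsilon> * (E u t * (2 * \<eta> u t * Dt \<eta> u t) - \<Lambda> * E u t * (\<eta> u t * \<eta> u t)) - Dt p u t"
    if "t \<in> I" for u t
    unfolding F_def using EJ \<eta>J p by (simp add: Dt_simps DE[OF that] algebra_simps)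
  have near: "\<exists>n::int. \<bar>u + of_int n * (2 * pi) - w t\<bar> \<le> \<rho>" if nn: "\<eta> u t \<ge> 0" for u t
  proof -
    obtain n :: int where "\<bar>(u - w t) + of_int n * (2 * pi)\<bar> \<le> \<rho>"
      by (rule cos_ge_imp_near[of \<rho> "u - w t"]) (use nn \<rho> pi_gt_zero in \<open>simp_all add: \<eta>_def\<close>)
    then show ?thesis by (intro exI[of _ n]) (simp add: algebra_simps)
  qed
  have inside: "p u t \<ge> 0 \<and> Dt p u t \<ge> S (S p) u t - C * \<bar>S p u t\<bar> - C * p u t"
    if ins: "\<eta> u t \<ge> 0" "t \<in> {t0..t1}" for u t
  proof -
    obtain n :: int where n: "\<bar>u + of_int n * (2 * pi) - w t\<bar> \<le> \<rho>" using near[OF ins(1)] by blast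
    have tI: "t \<in> I" using ins sub by auto
    have "ua \<le> u + of_int n * (2 * pi)" "u + of_int n * (2 * pi) \<le> ub"
      using n range[OF ins(2)] by (simp_all add: abs_le_iff)
    from nonneg[OF ins(2) this] eq[OF ins(2) this] show ?thesis
      using p tI by (simp add: periodic_of_int)
  qed
  have "F u1 t1 \<le> 0"
  proof (rule max_principle[OF FJ \<eta>J t(1,3)])
    fix u assume e: "\<eta> u t0 \<ge> 0"
    obtain n :: int where n: "\<bar>u + of_int n * (2 * pi) - w t0\<bar> \<le> \<rho>" using near[OF e] by blast
    then have "\<bar>(u + of_int n * (2 * pi)) - us\<bar> < d" using w0 \<rho> d by auto
    then have "\<epsilon> < p u t0" using d2[of "u + of_int n * (2 * pi)"] periodic_of_int[OF p t0I, of u n] by (simp add: \<epsilon>_def)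
    moreover have "\<epsilon> * (E u t0 * (\<eta> u t0 * \<eta> u t0)) \<le> \<epsilon>"
      using e \<eta>_le[of u t0] eps by (simp add: E_def mult_le_one)
    ultimately show "F u t0 \<le> 0" by (simp add: F_def)
  next
    fix u t assume "t \<in> {t0..t1}" "\<eta> u t = 0"
    then show "F u t \<le> 0" using inside[of u t] by (simp add: F_def)
  next
    fix u t assume a: "t0 < t" "t \<le> t1" "\<eta> u t > 0" "F u t > 0" "S F u t = 0" "S (S F) u t \<le> 0" "Dt F u t > 0"
    define h where "h = \<eta> u t"
    define e where "e = \<epsilon> * E u t"
    have tt: "t \<in> {t0..t1}" and tI: "t \<in> I" using a t by auto
    have e: "e > 0" using eps by (simp add: e_def E_def)
    have Sp: "S p u t = e * (2 * h * S \<eta> u t)" using a(5) by (simp add: SF e_def h_def)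
    have SSp: "e * (2 * (S \<eta> u t)\<^sup>2 + 2 * h * S (S \<eta>) u t) \<le> S (S p) u t"
      using a(6) by (simp add: SSF e_def h_def power2_eq_square mult.assoc)
    have pl: "p u t < e * h\<^sup>2" using a(4) by (simp add: F_def e_def h_def power2_eq_square mult.assoc)
    have D: "Dt p u t < e * (2 * h * Dt \<eta> u t - \<Lambda> * h\<^sup>2)"
      using a(7) DF[OF tI, of u] by (simp add: e_def h_def power2_eq_square algebra_simps)
    have "C * \<bar>S p u t\<bar> = e * (2 * h * C * \<bar>S \<eta> u t\<bar>)"
      unfolding Sp using e a(3) by (simp add: abs_mult h_def)
    moreover have "C * p u t \<le> e * (C * h\<^sup>2)"
      using mult_left_mono[OF less_imp_le[OF pl] C] by (simp add: algebra_simps)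
    moreover have "Dt p u t \<ge> S (S p) u t - C * \<bar>S p u t\<bar> - C * p u t"
      using inside[of u t] a tt by simp
    ultimately have "e * (2 * (S \<eta> u t)\<^sup>2 + 2 * h * S (S \<eta>) u t) - e * (2 * h * C * \<bar>S \<eta> u t\<bar>) - e * (C * h\<^sup>2)
        < e * (2 * h * Dt \<eta> u t - \<Lambda> * h\<^sup>2)"
      using SSp D by linarith
    then have "e * (2 * (S \<eta> u t)\<^sup>2 + 2 * h * S (S \<eta>) u t - 2 * h * C * \<bar>S \<eta> u t\<bar> - C * h\<^sup>2)
        < e * (2 * h * Dt \<eta> u t - \<Lambda> * h\<^sup>2)"
      by (simp add: algebra_simps)
    then have 1: "2 * (S \<eta> u t)\<^sup>2 + 2 * h * S (S \<eta>) u t - 2 * h * C * \<bar>S \<eta> u t\<bar> - C * h\<^sup>2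
        < 2 * h * Dt \<eta> u t - \<Lambda> * h\<^sup>2"
      using e by (simp add: mult_less_cancel_left_pos)
    have h: "h > 0" "h \<le> 1" using a(3) \<eta>_le by (auto simp: h_def)
    have "h * S (S \<eta>) u t \<ge> - (h * M2)"
      using mult_left_mono[of "- M2" "S (S \<eta>) u t" h] M2(2)[OF tt, of u] h by (auto simp: abs_le_iff)
    moreover have "h * C * \<bar>S \<eta> u t\<bar> \<le> h * C * M1"
      using M1(2)[OF tt, of u] h C by (intro mult_left_mono) auto
    moreover have "h * Dt \<eta> u t \<le> h * \<bar>v\<bar>"
    proof -
      have "Dt \<eta> u t \<le> \<bar>sin (u - w t)\<bar> * \<bar>v\<bar>"
        unfolding D\<eta>[OF tI] abs_mult[symmetric] by (rule abs_ge_self)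
      also have "\<dots> \<le> 1 * \<bar>v\<bar>" by (intro mult_right_mono abs_sin_le_one) auto
      finally show ?thesis using h by simp
    qed
    moreover have "(S \<eta> u t)\<^sup>2 \<ge> \<sigma>\<^sup>2 * (s2 - 3 * h)"
    proof -
      have "(sin (u - w t))\<^sup>2 = s2 - 2 * cos \<rho> * h - h\<^sup>2"
      proof -
        have "cos (u - w t) = h + cos \<rho>" by (simp add: h_def \<eta>_def)
        moreover have "(sin (u - w t))\<^sup>2 = 1 - (cos (u - w t))\<^sup>2" "s2 = 1 - (cos \<rho>)\<^sup>2"
          unfolding s2_def by (rule sin_squared_eq)+
        ultimately show ?thesis
          by (simp add: power2_eq_square algebra_simps)
      qed
      moreover have "cos \<rho> * h \<le> 1 * h" using h by (intro mult_right_mono) auto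
      moreover have "h\<^sup>2 \<le> h" using h by (simp add: power2_eq_square mult_left_le)
      ultimately have "s2 - 3 * h \<le> (sin (u - w t))\<^sup>2" by simp
      then have "\<sigma>\<^sup>2 * (s2 - 3 * h) \<le> \<sigma>\<^sup>2 * (sin (u - w t))\<^sup>2" by (intro mult_left_mono) auto
      also have "\<dots> \<le> (slow u t)\<^sup>2 * (sin (u - w t))\<^sup>2"
        using \<sigma>(1) \<sigma>(2)[OF tt, of u] by (intro mult_right_mono power_mono) auto
      finally show ?thesis by (simp add: S\<eta>[OF tI] power_mult_distrib)
    qed
    ultimately show False using 1 key[of h]
      by (simp add: K_def algebra_simps)
  next
    have "\<eta> u1 t1 = 1 - cos \<rho>" by (simp add: \<eta>_def w1)
    then show "\<eta> u1 t1 \<ge> 0" by simp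
  qed (use t in simp)
  moreover have "\<eta> u1 t1 > 0"
    using cos_monotone_0_pi[of 0 \<rho>] \<rho> by (simp add: \<eta>_def w1)
  then have "\<epsilon> * (E u1 t1 * (\<eta> u1 t1 * \<eta> u1 t1)) > 0" using eps by (simp add: E_def)
  ultimately show ?thesis by (simp add: F_def)
qed

end

section \<open>Critical points of functions whose levels are crossed at most twice\<close>

lemma alternates_minus:
  assumes "\<And>u. g (u + 2 * pi) = g u" "alternates \<epsilon> (\<lambda>u. - g u)"
  shows "alternates \<epsilon> g"
proof -
  obtain a b c d where o: "a < b" "b < c" "c < d" "d < a + 2 * pi"
    "\<epsilon> \<le> - g a" "- g b \<le> - \<epsilon>" "\<epsilon> \<le> - g c" "- g d \<le> - \<epsilon>"
    using assms(2) unfolding alternates_def by blast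
  show ?thesis
    unfolding alternates_def
    by (rule exI[of _ b], rule exI[of _ c], rule exI[of _ d], rule exI[of _ "a + 2 * pi"])
      (use o assms(1)[of a] in auto)
qed

lemma alternatesI:
  fixes g :: "real \<Rightarrow> real"
  assumes "a < b" "b < c" "c < d" "d < a + 2 * pi" "0 < g a" "g b < 0" "0 < g c" "g d < 0"
  shows "\<exists>\<epsilon>>0. alternates \<epsilon> g"
proof (intro exI conjI)
  define e where "e = Min {g a, - g b, g c, - g d}"
  have e: "e > 0" "e \<le> g a" "e \<le> - g b" "e \<le> g c" "e \<le> - g d"
    using assms by (auto simp: e_def)
  show "e > 0" by (rule e)
  show "alternates e g"
    unfolding alternates_def
    by (rule exI[of _ a], rule exI[of _ b], rule exI[of _ c], rule exI[of _ d]) (use e assms in auto)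
qed

context csf_flow
begin

definition caloric :: "(real \<Rightarrow> real \<Rightarrow> real) \<Rightarrow> bool" where
  "caloric w \<longleftrightarrow> w \<in> J \<and> Dt w = S (S w)"

lemma caloric_X: "caloric (X i)"
  by (simp add: caloric_def heat)

lemma caloric_const: "caloric (\<lambda>u t. c)"
  by (simp add: caloric_def dt_const S_const)

lemma caloric_add: "caloric f \<Longrightarrow> caloric g \<Longrightarrow> caloric (\<lambda>u t. f u t + g u t)"
  by (simp add: caloric_def dt_add S_add)

lemma caloric_cmult: "caloric f \<Longrightarrow> caloric (\<lambda>u t. c * f u t)"
  by (simp add: caloric_def Dt_cmult S_cmult)

lemma caloric_minus: "caloric f \<Longrightarrow> caloric (\<lambda>u t. - f u t)"
  by (simp add: caloric_def Dt_minus S_minus)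

lemma caloric_diff: "caloric f \<Longrightarrow> caloric g \<Longrightarrow> caloric (\<lambda>u t. f u t - g u t)"
  by (simp add: caloric_def Dt_diff S_diff)

lemmas caloric_intros = caloric_X caloric_const caloric_add caloric_cmult caloric_minus caloric_diff

lemma caloric_J: "caloric f \<Longrightarrow> f \<in> J"
  by (simp add: caloric_def)

lemma Dt_S_caloric: "caloric w \<Longrightarrow> Dt (S w) u t = S (S (S w)) u t + q u t * S w u t"
  by (simp add: caloric_def Dt_S)

text \<open>Quantifying over the shift \<open>c\<close> means that every level, not only 0, is
  crossed at most twice: around the circle the function rises once and falls once.\<close>

definition tame :: "(real \<Rightarrow> real \<Rightarrow> real) \<Rightarrow> bool" where
  "tame w \<longleftrightarrow> caloric w \<and> (\<forall>c. \<forall>\<epsilon>>0. \<forall>t\<in>I. \<not> alternates \<epsilon> (\<lambda>u. w u t + c))"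

lemma tame_minus: "tame w \<Longrightarrow> tame (\<lambda>u t. - w u t)"
proof -
  assume w: "tame w"
  then have J: "w \<in> J" by (simp add: tame_def caloric_J)
  have "\<not> alternates \<epsilon> (\<lambda>u. - w u t + c)" if t: "t \<in> I" and "\<epsilon> > 0" for \<epsilon> t c
  proof
    assume "alternates \<epsilon> (\<lambda>u. - w u t + c)"
    then have "alternates \<epsilon> (\<lambda>u. - (w u t + - c))" by simp
    then have "alternates \<epsilon> (\<lambda>u. w u t + - c)"
      by (rule alternates_minus[rotated]) (simp add: periodic[OF J t])
    then show False using w that unfolding tame_def by blast
  qed
  then show ?thesis using w by (auto simp: tame_def caloric_minus)
qed

lemma tame_no_alternation:
  assumes "tame w" "t \<in> I" "a < b" "b < c" "c < d" "d < a + 2 * pi"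
    "k < w a t" "w b t < k" "k < w c t" "w d t < k"
  shows False
proof -
  obtain \<epsilon> where "\<epsilon> > 0" "alternates \<epsilon> (\<lambda>u. w u t + - k)"
    using alternatesI[of a b c d "\<lambda>u. w u t + - k"] assms by auto
  then show False using assms(1,2) unfolding tame_def by blast
qed

lemma J_near:
  assumes "f \<in> J" "t \<in> I" "e > 0"
  obtains \<delta> where "\<delta> > 0" "\<And>v s. \<bar>v - u\<bar> < \<delta> \<Longrightarrow> \<bar>s - t\<bar> < \<delta> \<Longrightarrow> s \<in> I \<and> \<bar>f v s - f u t\<bar> < e"
proof -
  have "isCont (\<lambda>(u, t). f u t) (u, t)"
    using J_cont[OF assms(1)] assms(2) openI
    by (simp add: continuous_on_eq_continuous_at open_Times)
  then obtain d where d: "d > 0" "\<And>y. dist y (u, t) < d \<Longrightarrow> dist ((\<lambda>(u, t). f u t) y) (f u t) < e"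
    using assms(3) unfolding continuous_at_eps_delta by auto
  obtain d' where d': "d' > 0" "\<And>s. dist s t < d' \<Longrightarrow> s \<in> I"
    using openI assms(2) unfolding open_dist by blast
  show ?thesis
  proof (rule that[of "min (d / 2) d'"])
    fix v s assume 1: "\<bar>v - u\<bar> < min (d / 2) d'" "\<bar>s - t\<bar> < min (d / 2) d'"
    have "dist (v, s) (u, t) \<le> dist v u + dist s t"
      by (simp add: dist_Pair_Pair sqrt_sum_squares_le_sum)
    also have "\<dots> < d / 2 + d / 2" using 1 by (intro add_strict_mono) (auto simp: dist_real_def)
    finally have "dist (v, s) (u, t) < d" by simp
    from d(2)[OF this] show "s \<in> I \<and> \<bar>f v s - f u t\<bar> < e"
      using d'(2)[of s] 1 by (auto simp: dist_real_def)
  qed (use d d' in simp)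
qed

text \<open>A descent anywhere near \<open>(u0, t1)\<close> would, together with the low point
  \<open>um\<close> and the high point \<open>uM\<close>, cross one level four times. So
  \<open>S w\<close> is nonnegative nearby. It solves a linear parabolic equation, and its zero
  spreads to earlier times by the strong maximum principle, then back to \<open>t1\<close> by
  continuity.\<close>

lemma rising_noncritical_local:
  assumes w: "tame w" and t1: "t1 \<in> I" and o: "um < u0" "u0 < uM" "uM < um + 2 * pi"
    and wo: "w um t1 < w u0 t1" "w u0 t1 < w uM t1" and crit: "S w u0 t1 = 0"
  shows "\<exists>\<delta>>0. \<forall>u. \<bar>u - u0\<bar> < \<delta> \<longrightarrow> S w u t1 = 0"
proof -
  have J: "w \<in> J" and cal: "caloric w" using w by (auto simp: tame_def caloric_J)
  define c where "c = w u0 t1"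
  define e where "e = min (c - w um t1) (w uM t1 - c) / 2"
  have e: "e > 0" "w um t1 + e \<le> c - e" "c + e \<le> w uM t1 - e"
    using wo by (auto simp: e_def c_def min_def field_simps)
  obtain d1 where d1: "d1 > 0" "\<And>v s. \<bar>v - um\<bar> < d1 \<Longrightarrow> \<bar>s - t1\<bar> < d1 \<Longrightarrow> s \<in> I \<and> \<bar>w v s - w um t1\<bar> < e"
    using J_near[OF J t1 e(1)] by blast
  obtain d2 where d2: "d2 > 0" "\<And>v s. \<bar>v - uM\<bar> < d2 \<Longrightarrow> \<bar>s - t1\<bar> < d2 \<Longrightarrow> s \<in> I \<and> \<bar>w v s - w uM t1\<bar> < e"
    using J_near[OF J t1 e(1)] by blast
  obtain d3 where d3: "d3 > 0" "\<And>v s. \<bar>v - u0\<bar> < d3 \<Longrightarrow> \<bar>s - t1\<bar> < d3 \<Longrightarrow> s \<in> I \<and> \<bar>w v s - w u0 t1\<bar> < e"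
    using J_near[OF J t1 e(1)] by blast
  define \<delta> where "\<delta> = Min {d1, d2, d3, u0 - um, uM - u0}"
  have \<delta>: "\<delta> > 0" "\<delta> \<le> d1" "\<delta> \<le> d2" "\<delta> \<le> d3" "\<delta> \<le> u0 - um" "\<delta> \<le> uM - u0"
    using d1 d2 d3 o by (auto simp: \<delta>_def)
  have nonneg: "S w a t \<ge> 0" if a: "\<bar>a - u0\<bar> < \<delta>" "\<bar>t - t1\<bar> < \<delta>" for a t
  proof (rule ccontr)
    assume neg: "\<not> S w a t \<ge> 0"
    have tI: "t \<in> I" using d1(2)[of um t] a \<delta> by auto
    have "du I w a t < 0"
      using neg slow_pos[OF tI, of a] by (simp add: S_def zero_le_mult_iff not_le)
    then obtain h0 where h0: "h0 > 0" "\<And>h. 0 < h \<Longrightarrow> h < h0 \<Longrightarrow> w (a + h) t < w a t"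
      using DERIV_neg_dec_right[OF J_du[OF J tI]] by metis
    define h where "h = min h0 (u0 + \<delta> - a) / 2"
    have h: "0 < h" "h < h0" "h < u0 + \<delta> - a" using h0 a by (auto simp: h_def)
    define b where "b = a + h"
    have ab: "a < b" "w b t < w a t" "\<bar>b - u0\<bar> < \<delta>" using h h0(2)[OF h(1,2)] a by (auto simp: b_def)
    have "\<bar>w um t - w um t1\<bar> < e" "\<bar>w uM t - w uM t1\<bar> < e"
      using d1(2)[of um t] d2(2)[of uM t] a \<delta> d1(1) d2(1) by auto
    moreover have "\<bar>w a t - c\<bar> < e" "\<bar>w b t - c\<bar> < e"
      using d3(2)[of a t] d3(2)[of b t] a ab \<delta> by (auto simp: c_def)
    ultimately have B: "\<bar>w a t - c\<bar> < e" "\<bar>w b t - c\<bar> < e" "w um t < c - e" "c + e < w uM t"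
      using e by linarith+
    have e': "w (um + 2 * pi) t = w um t" by (rule periodic[OF J tI])
    show False
    proof (intro tame_no_alternation[OF w tI, of a b uM "um + 2 * pi" "(w a t + w b t) / 2"])
      show "b < uM" "um + 2 * pi < a + 2 * pi" using a ab \<delta> by linarith+
      have "c - e < w a t" "c - e < w b t" "w a t < c + e" "w b t < c + e"
        using B(1,2) by (simp_all add: abs_less_iff)
      then show "w (um + 2 * pi) t < (w a t + w b t) / 2" "(w a t + w b t) / 2 < w uM t"
        unfolding e' using B(3,4) by simp_all
    qed (use ab o in auto)
  qed
  have z: "S w u s = 0" if u: "\<bar>u - u0\<bar> < \<delta> / 2" and s: "t1 - \<delta> / 2 < s" "s < t1" for u s
  proof (rule ccontr)
    assume "S w u s \<noteq> 0"
    then have pos: "S w u s > 0" using nonneg[of u s] u s \<delta> by fastforce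
    have sub: "{s..t1} \<subseteq> I" using d1(2)[of um] s \<delta> d1 by (auto simp: subset_iff abs_if)
    obtain M where M: "M \<ge> 0" "\<And>u t. t \<in> {s..t1} \<Longrightarrow> \<bar>q u t\<bar> \<le> M"
      using J_bounded[OF q_J sub] by metis
    have ur: "u0 - \<delta> / 2 < u" "u < u0 + \<delta> / 2" using u by linarith+
    have sI: "0 < s" using subsetD[OF sub, of s] s(2) by auto
    have "S w u0 t1 > 0"
    proof (rule strong_max_principle[of "S w" s t1 "u0 - \<delta> / 2" u "u0 + \<delta> / 2" u0 0])
      show "S w u t \<ge> 0" if "t \<in> {s..t1}" "u0 - \<delta> / 2 \<le> u" "u \<le> u0 + \<delta> / 2" for u t
        using nonneg[of u t] that s \<delta> by (auto simp: abs_if)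
      then show "Dt (S w) u t \<ge> S (S (S w)) u t - 0 * \<bar>S (S w) u t\<bar> - 0 * S w u t"
        if "t \<in> {s..t1}" "u0 - \<delta> / 2 \<le> u" "u \<le> u0 + \<delta> / 2" for u t
        using that q_nonneg[of u t] by (simp add: Dt_S_caloric[OF cal])
    qed (use sI t1 s(2) ur \<delta>(1) pos S_J[OF J] in \<open>simp_all\<close>)
    then show False using crit by simp
  qed
  have "S w u t1 = 0" if u: "\<bar>u - u0\<bar> < \<delta> / 2" for u
  proof (rule ccontr)
    assume "S w u t1 \<noteq> 0"
    then obtain d where d: "d > 0" "\<And>v s. \<bar>v - u\<bar> < d \<Longrightarrow> \<bar>s - t1\<bar> < d \<Longrightarrow> s \<in> I \<and> \<bar>S w v s - S w u t1\<bar> < \<bar>S w u t1\<bar>"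
      using J_near[OF S_J[OF J] t1, of "\<bar>S w u t1\<bar>" u] by auto
    define h where "h = min d (\<delta> / 2) / 2"
    have h: "h > 0" "h < d" "h < \<delta> / 2" using d \<delta> by (auto simp: h_def)
    have "S w u (t1 - h) = 0" using z[OF u, of "t1 - h"] h by simp
    then show False using d(2)[of u "t1 - h"] h by simp
  qed
  then show ?thesis using \<delta>(1) by (intro exI[of _ "\<delta> / 2"]) auto
qed

text \<open>The critical points in the level of \<open>u0\<close> form an open and closed subset of
  \<open>(um, uM)\<close>. If there is one, \<open>w\<close> is constant up to \<open>um\<close>,
  against the lower value there.\<close>

lemma rising_noncritical:
  assumes w: "tame w" and t1: "t1 \<in> I" and o: "um < u0" "u0 < uM" "uM < um + 2 * pi"
    and wo: "w um t1 < w u0 t1" "w u0 t1 < w uM t1"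
  shows "S w u0 t1 \<noteq> 0"
proof
  assume crit: "S w u0 t1 = 0"
  have J: "w \<in> J" using w by (auto simp: tame_def caloric_J)
  define c where "c = w u0 t1"
  define A where "A = {u \<in> {um<..<uM}. w u t1 = c \<and> S w u t1 = 0}"
  have cw: "continuous_on {um<..<uM} (\<lambda>u. w u t1)" "continuous_on {um<..<uM} (\<lambda>u. S w u t1)"
    by (rule continuous_on_subset[OF J_cont_u[OF _ t1] subset_UNIV], simp add: J)+
  have "closedin (top_of_set {um<..<uM}) A"
  proof -
    have "closedin (top_of_set {um<..<uM}) ({u \<in> {um<..<uM}. w u t1 = c} \<inter> {u \<in> {um<..<uM}. S w u t1 = 0})"
      by (intro closedin_Int continuous_closedin_preimage_constant cw)
    then show ?thesis by (simp add: A_def Int_def conj_ac)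
  qed
  moreover have "open A"
    unfolding open_dist
  proof
    fix u assume u: "u \<in> A"
    then have u': "um < u" "u < uM" "w u t1 = c" "S w u t1 = 0" by (auto simp: A_def)
    obtain \<delta> where \<delta>: "\<delta> > 0" "\<And>v. \<bar>v - u\<bar> < \<delta> \<Longrightarrow> S w v t1 = 0"
      using rising_noncritical_local[OF w t1 u'(1,2) o(3) _ _ u'(4)] wo u' by (auto simp: c_def)
    define \<eta> where "\<eta> = min \<delta> (min (u - um) (uM - u))"
    have "v \<in> A" if "dist v u < \<eta>" for v
    proof -
      have v: "\<bar>v - u\<bar> < \<eta>" using that by (simp add: dist_real_def)
      have "du I w z t1 = 0" if "\<bar>z - u\<bar> < \<delta>" for z
        using slow_du[OF t1, of w z] \<delta>(2)[OF that] by simp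
      then have d: "((\<lambda>u. w u t1) has_real_derivative 0) (at z)" if "\<bar>z - u\<bar> < \<delta>" for z
        using J_du[OF J t1, of z] that by simp
      have "w v t1 = w u t1"
      proof (rule DERIV_isconst3[of "u - \<delta>" "u + \<delta>" v u "\<lambda>u. w u t1"])
        show "((\<lambda>u. w u t1) has_real_derivative 0) (at z)" if "z \<in> {u - \<delta><..<u + \<delta>}" for z
          using that by (intro d) auto
      qed (use v \<delta> in \<open>auto simp: \<eta>_def\<close>)
      then show ?thesis using v u' \<delta> by (auto simp: A_def \<eta>_def)
    qed
    moreover have "\<eta> > 0" using \<delta> u' by (simp add: \<eta>_def)
    ultimately show "\<exists>e>0. \<forall>v. dist v u < e \<longrightarrow> v \<in> A" by blast
  qed
  then have "openin (top_of_set {um<..<uM}) A" by (intro open_subset) (auto simp: A_def)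
  moreover have "u0 \<in> A" using o crit by (auto simp: A_def c_def)
  ultimately have A: "A = {um<..<uM}"
    using connected_Ioo[of um uM] unfolding connected_clopen by blast
  have "((\<lambda>u. w u t1) \<longlongrightarrow> w um t1) (at um)"
    using J_cont_u[OF J t1] unfolding continuous_on_def by simp
  from tendsto_within_subset[OF this subset_UNIV]
  have lim: "((\<lambda>u. w u t1) \<longlongrightarrow> w um t1) (at_right um)" .
  have "\<forall>\<^sub>F u in at_right um. w u t1 = c"
  proof -
    have "um < uM" using o by simp
    have c: "w u t1 = c" if "u \<in> {um<..<uM}" for u
    proof -
      have "u \<in> A" using that by (simp only: A)
      then show ?thesis unfolding A_def by blast
    qed
    from eventually_at_right_real[OF \<open>um < uM\<close>] show ?thesis
      by (rule eventually_mono) (rule c)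
  qed
  from tendsto_unique[OF trivial_limit_at_right_real lim tendsto_eventually[OF this]]
  have "w um t1 = c" .
  then show False using wo by (simp add: c_def)
qed

text \<open>After shifts by periods the low and the high point lie within one period of
  \<open>u0\<close>. Depending on their order, \<open>u0\<close> lies on a rising arc of
  \<open>w\<close> or of \<open>- w\<close>.\<close>

lemma nonextremal_noncritical:
  assumes w: "tame w" and t1: "t1 \<in> I" and wo: "w um t1 < w u0 t1" "w u0 t1 < w uM t1"
  shows "S w u0 t1 \<noteq> 0"
proof -
  have J: "w \<in> J" using w by (auto simp: tame_def caloric_J)
  obtain n :: int where n: "u0 - 2 * pi \<le> um + of_int n * (2 * pi)" "um + of_int n * (2 * pi) < u0 - 2 * pi + 2 * pi"
    using periodic_reduce[of "2 * pi" "u0 - 2 * pi" um] by auto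
  obtain m :: int where m: "u0 \<le> uM + of_int m * (2 * pi)" "uM + of_int m * (2 * pi) < u0 + 2 * pi"
    using periodic_reduce[of "2 * pi" u0 uM] by auto
  define a where "a = um + of_int n * (2 * pi)"
  define b where "b = uM + of_int m * (2 * pi)"
  have wa: "w a t1 = w um t1" and wb: "w b t1 = w uM t1"
    using periodic_of_int[OF J t1] by (auto simp: a_def b_def)
  have w2: "w (a + 2 * pi) t1 = w um t1" "w (b - 2 * pi) t1 = w uM t1"
    using periodic[OF J t1, of a] periodic[OF J t1, of "b - 2 * pi"] wa wb by auto
  have ab: "a < u0" "u0 < b" "u0 - 2 * pi \<le> a" "b < u0 + 2 * pi"
    using n m wb wo by (auto simp: a_def b_def order_le_less)
  show ?thesis
  proof (cases "b < a + 2 * pi")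
    case True
    show ?thesis
      by (rule rising_noncritical[OF w t1 ab(1,2) True]) (use wa wb wo in auto)
  next
    case False
    then have "a + 2 * pi < b" using wb w2 wo by (cases "b = a + 2 * pi") auto
    moreover have "u0 < a + 2 * pi" using ab(3) w2 wo by (cases "u0 = a + 2 * pi") auto
    ultimately have "S (\<lambda>u t. - w u t) u0 t1 \<noteq> 0"
      by (intro rising_noncritical[OF tame_minus[OF w] t1, of "b - 2 * pi" u0 "a + 2 * pi"])
        (use ab w2 wo in auto)
    then show ?thesis using J by (simp add: S_minus)
  qed
qed

end

section \<open>Sign changes of derivatives\<close>

lemma crossing_down:
  fixes v :: "real \<Rightarrow> real"
  assumes d: "\<And>u. (v has_real_derivative v' u) (at u)" and ab: "a < b" "v a > 0" "v b < 0"
  obtains z where "a < z" "z < b" "v z = 0" "v' z \<le> 0"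
proof -
  have cont: "continuous_on UNIV v"
    using d by (intro continuous_at_imp_continuous_on) (auto intro: DERIV_isCont)
  define A where "A = {u \<in> {a..b}. v u \<le> 0}"
  have "closed A"
    unfolding A_def
    by (intro continuous_on_closed_Collect_le continuous_on_subset[OF cont] continuous_intros) auto
  moreover have "bounded A" by (rule bounded_subset[of "{a..b}"]) (auto simp: A_def)
  ultimately have "compact A" by (simp add: compact_eq_bounded_closed)
  moreover have "b \<in> A" using ab by (auto simp: A_def)
  ultimately obtain z where z: "z \<in> A" "\<And>y. y \<in> A \<Longrightarrow> z \<le> y"
    using compact_attains_inf[of A] by blast
  have pos: "v y > 0" if "a \<le> y" "y < z" for y
    using z that by (force simp: A_def not_le)
  have "a < z" using z(1) ab by (auto simp: A_def order_le_less)
  have "v z \<ge> 0"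
  proof (rule tendsto_lowerbound)
    show "(v \<longlongrightarrow> v z) (at_left z)"
      using DERIV_isCont[OF d[of z]] unfolding isCont_def by (rule tendsto_within_subset) simp
    show "\<forall>\<^sub>F y in at_left z. 0 \<le> v y"
      using eventually_at_left_real[OF \<open>a < z\<close>] by (rule eventually_mono) (use pos in \<open>auto intro: less_imp_le\<close>)
  qed simp
  then have vz: "v z = 0" using z(1) by (auto simp: A_def)
  have "v' z \<le> 0"
  proof (rule ccontr)
    assume "\<not> v' z \<le> 0"
    then have "v' z > 0" by simp
    then obtain e where e: "e > 0" "\<And>h. 0 < h \<Longrightarrow> h < e \<Longrightarrow> v (z - h) < v z"
      using DERIV_pos_inc_left[OF d] by metis
    define h where "h = min e (z - a) / 2"
    have h: "h > 0" "h < e" "h < z - a" using e \<open>a < z\<close> by (auto simp: h_def)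
    show False using e(2)[OF h(1,2)] pos[of "z - h"] h vz by simp
  qed
  moreover have "z < b" using z(1) vz ab by (auto simp: A_def order_le_less)
  ultimately show ?thesis using that \<open>a < z\<close> vz by blast
qed

context csf_flow
begin

lemma du_pos: "t \<in> I \<Longrightarrow> (0 < du I f u t) = (0 < S f u t)"
  and du_neg: "t \<in> I \<Longrightarrow> (du I f u t < 0) = (S f u t < 0)"
  using slow_pos[of t u] by (auto simp: S_def zero_less_mult_iff mult_less_0_iff)

lemma peak_between:
  assumes w: "w \<in> J" and t: "t \<in> I" and ab: "a < b" and s: "S w a t > 0" "S w b t < 0"
  obtains m where "a < m" "m < b" "w a t < w m t" "w b t < w m t"
proof -
  note d = J_du[OF w t]
  have cont: "continuous_on {a..b} (\<lambda>u. w u t)"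
    by (rule continuous_on_subset[OF J_cont_u[OF w t]]) simp
  obtain m where m: "m \<in> {a..b}" "\<And>y. y \<in> {a..b} \<Longrightarrow> w y t \<le> w m t"
    using continuous_attains_sup[OF _ _ cont] ab by auto
  obtain e1 where e1: "e1 > 0" "\<And>h. 0 < h \<Longrightarrow> h < e1 \<Longrightarrow> w a t < w (a + h) t"
    using DERIV_pos_inc_right[OF d, of a] s by (auto simp: du_pos[OF t])
  obtain e2 where e2: "e2 > 0" "\<And>h. 0 < h \<Longrightarrow> h < e2 \<Longrightarrow> w b t < w (b - h) t"
    using DERIV_neg_dec_left[OF d, of b] s by (auto simp: du_neg[OF t])
  define h where "h = min (min e1 e2) (b - a) / 2"
  have h: "h > 0" "h < e1" "h < e2" "h < b - a" using e1 e2 ab by (auto simp: h_def)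
  have "w a t < w m t" "w b t < w m t"
    using e1(2)[OF h(1,2)] e2(2)[OF h(1,3)] m(2)[of "a + h"] m(2)[of "b - h"] h by auto
  moreover have "a < m" "m < b" using calculation m(1) by (auto simp: order_le_less)
  ultimately show ?thesis using that by blast
qed

text \<open>An ascent followed by a descent encloses a peak above both points, a descent followed by
  an ascent a valley below both. Four sign changes of the derivative give two peaks and two valleys,
  and a level between the higher valley and the lower peak is crossed four times.\<close>

lemma S_tame_no_alternation:
  assumes w: "tame w" and t: "t \<in> I" and o: "a < b" "b < c" "c < d" "d < a + 2 * pi"
    and s: "S w a t > 0" "S w b t < 0" "S w c t > 0" "S w d t < 0"
  shows False
proof -
  have J: "w \<in> J" using w by (simp add: tame_def caloric_J)
  have J': "(\<lambda>u t. - w u t) \<in> J" using J by simp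
  have s': "S (\<lambda>u t. - w u t) u t = - S w u t" for u using J by (simp add: S_minus)
  have pa: "S w (a + 2 * pi) t = S w a t" "w (a + 2 * pi) t = w a t"
    using periodic[OF S_J[OF J] t] periodic[OF J t] by simp_all
  obtain m1 where m1: "a < m1" "m1 < b" "w a t < w m1 t" "w b t < w m1 t"
    using peak_between[OF J t o(1) s(1,2)] by blast
  obtain m3 where m3: "c < m3" "m3 < d" "w c t < w m3 t" "w d t < w m3 t"
    using peak_between[OF J t o(3) s(3,4)] by blast
  obtain m2 where m2: "b < m2" "m2 < c" "- w b t < - w m2 t" "- w c t < - w m2 t"
    using peak_between[OF J' t o(2)] s s' by auto
  obtain m4 where m4: "d < m4" "m4 < a + 2 * pi" "- w d t < - w m4 t" "- w (a + 2 * pi) t < - w m4 t"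
    using peak_between[OF J' t o(4)] s s' pa by auto
  define lo where "lo = max (w m2 t) (w m4 t)"
  define hi where "hi = min (w m1 t) (w m3 t)"
  have "lo < hi"
    using m1 m2 m3 m4 pa by (auto simp: lo_def hi_def)
  moreover have "w m2 t \<le> lo" "w m4 t \<le> lo" "hi \<le> w m1 t" "hi \<le> w m3 t"
    by (auto simp: lo_def hi_def)
  moreover define k where "k = (lo + hi) / 2"
  ultimately have k: "w m2 t < k" "w m4 t < k" "k < w m1 t" "k < w m3 t"
    by simp_all
  show False
    by (rule tame_no_alternation[OF w t, of m1 m2 m3 m4 k]) (use m1 m2 m3 m4 k in auto)
qed

end

section \<open>The projected curve\<close>

text \<open>The coordinates of the projection are abstract caloric functions instead of fixed
  components, so that rotating and translating the plane yields another instance; this later puts a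
  diameter on the first axis.\<close>

locale planar_flow = csf_flow \<gamma> T D
  for \<gamma> :: "real \<Rightarrow> real \<Rightarrow> real^'n::finite" and T D +
  fixes x y :: "real \<Rightarrow> real \<Rightarrow> real"
  assumes caloric_x: "caloric x" and caloric_y: "caloric y"
    and tame_lin: "\<And>a b. tame (\<lambda>u t. a * x u t + b * y u t)"
    and proj_le: "\<And>u t. t \<in> I \<Longrightarrow> (S x u t)\<^sup>2 + (S y u t)\<^sup>2 \<le> 1"
begin

lemma x_J [simp]: "x \<in> J" and y_J [simp]: "y \<in> J"
  using caloric_x caloric_y by (simp_all add: caloric_J)

lemma Dt_x: "Dt x = S (S x)" and Dt_y: "Dt y = S (S y)"
  using caloric_x caloric_y by (simp_all add: caloric_def)

abbreviation lin :: "real \<Rightarrow> real \<Rightarrow> real \<Rightarrow> real \<Rightarrow> real" where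
  "lin a b \<equiv> (\<lambda>u t. a * x u t + b * y u t)"

lemma lin_J: "lin a b \<in> J" by simp

lemma S_lin: "S (lin a b) = (\<lambda>u t. a * S x u t + b * S y u t)"
  by (simp add: S_simps)

lemma SS_lin: "S (S (lin a b)) = (\<lambda>u t. a * S (S x) u t + b * S (S y) u t)"
  by (simp add: S_simps)

text \<open>The squared speed of the projection with respect to arclength in space.\<close>

definition r2 :: "real \<Rightarrow> real \<Rightarrow> real" where
  "r2 = (\<lambda>u t. (S x u t)\<^sup>2 + (S y u t)\<^sup>2)"

text \<open>The planar curvature of the projection times the cube of its speed. Without a division
  it makes sense before the projection is known to be immersed.\<close>

definition \<beta> :: "real \<Rightarrow> real \<Rightarrow> real" where
  "\<beta> = (\<lambda>u t. S x u t * S (S y) u t - S y u t * S (S x) u t)"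

lemma r2_J: "r2 \<in> J" and \<beta>_J: "\<beta> \<in> J"
  unfolding r2_def \<beta>_def by simp_all

definition nondegenerate :: "real \<Rightarrow> bool" where
  "nondegenerate t \<longleftrightarrow> (\<forall>a b. (a, b) \<noteq> (0, 0) \<longrightarrow> (\<exists>u v. lin a b u t \<noteq> lin a b v t))"

text \<open>A critical point of a tame function is a global extremum. Geometrically, every tangent
  line of the projection supports the curve.\<close>

lemma support:
  assumes t: "t \<in> I" and c: "a * S x u t + b * S y u t = 0"
  shows "(\<forall>v. lin a b v t \<le> lin a b u t) \<or> (\<forall>v. lin a b u t \<le> lin a b v t)"
proof (rule ccontr)
  assume "\<not> ?thesis"
  then obtain v v' where "lin a b v t > lin a b u t" "lin a b u t > lin a b v' t"
    by (auto simp: not_le)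
  from nonextremal_noncritical[OF tame_lin t this(2,1)] show False
    using c by (simp add: S_lin)
qed

text \<open>Where both derivatives vanish, every linear function is critical and hence extremal; but
  off a line some linear function takes both larger and smaller values elsewhere.\<close>

lemma immersed:
  assumes t: "t \<in> I" and nd: "nondegenerate t"
  shows "r2 u t > 0"
proof (rule ccontr)
  assume "\<not> r2 u t > 0"
  then have "(S x u t)\<^sup>2 + (S y u t)\<^sup>2 \<le> 0" by (simp add: r2_def)
  then have z: "S x u t = 0" "S y u t = 0" by (simp_all add: sum_power2_le_zero_iff)
  define X' where "X' v = x v t - x u t" for v
  define Y' where "Y' v = y v t - y u t" for v
  have nd': "\<exists>v. a * X' v + b * Y' v \<noteq> 0" if ab: "(a, b) \<noteq> (0, 0)" for a b
  proof (rule ccontr)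
    assume n: "\<not> ?thesis"
    have "lin a b v t = lin a b u t" for v
    proof -
      have "a * X' v + b * Y' v = 0" using n by blast
      then show ?thesis by (simp add: X'_def Y'_def algebra_simps)
    qed
    then show False using nd ab unfolding nondegenerate_def by metis
  qed
  obtain A where A: "X' A \<noteq> 0 \<or> Y' A \<noteq> 0"
    using nd'[of 1 0] by auto
  then obtain B where B: "- Y' A * X' B + X' A * Y' B \<noteq> 0"
    using nd'[of "- Y' A" "X' A"] by auto
  define D where "D = - Y' A * X' B + X' A * Y' B"
  \<comment> \<open>Cramer's rule for the linear function that exceeds its value at \<open>u\<close>
    by 1 at \<open>A\<close> and by -1 at \<open>B\<close>.\<close>
  define a where "a = (Y' B + Y' A) / D"
  define b where "b = - (X' A + X' B) / D"
  have D: "D \<noteq> 0" using B by (simp add: D_def)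
  have "D * (a * X' A + b * Y' A) = (Y' B + Y' A) * X' A - (X' A + X' B) * Y' A"
    "D * (a * X' B + b * Y' B) = (Y' B + Y' A) * X' B - (X' A + X' B) * Y' B"
    using D by (simp_all add: a_def b_def field_simps)
  then have "D * (a * X' A + b * Y' A) = D * 1" "D * (a * X' B + b * Y' B) = D * (- 1)"
    by (simp_all add: D_def algebra_simps)
  then have "a * X' A + b * Y' A = 1" "a * X' B + b * Y' B = - 1"
    unfolding mult_left_cancel[OF D] by blast+
  then have AB: "lin a b A t = lin a b u t + 1" "lin a b B t = lin a b u t - 1"
    by (simp_all add: X'_def Y'_def algebra_simps)
  have "a * S x u t + b * S y u t = 0" using z by simp
  from support[OF t this] show False
  proof
    assume "\<forall>v. lin a b v t \<le> lin a b u t"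
    from spec[OF this, of A] show False unfolding AB by simp
  next
    assume "\<forall>v. lin a b u t \<le> lin a b v t"
    from spec[OF this, of B] show False unfolding AB by simp
  qed
qed

text \<open>The reaction contains the cross product of second and third derivatives. In the plane
  this is a combination of \<open>S \<beta>\<close>, the cross product of first and third
  derivatives, and of \<open>\<beta>\<close> itself, as soon as the first derivative is nonzero. The
  result is linear in \<open>\<beta>\<close>, as the strong maximum principle requires.\<close>

lemma \<beta>_equation:
  assumes "r2 u t \<noteq> 0"
  shows "Dt \<beta> u t = S (S \<beta>) u t
    - 2 * ((S x u t * S (S x) u t + S y u t * S (S y) u t) / r2 u t) * S \<beta> u t
    + (2 * ((S x u t * S (S (S x)) u t + S y u t * S (S (S y)) u t) / r2 u t) + 3 * q u t) * \<beta> u t"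
proof -
  define a b c d e f where "a = S x u t" and "b = S y u t" and "c = S (S x) u t" and "d = S (S y) u t"
    and "e = S (S (S x)) u t" and "f = S (S (S y)) u t"
  note abc = a_def[symmetric] b_def[symmetric] c_def[symmetric] d_def[symmetric] e_def[symmetric] f_def[symmetric]
  have 1: "S \<beta> u t = a * f - b * e"
    unfolding \<beta>_def by (simp add: S_simps abc)
  have 2: "S (S \<beta>) u t = c * f - d * e + a * S (S (S (S y))) u t - b * S (S (S (S x))) u t"
    unfolding \<beta>_def by (simp add: S_simps abc)
  have 3: "Dt \<beta> u t = (e + q u t * a) * d + a * (S (S (S (S y))) u t + S q u t * b + 2 * q u t * d)
     - (f + q u t * b) * c - b * (S (S (S (S x))) u t + S q u t * a + 2 * q u t * c)"
    unfolding \<beta>_def by (simp add: Dt_simps Dt_S Dt_x Dt_y q_J S_simps abc algebra_simps)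
  have r: "r2 u t = a * a + b * b" by (simp add: r2_def abc power2_eq_square)
  have 4: "(a * a + b * b) * (c * f - d * e) = (a * c + b * d) * (a * f - b * e) - (a * e + b * f) * (a * d - b * c)"
    by algebra
  have "c * f - d * e = ((a * c + b * d) * (a * f - b * e) - (a * e + b * f) * (a * d - b * c)) / (a * a + b * b)"
    using assms r 4 by (simp add: field_simps)
  then have 5: "c * f - d * e = ((a * c + b * d) / r2 u t) * S \<beta> u t - ((a * e + b * f) / r2 u t) * \<beta> u t"
    unfolding r 1 by (simp add: \<beta>_def abc diff_divide_distrib)
  have "Dt \<beta> u t = S (S \<beta>) u t - 2 * (c * f - d * e) + 3 * q u t * \<beta> u t"
    unfolding 3 2 by (simp add: \<beta>_def abc algebra_simps)
  then show ?thesis unfolding 5 by (simp add: abc algebra_simps)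
qed

text \<open>The signed distance of the point at \<open>v\<close> from the tangent line at
  \<open>u\<close>, times the projected speed at \<open>u\<close>.\<close>

definition cross :: "real \<Rightarrow> real \<Rightarrow> real \<Rightarrow> real" where
  "cross u v t = S x u t * (y v t - y u t) - S y u t * (x v t - x u t)"

lemma cross_lin: "cross u v t = lin (- S y u t) (S x u t) v t - lin (- S y u t) (S x u t) u t"
  by (simp add: cross_def algebra_simps)

lemma cross_sign:
  assumes "t \<in> I"
  shows "(\<forall>v. cross u v t \<ge> 0) \<or> (\<forall>v. cross u v t \<le> 0)"
  using support[OF assms, of "- S y u t" u "S x u t"] unfolding cross_lin by auto

lemma cross_nonzero:
  assumes t: "t \<in> I" and nd: "nondegenerate t"
  shows "\<exists>v. cross u v t \<noteq> 0"
proof (rule ccontr)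
  assume "\<not> ?thesis"
  then have "lin (- S y u t) (S x u t) v t = lin (- S y u t) (S x u t) u t" for v
    unfolding cross_lin by (metis eq_iff_diff_eq_0)
  moreover have "(- S y u t, S x u t) \<noteq> (0, 0)"
    using immersed[OF t nd, of u] by (auto simp: r2_def)
  ultimately show False using nd unfolding nondegenerate_def by metis
qed

text \<open>Each tangent line has the curve on one side. The sets of pairs \<open>(u, t)\<close> for
  the two sides are relatively open, disjoint and cover \<open>UNIV \<times> A\<close>; as this is
  connected, one of them is empty.\<close>

lemma cross_orientation:
  assumes A: "A \<subseteq> I" "connected A" and nd: "\<And>t. t \<in> A \<Longrightarrow> nondegenerate t"
  obtains \<sigma> :: real where "\<sigma> \<in> {1, -1}" "\<And>u v t. t \<in> A \<Longrightarrow> \<sigma> * cross u v t \<ge> 0"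
proof -
  define P where "P k = (UNIV \<times> A) \<inter> (\<Union>v. {z. k * (\<lambda>(u, t). cross u v t) z > 0})" for k :: real
  have cont: "continuous_on (UNIV \<times> A) (\<lambda>(u, t). cross u v t)" for v
  proof -
    have c: "continuous_on (UNIV \<times> A) (\<lambda>(u, t). f u t)" if "f \<in> J" for f
      by (rule J_cont_on[OF that A(1)])
    have c': "continuous_on (UNIV \<times> A) (\<lambda>z. f v (snd z))" if "f \<in> J" for f
    proof -
      have "continuous_on (UNIV \<times> A) (\<lambda>z. (\<lambda>(u, t). f u t) (v, snd z))"
        by (rule continuous_on_compose2[OF c[OF that]]) (auto intro!: continuous_intros)
      then show ?thesis by simp
    qed
    show ?thesis
      unfolding cross_def
      using c[OF x_J] c[OF y_J] c[OF S_J[OF x_J]] c[OF S_J[OF y_J]] c'[OF x_J] c'[OF y_J]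
      by (auto simp: case_prod_unfold intro!: continuous_intros)
  qed
  have op: "openin (top_of_set (UNIV \<times> A)) (P k)" for k
  proof -
    have "P k = (\<Union>v. (UNIV \<times> A) \<inter> (\<lambda>z. k * (\<lambda>(u, t). cross u v t) z) -` {0<..})"
      by (auto simp: P_def)
    moreover have "openin (top_of_set (UNIV \<times> A)) ((UNIV \<times> A) \<inter> (\<lambda>z. k * (\<lambda>(u, t). cross u v t) z) -` {0<..})" for v
      by (rule continuous_openin_preimage_gen) (auto intro!: continuous_intros cont)
    ultimately show ?thesis by (metis (no_types, lifting) openin_Union imageE)
  qed
  have disj: "P 1 \<inter> P (- 1) = {}"
  proof -
    have False if t: "t \<in> A" and "cross u v t > 0" "cross u v' t < 0" for u v v' t
      using cross_sign[of t u] t A(1) that(2,3) by (meson not_le subsetD)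
    then show ?thesis by (fastforce simp: P_def)
  qed
  have cover: "UNIV \<times> A \<subseteq> P 1 \<union> P (- 1)"
  proof
    fix z :: "real \<times> real" assume "z \<in> UNIV \<times> A"
    then obtain u t where z: "z = (u, t)" "t \<in> A" by auto
    obtain v where "cross u v t \<noteq> 0" using cross_nonzero[of t u] nd z A(1) by blast
    then show "z \<in> P 1 \<union> P (- 1)" using z by (auto simp: P_def neq_iff)
  qed
  have "connected (UNIV \<times> A :: (real \<times> real) set)"
    by (intro connected_Times connected_UNIV A)
  then have "P 1 = {} \<or> P (- 1) = {}"
    using connected_openin[of "UNIV \<times> A :: (real \<times> real) set"] op[of 1] op[of "-1"] disj cover by blast
  then consider "P (- 1) = {}" | "P 1 = {}" by blast
  then show ?thesis
  proof cases
    case 1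
    have "1 * cross u v t \<ge> 0" if "t \<in> A" for u v t
    proof (rule ccontr)
      assume "\<not> 1 * cross u v t \<ge> 0"
      then have "cross u v t < 0" by simp
      then have "(u, t) \<in> P (- 1)" using that by (auto simp: P_def)
      then show False using 1 by simp
    qed
    then show ?thesis using that[of 1] by blast
  next
    case 2
    have "- 1 * cross u v t \<ge> 0" if "t \<in> A" for u v t
    proof (rule ccontr)
      assume "\<not> - 1 * cross u v t \<ge> 0"
      then have "cross u v t > 0" by simp
      then have "(u, t) \<in> P 1" using that by (auto simp: P_def)
      then show False using 2 by simp
    qed
    then show ?thesis using that[of "- 1"] by blast
  qed
qed

text \<open>A curve that touches its tangent line from one side has a second derivative of that sign
  in the normal direction.\<close>

lemma \<beta>_sign:
  assumes t: "t \<in> I" and s: "\<sigma> \<in> {1, -1}" "\<And>v. \<sigma> * cross u v t \<ge> 0"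
  shows "\<sigma> * \<beta> u t \<ge> 0"
proof -
  let ?f = "lin (\<sigma> * - S y u t) (\<sigma> * S x u t)"
  have "?f u t \<le> ?f v t" for v
    using s(2)[of v] by (simp add: cross_def algebra_simps)
  then have "S (S ?f) u t \<ge> 0"
    by (intro local_min_conditions(2)[OF lin_J t zero_less_one]) auto
  then show ?thesis
    unfolding SS_lin by (simp add: \<beta>_def algebra_simps)
qed

text \<open>Up to a constant, \<open>g\<close> is the squared sine of the angle between the tangents
  at \<open>u\<close> and at 0. Where \<open>\<beta>\<close> vanishes it is stationary, so without
  curvature the tangent never turns and the projection lies on a line.\<close>

lemma not_straight:
  assumes t: "t \<in> I" and nd: "nondegenerate t"
  shows "\<exists>u. \<beta> u t \<noteq> 0"
proof (rule ccontr)
  assume "\<not> ?thesis"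
  then have z: "\<And>u. \<beta> u t = 0" by blast
  define f where "f = S (lin (- S y 0 t) (S x 0 t))"
  have fJ: "f \<in> J" unfolding f_def by (intro S_J lin_J)
  have f: "f u t = - S y 0 t * S x u t + S x 0 t * S y u t" for u
    unfolding f_def S_lin by simp
  have Sf: "S f u t = - S y 0 t * S (S x) u t + S x 0 t * S (S y) u t" for u
    unfolding f_def SS_lin by simp
  have pos: "r2 u t > 0" for u by (rule immersed[OF t nd])
  define g where "g u = (f u t)\<^sup>2 / r2 u t" for u
  have dg: "(g has_real_derivative 0) (at u)" for u
  proof -
    have "(g has_real_derivative (2 * f u t * du I f u t * r2 u t - (f u t)\<^sup>2 * du I r2 u t) / (r2 u t * r2 u t)) (at u)"
      unfolding g_def using pos[of u]
      by (auto intro!: derivative_eq_intros J_du[OF fJ t] J_du[OF r2_J t] simp: algebra_simps power2_eq_square)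
    moreover have "2 * f u t * du I f u t * r2 u t - (f u t)\<^sup>2 * du I r2 u t = 0"
    proof -
      have "S r2 u t = 2 * (S x u t * S (S x) u t + S y u t * S (S y) u t)"
        unfolding r2_def by (simp add: S_simps)
      moreover have "S x u t * S (S y) u t = S y u t * S (S x) u t"
        using z[of u] by (simp add: \<beta>_def)
      ultimately have "2 * f u t * S f u t * r2 u t - (f u t)\<^sup>2 * S r2 u t = 0"
        unfolding f Sf r2_def power2_eq_square by algebra
      then show ?thesis using slow_pos[OF t, of u]
        by (simp add: slow_du[OF t] field_simps)
    qed
    ultimately show ?thesis by simp
  qed
  have "g u = g 0" for u using DERIV_const_ratio_const2[of 0 u g 0] dg
    by (metis DERIV_isconst_all)
  moreover have "g 0 = 0" by (simp add: g_def f)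
  ultimately have gz: "g u = 0" for u by simp
  have fz: "f u t = 0" for u using gz[of u] pos[of u] unfolding g_def by simp
  have "lin (- S y 0 t) (S x 0 t) u t = lin (- S y 0 t) (S x 0 t) v t" for u v
  proof -
    have "du I (lin (- S y 0 t) (S x 0 t)) u t = 0" for u
      using fz[of u] slow_du[OF t] by (simp add: f_def)
    then have "((\<lambda>u. lin (- S y 0 t) (S x 0 t) u t) has_real_derivative 0) (at u)" for u
      using J_du[OF lin_J t, of "- S y 0 t" "S x 0 t" u] by simp
    then show ?thesis using DERIV_isconst_all[of "\<lambda>u. lin (- S y 0 t) (S x 0 t) u t"] by blast
  qed
  moreover have "(- S y 0 t, S x 0 t) \<noteq> (0, 0)"
    using pos[of 0] by (auto simp: r2_def)
  ultimately show False using nd unfolding nondegenerate_def by metis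
qed

lemma strictly_convex:
  assumes t: "0 < t1" "t1 < T" and nd: "\<And>t. 0 < t \<Longrightarrow> t \<le> t1 \<Longrightarrow> nondegenerate t"
  obtains \<sigma> where "\<sigma> \<in> {1, -1}" "\<And>u. \<sigma> * \<beta> u t1 > 0"
proof -
  have sub: "{0<..t1} \<subseteq> I" using t by auto
  obtain \<sigma> :: real where s: "\<sigma> \<in> {1, -1}" "\<And>u v t. t \<in> {0<..t1} \<Longrightarrow> \<sigma> * cross u v t \<ge> 0"
    by (rule cross_orientation[OF sub]) (use nd in auto)
  have nonneg: "\<sigma> * \<beta> u t \<ge> 0" if "t \<in> {0<..t1}" for u t
    by (rule \<beta>_sign) (use that s t in auto)
  \<comment> \<open>At an earlier positive time the curvature is nonzero somewhere; the strong
    maximum principle spreads this to all points by time \<open>t1\<close>.\<close>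
  define t0 where "t0 = t1 / 2"
  have t0: "0 < t0" "t0 < t1" "t0 \<in> I" "{t0..t1} \<subseteq> I" using t by (auto simp: t0_def)
  obtain us where us: "\<beta> us t0 \<noteq> 0" using not_straight[OF t0(3)] nd[of t0] t0 by auto
  then have pos: "\<sigma> * \<beta> us t0 > 0" using nonneg[of t0 us] s(1) t0 by (auto simp: order_le_less)
  have r2pos: "r2 u t > 0" if "t \<in> {t0..t1}" for u t
    by (rule immersed) (use that t0 nd in auto)
  obtain m where m: "m > 0" "\<And>u t. t \<in> {t0..t1} \<Longrightarrow> m \<le> r2 u t"
    using J_lower_bound[OF r2_J less_imp_le[OF t0(2)] t0(4) r2pos] by metis
  let ?b = "\<lambda>u t. S x u t * S (S x) u t + S y u t * S (S y) u t"
  let ?c = "\<lambda>u t. S x u t * S (S (S x)) u t + S y u t * S (S (S y)) u t"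
  have bJ: "?b \<in> J" and cJ: "?c \<in> J" by simp_all
  obtain Mb where Mb: "Mb \<ge> 0" "\<And>u t. t \<in> {t0..t1} \<Longrightarrow> \<bar>?b u t\<bar> \<le> Mb"
    using J_bounded[OF bJ t0(4)] by metis
  obtain Mc where Mc: "Mc \<ge> 0" "\<And>u t. t \<in> {t0..t1} \<Longrightarrow> \<bar>?c u t\<bar> \<le> Mc"
    using J_bounded[OF cJ t0(4)] by metis
  define C where "C = 2 * (Mb / m) + 2 * (Mc / m)"
  have C: "C \<ge> 0" using Mb Mc m by (simp add: C_def)
  have pJ: "(\<lambda>u t. \<sigma> * \<beta> u t) \<in> J" using \<beta>_J by simp
  have "\<sigma> * \<beta> u t1 > 0" for u
  proof (rule strong_max_principle[OF pJ t0(1,2) t(2), of "min us u - 1" us "max us u + 1" u C])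
    show "\<sigma> * \<beta> u t \<ge> 0" if "t \<in> {t0..t1}" for u t
      using nonneg[of t u] that t0 by auto
    fix v t assume tt: "t \<in> {t0..t1}"
    have rp: "r2 v t > 0" and rm: "m \<le> r2 v t" using r2pos m tt by auto
    define p where "p = \<sigma> * \<beta> v t"
    have p: "p \<ge> 0" using nonneg[of t v] tt t0 by (auto simp: p_def)
    have d: "\<bar>z / r2 v t\<bar> \<le> M / m" if "\<bar>z\<bar> \<le> M" for z M
    proof -
      have "M \<ge> 0" using that by linarith
      then show ?thesis using that rp rm m(1) by (simp add: abs_divide frac_le)
    qed
    have S\<beta>: "S (\<lambda>u t. \<sigma> * \<beta> u t) = (\<lambda>u t. \<sigma> * S \<beta> u t)"
      "S (\<lambda>u t. \<sigma> * S \<beta> u t) = (\<lambda>u t. \<sigma> * S (S \<beta>) u t)"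
      using \<beta>_J by (simp_all add: S_cmult)
    have D\<beta>: "Dt (\<lambda>u t. \<sigma> * \<beta> u t) v t = \<sigma> * Dt \<beta> v t" using \<beta>_J by (simp add: Dt_cmult)
    define A where "A = 2 * (?b v t / r2 v t)"
    define B where "B = 2 * (?c v t / r2 v t)"
    have A: "\<bar>A\<bar> \<le> C" and B: "\<bar>B\<bar> \<le> C"
    proof -
      have nn: "Mb / m \<ge> 0" "Mc / m \<ge> 0" using Mb Mc m by auto
      show "\<bar>A\<bar> \<le> C" using d[OF Mb(2)[OF tt, of v]] nn unfolding A_def C_def abs_mult by simp
      show "\<bar>B\<bar> \<le> C" using d[OF Mc(2)[OF tt, of v]] nn unfolding B_def C_def abs_mult by simp
    qed
    have "\<sigma> * Dt \<beta> v t = \<sigma> * S (S \<beta>) v t - A * (\<sigma> * S \<beta> v t) + (B + 3 * q v t) * p"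
    proof -
      have "Dt \<beta> v t = S (S \<beta>) v t - A * S \<beta> v t + (B + 3 * q v t) * \<beta> v t"
        unfolding A_def B_def by (rule \<beta>_equation) (use rp in simp)
      show ?thesis unfolding \<open>Dt \<beta> v t = _\<close> p_def by (simp add: algebra_simps)
    qed
    moreover have "A * (\<sigma> * S \<beta> v t) \<le> C * \<bar>\<sigma> * S \<beta> v t\<bar>"
    proof -
      have "A * (\<sigma> * S \<beta> v t) \<le> \<bar>A\<bar> * \<bar>\<sigma> * S \<beta> v t\<bar>"
        unfolding abs_mult[symmetric] by (rule abs_ge_self)
      also have "\<dots> \<le> C * \<bar>\<sigma> * S \<beta> v t\<bar>" using A by (intro mult_right_mono) auto
      finally show ?thesis .
    qed
    moreover have "- C * p \<le> (B + 3 * q v t) * p"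
      using p B q_nonneg[of v t] by (intro mult_right_mono) (auto simp: abs_le_iff)
    ultimately show "Dt (\<lambda>u t. \<sigma> * \<beta> u t) v t \<ge> S (S (\<lambda>u t. \<sigma> * \<beta> u t)) v t
        - C * \<bar>S (\<lambda>u t. \<sigma> * \<beta> u t) v t\<bar> - C * (\<sigma> * \<beta> v t)"
      unfolding D\<beta> S\<beta> p_def[symmetric] by simp
  qed (use C pos in auto)
  then show ?thesis using that s(1) by blast
qed

end

section \<open>A lower bound for the projected speed\<close>

lemma alternates_signs:
  assumes "alternates \<epsilon> g" "\<epsilon> > 0"
  obtains a b c d where "a < b" "b < c" "c < d" "d < a + 2 * pi" "0 < g a" "g b < 0" "0 < g c" "g d < 0"
proof -
  obtain a b c d where "a < b" "b < c" "c < d" "d < a + 2 * pi"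
    "\<epsilon> \<le> g a" "g b \<le> - \<epsilon>" "\<epsilon> \<le> g c" "g d \<le> - \<epsilon>"
    using assms(1) unfolding alternates_def by blast
  then show ?thesis using assms(2) by (intro that[of a b c d]) linarith+
qed

lemma continuous_on_Max:
  fixes f :: "'i \<Rightarrow> 'a::topological_space \<Rightarrow> real"
  assumes "finite K" "K \<noteq> {}" "\<And>i. i \<in> K \<Longrightarrow> continuous_on A (f i)"
  shows "continuous_on A (\<lambda>z. Max ((\<lambda>i. f i z) ` K))"
  using assms
proof (induction K rule: finite_ne_induct)
  case (insert i K)
  then show ?case by (auto intro!: continuous_on_max)
qed simp

context planar_flow
begin

lemma J_bounded_at: "f \<in> J \<Longrightarrow> t \<in> I \<Longrightarrow> \<exists>M\<ge>0. \<forall>u. \<bar>f u t\<bar> \<le> M"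
  by (rule J_bounded[of f t t]) auto

abbreviation steep :: "(real \<Rightarrow> real \<Rightarrow> real) \<Rightarrow> real \<Rightarrow> real \<Rightarrow> real \<Rightarrow> real \<Rightarrow> real" where
  "steep Z a b \<equiv> (\<lambda>u t. Z u t - lin a b u t)"

lemma S_steep: "Z \<in> J \<Longrightarrow> S (steep Z a b) = (\<lambda>u t. S Z u t - (a * S x u t + b * S y u t))"
  by (simp add: S_simps)

text \<open>Where the derivative of \<open>steep Z a b\<close> vanishes, its own derivative has the sign of
  \<open>\<sigma> (a S y - b S x)\<close>, by strict convexity and since \<open>(a, b)\<close> is large. So an alternation would make
  the latter, the derivative of a linear function of the projection, alternate as well.\<close>

lemma steep_no_alternation_at:
  assumes t: "t \<in> I" and Z: "Z \<in> J" and s: "\<sigma> \<in> {1, -1}" and pos: "\<And>u. \<sigma> * \<beta> u t > 0"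
  obtains M where "M > 0" "\<And>a b \<epsilon>. a\<^sup>2 + b\<^sup>2 \<ge> M\<^sup>2 \<Longrightarrow> \<epsilon> > 0 \<Longrightarrow> \<not> alternates \<epsilon> (\<lambda>u. S (steep Z a b) u t)"
proof -
  have sub: "{t..t} \<subseteq> I" using t by simp
  have "(\<lambda>u t. \<sigma> * \<beta> u t) \<in> J" using \<beta>_J by simp
  then obtain \<beta>0 where b0: "\<beta>0 > 0" "\<And>u. \<beta>0 \<le> \<sigma> * \<beta> u t"
    using J_lower_bound[of "\<lambda>u t. \<sigma> * \<beta> u t" t t] sub pos by auto
  obtain K1 where K1: "K1 \<ge> 0" "\<And>u. \<bar>S Z u t\<bar> \<le> K1"
    using J_bounded_at[OF S_J[OF Z] t] by blast
  obtain K2 where K2: "K2 \<ge> 0" "\<And>u. \<bar>S (S Z) u t\<bar> \<le> K2"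
    using J_bounded_at[OF S_J[OF S_J[OF Z]] t] by blast
  obtain K3 where K3: "K3 \<ge> 0" "\<And>u. \<bar>S (S x) u t\<bar> \<le> K3"
    using J_bounded_at[OF S_J[OF S_J[OF x_J]] t] by blast
  obtain K4 where K4: "K4 \<ge> 0" "\<And>u. \<bar>S (S y) u t\<bar> \<le> K4"
    using J_bounded_at[OF S_J[OF S_J[OF y_J]] t] by blast
  \<comment> \<open>The term with \<open>K1\<close> limits the contribution of \<open>B\<close> in
    \<open>key\<close> to half of \<open>Q\<^sup>2 * \<beta>0\<close>; the term with
    \<open>K2\<close> makes \<open>P * A\<close> too small for \<open>key\<close> whenever
    \<open>\<bar>A\<bar> \<le> K2\<close>.\<close>
  define M where "M = 1 + (2 * K1 * (K3 + K4) + 4 * K2) / \<beta>0"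
  have M: "M > 0" using K1 K2 K3 K4 b0 by (simp add: M_def add_pos_nonneg)
  have "\<not> alternates \<epsilon> (\<lambda>u. S (steep Z a b) u t)" if Q: "a\<^sup>2 + b\<^sup>2 \<ge> M\<^sup>2" and eps: "\<epsilon> > 0" for a b \<epsilon>
  proof
    assume "alternates \<epsilon> (\<lambda>u. S (steep Z a b) u t)"
    then obtain u1 u2 u3 u4 where o: "u1 < u2" "u2 < u3" "u3 < u4" "u4 < u1 + 2 * pi"
      and sg: "0 < S (steep Z a b) u1 t" "S (steep Z a b) u2 t < 0" "0 < S (steep Z a b) u3 t" "S (steep Z a b) u4 t < 0"
      using eps by (rule alternates_signs)
    define Q where "Q = sqrt (a\<^sup>2 + b\<^sup>2)"
    have QM: "Q \<ge> M" using Q M by (simp add: Q_def real_le_rsqrt)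
    have Qpos: "Q > 0" using QM M by simp
    have Q2: "Q\<^sup>2 = a\<^sup>2 + b\<^sup>2" by (simp add: Q_def)
    have ab: "\<bar>a\<bar> \<le> Q" "\<bar>b\<bar> \<le> Q" by (simp_all add: Q_def real_le_rsqrt)
    define v where "v = steep Z a b"
    have vJ: "v \<in> J" using Z by (simp add: v_def)
    have Sv: "S v u t = S Z u t - (a * S x u t + b * S y u t)" for u using Z by (simp add: v_def S_steep)
    have SSv: "S (S v) u t = S (S Z) u t - (a * S (S x) u t + b * S (S y) u t)" for u
      using Z by (simp add: v_def S_simps)
    define A where "A u = a * S (S x) u t + b * S (S y) u t" for u
    define P where "P u = - b * S x u t + a * S y u t" for u
    have Pabs: "\<bar>P u\<bar> \<le> 2 * Q" for u
    proof -
      have "(S x u t)\<^sup>2 \<le> 1\<^sup>2" "(S y u t)\<^sup>2 \<le> 1\<^sup>2"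
        using proj_le[OF t, of u] zero_le_power2[of "S x u t"] zero_le_power2[of "S y u t"] by (simp; linarith)+
      then have "\<bar>S x u t\<bar> \<le> 1" "\<bar>S y u t\<bar> \<le> 1" by (simp_all add: abs_square_le_1)
      then have "\<bar>b * S x u t\<bar> \<le> Q * 1" "\<bar>a * S y u t\<bar> \<le> Q * 1"
        unfolding abs_mult using ab Qpos by (intro mult_mono; simp)+
      then show ?thesis unfolding P_def by linarith
    qed
    have key: "\<sigma> * (P z * A z) \<le> - (Q\<^sup>2 * \<beta>0 / 2)" if "S v z t = 0" for z
    proof -
      define B where "B = - b * S (S x) z t + a * S (S y) z t"
      have "\<bar>b * S (S x) z t\<bar> \<le> Q * K3" "\<bar>a * S (S y) z t\<bar> \<le> Q * K4"
        unfolding abs_mult using ab Qpos K3(2)[of z] K4(2)[of z] by (intro mult_mono; simp)+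
      then have B: "\<bar>B\<bar> \<le> Q * (K3 + K4)" unfolding B_def by (simp add: algebra_simps abs_if split: if_splits)
      \<comment> \<open>The cross product \<open>\<beta>\<close> expanded in the orthogonal frame
        \<open>(a, b)\<close>, \<open>(- b, a)\<close>, with \<open>a * S x + b * S y\<close>
        replaced by \<open>S Z\<close>, to which it is equal at a zero of
        \<open>S v\<close>.\<close>
      have eq: "P z * A z = S Z z t * B - Q\<^sup>2 * \<beta> z t"
      proof -
        have SZ: "S Z z t = a * S x z t + b * S y z t" using that unfolding Sv by simp
        show ?thesis unfolding SZ P_def A_def B_def \<beta>_def Q2 by (simp add: power2_eq_square algebra_simps)
      qed
      moreover have "\<sigma> * (S Z z t * B) \<le> K1 * (Q * (K3 + K4))"
      proof -
        have "\<sigma> * (S Z z t * B) \<le> \<bar>S Z z t\<bar> * \<bar>B\<bar>"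
          using s by (auto simp: abs_mult[symmetric] abs_ge_self abs_ge_minus_self)
        also have "\<dots> \<le> K1 * (Q * (K3 + K4))" using B K1 by (intro mult_mono) auto
        finally show ?thesis .
      qed
      moreover have "Q\<^sup>2 * \<beta>0 \<le> \<sigma> * (Q\<^sup>2 * \<beta> z t)"
        using mult_left_mono[OF b0(2)[of z], of "Q\<^sup>2"] by (simp add: algebra_simps)
      moreover have "K1 * (Q * (K3 + K4)) \<le> Q\<^sup>2 * \<beta>0 / 2"
      proof -
        have "2 * K1 * (K3 + K4) / \<beta>0 \<le> Q"
        proof -
          have "2 * K1 * (K3 + K4) / \<beta>0 \<le> M"
            using K2 b0 by (simp add: M_def add_divide_distrib)
          then show ?thesis using QM by simp
        qed
        then have "2 * K1 * (K3 + K4) \<le> Q * \<beta>0" using b0 by (simp add: field_simps)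
        then have "Q * (2 * K1 * (K3 + K4)) \<le> Q * (Q * \<beta>0)" using Qpos by (intro mult_left_mono) auto
        then show ?thesis by (simp add: power2_eq_square algebra_simps)
      qed
      moreover have "\<sigma> * (P z * A z) = \<sigma> * (S Z z t * B) - \<sigma> * (Q\<^sup>2 * \<beta> z t)"
        unfolding eq by (rule right_diff_distrib)
      ultimately show ?thesis by linarith
    qed
    have small: "\<bar>P z * A z\<bar> < Q\<^sup>2 * \<beta>0 / 2" if "\<bar>A z\<bar> \<le> K2" for z
    proof -
      have "\<bar>P z * A z\<bar> \<le> 2 * Q * K2"
        unfolding abs_mult using Pabs[of z] that Qpos by (intro mult_mono) auto
      also have "4 * K2 / \<beta>0 < Q"
      proof -
        have "4 * K2 / \<beta>0 < M"
          using K1 K3 K4 b0 by (simp add: M_def add_divide_distrib add_pos_nonneg)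
        then show ?thesis using QM by simp
      qed
      then have "4 * K2 < Q * \<beta>0" using b0 by (simp add: field_simps)
      then have "Q * (4 * K2) < Q * (Q * \<beta>0)" using Qpos by (intro mult_strict_left_mono) auto
      then have "2 * Q * K2 < Q\<^sup>2 * \<beta>0 / 2" by (simp add: power2_eq_square algebra_simps)
      finally show ?thesis .
    qed
    have down: "\<sigma> * P z < 0" if z: "S v z t = 0" "S (S v) z t \<le> 0" for z
    proof -
      have A1: "A z \<ge> - K2" using z(2) K2(2)[of z] unfolding SSv A_def by (auto simp: abs_le_iff)
      have k: "\<sigma> * (P z * A z) \<le> - (Q\<^sup>2 * \<beta>0 / 2)" by (rule key[OF z(1)])
      have "A z > 0"
      proof (rule ccontr)
        assume "\<not> A z > 0"
        then have "\<bar>A z\<bar> \<le> K2" using A1 by auto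
        from small[OF this] have "\<sigma> * (P z * A z) > - (Q\<^sup>2 * \<beta>0 / 2)"
          using s by (auto simp: abs_less_iff)
        then show False using k by simp
      qed
      moreover have "Q\<^sup>2 * \<beta>0 / 2 > 0" using Qpos b0 by simp
      then have "(\<sigma> * P z) * A z < 0" using k by (simp add: mult.assoc)
      ultimately show ?thesis by (simp add: mult_less_0_iff)
    qed
    have up: "\<sigma> * P z > 0" if z: "S v z t = 0" "S (S v) z t \<ge> 0" for z
    proof -
      have A1: "A z \<le> K2" using z(2) K2(2)[of z] unfolding SSv A_def by (auto simp: abs_le_iff)
      have k: "\<sigma> * (P z * A z) \<le> - (Q\<^sup>2 * \<beta>0 / 2)" by (rule key[OF z(1)])
      have "A z < 0"
      proof (rule ccontr)
        assume "\<not> A z < 0"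
        then have "\<bar>A z\<bar> \<le> K2" using A1 by auto
        from small[OF this] have "\<sigma> * (P z * A z) > - (Q\<^sup>2 * \<beta>0 / 2)"
          using s by (auto simp: abs_less_iff)
        then show False using k by simp
      qed
      moreover have "Q\<^sup>2 * \<beta>0 / 2 > 0" using Qpos b0 by simp
      then have "(\<sigma> * P z) * A z < 0" using k by (simp add: mult.assoc)
      ultimately show ?thesis by (simp add: mult_less_0_iff)
    qed
    note dv = J_du[OF S_J[OF vJ] t]
    have dv': "((\<lambda>u. - S v u t) has_real_derivative - du I (S v) u t) (at u)" for u
      by (intro derivative_intros dv)
    have pv: "S v (u1 + 2 * pi) t = S v u1 t" by (rule periodic[OF S_J[OF vJ] t])
    have cd: "\<exists>z>l. z < r \<and> \<sigma> * P z < 0" if lr: "l < r" "S v l t > 0" "S v r t < 0" for l r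
    proof -
      obtain z where z: "l < z" "z < r" "S v z t = 0" "du I (S v) z t \<le> 0"
        using crossing_down[OF dv lr] by blast
      then have "S (S v) z t \<le> 0" using du_pos[OF t, of "S v" z] by linarith
      then show ?thesis using down[of z] z by blast
    qed
    have cu: "\<exists>z>l. z < r \<and> \<sigma> * P z > 0" if lr: "l < r" "S v l t < 0" "S v r t > 0" for l r
    proof -
      obtain z where z: "l < z" "z < r" "- S v z t = 0" "- du I (S v) z t \<le> 0"
        by (rule crossing_down[OF dv' lr(1)]) (use lr in auto)
      then have "S (S v) z t \<ge> 0" using du_neg[OF t, of "S v" z] by linarith
      then show ?thesis using up[of z] z by auto
    qed
    note sg' = sg[folded v_def]
    \<comment> \<open>The zeros of \<open>S v\<close> are crossed in alternating directions, so
      \<open>\<sigma> * P\<close> alternates in sign at four successive points, although it is the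
      derivative of a tame function up to sign.\<close>
    obtain z1 where z1: "u1 < z1" "z1 < u2" "\<sigma> * P z1 < 0" using cd[OF o(1) sg'(1,2)] by blast
    obtain z2 where z2: "u2 < z2" "z2 < u3" "\<sigma> * P z2 > 0" using cu[OF o(2) sg'(2,3)] by blast
    obtain z3 where z3: "u3 < z3" "z3 < u4" "\<sigma> * P z3 < 0" using cd[OF o(3) sg'(3,4)] by blast
    obtain z4 where z4: "u4 < z4" "z4 < u1 + 2 * pi" "\<sigma> * P z4 > 0"
      using cu[OF o(4) sg'(4)] pv sg'(1) by auto
    have SP: "S (lin (\<sigma> * b) (- \<sigma> * a)) z t = - (\<sigma> * P z)" for z
      unfolding S_lin P_def by (simp add: algebra_simps)
    show False
    proof (rule S_tame_no_alternation[OF tame_lin t])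
      show "z1 < z2" "z2 < z3" "z3 < z4" "z4 < z1 + 2 * pi" using z1 z2 z3 z4 by linarith+
      show "S (lin (\<sigma> * b) (- \<sigma> * a)) z1 t > 0" "S (lin (\<sigma> * b) (- \<sigma> * a)) z3 t > 0"
        "S (lin (\<sigma> * b) (- \<sigma> * a)) z2 t < 0" "S (lin (\<sigma> * b) (- \<sigma> * a)) z4 t < 0"
        unfolding SP using z1(3) z2(3) z3(3) z4(3) by linarith+
    qed
  qed
  then show ?thesis using that M by blast
qed

text \<open>An alternation at \<open>t\<close> would be carried back to \<open>ts\<close>, because
  the zeroth-order coefficient \<open>q\<close> in the equation for the derivative is bounded on the
  compact time interval.\<close>

lemma steep_no_alternation_later:
  assumes ts: "ts \<in> I" "ts \<le> t" "t < T" and Z: "caloric Z"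
    and no: "\<And>\<epsilon>. \<epsilon> > 0 \<Longrightarrow> \<not> alternates \<epsilon> (\<lambda>u. S (steep Z a b) u ts)"
    and eps: "\<epsilon> > 0"
  shows "\<not> alternates \<epsilon> (\<lambda>u. S (steep Z a b) u t)"
proof
  assume alt: "alternates \<epsilon> (\<lambda>u. S (steep Z a b) u t)"
  have sub: "{ts..t} \<subseteq> I" using ts by auto
  have cal: "caloric (steep Z a b)"
    by (intro caloric_diff caloric_add caloric_cmult Z caloric_x caloric_y)
  obtain C where C: "C \<ge> 0" "\<And>u s. s \<in> {ts..t} \<Longrightarrow> \<bar>q u s\<bar> \<le> C"
    using J_bounded[OF q_J sub] by metis
  have "alternates (\<epsilon> * exp ((C + 1) * (ts - t))) (\<lambda>u. S (steep Z a b) u ts)"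
  proof (rule alternates_backward[OF S_J[OF caloric_J[OF cal]] _ ts(2,3) _ eps alt])
    fix u s assume "s \<in> {ts..t}"
    then show "\<bar>Dt (S (steep Z a b)) u s - S (S (S (steep Z a b))) u s\<bar> \<le> C * \<bar>S (steep Z a b) u s\<bar>"
      using C(2)[of s u] unfolding Dt_S_caloric[OF cal] by (simp add: abs_mult mult_right_mono)
  qed (use ts in auto)
  then show False using no[of "\<epsilon> * exp ((C + 1) * (ts - t))"] eps by simp
qed

lemma r2_cmult_bound: "\<bar>a * S x u t + b * S y u t\<bar> \<le> \<bar>a\<bar> + \<bar>b\<bar>" if t: "t \<in> I"
proof -
  have "(S x u t)\<^sup>2 \<le> 1\<^sup>2" "(S y u t)\<^sup>2 \<le> 1\<^sup>2"
    using proj_le[OF t, of u] zero_le_power2[of "S x u t"] zero_le_power2[of "S y u t"] by (simp; linarith)+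
  then have "\<bar>S x u t\<bar> \<le> 1" "\<bar>S y u t\<bar> \<le> 1" by (simp_all add: abs_square_le_1)
  then have "\<bar>a * S x u t\<bar> \<le> \<bar>a\<bar> * 1" "\<bar>b * S y u t\<bar> \<le> \<bar>b\<bar> * 1"
    unfolding abs_mult by (intro mult_left_mono; simp)+
  then show ?thesis by linarith
qed

text \<open>At a first contact of \<open>Z\<^sub>s\<close> with a multiple of the projected speed, the steep linear
  function of matching slope has a strict local minimum of its derivative with value \<open>0\<close>; raising
  the slope slightly produces an alternation.\<close>

lemma steep_contact_impossible:
  assumes t: "t \<in> I" and Z: "Z \<in> J" and M: "a\<^sup>2 + b\<^sup>2 \<ge> M\<^sup>2"
    and no: "\<And>a b \<epsilon>. a\<^sup>2 + b\<^sup>2 \<ge> M\<^sup>2 \<Longrightarrow> \<epsilon> > 0 \<Longrightarrow> \<not> alternates \<epsilon> (\<lambda>u. S (steep Z a b) u t)"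
    and v: "S (steep Z a b) u t = 0" "S (S (steep Z a b)) u t = 0" "S (S (S (steep Z a b))) u t > 0"
    and pos: "S (lin a b) u t > 0"
  shows False
proof -
  define w where "w = steep Z a b"
  have J: "w \<in> J" "S w \<in> J" "S (S w) \<in> J" using Z by (simp_all add: w_def)
  note v' = v[folded w_def]
  note d1 = J_du[OF J(1) t] and d2 = J_du[OF J(2) t] and d3 = J_du[OF J(3) t]
  have "du I (S (S w)) u t > 0" using v'(3) by (simp add: du_pos[OF t])
  then obtain e1 e2 where e1: "e1 > 0" "\<And>h. 0 < h \<Longrightarrow> h < e1 \<Longrightarrow> S (S w) u t < S (S w) (u + h) t"
    and e2: "e2 > 0" "\<And>h. 0 < h \<Longrightarrow> h < e2 \<Longrightarrow> S (S w) (u - h) t < S (S w) u t"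
    using DERIV_pos_inc_right[OF d3] DERIV_pos_inc_left[OF d3] by metis
  define e where "e = min (min e1 e2) 1"
  have e: "e > 0" "e \<le> e1" "e \<le> e2" "e \<le> 1" using e1 e2 by (auto simp: e_def)
  have right: "S w (u + h) t > 0" if h: "0 < h" "h < e" for h
  proof -
    have "\<exists>z>u. z < u + h \<and> S w (u + h) t - S w u t = (u + h - u) * du I (S w) z t"
      by (rule MVT2) (use h d2 in auto)
    then obtain z where z: "u < z" "z < u + h" "S w (u + h) t = h * du I (S w) z t"
      using v'(1) by auto
    have "S (S w) z t > 0" using e1(2)[of "z - u"] z h e v'(2) by simp
    then show ?thesis using z(3) h by (simp add: du_pos[OF t])
  qed
  have left: "S w (u - h) t > 0" if h: "0 < h" "h < e" for h
  proof -
    have "\<exists>z>u - h. z < u \<and> S w u t - S w (u - h) t = (u - (u - h)) * du I (S w) z t"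
      by (rule MVT2) (use h d2 in auto)
    then obtain z where z: "u - h < z" "z < u" "- S w (u - h) t = h * du I (S w) z t"
      using v'(1) by auto
    have "S (S w) z t < 0" using e2(2)[of "u - z"] z h e v'(2) by simp
    then have "h * du I (S w) z t < 0" using h by (simp add: mult_less_0_iff du_neg[OF t])
    then show ?thesis using z(3) by linarith
  qed
  define h where "h = e / 2"
  have h: "0 < h" "h < e" "h < 1" using e by (auto simp: h_def)
  have nn: "S w z t \<ge> 0" if "\<bar>z - u\<bar> \<le> h" for z
  proof -
    consider "z < u" | "z = u" | "z > u" by linarith
    then show ?thesis
    proof cases
      case 1 then show ?thesis using left[of "u - z"] that h by simp
    next
      case 2 then show ?thesis using v' by simp
    next
      case 3 then show ?thesis using right[of "z - u"] that h by simp
    qed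
  qed
  \<comment> \<open>A derivative that is nowhere negative and somewhere positive contradicts the
    periodicity of \<open>w\<close>.\<close>
  obtain z0 where z0: "S w z0 t < 0"
  proof (rule ccontr)
    assume "\<not> thesis"
    then have all: "S w z t \<ge> 0" for z using that[of z] by fastforce
    have mono: "w l t \<le> w r t" if "l \<le> r" for l r
      by (rule DERIV_nonneg_imp_nondecreasing[OF that])
        (use d1 all du_neg[OF t, of w] in \<open>metis not_le\<close>)
    have "du I w (u + h) t > 0" using right[OF h(1,2)] by (simp add: du_pos[OF t])
    then obtain e3 where e3: "e3 > 0" "\<And>k. 0 < k \<Longrightarrow> k < e3 \<Longrightarrow> w (u + h) t < w (u + h + k) t"
      using DERIV_pos_inc_right[OF d1] by metis
    define k where "k = min e3 1 / 2"
    have k: "0 < k" "k < e3" "k < 2 * pi" using e3 pi_gt3 by (auto simp: k_def)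
    have "w (u + h) t < w (u + h + k) t" by (rule e3(2)[OF k(1,2)])
    also have "\<dots> \<le> w (u + h + 2 * pi) t" by (rule mono) (use k in simp)
    also have "\<dots> = w (u + h) t" by (rule periodic[OF J(1) t])
    finally show False by simp
  qed
  obtain n :: int where n: "u - h \<le> z0 + of_int n * (2 * pi)" "z0 + of_int n * (2 * pi) < u - h + 2 * pi"
    using periodic_reduce[of "2 * pi" "u - h" z0] by auto
  define z where "z = z0 + of_int n * (2 * pi)"
  have z: "S w z t < 0" unfolding z_def using z0 periodic_of_int[OF J(2) t] by simp
  have "\<not> \<bar>z - u\<bar> \<le> h" using nn[of z] z by linarith
  then have zo: "u + h < z" "z < u - h + 2 * pi"
    using n unfolding z_def[symmetric] by linarith+
  define K where "K = \<bar>a\<bar> + \<bar>b\<bar> + 1"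
  define m where "m = Min {S w (u - h) t, S w (u + h) t, - S w z t}"
  have m: "m > 0" "m \<le> S w (u - h) t" "m \<le> S w (u + h) t" "m \<le> - S w z t"
    using left[OF h(1,2)] right[OF h(1,2)] z by (auto simp: m_def)
  have K: "K > 0" by (simp add: K_def add_nonneg_pos)
  \<comment> \<open>Small enough that the tilt keeps the signs at \<open>u - h\<close>,
    \<open>u + h\<close> and \<open>z\<close>; at \<open>u\<close>, where \<open>S w\<close>
    vanishes, the tilt makes the value negative.\<close>
  define \<delta> where "\<delta> = m / (2 * K)"
  have \<delta>: "\<delta> > 0" "\<delta> * K < m" using m(1) K by (simp_all add: \<delta>_def)
  have b: "\<bar>\<delta> * S (lin a b) c t\<bar> < m" for c
  proof -
    have "\<bar>S (lin a b) c t\<bar> \<le> K" using r2_cmult_bound[OF t, of a c b] unfolding S_lin K_def by simp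
    then have "\<bar>\<delta> * S (lin a b) c t\<bar> \<le> \<delta> * K" using \<delta>(1) by (simp add: abs_mult)
    then show ?thesis using \<delta>(2) by simp
  qed
  have S': "S (steep Z ((1 + \<delta>) * a) ((1 + \<delta>) * b)) c t = S w c t - \<delta> * S (lin a b) c t" for c
    unfolding w_def S_steep[OF Z] S_lin by (simp add: algebra_simps)
  have "\<exists>\<epsilon>>0. alternates \<epsilon> (\<lambda>c. S (steep Z ((1 + \<delta>) * a) ((1 + \<delta>) * b)) c t)"
  proof (rule alternatesI[of "u - h" u "u + h" z])
    show "0 < S (steep Z ((1 + \<delta>) * a) ((1 + \<delta>) * b)) (u - h) t" unfolding S' using b[of "u - h"] m by linarith
    show "0 < S (steep Z ((1 + \<delta>) * a) ((1 + \<delta>) * b)) (u + h) t" unfolding S' using b[of "u + h"] m by linarith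
    show "S (steep Z ((1 + \<delta>) * a) ((1 + \<delta>) * b)) z t < 0" unfolding S' using b[of z] m by linarith
    show "S (steep Z ((1 + \<delta>) * a) ((1 + \<delta>) * b)) u t < 0" unfolding S' using \<delta>(1) pos v'(1) by simp
  qed (use h zo in auto)
  moreover have "((1 + \<delta>) * a)\<^sup>2 + ((1 + \<delta>) * b)\<^sup>2 \<ge> M\<^sup>2"
  proof -
    have "M\<^sup>2 \<le> 1 * (a\<^sup>2 + b\<^sup>2)" using M by simp
    also have "\<dots> \<le> (1 + \<delta>)\<^sup>2 * (a\<^sup>2 + b\<^sup>2)"
      using \<delta>(1) by (intro mult_right_mono) (simp_all add: one_le_power)
    also have "\<dots> = ((1 + \<delta>) * a)\<^sup>2 + ((1 + \<delta>) * b)\<^sup>2"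
      by (simp only: power_mult_distrib distrib_left)
    finally show ?thesis .
  qed
  ultimately show False using no by blast
qed

text \<open>The largest squared coordinate of the unit tangent is compared with
  \<open>\<mu>\<^sup>2 * r2\<close>. At a first contact a steep linear function of slope exactly
  \<open>\<mu>\<close> meets the hypotheses of \<open>steep_contact_impossible\<close>. Since the
  squared coordinates sum to 1, the comparison bounds \<open>r2\<close> from below.\<close>

lemma projection_speed_bound:
  assumes ts: "0 < ts" "ts < T" and nd: "\<And>t. 0 < t \<Longrightarrow> t \<le> ts \<Longrightarrow> nondegenerate t"
  obtains \<rho> where "\<rho> > 0" "\<And>u t. ts \<le> t \<Longrightarrow> t < T \<Longrightarrow> \<rho> \<le> r2 u t"
proof -
  have tsI: "ts \<in> I" using ts by simp
  have ndts: "nondegenerate ts" by (rule nd) (use ts in auto)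
  obtain \<sigma> where \<sigma>: "\<sigma> \<in> {1, -1}" "\<And>u. \<sigma> * \<beta> u ts > 0"
  proof (rule strictly_convex[OF ts])
    show "nondegenerate t" if "0 < t" "t \<le> ts" for t by (rule nd[OF that])
  qed (rule that)
  \<comment> \<open>Both signs of each coordinate are included, as \<open>S (X i)\<close> may have
    either sign at the contact.\<close>
  define Z where "Z = (\<lambda>(i, k::real) u t. k * X i u t)"
  have Zcal: "caloric (Z j)" for j
    by (cases j) (simp add: Z_def caloric_cmult caloric_X)
  have ZJ: "Z j \<in> J" for j by (rule caloric_J[OF Zcal])
  define ok where "ok j M \<longleftrightarrow> M > 0 \<and> (\<forall>a b \<epsilon>. a\<^sup>2 + b\<^sup>2 \<ge> M\<^sup>2 \<longrightarrow> \<epsilon> > 0 \<longrightarrow>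
      \<not> alternates \<epsilon> (\<lambda>u. S (steep (Z j) a b) u ts))" for j M
  have "\<exists>M. ok j M" for j
  proof -
    obtain M where "M > 0" "\<And>a b \<epsilon>. a\<^sup>2 + b\<^sup>2 \<ge> M\<^sup>2 \<Longrightarrow> \<epsilon> > 0 \<Longrightarrow> \<not> alternates \<epsilon> (\<lambda>u. S (steep (Z j) a b) u ts)"
      by (rule steep_no_alternation_at[OF tsI ZJ[of j] \<sigma>]) (rule that)
    then show ?thesis unfolding ok_def by blast
  qed
  then obtain Mf where ok: "\<And>j. ok j (Mf j)" using choice[of ok] by blast
  have Mf: "Mf j > 0" "a\<^sup>2 + b\<^sup>2 \<ge> (Mf j)\<^sup>2 \<Longrightarrow> \<epsilon> > 0 \<Longrightarrow> \<not> alternates \<epsilon> (\<lambda>u. S (steep (Z j) a b) u ts)" for j a b \<epsilon>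
    using ok[of j] unfolding ok_def by blast+
  define M where "M = (\<Sum>j\<in>UNIV \<times> {1, -1}. Mf j)"
  have MM: "Mf j \<le> M" if "j \<in> UNIV \<times> {1, -1}" for j
    unfolding M_def using that Mf(1) by (intro member_le_sum) (auto intro: less_imp_le)
  have M: "M \<ge> 0" unfolding M_def using Mf(1) by (intro sum_nonneg) (auto intro: less_imp_le)
  obtain m where m: "m > 0" "\<And>u. m \<le> r2 u ts"
  proof (rule J_lower_bound[OF r2_J order_refl])
    show "{ts..ts} \<subseteq> I" using tsI by simp
    show "r2 u t > 0" if "t \<in> {ts..ts}" for u t using immersed[OF tsI ndts] that by simp
  qed auto
  \<comment> \<open>\<open>M\<close> makes the slope admissible, \<open>1 + 1 / m\<close> makes the
    comparison strict at \<open>ts\<close>, and the growth in time turns the contact condition into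
    a strict inequality between third derivatives.\<close>
  define \<mu> where "\<mu> t = M + 1 + 1 / m + (t - ts)" for t
  have \<mu>: "\<mu> t > 0" "\<mu> t \<ge> M" if "ts \<le> t" for t
    using M m that by (auto simp: \<mu>_def add_pos_nonneg intro: add_pos_nonneg)
  define f where "f i = (\<lambda>u t. (S (X i) u t)\<^sup>2)" for i
  define g where "g = (\<lambda>u t. \<mu> t * \<mu> t * r2 u t)"
  define F where "F = (\<lambda>u t. Max (range (\<lambda>i. f i u t)) - g u t)"
  have \<mu>J: "(\<lambda>u t. \<mu> t) \<in> J" unfolding \<mu>_def using time_J by simp
  have fJ: "f i \<in> J" for i by (simp add: f_def)
  have gJ: "g \<in> J" unfolding g_def using \<mu>J r2_J by simp
  have tangent: "(\<Sum>i\<in>UNIV. f i u t) = 1" if "t \<in> I" for u t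
    unfolding f_def by (rule unit_tangent[OF that])
  have Fneg: "F u t < 0" if t: "ts \<le> t" "t < T" for u t
  proof (rule ccontr)
    assume bad: "\<not> F u t < 0"
    have sub: "{ts..t} \<subseteq> I" using ts t by auto
    have contF: "continuous_on (UNIV \<times> {ts..t}) (\<lambda>(u, t). F u t)"
    proof -
      have "continuous_on (UNIV \<times> {ts..t}) (\<lambda>z. Max (range (\<lambda>i. f i (fst z) (snd z))))"
        by (rule continuous_on_Max) (use J_cont_on[OF fJ sub] in \<open>simp_all add: case_prod_unfold\<close>)
      moreover have "continuous_on (UNIV \<times> {ts..t}) (\<lambda>z. g (fst z) (snd z))"
        using J_cont_on[OF gJ sub] by (simp add: case_prod_unfold)
      ultimately show ?thesis
        unfolding F_def case_prod_unfold by (intro continuous_intros)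
    qed
    have per: "F (u + 2 * pi) t' = F u t'" if "t' \<in> {ts..t}" for u t'
      unfolding F_def using periodic[OF fJ subsetD[OF sub that]] periodic[OF gJ subsetD[OF sub that]] by simp
    have init: "F u ts < 0" for u
    proof -
      have "f i u ts \<le> 1" for i
        using member_le_sum[of i UNIV "\<lambda>i. f i u ts"] tangent[OF tsI, of u] by (simp add: f_def)
      then have "Max (range (\<lambda>i. f i u ts)) \<le> 1" by simp
      moreover have "1 < g u ts"
      proof -
        have "1 < (1 + 1 / m) * (1 + 1 / m) * m" using m(1) by (auto simp: field_simps intro!: add_pos_pos)
        also have "\<dots> \<le> \<mu> ts * \<mu> ts * r2 u ts"
          using m M by (intro mult_mono) (auto simp: \<mu>_def)
        finally show ?thesis by (simp add: g_def)
      qed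
      ultimately show ?thesis unfolding F_def by linarith
    qed
    obtain v s \<delta> where vs: "ts < s" "s \<le> t" "F v s = 0" "\<delta> > 0"
      "\<And>c r. \<bar>c - v\<bar> < \<delta> \<Longrightarrow> s - \<delta> < r \<Longrightarrow> r \<le> s \<Longrightarrow> F c r \<le> 0"
    proof (rule first_touch[OF contF, of "\<lambda>_ _. 1" "2 * pi" u t])
      fix v s \<delta>
      assume a: "ts < s" "s \<le> t" "F v s = 0" "\<delta> > 0"
        "\<And>x r. \<bar>x - v\<bar> < \<delta> \<Longrightarrow> s - \<delta> < r \<Longrightarrow> r \<le> s \<Longrightarrow> F x r \<le> 0"
      show thesis by (rule that[OF a(1-4)]) (rule a(5))
    next
      show "F (u + 2 * pi) t' = F u t'" if "t' \<in> {ts..t}" for u t' by (rule per[OF that])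
      show "F u ts < 0" for u by (rule init)
      show "0 \<le> F u t" using bad by simp
      show "t \<in> {ts..t}" using t by simp
    qed (simp_all add: case_prod_unfold)
    have sI: "s \<in> I" using vs(1,2) ts t by auto
    obtain i where i: "Max (range (\<lambda>i. f i v s)) = f i v s"
    proof -
      have "Max (range (\<lambda>i. f i v s)) \<in> range (\<lambda>i. f i v s)" by (intro Max_in) auto
      then show thesis using that by (rule rangeE)
    qed
    \<comment> \<open>The maximum over the coordinates is not smooth. \<open>H\<close> lies below
      \<open>F\<close> with the same value at the contact, so the derivative tests apply to
      it.\<close>
    define H where "H = (\<lambda>u t. f i u t - g u t)"
    have HJ: "H \<in> J" unfolding H_def using fJ gJ by simp
    have HF: "H c r \<le> F c r" for c r by (simp add: H_def F_def)
    have H0: "H v s = 0" using vs(3) i by (simp add: H_def F_def)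
    have SH: "S H v s = 0"
      by (rule local_max_conditions(1)[OF HJ sI vs(4)])
        (use order_trans[OF HF vs(5)] H0 vs(4) in simp)
    have DH: "Dt H v s \<ge> 0"
      by (rule time_max_condition[OF HJ sI vs(4)])
        (use order_trans[OF HF vs(5)] H0 vs(4) in simp)
    define \<mu>s where "\<mu>s = \<mu> s"
    define c where "c = S (X i) v s"
    define a where "a = S x v s"
    define b where "b = S y v s"
    have mu: "\<mu>s > 0" "\<mu>s \<ge> M" using \<mu>[of s] vs(1) by (auto simp: \<mu>s_def)
    have c2: "c\<^sup>2 = \<mu>s\<^sup>2 * (a\<^sup>2 + b\<^sup>2)"
      using H0 by (simp add: H_def f_def g_def r2_def c_def a_def b_def \<mu>s_def power2_eq_square)
    have cne: "c \<noteq> 0"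
    proof
      assume "c = 0"
      then have "f j v s \<le> 0" for j
        using i Max_ge[of "range (\<lambda>i. f i v s)" "f j v s"] by (auto simp: f_def c_def)
      then have "(\<Sum>j\<in>UNIV. f j v s) \<le> 0" by (intro sum_nonpos) auto
      then show False using tangent[OF sI, of v] by simp
    qed
    have S\<mu>: "S (\<lambda>u t. \<mu> t) = (\<lambda>u t. 0)" using du_time[of \<mu>] by (simp add: S_def)
    have D\<mu>: "Dt (\<lambda>u t. \<mu> t) v s = 1"
      by (rule dt_time[OF _ sI]) (auto simp: \<mu>_def intro!: derivative_eq_intros)
    define A where "A = S (S (X i)) v s"
    define B where "B = a * S (S x) v s + b * S (S y) v s"
    have SH': "c * A = \<mu>s\<^sup>2 * B"
      using SH unfolding H_def f_def g_def r2_def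
      by (simp add: S_simps S\<mu> \<mu>J c_def[symmetric] a_def[symmetric] b_def[symmetric] A_def B_def \<mu>s_def[symmetric] power2_eq_square)
        (simp add: algebra_simps)
    define A3 where "A3 = S (S (S (X i))) v s"
    define B3 where "B3 = a * S (S (S x)) v s + b * S (S (S y)) v s"
    have "0 \<le> 2 * c * (A3 + q v s * c) - (2 * \<mu>s * (a\<^sup>2 + b\<^sup>2) + \<mu>s\<^sup>2 * (2 * B3 + 2 * q v s * (a\<^sup>2 + b\<^sup>2)))"
      using DH unfolding H_def f_def g_def r2_def
      by (simp add: Dt_simps D\<mu> \<mu>J Dt_S heat Dt_x Dt_y c_def[symmetric] a_def[symmetric] b_def[symmetric] A3_def B3_def \<mu>s_def[symmetric] power2_eq_square)
        (simp add: algebra_simps)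
    then have DH': "\<mu>s * (a\<^sup>2 + b\<^sup>2) \<le> c * A3 - \<mu>s\<^sup>2 * B3"
    proof -
      assume h: "0 \<le> 2 * c * (A3 + q v s * c) - (2 * \<mu>s * (a\<^sup>2 + b\<^sup>2) + \<mu>s\<^sup>2 * (2 * B3 + 2 * q v s * (a\<^sup>2 + b\<^sup>2)))"
      have "2 * c * (A3 + q v s * c) - (2 * \<mu>s * (a\<^sup>2 + b\<^sup>2) + \<mu>s\<^sup>2 * (2 * B3 + 2 * q v s * (a\<^sup>2 + b\<^sup>2)))
        = 2 * (c * A3 - \<mu>s\<^sup>2 * B3 - \<mu>s * (a\<^sup>2 + b\<^sup>2)) + 2 * q v s * (c\<^sup>2 - \<mu>s\<^sup>2 * (a\<^sup>2 + b\<^sup>2))"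
        by (simp add: power2_eq_square algebra_simps)
      then show ?thesis using h c2 by simp
    qed
    define k where "k = sgn c"
    have k: "k \<in> {1, -1}" "k * c = \<bar>c\<bar>" "k * k = 1" using cne by (auto simp: k_def sgn_if)
    \<comment> \<open>The slope is parallel to the projected tangent and scaled so that the linear
      function has derivative \<open>\<bar>c\<bar>\<close> at the contact; its length is then
      \<open>\<mu>s\<close>.\<close>
    define \<alpha> where "\<alpha> = \<mu>s\<^sup>2 * a / \<bar>c\<bar>"
    define \<beta>' where "\<beta>' = \<mu>s\<^sup>2 * b / \<bar>c\<bar>"
    have ab: "\<alpha>\<^sup>2 + \<beta>'\<^sup>2 = \<mu>s\<^sup>2"
    proof -
      have "\<alpha>\<^sup>2 + \<beta>'\<^sup>2 = \<mu>s\<^sup>2 * (\<mu>s\<^sup>2 * (a\<^sup>2 + b\<^sup>2)) / c\<^sup>2"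
        by (simp add: \<alpha>_def \<beta>'_def power_divide power_mult_distrib add_divide_distrib algebra_simps power2_eq_square)
      then show ?thesis unfolding c2[symmetric] using cne by simp
    qed
    have lin: "S (lin \<alpha> \<beta>') v s = \<bar>c\<bar>"
    proof -
      have "S (lin \<alpha> \<beta>') v s = \<mu>s\<^sup>2 * (a\<^sup>2 + b\<^sup>2) / \<bar>c\<bar>"
        unfolding S_lin by (simp add: \<alpha>_def \<beta>'_def a_def b_def power2_eq_square add_divide_distrib algebra_simps)
      also have "\<dots> = \<bar>c\<bar>\<^sup>2 / \<bar>c\<bar>" using c2 by simp
      finally show ?thesis using cne by (cases "c > 0") (auto simp: power2_eq_square)
    qed
    have Zik: "S (Z (i, k)) = (\<lambda>u t. k * S (X i) u t)" "S (\<lambda>u t. k * S (X i) u t) = (\<lambda>u t. k * S (S (X i)) u t)"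
      "S (\<lambda>u t. k * S (S (X i)) u t) = (\<lambda>u t. k * S (S (S (X i))) u t)"
      by (simp_all add: Z_def S_cmult)
    show False
    proof (rule steep_contact_impossible[OF sI ZJ[of "(i, k)"], where a = \<alpha> and b = \<beta>' and M = "Mf (i, k)" and u = v])
      show "(Mf (i, k))\<^sup>2 \<le> \<alpha>\<^sup>2 + \<beta>'\<^sup>2"
        unfolding ab using mu(2) MM[of "(i, k)"] k(1) Mf(1)[of "(i, k)"] by (intro power_mono) auto
      show "\<not> alternates \<epsilon> (\<lambda>u. S (steep (Z (i, k)) a b) u s)" if "(Mf (i, k))\<^sup>2 \<le> a\<^sup>2 + b\<^sup>2" "\<epsilon> > 0" for a b \<epsilon>
        by (rule steep_no_alternation_later[OF tsI _ _ Zcal Mf(2)[OF that(1)] that(2)]) (use vs t in auto)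
      show "S (lin \<alpha> \<beta>') v s > 0" using lin cne by simp
      show "S (steep (Z (i, k)) \<alpha> \<beta>') v s = 0"
        using lin k(2) ZJ[of "(i, k)"] by (simp add: S_diff Zik c_def)
      have "S (S (steep (Z (i, k)) \<alpha> \<beta>')) v s = k * A - \<mu>s\<^sup>2 * B / \<bar>c\<bar>"
      proof -
        have "S (S (steep (Z (i, k)) \<alpha> \<beta>')) v s = k * A - (\<alpha> * S (S x) v s + \<beta>' * S (S y) v s)"
          using ZJ[of "(i, k)"] by (simp add: S_simps Zik A_def)
        then show ?thesis by (simp add: B_def \<alpha>_def \<beta>'_def add_divide_distrib algebra_simps)
      qed
      also have "\<dots> = 0"
      proof -
        have "\<bar>c\<bar> * (k * A) = \<mu>s\<^sup>2 * B"
          unfolding k(2)[symmetric] using SH' k(3) by (simp add: algebra_simps)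
        then show ?thesis using cne by (simp add: field_simps)
      qed
      finally show "S (S (steep (Z (i, k)) \<alpha> \<beta>')) v s = 0" .
      have "S (S (S (steep (Z (i, k)) \<alpha> \<beta>'))) v s = k * A3 - \<mu>s\<^sup>2 * B3 / \<bar>c\<bar>"
      proof -
        have "S (S (S (steep (Z (i, k)) \<alpha> \<beta>'))) v s = k * A3 - (\<alpha> * S (S (S x)) v s + \<beta>' * S (S (S y)) v s)"
          using ZJ[of "(i, k)"] by (simp add: S_simps Zik A3_def)
        then show ?thesis by (simp add: B3_def \<alpha>_def \<beta>'_def add_divide_distrib algebra_simps)
      qed
      also have "\<dots> > 0"
      proof -
        have "\<bar>c\<bar> * (k * A3) = c * A3"
          unfolding k(2)[symmetric] using k(3) by (simp add: algebra_simps)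
        moreover have "\<mu>s * (a\<^sup>2 + b\<^sup>2) > 0"
        proof -
          have "a\<^sup>2 + b\<^sup>2 \<noteq> 0" using c2 cne by auto
          then have "a\<^sup>2 + b\<^sup>2 > 0" using sum_power2_ge_zero[of a b] by linarith
          then show ?thesis using mu(1) by simp
        qed
        ultimately have "\<bar>c\<bar> * (k * A3) > \<mu>s\<^sup>2 * B3" using DH' by linarith
        then show ?thesis using cne by (simp add: field_simps)
      qed
      finally show "S (S (S (steep (Z (i, k)) \<alpha> \<beta>'))) v s > 0" .
    qed
  qed
  define \<mu>m where "\<mu>m = \<mu> T"
  have mum: "\<mu>m > 0" using \<mu>(1)[of T] ts by (simp add: \<mu>m_def)
  define \<rho> where "\<rho> = 1 / (real CARD('n) * \<mu>m\<^sup>2)"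
  have card: "real CARD('n) > 0" by simp
  have pos: "real CARD('n) * \<mu>m\<^sup>2 > 0" by (rule mult_pos_pos[OF card]) (use mum in simp)
  then have "\<rho> > 0" by (simp add: \<rho>_def)
  moreover have "\<rho> \<le> r2 u t" if t: "ts \<le> t" "t < T" for u t
  proof -
    have tI: "t \<in> I" using t ts by auto
    have r: "r2 u t \<ge> 0" by (simp add: r2_def)
    have "f i u t \<le> \<mu>m\<^sup>2 * r2 u t" for i
    proof -
      have "f i u t \<le> Max (range (\<lambda>i. f i u t))" by (intro Max_ge) auto
      also have "\<dots> \<le> g u t" using Fneg[OF t, of u] unfolding F_def by linarith
      also have "\<dots> \<le> \<mu>m * \<mu>m * r2 u t"
        unfolding g_def using \<mu>(1)[of t] t r mum by (intro mult_right_mono mult_mono) (auto simp: \<mu>m_def \<mu>_def)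
      finally show ?thesis by (simp add: power2_eq_square)
    qed
    then have "(\<Sum>i\<in>UNIV. f i u t) \<le> (\<Sum>i\<in>(UNIV::'n set). \<mu>m\<^sup>2 * r2 u t)" by (intro sum_mono)
    then have "1 \<le> real CARD('n) * \<mu>m\<^sup>2 * r2 u t" using tangent[OF tI, of u] by simp
    then show ?thesis using pos by (simp add: \<rho>_def pos_divide_le_eq mult.commute)
  qed
  ultimately show ?thesis by (rule that)
qed

end

section \<open>The convex hull of the projection\<close>

text \<open>If the interior is empty, the set lies in a hyperplane, whose normal serves; otherwise
  \<open>m\<close> is on the relative frontier.\<close>

lemma support_at_noninterior:
  fixes C :: "'a::euclidean_space set"
  assumes "convex C" "m \<in> C" "m \<notin> interior C"
  obtains a where "a \<noteq> 0" "\<And>y. y \<in> C \<Longrightarrow> a \<bullet> y \<le> a \<bullet> m"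
proof (cases "interior C = {}")
  case True
  obtain a b where "a \<noteq> 0" and sub: "C \<subseteq> {x. a \<bullet> x = b}"
    by (rule empty_interior_subset_hyperplane[OF assms(1) True])
  then have "a \<bullet> y \<le> a \<bullet> m" if "y \<in> C" for y
    using subsetD[OF sub that] subsetD[OF sub assms(2)] by simp
  with \<open>a \<noteq> 0\<close> show ?thesis by (rule that)
next
  case False
  then have "m \<notin> rel_interior C" using assms(3) by (simp add: rel_interior_nonempty_interior)
  then obtain a where a: "a \<noteq> 0" "\<And>y. y \<in> closure C \<Longrightarrow> a \<bullet> m \<le> a \<bullet> y"
    using supporting_hyperplane_relative_frontier[OF assms(1) subsetD[OF closure_subset assms(2)]] by metis
  have "- a \<bullet> y \<le> - a \<bullet> m" if "y \<in> C" for y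
    using a(2)[OF subsetD[OF closure_subset that]] by simp
  moreover have "- a \<noteq> 0" using a(1) by simp
  ultimately show ?thesis by (intro that)
qed

context csf_flow
begin

lemma J_uniform:
  assumes f: "f \<in> J" and t: "t \<in> I" and e: "e > 0"
  obtains \<delta> where "\<delta> > 0" "\<And>s u. \<bar>s - t\<bar> < \<delta> \<Longrightarrow> s \<in> I \<and> \<bar>f u s - f u t\<bar> < e"
proof -
  define d0 where "d0 = min t (T - t) / 2"
  have "d0 \<le> t / 2" "d0 \<le> (T - t) / 2" by (simp_all add: d0_def)
  moreover have d0pos: "d0 > 0" using t by (simp add: d0_def)
  ultimately have "0 < t - d0" "t + d0 < T" using t by (simp_all add: field_simps)
  then have d0: "d0 > 0" "{t - d0..t + d0} \<subseteq> I" using d0pos by auto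
  let ?Q = "{0..2*pi} \<times> {t - d0..t + d0}"
  have "uniformly_continuous_on ?Q (\<lambda>(u, t). f u t)"
    by (rule compact_uniformly_continuous)
      (auto intro!: compact_Times continuous_on_subset[OF J_cont_on[OF f d0(2)]])
  then obtain d where d: "d > 0" "\<And>z z'. z \<in> ?Q \<Longrightarrow> z' \<in> ?Q \<Longrightarrow> dist z' z < d \<Longrightarrow>
      dist ((\<lambda>(u, t). f u t) z') ((\<lambda>(u, t). f u t) z) < e"
    unfolding uniformly_continuous_on_def using e by metis
  show ?thesis
  proof (rule that[of "min d d0"])
    fix s u assume s: "\<bar>s - t\<bar> < min d d0"
    have sI: "s \<in> I" using s d0(2) by (auto simp: abs_less_iff subset_iff)
    obtain n :: int where n: "0 \<le> u + of_int n * (2 * pi)" "u + of_int n * (2 * pi) < 0 + 2 * pi"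
      using periodic_reduce[of "2 * pi" 0 u] by auto
    let ?u = "u + of_int n * (2 * pi)"
    have "dist (?u, s) (?u, t) < d" using s by (simp add: dist_Pair_Pair dist_real_def)
    then have "dist (f ?u s) (f ?u t) < e"
      using d(2)[of "(?u, t)" "(?u, s)"] n s d0(1) by (auto simp: abs_less_iff)
    then show "s \<in> I \<and> \<bar>f u s - f u t\<bar> < e"
      using sI t periodic_of_int[OF f] by (simp add: dist_real_def)
  qed (use d d0 in simp)
qed

lemma caloric_max_decreasing:
  assumes w: "caloric w" and t: "0 < t0" "t0 \<le> t" "t < T" and le: "\<And>u. w u t0 \<le> c"
  shows "w u t \<le> c"
proof -
  have FJ: "(\<lambda>u t. w u t - c) \<in> J" using caloric_J[OF w] by simp
  have cal: "caloric (\<lambda>u t. w u t - c)" by (intro caloric_intros w)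
  have "w u t - c \<le> 0"
    by (rule global_max_principle[OF FJ t(1), of t]) (use t le cal in \<open>auto simp: caloric_def\<close>)
  then show ?thesis by simp
qed

end

context planar_flow
begin

lemma caloric_lin: "caloric (lin a b)"
  by (intro caloric_add caloric_cmult caloric_x caloric_y)

definition pt :: "real \<Rightarrow> real \<Rightarrow> real \<times> real" where "pt u t = (x u t, y u t)"

definition K :: "real \<Rightarrow> (real \<times> real) set" where "K t = convex hull (range (\<lambda>u. pt u t))"

lemma lin_pt: "lin a b u t = (a, b) \<bullet> pt u t"
  by (simp add: pt_def)

lemma pt_K: "pt u t \<in> K t"
  unfolding K_def by (rule hull_inc) simp

lemma convex_K: "convex (K t)" by (simp add: K_def)

lemma pt_periodic: "t \<in> I \<Longrightarrow> pt (u + of_int n * (2 * pi)) t = pt u t"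
  by (simp add: pt_def periodic_of_int)

lemma pt_continuous: "t \<in> I \<Longrightarrow> continuous_on UNIV (\<lambda>u. pt u t)"
  unfolding pt_def by (intro continuous_intros J_cont_u x_J y_J)

lemma compact_curve: "t \<in> I \<Longrightarrow> compact (range (\<lambda>u. pt u t))"
proof -
  assume t: "t \<in> I"
  have "range (\<lambda>u. pt u t) = (\<lambda>u. pt u t) ` {0..2*pi}"
  proof (intro equalityI subsetI)
    fix z assume "z \<in> range (\<lambda>u. pt u t)"
    then obtain u where u: "z = pt u t" by auto
    obtain n :: int where n: "0 \<le> u + of_int n * (2 * pi)" "u + of_int n * (2 * pi) < 0 + 2 * pi"
      using periodic_reduce[of "2 * pi" 0 u] by auto
    then show "z \<in> (\<lambda>u. pt u t) ` {0..2*pi}"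
      using pt_periodic[OF t, of u n] by (intro image_eqI[of _ _ "u + of_int n * (2 * pi)"]) (auto simp: u)
  qed auto
  moreover have "compact ((\<lambda>u. pt u t) ` {0..2*pi})"
    by (intro compact_continuous_image continuous_on_subset[OF pt_continuous[OF t]]) auto
  ultimately show ?thesis by simp
qed

lemma compact_K: "t \<in> I \<Longrightarrow> compact (K t)"
  unfolding K_def by (intro compact_convex_hull compact_curve)

lemma closed_K: "t \<in> I \<Longrightarrow> closed (K t)"
  by (simp add: compact_K compact_imp_closed)

lemma K_le: "m \<in> K t \<Longrightarrow> (\<And>u. lin a b u t \<le> c) \<Longrightarrow> (a, b) \<bullet> m \<le> c"
proof -
  assume m: "m \<in> K t" and le: "\<And>u. lin a b u t \<le> c"
  have "K t \<subseteq> {z. (a, b) \<bullet> z \<le> c}"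
    unfolding K_def
  proof (rule hull_minimal)
    show "range (\<lambda>u. pt u t) \<subseteq> {z. (a, b) \<bullet> z \<le> c}"
      using le by (auto simp: lin_pt)
  qed (rule convex_halfspace_le)
  then show ?thesis using m by auto
qed

lemma lin_max: "t \<in> I \<Longrightarrow> \<exists>u. \<forall>v. lin a b v t \<le> lin a b u t"
  by (rule J_attains_sup[OF lin_J[of a b] order_refl, of t]) auto

lemma not_K:
  assumes t: "t \<in> I" and m: "m \<notin> K t"
  obtains a b where "\<And>u. lin a b u t < (a, b) \<bullet> m"
proof -
  obtain v c where v: "v \<bullet> m < c" "\<forall>z\<in>K t. v \<bullet> z > c"
    using separating_hyperplane_closed_point[OF convex_K closed_K[OF t] m] by blast
  show ?thesis
  proof (rule that[of "- fst v" "- snd v"])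
    fix u
    have e: "(- fst v, - snd v) = - v" by (simp add: prod_eq_iff)
    have "v \<bullet> pt u t > c" using v(2) pt_K by blast
    then show "lin (- fst v) (- snd v) u t < (- fst v, - snd v) \<bullet> m"
      using v(1) unfolding lin_pt e by simp
  qed
qed

text \<open>A half plane that contains the curve keeps containing it, by the maximum principle for
  linear functions.\<close>

lemma K_antimono:
  assumes t: "0 < t0" "t0 \<le> t" "t < T"
  shows "K t \<subseteq> K t0"
proof
  fix m assume m: "m \<in> K t"
  have t0: "t0 \<in> I" using t by auto
  show "m \<in> K t0"
  proof (rule ccontr)
    assume "m \<notin> K t0"
    then obtain a b where ab: "\<And>u. lin a b u t0 < (a, b) \<bullet> m" using not_K[OF t0] by blast
    obtain u0 where u0: "\<And>v. lin a b v t0 \<le> lin a b u0 t0" using lin_max[OF t0] by blast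
    have "(a, b) \<bullet> m \<le> lin a b u0 t0"
      by (rule K_le[OF m]) (rule caloric_max_decreasing[OF caloric_lin t u0])
    then show False using ab[of u0] by simp
  qed
qed

text \<open>The tangent line at the point supports the curve and hence its hull, so a small push
  along the outward normal leaves the hull.\<close>

lemma curve_not_interior:
  assumes t: "t \<in> I" and nd: "nondegenerate t"
  shows "pt u t \<notin> interior (K t)"
proof
  assume int: "pt u t \<in> interior (K t)"
  define a where "a = - S y u t"
  define b where "b = S x u t"
  have ab: "(a, b) \<noteq> (0, 0)" using immersed[OF t nd, of u] by (auto simp: r2_def a_def b_def)
  have "a * S x u t + b * S y u t = 0" by (simp add: a_def b_def)
  then obtain k :: real where k: "k \<in> {1, -1}" "\<And>v. lin (k * a) (k * b) v t \<le> lin (k * a) (k * b) u t"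
    using support[OF t] by (metis (no_types, lifting) insertI1 insertI2 minus_add_distrib mult_1 mult_minus1 mult_minus_left neg_le_iff_le singletonI)
  have kab: "(k * a, k * b) \<noteq> (0, 0)" using k(1) ab by auto
  obtain e where e: "e > 0" "ball (pt u t) e \<subseteq> K t" using int by (auto simp: mem_interior)
  define w where "w = (k * a, k * b)"
  define z where "z = pt u t + (e / (2 * norm w)) *\<^sub>R w"
  have wn: "norm w > 0" using kab by (simp add: w_def zero_prod_def)
  have "dist (pt u t) z = e / 2" using wn e by (simp add: z_def dist_norm)
  then have "z \<in> K t" using e by auto
  then have "w \<bullet> z \<le> lin (k * a) (k * b) u t" unfolding w_def by (rule K_le) (rule k(2))
  moreover have "w \<bullet> z = lin (k * a) (k * b) u t + (e / (2 * norm w)) * (w \<bullet> w)"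
    unfolding lin_pt w_def[symmetric] by (simp add: z_def inner_add_right)
  moreover have "(e / (2 * norm w)) * (w \<bullet> w) > 0" using wn e by simp
  ultimately show False by simp
qed

text \<open>The curve does not lie entirely on a supporting line of the earlier hull, so by the
  strong maximum principle it leaves that line at once.\<close>

lemma K_subset_interior:
  assumes t: "0 < t0" "t0 < t1" "t1 < T" and nd: "nondegenerate t0"
  shows "K t1 \<subseteq> interior (K t0)"
proof
  fix m assume m: "m \<in> K t1"
  have t0I: "t0 \<in> I" "t1 \<in> I" using t by auto
  have m0: "m \<in> K t0" using K_antimono[of t0 t1] t m by auto
  show "m \<in> interior (K t0)"
  proof (rule ccontr)
    assume "m \<notin> interior (K t0)"
    then obtain v where v: "v \<noteq> 0" "\<And>z. z \<in> K t0 \<Longrightarrow> v \<bullet> z \<le> v \<bullet> m"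
      using support_at_noninterior[OF convex_K m0] by blast
    obtain a b where vab: "v = (a, b)" by (cases v)
    define c where "c = v \<bullet> m"
    have le0: "lin a b u t0 \<le> c" for u using v(2)[OF pt_K, of u] by (simp add: lin_pt vab c_def)
    have le: "lin a b u t \<le> c" if "t \<in> {t0..t1}" for u t
      by (rule caloric_max_decreasing[OF caloric_lin t(1) _ _ le0]) (use that t in auto)
    obtain us where us: "lin a b us t0 < c"
    proof -
      have "(a, b) \<noteq> (0, 0)" using v(1) vab by (simp add: zero_prod_def)
      then obtain u w where "lin a b u t0 \<noteq> lin a b w t0" using nd unfolding nondegenerate_def by blast
      then show thesis using that[of u] that[of w] le0[of u] le0[of w] by linarith
    qed
    define p where "p = (\<lambda>u t. c - lin a b u t)"
    have pcal: "caloric p" unfolding p_def by (intro caloric_diff caloric_const caloric_lin)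
    have "p u t1 > 0" for u
    proof (rule strong_max_principle[OF caloric_J[OF pcal] t, of "min us u - 1" us "max us u + 1" u 0])
      show "p u t \<ge> 0" if "t \<in> {t0..t1}" for u t using le[OF that, of u] by (simp add: p_def)
      show "Dt p u t \<ge> S (S p) u t - 0 * \<bar>S p u t\<bar> - 0 * p u t" for u t
        using pcal by (simp add: caloric_def)
    qed (use us in \<open>auto simp: p_def\<close>)
    then have lt: "lin a b u t1 < c" for u by (simp add: p_def)
    obtain u0 where u0: "\<And>v. lin a b v t1 \<le> lin a b u0 t1" using lin_max[OF t0I(2)] by blast
    have "(a, b) \<bullet> m \<le> lin a b u0 t1" by (rule K_le[OF m u0])
    then show False using lt[of u0] by (simp add: c_def vab)
  qed
qed

text \<open>A supporting line at \<open>m\<close> meets the curve on both sides of \<open>m\<close>.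
  The linear function is tame, so one of the two arcs between these points stays on the line, and
  the intermediate value theorem finds \<open>m\<close> on it.\<close>

lemma frontier_K_curve:
  assumes t: "t \<in> I" and m: "m \<in> K t" "m \<notin> interior (K t)"
  obtains u where "pt u t = m"
proof -
  obtain v where v: "v \<noteq> 0" "\<And>z. z \<in> K t \<Longrightarrow> v \<bullet> z \<le> v \<bullet> m"
    using support_at_noninterior[OF convex_K m] by blast
  obtain a b where vab: "v = (a, b)" by (cases v)
  define c where "c = v \<bullet> m"
  have le: "lin a b u t \<le> c" for u using v(2)[OF pt_K, of u] by (simp add: lin_pt vab c_def)
  define d where "d = (- b, a) \<bullet> m"
  text \<open>The curve meets the supporting line on either side of \<open>m\<close>.\<close>
  have side: "\<exists>u. lin a b u t = c \<and> k * lin (- b) a u t \<ge> k * d" if k: "k \<in> {1, -1 :: real}" for k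
  proof -
    \<comment> \<open>Tilt the functional by \<open>e\<close>: its maximum over the curve dominates
      its value at \<open>m\<close>. As \<open>e\<close> tends to 0, a limit of such points lies on
      the supporting line, while the inequality along the line survives.\<close>
    have ex: "\<exists>u\<in>{0..2*pi}. lin a b u t + e * (k * lin (- b) a u t) \<ge> c + e * (k * d)" for e
    proof -
      have lincomb: "lin (a - e * k * b) (b + e * k * a) u t = lin a b u t + e * (k * lin (- b) a u t)" for u
        by (simp add: algebra_simps)
      obtain u0 where u0: "\<And>v. lin (a - e * k * b) (b + e * k * a) v t \<le> lin (a - e * k * b) (b + e * k * a) u0 t"
        using lin_max[OF t] by blast
      have "(a - e * k * b, b + e * k * a) \<bullet> m \<le> lin (a - e * k * b) (b + e * k * a) u0 t"
        by (rule K_le[OF m(1) u0])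
      moreover have "(a - e * k * b, b + e * k * a) \<bullet> m = c + e * (k * d)"
        by (cases m) (simp add: c_def d_def vab algebra_simps)
      ultimately have 1: "lin a b u0 t + e * (k * lin (- b) a u0 t) \<ge> c + e * (k * d)"
        unfolding lincomb by simp
      obtain n :: int where n: "0 \<le> u0 + of_int n * (2 * pi)" "u0 + of_int n * (2 * pi) < 0 + 2 * pi"
        using periodic_reduce[of "2 * pi" 0 u0] by auto
      show ?thesis
        by (rule bexI[of _ "u0 + of_int n * (2 * pi)"])
          (use 1 n t in \<open>simp_all add: periodic_of_int\<close>)
    qed
    have "\<forall>j::nat. \<exists>u\<in>{0..2*pi}. lin a b u t + inverse (real (Suc j)) * (k * lin (- b) a u t)
        \<ge> c + inverse (real (Suc j)) * (k * d)" using ex by blast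
    then obtain w where w: "\<And>j. w j \<in> {0..2*pi}" "\<And>j. lin a b (w j) t + inverse (real (Suc j)) * (k * lin (- b) a (w j) t)
        \<ge> c + inverse (real (Suc j)) * (k * d)" by metis
    obtain l r where l: "l \<in> {0..2*pi}" and r: "strict_mono (r :: nat \<Rightarrow> nat)" and lim: "(w \<circ> r) \<longlonglongrightarrow> l"
      using w(1) compact_Icc[of 0 "2*pi"] unfolding compact_def by metis
    have side_ge: "k * lin (- b) a (w j) t \<ge> k * d" for j
    proof -
      have "inverse (real (Suc j)) * (k * d) \<le> inverse (real (Suc j)) * (k * lin (- b) a (w j) t)"
        using w(2)[of j] le[of "w j"] by linarith
      then show ?thesis by (simp only: mult_le_cancel_left_pos[OF inverse_positive_iff_positive[THEN iffD2, of "real (Suc j)"]] of_nat_0_less_iff zero_less_Suc)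
    qed
    have c0: "isCont (\<lambda>u. lin a' b' u t) l" for a' b'
      using J_cont_u[OF lin_J[of a' b'] t] by (simp add: continuous_on_eq_continuous_at)
    note c1 = c0[of a b] c0[of "- b" a]
    have l1: "(\<lambda>j. lin a b (w (r j)) t) \<longlonglongrightarrow> lin a b l t"
      "(\<lambda>j. lin (- b) a (w (r j)) t) \<longlonglongrightarrow> lin (- b) a l t"
      using isCont_tendsto_compose[OF c1(1) lim] isCont_tendsto_compose[OF c1(2) lim] by (simp_all add: o_def)
    have "k * lin (- b) a l t \<ge> k * d"
      by (rule LIMSEQ_le_const[OF tendsto_mult_left[OF l1(2)]]) (use side_ge in blast)
    moreover have "lin a b l t \<ge> c"
    proof (rule LIMSEQ_le)
      have i: "(\<lambda>j. inverse (real (Suc (r j)))) \<longlonglongrightarrow> 0"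
        using LIMSEQ_subseq_LIMSEQ[OF LIMSEQ_inverse_real_of_nat r] by (simp add: o_def)
      show "(\<lambda>j. c + inverse (real (Suc (r j))) * (k * d)) \<longlonglongrightarrow> c"
        using tendsto_add[OF tendsto_const[of c] tendsto_mult_left_zero[OF i, of "k * d"]] by simp
      show "(\<lambda>j. lin a b (w (r j)) t + inverse (real (Suc (r j))) * (k * lin (- b) a (w (r j)) t)) \<longlonglongrightarrow> lin a b l t"
        using tendsto_add[OF l1(1) tendsto_mult[OF i tendsto_mult_left[OF l1(2), of k]]] by simp
      show "\<exists>N. \<forall>n\<ge>N. c + inverse (real (Suc (r n))) * (k * d)
          \<le> lin a b (w (r n)) t + inverse (real (Suc (r n))) * (k * lin (- b) a (w (r n)) t)"
        using w(2) by blast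
    qed
    ultimately show ?thesis using le[of l] by (intro exI[of _ l]) auto
  qed
  obtain ul where ul: "lin a b ul t = c" "lin (- b) a ul t \<le> d" using side[of "-1"] by auto
  obtain ur0 where ur0: "lin a b ur0 t = c" "lin (- b) a ur0 t \<ge> d" using side[of 1] by auto
  obtain n :: int where n: "ul \<le> ur0 + of_int n * (2 * pi)" "ur0 + of_int n * (2 * pi) < ul + 2 * pi"
    using periodic_reduce[of "2 * pi" ul ur0] by auto
  define ur where "ur = ur0 + of_int n * (2 * pi)"
  have ur: "lin a b ur t = c" "lin (- b) a ur t \<ge> d" "ul \<le> ur" "ur < ul + 2 * pi"
    using ur0 n t by (simp_all add: ur_def periodic_of_int)
  have ul': "lin a b (ul + 2 * pi) t = c" "lin (- b) a (ul + 2 * pi) t \<le> d"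
    using ul periodic[OF x_J t, of ul] periodic[OF y_J t, of ul] by simp_all
  have cont: "continuous_on A (\<lambda>u. lin (- b) a u t)" for A
    by (rule continuous_on_subset[OF J_cont_u[OF lin_J t]]) simp
  \<comment> \<open>If both arcs left the line, a level slightly below \<open>c\<close> would be
    crossed four times.\<close>
  have arc: "(\<forall>u\<in>{ul..ur}. lin a b u t = c) \<or> (\<forall>u\<in>{ur..ul + 2 * pi}. lin a b u t = c)"
  proof (rule ccontr)
    assume "\<not> ?thesis"
    then obtain u2 u4 where u2: "ul \<le> u2" "u2 \<le> ur" "lin a b u2 t \<noteq> c"
      and u4: "ur \<le> u4" "u4 \<le> ul + 2 * pi" "lin a b u4 t \<noteq> c" by auto
    define k where "k = (c + max (lin a b u2 t) (lin a b u4 t)) / 2"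
    have "max (lin a b u2 t) (lin a b u4 t) < c" using le[of u2] le[of u4] u2 u4 by auto
    then have k: "k < c" "max (lin a b u2 t) (lin a b u4 t) < k" by (simp_all add: k_def)
    have "ul < u2" "u2 < ur" "ur < u4" "u4 < ul + 2 * pi"
      using u2 u4 ul(1) ur(1) ul'(1) by (auto simp: order_le_less)
    then show False
      by (rule tame_no_alternation[OF tame_lin t]) (use k ul ur in auto)
  qed
  have "\<exists>u. lin a b u t = c \<and> lin (- b) a u t = d"
    using arc
  proof
    assume A: "\<forall>u\<in>{ul..ur}. lin a b u t = c"
    have "\<exists>u\<ge>ul. u \<le> ur \<and> lin (- b) a u t = d"
      by (rule IVT'[OF ul(2) ur(2) ur(3) cont])
    then show ?thesis using A by auto
  next
    assume A: "\<forall>u\<in>{ur..ul + 2 * pi}. lin a b u t = c"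
    have "\<exists>u\<ge>ur. u \<le> ul + 2 * pi \<and> lin (- b) a u t = d"
      by (rule IVT2'[OF ul'(2) ur(2) _ cont]) (use ur in simp)
    then show ?thesis using A by auto
  qed
  then obtain u where u: "lin a b u t = c" "lin (- b) a u t = d" by blast
  have "a * (x u t - fst m) + b * (y u t - snd m) = 0" "- b * (x u t - fst m) + a * (y u t - snd m) = 0"
    using u by (cases m, simp add: c_def d_def vab algebra_simps)+
  then have "(a\<^sup>2 + b\<^sup>2) * (x u t - fst m) = 0" "(a\<^sup>2 + b\<^sup>2) * (y u t - snd m) = 0"
    by algebra+
  moreover have "a\<^sup>2 + b\<^sup>2 \<noteq> 0" using v(1) vab by (auto simp: sum_power2_eq_zero_iff zero_prod_def)
  ultimately have "pt u t = m" by (auto simp: pt_def prod_eq_iff)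
  then show ?thesis by (rule that)
qed

section \<open>Continuity of the hull in time\<close>

lemma pt_uniform:
  assumes t: "t \<in> I" and e: "e > 0"
  obtains \<delta> where "\<delta> > 0" "\<And>s u. \<bar>s - t\<bar> < \<delta> \<Longrightarrow> s \<in> I \<and> dist (pt u s) (pt u t) < e"
proof -
  have e2: "e / 2 > 0" using e by simp
  obtain d1 where d1: "d1 > 0" "\<And>s u. \<bar>s - t\<bar> < d1 \<Longrightarrow> s \<in> I \<and> \<bar>x u s - x u t\<bar> < e / 2"
    by (rule J_uniform[OF x_J t e2]) (rule that)
  obtain d2 where d2: "d2 > 0" "\<And>s u. \<bar>s - t\<bar> < d2 \<Longrightarrow> s \<in> I \<and> \<bar>y u s - y u t\<bar> < e / 2"
    by (rule J_uniform[OF y_J t e2]) (rule that)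
  show ?thesis
  proof (rule that[of "min d1 d2"])
    fix s u assume s: "\<bar>s - t\<bar> < min d1 d2"
    have "dist (pt u s) (pt u t) \<le> dist (x u s) (x u t) + dist (y u s) (y u t)"
      by (simp add: pt_def dist_Pair_Pair sqrt_sum_squares_le_sum)
    also have "\<dots> < e / 2 + e / 2"
      using d1(2)[of s u] d2(2)[of s u] s by (intro add_strict_mono) (auto simp: dist_real_def)
    finally show "s \<in> I \<and> dist (pt u s) (pt u t) < e" using d1(2)[of s u] s by simp
  qed (use d1 d2 in simp)
qed

lemma lin_le_of_dist: "dist (pt u s) (pt u t) \<le> e \<Longrightarrow> lin a b u s \<le> lin a b u t + norm (a, b) * e"
proof -
  assume d: "dist (pt u s) (pt u t) \<le> e"
  have "lin a b u s - lin a b u t = (a, b) \<bullet> (pt u s - pt u t)" by (simp add: lin_pt inner_diff_right)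
  also have "\<dots> \<le> norm (a, b) * norm (pt u s - pt u t)" by (rule norm_cauchy_schwarz)
  also have "\<dots> \<le> norm (a, b) * e" using d by (intro mult_left_mono) (auto simp: dist_norm)
  finally show ?thesis by simp
qed

lemma not_K_open:
  assumes t: "t \<in> I" and m: "m \<notin> K t"
  obtains \<delta> where "\<delta> > 0" "\<And>s. \<bar>s - t\<bar> < \<delta> \<Longrightarrow> s \<in> I \<and> m \<notin> K s"
proof -
  obtain a b where ab: "\<And>u. lin a b u t < (a, b) \<bullet> m" using not_K[OF t m] by blast
  obtain u0 where u0: "\<And>v. lin a b v t \<le> lin a b u0 t" using lin_max[OF t] by blast
  define g where "g = (a, b) \<bullet> m - lin a b u0 t"
  have g: "g > 0" using ab[of u0] by (simp add: g_def)
  define N where "N = norm (a, b) + 1"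
  define e where "e = g / (2 * N)"
  have nn: "N > 0" by (simp add: N_def add_nonneg_pos)
  have e: "e > 0" using g nn by (simp add: e_def)
  have "N * e = g / 2" using nn by (simp add: e_def)
  then have "(norm (a, b) + 1) * e = g / 2" by (simp add: N_def)
  then have small: "norm (a, b) * e < g" using g e by (simp add: algebra_simps)
  obtain \<delta> where \<delta>: "\<delta> > 0" "\<And>s u. \<bar>s - t\<bar> < \<delta> \<Longrightarrow> s \<in> I \<and> dist (pt u s) (pt u t) < e"
    by (rule pt_uniform[OF t e]) (rule that)
  show ?thesis
  proof (rule that[OF \<delta>(1)])
    fix s assume s: "\<bar>s - t\<bar> < \<delta>"
    have "m \<notin> K s"
    proof
      assume "m \<in> K s"
      then have "(a, b) \<bullet> m \<le> lin a b u0 t + norm (a, b) * e"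
      proof (rule K_le)
        fix u
        have "lin a b u s \<le> lin a b u t + norm (a, b) * e"
          by (rule lin_le_of_dist) (use \<delta>(2)[OF s, of u] in simp)
        then show "lin a b u s \<le> lin a b u0 t + norm (a, b) * e" using u0[of u] by simp
      qed
      then show False using small by (simp add: g_def)
    qed
    then show "s \<in> I \<and> m \<notin> K s" using \<delta>(2)[OF s] by blast
  qed
qed

lemma interior_K_open:
  assumes t: "t \<in> I" and m: "m \<in> interior (K t)"
  obtains \<delta> where "\<delta> > 0" "\<And>s. \<bar>s - t\<bar> < \<delta> \<Longrightarrow> s \<in> I \<and> m \<in> K s"
proof -
  obtain e where e: "e > 0" "cball m e \<subseteq> K t" using m by (auto simp: mem_interior_cball)
  obtain \<delta> where \<delta>: "\<delta> > 0" "\<And>s u. \<bar>s - t\<bar> < \<delta> \<Longrightarrow> s \<in> I \<and> dist (pt u s) (pt u t) < e"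
    by (rule pt_uniform[OF t e(1)]) (rule that)
  show ?thesis
  proof (rule that[OF \<delta>(1)])
    fix s assume s: "\<bar>s - t\<bar> < \<delta>"
    then have sI: "s \<in> I" using \<delta>(2) by blast
    have "m \<in> K s"
    proof (rule ccontr)
      assume "m \<notin> K s"
      then obtain a b where ab: "\<And>u. lin a b u s < (a, b) \<bullet> m" using not_K[OF sI] by blast
      obtain u0 where u0: "\<And>v. lin a b v t \<le> lin a b u0 t" using lin_max[OF t] by blast
      define w where "w = (a, b)"
      have w: "norm w > 0"
      proof -
        have "w \<noteq> 0" using ab[of 0] by (cases m) (auto simp: w_def zero_prod_def)
        then show ?thesis by simp
      qed
      have "m + (e / norm w) *\<^sub>R w \<in> cball m e" using w e by (simp add: dist_norm)
      then have "w \<bullet> (m + (e / norm w) *\<^sub>R w) \<le> lin a b u0 t"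
        unfolding w_def by (intro K_le[OF _ u0]) (use e w_def in blast)
      then have "w \<bullet> m + norm w * e \<le> lin a b u0 t"
        using w by (simp add: inner_add_right power2_norm_eq_inner[symmetric] power2_eq_square mult.commute)
      moreover have "lin a b u0 t \<le> lin a b u0 s + norm w * e"
        unfolding w_def by (rule lin_le_of_dist) (use \<delta>(2)[OF s, of u0] in \<open>simp add: dist_commute\<close>)
      ultimately show False using ab[of u0] by (simp add: w_def)
    qed
    then show "s \<in> I \<and> m \<in> K s" using sI by simp
  qed
qed

text \<open>A point that the curve never meets is interior to the hull or outside it at each time;
  both cases are open in time, and the time interval is connected.\<close>

lemma stays_inside:
  assumes t: "0 < t0" "t0 \<le> t1" "t1 < T" and m: "m \<in> K t0"
    and off: "\<And>u t. t \<in> {t0..t1} \<Longrightarrow> pt u t \<noteq> m"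
  shows "m \<in> interior (K t1)"
proof -
  define U where "U = interior {s. m \<in> K s}"
  define V where "V = interior {s. m \<notin> K s}"
  have int: "m \<in> interior (K s)" if h: "s \<in> {t0..t1}" "m \<in> K s" for s
  proof (rule ccontr)
    assume n: "m \<notin> interior (K s)"
    have sI: "s \<in> I" using h(1) t by auto
    obtain u where "pt u s = m" by (rule frontier_K_curve[OF sI h(2) n])
    then show False using off[OF h(1)] by blast
  qed
  have UV: "s \<in> U \<or> s \<in> V" if s: "s \<in> {t0..t1}" for s
  proof (cases "m \<in> K s")
    case True
    obtain \<delta> where \<delta>: "\<delta> > 0" "\<And>r. \<bar>r - s\<bar> < \<delta> \<Longrightarrow> r \<in> I \<and> m \<in> K r"
      by (rule interior_K_open[OF _ int[OF s True]]) (use s t in auto)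
    then have "ball s \<delta> \<subseteq> {s. m \<in> K s}" by (auto simp: dist_real_def abs_minus_commute)
    then show ?thesis using \<delta>(1) by (auto simp: U_def mem_interior)
  next
    case False
    obtain \<delta> where \<delta>: "\<delta> > 0" "\<And>r. \<bar>r - s\<bar> < \<delta> \<Longrightarrow> r \<in> I \<and> m \<notin> K r"
      by (rule not_K_open[OF _ False]) (use s t in auto)
    then have "ball s \<delta> \<subseteq> {s. m \<notin> K s}" by (auto simp: dist_real_def abs_minus_commute)
    then show ?thesis using \<delta>(1) by (auto simp: V_def mem_interior)
  qed
  have dis: "U \<inter> V = {}" unfolding U_def V_def using interior_subset by blast
  have "U \<inter> {t0..t1} = {} \<or> V \<inter> {t0..t1} = {}"
  proof (rule connectedD[OF connected_Icc])
    show "open U" "open V" by (simp_all add: U_def V_def)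
    show "U \<inter> V \<inter> {t0..t1} = {}" using dis by simp
    show "{t0..t1} \<subseteq> U \<union> V" using UV by blast
  qed
  moreover have "t0 \<in> U" using UV[of t0] m t interior_subset by (auto simp: V_def)
  ultimately have "V \<inter> {t0..t1} = {}" using t by auto
  then have "t1 \<in> U" using UV[of t1] t by auto
  then have "m \<in> K t1" using interior_subset by (auto simp: U_def)
  then show ?thesis using int[of t1] t by simp
qed

end

section \<open>Barriers\<close>

context csf_flow
begin

lemma J_cosh: "f \<in> J \<Longrightarrow> (\<lambda>u t. cosh (f u t)) \<in> J" and J_sinh: "f \<in> J \<Longrightarrow> (\<lambda>u t. sinh (f u t)) \<in> J"
proof -
  assume f: "f \<in> J"
  have "(\<lambda>u t. 1 / 2 * (exp (f u t) + exp (- f u t))) \<in> J" "(\<lambda>u t. 1 / 2 * (exp (f u t) - exp (- f u t))) \<in> J"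
    by (intro jets_mult jets_const jets_add J_diff J_exp J_minus f)+
  then show "(\<lambda>u t. cosh (f u t)) \<in> J" "(\<lambda>u t. sinh (f u t)) \<in> J"
    by (simp_all add: cosh_def sinh_def)
qed

lemma S_time: "S (\<lambda>u t. h t) = (\<lambda>u t. 0)"
  by (simp add: S_def du_time)

lemma S_exp: "f \<in> J \<Longrightarrow> S (\<lambda>u t. exp (f u t)) = (\<lambda>u t. exp (f u t) * S f u t)"
  by (rule S_comp) (auto intro: DERIV_exp)

lemma S_cos: "f \<in> J \<Longrightarrow> S (\<lambda>u t. cos (f u t)) = (\<lambda>u t. - sin (f u t) * S f u t)"
  by (rule S_comp) (auto intro: DERIV_cos)

lemma S_sin: "f \<in> J \<Longrightarrow> S (\<lambda>u t. sin (f u t)) = (\<lambda>u t. cos (f u t) * S f u t)"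
  by (rule S_comp) (auto intro: DERIV_sin)

lemma S_cosh: "f \<in> J \<Longrightarrow> S (\<lambda>u t. cosh (f u t)) = (\<lambda>u t. sinh (f u t) * S f u t)"
  by (rule S_comp) (auto intro!: derivative_eq_intros)

lemma S_sinh: "f \<in> J \<Longrightarrow> S (\<lambda>u t. sinh (f u t)) = (\<lambda>u t. cosh (f u t) * S f u t)"
  by (rule S_comp) (auto intro!: derivative_eq_intros)

lemma Dt_exp: "f \<in> J \<Longrightarrow> Dt (\<lambda>u t. exp (f u t)) = (\<lambda>u t. exp (f u t) * Dt f u t)"
  by (rule dt_comp) (auto intro: DERIV_exp)

lemma Dt_cos: "f \<in> J \<Longrightarrow> Dt (\<lambda>u t. cos (f u t)) = (\<lambda>u t. - sin (f u t) * Dt f u t)"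
  by (rule dt_comp) (auto intro: DERIV_cos)

lemma Dt_cosh: "f \<in> J \<Longrightarrow> Dt (\<lambda>u t. cosh (f u t)) = (\<lambda>u t. sinh (f u t) * Dt f u t)"
  by (rule dt_comp) (auto intro!: derivative_eq_intros)

lemma SS_exp: "f \<in> J \<Longrightarrow> S (S (\<lambda>u t. exp (f u t))) = (\<lambda>u t. exp (f u t) * (S (S f) u t + (S f u t)\<^sup>2))"
  by (simp add: S_exp S_mult J_exp power2_eq_square algebra_simps)

lemma SS_cos: "f \<in> J \<Longrightarrow> S (S (\<lambda>u t. cos (f u t))) = (\<lambda>u t. - sin (f u t) * S (S f) u t - cos (f u t) * (S f u t)\<^sup>2)"
  using J_sin[of f] by (simp add: S_cos S_mult S_minus S_sin power2_eq_square algebra_simps)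

lemma SS_cosh: "f \<in> J \<Longrightarrow> S (S (\<lambda>u t. cosh (f u t))) = (\<lambda>u t. sinh (f u t) * S (S f) u t + cosh (f u t) * (S f u t)\<^sup>2)"
  using J_sinh[of f] by (simp add: S_cosh S_mult S_sinh power2_eq_square algebra_simps)

end

context planar_flow
begin

lemma r2_le: "t \<in> I \<Longrightarrow> r2 u t \<le> 1"
  using proj_le by (simp add: r2_def)

lemma Sx_le: "t \<in> I \<Longrightarrow> (S x u t)\<^sup>2 \<le> 1"
  using proj_le[of t u] zero_le_power2[of "S y u t"] by linarith

text \<open>The time derivative of the squared distance minus its second arclength derivative is
  \<open>- 2 * r2\<close>, which is at least -2.\<close>

lemma pt_distance_decay:
  assumes t: "0 < t0" "t1 < T" and init: "\<And>u. dist (pt u t0) p \<ge> \<rho>" "\<rho> \<ge> 0" and tt: "t \<in> {t0..t1}"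
  shows "(dist (pt u t) p)\<^sup>2 \<ge> \<rho>\<^sup>2 - 2 * (t - t0)"
proof -
  obtain a b where p: "p = (a, b)" by (cases p)
  have d2: "(dist (pt u t) p)\<^sup>2 = (x u t - a)\<^sup>2 + (y u t - b)\<^sup>2" for u t
    by (simp add: pt_def p dist_Pair_Pair dist_real_def)
  define G where "G = (\<lambda>u t. (x u t - a)\<^sup>2 + (y u t - b)\<^sup>2)"
  define h where "h = (\<lambda>t. \<rho>\<^sup>2 - 2 * (t - t0))"
  define F where "F = (\<lambda>u t. h t - G u t)"
  have GJ: "G \<in> J" unfolding G_def by simp
  have hJ: "(\<lambda>u t. h t) \<in> J" unfolding h_def using time_J by simp
  have FJ: "F \<in> J" unfolding F_def using GJ hJ by simp
  have SSG: "S (S G) = (\<lambda>u t. 2 * r2 u t + 2 * (x u t - a) * S (S x) u t + 2 * (y u t - b) * S (S y) u t)"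
    unfolding G_def r2_def by (simp add: S_simps fun_eq_iff power2_eq_square algebra_simps)
  have DG: "Dt G = (\<lambda>u t. 2 * (x u t - a) * S (S x) u t + 2 * (y u t - b) * S (S y) u t)"
    unfolding G_def by (simp add: Dt_simps Dt_x Dt_y fun_eq_iff)
  have SSF: "S (S F) = (\<lambda>u t. - S (S G) u t)"
    unfolding F_def using GJ hJ by (simp add: S_diff S_time S_minus)
  have DF: "Dt F u t = - 2 - Dt G u t" if "t \<in> I" for u t
  proof -
    have "Dt (\<lambda>u t. h t) u t = - 2"
      by (rule dt_time[OF _ that]) (auto simp: h_def intro!: derivative_eq_intros)
    then show ?thesis unfolding F_def using GJ hJ by (simp add: Dt_diff)
  qed
  have "F u t \<le> 0"
  proof (rule global_max_principle[OF FJ t])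
    fix u show "F u t0 \<le> 0"
      using power_mono[OF init(1)[of u] init(2), of 2] by (simp add: F_def G_def h_def d2)
  next
    fix u t assume a: "t0 < t" "t \<le> t1" "S (S F) u t \<le> 0" "0 < Dt F u t"
    have tI: "t \<in> I" using a t by auto
    show False using a(3,4) r2_le[OF tI, of u] unfolding SSF SSG DF[OF tI] DG by simp
  qed (use tt in auto)
  then show ?thesis by (simp add: F_def G_def h_def d2)
qed

text \<open>Companion of \<open>pt_distance_decay\<close> with \<open>\<rho> \<le> r2\<close>; it
  later bounds the remaining lifetime by the squared diameter.\<close>

lemma pt_distance_shrink:
  assumes t: "0 < t0" "t1 < T" and init: "\<And>u. dist (pt u t0) p \<le> R"
    and r: "\<And>u t. t \<in> {t0..t1} \<Longrightarrow> \<rho> \<le> r2 u t" and tt: "t \<in> {t0..t1}"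
  shows "(dist (pt u t) p)\<^sup>2 \<le> R\<^sup>2 - 2 * \<rho> * (t - t0)"
proof -
  obtain a b where p: "p = (a, b)" by (cases p)
  have d2: "(dist (pt u t) p)\<^sup>2 = (x u t - a)\<^sup>2 + (y u t - b)\<^sup>2" for u t
    by (simp add: pt_def p dist_Pair_Pair dist_real_def)
  define G where "G = (\<lambda>u t. (x u t - a)\<^sup>2 + (y u t - b)\<^sup>2)"
  define h where "h = (\<lambda>t. R\<^sup>2 - 2 * \<rho> * (t - t0))"
  define F where "F = (\<lambda>u t. G u t - h t)"
  have GJ: "G \<in> J" unfolding G_def by simp
  have hJ: "(\<lambda>u t. h t) \<in> J" unfolding h_def using time_J by simp
  have FJ: "F \<in> J" unfolding F_def using GJ hJ by simp
  have SSG: "S (S G) = (\<lambda>u t. 2 * r2 u t + 2 * (x u t - a) * S (S x) u t + 2 * (y u t - b) * S (S y) u t)"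
    unfolding G_def r2_def by (simp add: S_simps fun_eq_iff power2_eq_square algebra_simps)
  have DG: "Dt G = (\<lambda>u t. 2 * (x u t - a) * S (S x) u t + 2 * (y u t - b) * S (S y) u t)"
    unfolding G_def by (simp add: Dt_simps Dt_x Dt_y fun_eq_iff)
  have SSF: "S (S F) = S (S G)"
    unfolding F_def using GJ hJ by (simp add: S_diff S_time)
  have DF: "Dt F u t = Dt G u t + 2 * \<rho>" if "t \<in> I" for u t
  proof -
    have "Dt (\<lambda>u t. h t) u t = - (2 * \<rho>)"
      by (rule dt_time[OF _ that]) (auto simp: h_def intro!: derivative_eq_intros)
    then show ?thesis unfolding F_def using GJ hJ by (simp add: Dt_diff)
  qed
  have "F u t \<le> 0"
  proof (rule global_max_principle[OF FJ t])
    fix u show "F u t0 \<le> 0"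
      using power_mono[OF init[of u] zero_le_dist, of 2] by (simp add: F_def G_def h_def d2)
  next
    fix u t assume a: "t0 < t" "t \<le> t1" "S (S F) u t \<le> 0" "0 < Dt F u t"
    have tI: "t \<in> I" using a t by auto
    show False using a r[of t u] unfolding SSF SSG DF[OF tI] DG by simp
  qed (use tt in auto)
  then show ?thesis by (simp add: F_def G_def h_def d2)
qed

text \<open>A grim reaper enclosing a curve in a strip of half-width \<open>h\<close> forces its tip to recede at
  speed proportional to \<open>1 / h\<close>.\<close>

lemma tip_recession:
  assumes t: "0 < t0" "t1 < T" and h: "h > 0" and k: "k \<in> {1, -1 :: real}"
    and strip: "\<And>u. \<bar>y u t0 - b\<bar> \<le> h" and tip: "\<And>u. k * x u t0 \<le> d"
    and r: "\<And>u t. t \<in> {t0..t1} \<Longrightarrow> \<rho> \<le> r2 u t" and tt: "t \<in> {t0..t1}"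
  shows "k * x u t \<le> d + h - \<rho> * (t - t0) / h"
proof -
  have cal: "caloric (\<lambda>u t. y u t - b)" "caloric (\<lambda>u t. - (y u t - b))"
    by (intro caloric_intros caloric_y)+
  have strip_t: "\<bar>y u t - b\<bar> \<le> h" if "t \<in> {t0..t1}" for u t
    using caloric_max_decreasing[OF cal(1) t(1), of t h u] caloric_max_decreasing[OF cal(2) t(1), of t h u]
      strip that t by (auto simp: abs_le_iff)
  define \<kappa> where "\<kappa> = k / h"
  define \<eta> where "\<eta> = 1 / h"
  define f where "f = (\<lambda>u t. \<kappa> * x u t)"
  define g where "g = (\<lambda>u t. \<eta> * (y u t - b))"
  have fJ: "f \<in> J" and gJ: "g \<in> J" by (simp_all add: f_def g_def)
  have k2: "k\<^sup>2 = 1" using k by auto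
  have Sf: "S f = (\<lambda>u t. \<kappa> * S x u t)" "S (S f) = (\<lambda>u t. \<kappa> * S (S x) u t)"
    and Df: "Dt f = S (S f)"
    by (simp_all add: f_def S_cmult Dt_cmult Dt_x)
  have Sg: "S g = (\<lambda>u t. \<eta> * S y u t)" "S (S g) = (\<lambda>u t. \<eta> * S (S y) u t)"
    and Dg: "Dt g = S (S g)"
    by (simp_all add: g_def S_cmult S_diff S_const Dt_cmult Dt_diff dt_const Dt_y)
  \<comment> \<open>\<open>exp f = L * cos g\<close> is the grim reaper. The strip is scaled to
    half-width 1, less than \<open>pi / 2\<close>, so the cosine stays above \<open>cos 1\<close>;
    the factor \<open>1 / cos 1\<close> lets the reaper enclose the initial curve and is at most
    \<open>exp 1\<close>, which costs the summand \<open>h\<close> in the claim. Its rate carries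
    the factor \<open>\<rho>\<close> because the curve may move as slowly as that.\<close>
  define L where "L = (\<lambda>t. exp (d / h) / cos 1 * exp (- (\<rho> / h\<^sup>2 * (t - t0))))"
  have cos1: "cos 1 \<ge> (1 / 2 :: real)"
  proof -
    have "cos (pi / 3) \<le> cos (1 :: real)"
      by (rule cos_monotone_0_pi_le) (use pi_gt3 in auto)
    then show ?thesis by (simp add: cos_60)
  qed
  have Lpos: "L t > 0" for t using cos1 by (simp add: L_def)
  have LJ: "(\<lambda>u t. L t) \<in> J"
    unfolding L_def using time_J by (intro jets_mult jets_const J_exp J_minus J_diff)
  have DL: "Dt (\<lambda>u t. L t) u t = - (\<rho> / h\<^sup>2) * L t" if "t \<in> I" for u t
  proof -
    define \<mu> where "\<mu> = \<rho> / h\<^sup>2"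
    define c0 where "c0 = exp (d / h) / cos 1"
    have L: "L = (\<lambda>t. c0 * exp (- (\<mu> * (t - t0))))" by (simp add: L_def c0_def \<mu>_def)
    have "(L has_real_derivative - \<mu> * L t) (at t)"
      unfolding L by (auto intro!: derivative_eq_intros)
    then show ?thesis unfolding \<mu>_def by (rule dt_time[OF _ that])
  qed
  define F where "F = (\<lambda>u t. exp (f u t) - L t * cos (g u t))"
  have FJ: "F \<in> J" unfolding F_def by (intro J_diff jets_mult LJ J_exp J_cos fJ gJ)
  have cJ: "(\<lambda>u t. cos (g u t)) \<in> J" and eJ: "(\<lambda>u t. exp (f u t)) \<in> J" by (intro J_cos J_exp fJ gJ)+
  have SL: "S (\<lambda>u t. L t * G u t) = (\<lambda>u t. L t * S G u t)" if "G \<in> J" for G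
    using S_mult[OF LJ that] S_time[of L] by simp
  have SSF: "S (S F) u t = exp (f u t) * (S (S f) u t + (S f u t)\<^sup>2)
      - L t * (- sin (g u t) * S (S g) u t - cos (g u t) * (S g u t)\<^sup>2)" for u t
  proof -
    have "S F = (\<lambda>u t. S (\<lambda>u t. exp (f u t)) u t - L t * S (\<lambda>u t. cos (g u t)) u t)"
      unfolding F_def using S_diff[OF eJ jets_mult[OF LJ cJ]] SL[OF cJ] by simp
    moreover have "S \<dots> = (\<lambda>u t. S (S (\<lambda>u t. exp (f u t))) u t - L t * S (S (\<lambda>u t. cos (g u t))) u t)"
      using S_diff[OF S_J[OF eJ] jets_mult[OF LJ S_J[OF cJ]]] SL[OF S_J[OF cJ]] by simp
    ultimately show ?thesis by (simp add: SS_exp SS_cos fJ gJ)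
  qed
  have DF: "Dt F u t = exp (f u t) * S (S f) u t + \<rho> / h\<^sup>2 * L t * cos (g u t) + L t * sin (g u t) * S (S g) u t"
    if tI: "t \<in> I" for u t
    unfolding F_def using Dt_diff[OF eJ jets_mult[OF LJ cJ]] dt_mult[OF LJ cJ] DL[OF tI]
    by (simp add: Dt_exp Dt_cos fJ gJ Df Dg)
  have cosg: "cos (g u t) \<ge> cos 1" if "t \<in> {t0..t1}" for u t
  proof -
    have "\<bar>g u t\<bar> \<le> 1" using strip_t[OF that, of u] h by (simp add: g_def \<eta>_def abs_mult)
    then have "cos 1 \<le> cos \<bar>g u t\<bar>" by (intro cos_monotone_0_pi_le) (use pi_gt3 in auto)
    then show ?thesis by simp
  qed
  have "F u t \<le> 0"
  proof (rule global_max_principle[OF FJ t])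
    fix u
    show "F u t0 \<le> 0"
    proof (cases "t0 \<le> t1")
      case True
      have "exp (f u t0) \<le> exp (d / h)" using tip[of u] h by (simp add: f_def \<kappa>_def divide_right_mono)
      also have "\<dots> = L t0 * cos 1" using cos1 by (simp add: L_def)
      also have "\<dots> \<le> L t0 * cos (g u t0)"
        using cosg[of t0 u] True Lpos[of t0] by (intro mult_left_mono) auto
      finally show ?thesis by (simp add: F_def)
    qed (use tt in auto)
  next
    fix u t assume a: "t0 < t" "t \<le> t1" "0 < F u t" "S (S F) u t \<le> 0" "0 < Dt F u t"
    have tI: "t \<in> I" and t': "t \<in> {t0..t1}" using a t by auto
    have cg: "cos (g u t) > 0" using cosg[OF t', of u] cos1 by linarith
    have e: "L t * cos (g u t) * (S f u t)\<^sup>2 \<le> exp (f u t) * (S f u t)\<^sup>2"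
      using a(3) by (intro mult_right_mono) (auto simp: F_def)
    have sum: "(S f u t)\<^sup>2 + (S g u t)\<^sup>2 = r2 u t / h\<^sup>2"
      unfolding Sf Sg r2_def \<kappa>_def \<eta>_def using k2 by (simp add: power_mult_distrib power_divide add_divide_distrib)
    have "exp (f u t) * (S f u t)\<^sup>2 + L t * cos (g u t) * (S g u t)\<^sup>2 < \<rho> / h\<^sup>2 * L t * cos (g u t)"
      using a(4,5) unfolding SSF DF[OF tI] by (simp add: algebra_simps)
    then have "L t * cos (g u t) * ((S f u t)\<^sup>2 + (S g u t)\<^sup>2) < L t * cos (g u t) * (\<rho> / h\<^sup>2)"
      using e by (simp add: algebra_simps)
    then have "r2 u t / h\<^sup>2 < \<rho> / h\<^sup>2"
      unfolding sum by (rule mult_less_cancel_left_pos[OF mult_pos_pos[OF Lpos cg], THEN iffD1])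
    then show False using r[OF t', of u] h by (simp add: divide_less_cancel)
  qed (use tt in auto)
  then have "exp (f u t) \<le> L t * cos (g u t)" by (simp add: F_def)
  also have "\<dots> \<le> L t * 1" using Lpos[of t] by (intro mult_left_mono) auto
  also have "\<dots> \<le> exp (d / h + 1 - \<rho> / h\<^sup>2 * (t - t0))"
  proof -
    have "1 / cos 1 \<le> exp (1::real)"
    proof -
      have "1 / cos 1 \<le> (2::real)" using cos1 by (simp add: field_simps)
      also have "\<dots> \<le> exp 1" using exp_ge_add_one_self[of 1] by simp
      finally show ?thesis .
    qed
    then have "exp (d / h) * (1 / cos 1) * exp (- (\<rho> / h\<^sup>2 * (t - t0)))
        \<le> exp (d / h) * exp 1 * exp (- (\<rho> / h\<^sup>2 * (t - t0)))"
      by (intro mult_right_mono mult_left_mono) auto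
    also have "\<dots> = exp (d / h + 1 - \<rho> / h\<^sup>2 * (t - t0))"
      by (simp only: exp_add[symmetric]) (simp add: algebra_simps)
    finally show ?thesis by (simp add: L_def)
  qed
  finally have "f u t \<le> d / h + 1 - \<rho> / h\<^sup>2 * (t - t0)" by simp
  then have "h * f u t \<le> h * (d / h + 1 - \<rho> / h\<^sup>2 * (t - t0))" using h by (intro mult_left_mono) auto
  then show ?thesis using h by (simp add: f_def \<kappa>_def power2_eq_square distrib_left right_diff_distrib diff_divide_distrib)
qed

text \<open>An inscribed Angenent oval, shrunk at twice its own speed, is an inner barrier; hence long thin
  regions do not disappear too fast.\<close>

lemma inscribed_oval:
  assumes t: "0 < t0" "t0 \<le> t1" "t1 < T" and nd: "nondegenerate t0"
    and k: "k > 0" and rect: "\<And>a b. \<bar>a - x0\<bar> \<le> l \<Longrightarrow> \<bar>b - y0\<bar> \<le> k \<Longrightarrow> (a, b) \<in> K t0"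
    and c: "c = pi / (2 * k)" and small: "cosh (c * \<xi>) * exp (2 * c\<^sup>2 * (t1 - t0)) < cosh (c * l)" and l: "l > 0"
  shows "(x0 + \<xi>, y0) \<in> K t1"
proof -
  have cpos: "c > 0" using k c by simp
  define E where "E = cosh (c * \<xi>) * exp (2 * c\<^sup>2 * (t1 - t0))"
  define C where "C = cosh (c * l)"
  \<comment> \<open>A value between \<open>1 / C\<close> and \<open>1 / E\<close>: above
    \<open>1 / C\<close> the oval starts with half-length less than \<open>l\<close>, below
    \<open>1 / E\<close> it still contains the point at \<open>\<xi>\<close> at time
    \<open>t1\<close>.\<close>
  define \<Lambda>0 where "\<Lambda>0 = 2 / (C + E)"
  have E: "E > 0" "E < C" using small by (simp_all add: E_def C_def)
  have L0: "\<Lambda>0 > 0" "\<Lambda>0 * C > 1" "\<Lambda>0 * E < 1" using E by (simp_all add: \<Lambda>0_def field_simps)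
  define f where "f = (\<lambda>u t. c * (x u t - x0))"
  define g where "g = (\<lambda>u t. c * (y u t - y0))"
  have fJ: "f \<in> J" and gJ: "g \<in> J" by (simp_all add: f_def g_def)
  have Sf: "S f = (\<lambda>u t. c * S x u t)" "S (S f) = (\<lambda>u t. c * S (S x) u t)" and Df: "Dt f = S (S f)"
    by (simp_all add: f_def S_cmult S_diff S_const Dt_cmult Dt_diff dt_const Dt_x)
  have Sg: "S g = (\<lambda>u t. c * S y u t)" "S (S g) = (\<lambda>u t. c * S (S y) u t)" and Dg: "Dt g = S (S g)"
    by (simp_all add: g_def S_cmult S_diff S_const Dt_cmult Dt_diff dt_const Dt_y)
  \<comment> \<open>An Angenent oval has the rate \<open>c\<^sup>2\<close>; doubling it leaves
    strict room because \<open>r2 \<le> 1 < 2\<close>.\<close>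
  define L where "L = (\<lambda>t. \<Lambda>0 * exp (2 * c\<^sup>2 * (t - t0)))"
  have Lpos: "L t > 0" for t using L0 by (simp add: L_def)
  have LJ: "(\<lambda>u t. L t) \<in> J"
    unfolding L_def using time_J by (intro jets_mult jets_const J_exp J_diff)
  have DL: "Dt (\<lambda>u t. L t) u t = 2 * c\<^sup>2 * L t" if "t \<in> I" for u t
    by (rule dt_time[OF _ that]) (auto simp: L_def intro!: derivative_eq_intros)
  define F where "F = (\<lambda>u t. cos (g u t) - L t * cosh (f u t))"
  \<comment> \<open>The comparison is confined to the strip where the cosine is nonnegative; on its
    edge the cosine vanishes and \<open>F\<close> is negative.\<close>
  define G where "G = (\<lambda>u t. (pi / 2)\<^sup>2 - (g u t)\<^sup>2)"
  have cJ: "(\<lambda>u t. cos (g u t)) \<in> J" and hJ: "(\<lambda>u t. cosh (f u t)) \<in> J" by (intro J_cos J_cosh fJ gJ)+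
  have FJ: "F \<in> J" unfolding F_def by (intro J_diff jets_mult LJ cJ hJ)
  have GJ: "G \<in> J" unfolding G_def using gJ by simp
  have SL: "S (\<lambda>u t. L t * H u t) = (\<lambda>u t. L t * S H u t)" if "H \<in> J" for H
    using S_mult[OF LJ that] S_time[of L] by simp
  have SSF: "S (S F) u t = - sin (g u t) * S (S g) u t - cos (g u t) * (S g u t)\<^sup>2
      - L t * (sinh (f u t) * S (S f) u t + cosh (f u t) * (S f u t)\<^sup>2)" for u t
  proof -
    have "S F = (\<lambda>u t. S (\<lambda>u t. cos (g u t)) u t - L t * S (\<lambda>u t. cosh (f u t)) u t)"
      unfolding F_def using S_diff[OF cJ jets_mult[OF LJ hJ]] SL[OF hJ] by simp
    moreover have "S \<dots> = (\<lambda>u t. S (S (\<lambda>u t. cos (g u t))) u t - L t * S (S (\<lambda>u t. cosh (f u t))) u t)"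
      using S_diff[OF S_J[OF cJ] jets_mult[OF LJ S_J[OF hJ]]] SL[OF S_J[OF hJ]] by simp
    ultimately show ?thesis by (simp add: SS_cosh SS_cos fJ gJ)
  qed
  have DF: "Dt F u t = - sin (g u t) * S (S g) u t - 2 * c\<^sup>2 * L t * cosh (f u t) - L t * sinh (f u t) * S (S f) u t"
    if tI: "t \<in> I" for u t
    unfolding F_def using Dt_diff[OF cJ jets_mult[OF LJ hJ]] dt_mult[OF LJ hJ] DL[OF tI]
    by (simp add: Dt_cosh Dt_cos fJ gJ Df Dg)
  have gabs: "G u t \<ge> 0 \<longleftrightarrow> \<bar>g u t\<bar> \<le> pi / 2" for u t
    unfolding G_def using abs_le_square_iff[of "g u t" "pi / 2"] by simp
  have neg: "F u t < 0" if tt: "t \<in> {t0..t1}" and G: "G u t \<ge> 0" for u t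
  proof (rule max_principle_strict[OF FJ GJ t(1,3) _ _ _ tt G])
    fix u assume G0: "G u t0 \<ge> 0"
    show "F u t0 < 0"
    proof (rule ccontr)
      assume "\<not> F u t0 < 0"
      then have ge: "cos (g u t0) \<ge> \<Lambda>0 * cosh (f u t0)" by (simp add: F_def L_def)
      have "\<Lambda>0 * cosh (f u t0) > 0" using L0 by simp
      then have "cos (g u t0) \<noteq> 0" using ge by linarith
      moreover have "\<bar>g u t0\<bar> \<le> pi / 2" using G0 by (simp add: gabs)
      moreover have "cos \<bar>g u t0\<bar> = cos (g u t0)" by simp
      ultimately have "\<bar>g u t0\<bar> < pi / 2" by (metis cos_pi_half order_le_less)
      then have "c * \<bar>y u t0 - y0\<bar> < pi / 2" using cpos by (simp add: g_def abs_mult)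
      also have "pi / 2 = c * k" using k c by simp
      finally have b: "\<bar>y u t0 - y0\<bar> < k" by (rule mult_less_cancel_left_pos[OF cpos, THEN iffD1])
      have "\<Lambda>0 * cosh (f u t0) \<le> 1" using ge cos_le_one[of "g u t0"] by linarith
      then have "\<Lambda>0 * cosh (f u t0) < \<Lambda>0 * C" using L0 by linarith
      then have "cosh \<bar>f u t0\<bar> < cosh (c * l)" using L0 by (simp add: C_def)
      then have "\<bar>f u t0\<bar> < c * l"
        using cosh_real_nonneg_le_iff[of "c * l" "\<bar>f u t0\<bar>"] cpos l by (simp add: not_le[symmetric])
      then have a: "\<bar>x u t0 - x0\<bar> < l" using cpos by (simp add: f_def abs_mult)
      have "open ({x0 - l<..<x0 + l} \<times> {y0 - k<..<y0 + k})" by (intro open_Times) auto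
      moreover have "{x0 - l<..<x0 + l} \<times> {y0 - k<..<y0 + k} \<subseteq> K t0" using rect by auto
      moreover have "pt u t0 \<in> {x0 - l<..<x0 + l} \<times> {y0 - k<..<y0 + k}" using a b by (auto simp: pt_def)
      ultimately have "pt u t0 \<in> interior (K t0)" by (meson interiorI)
      moreover have "t0 \<in> I" using t by auto
      ultimately show False using curve_not_interior nd by blast
    qed
  next
    fix u t assume "t \<in> {t0..t1}" "G u t = 0"
    then have "(g u t)\<^sup>2 = (pi / 2)\<^sup>2" by (simp add: G_def)
    then have "g u t = pi / 2 \<or> g u t = - (pi / 2)" by (simp add: power2_eq_iff)
    then have "cos (g u t) = 0" by (elim disjE) (simp_all only: cos_minus cos_pi_half)
    then show "F u t < 0" using Lpos[of t] by (simp add: F_def)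
  next
    fix u t assume a: "t0 < t" "t \<le> t1" "F u t = 0" "S (S F) u t \<le> 0" "Dt F u t \<ge> 0"
    have tI: "t \<in> I" using a t by auto
    have e: "cos (g u t) = L t * cosh (f u t)" using a(3) by (simp add: F_def)
    define P where "P = L t * cosh (f u t)"
    have P: "P > 0" using Lpos[of t] by (simp add: P_def)
    have "(S f u t)\<^sup>2 + (S g u t)\<^sup>2 = c\<^sup>2 * r2 u t"
      unfolding Sf Sg r2_def by (simp add: power_mult_distrib distrib_left)
    moreover have "0 \<le> Dt F u t - S (S F) u t" using a by linarith
    then have "0 \<le> P * ((S f u t)\<^sup>2 + (S g u t)\<^sup>2 - 2 * c\<^sup>2)"
      unfolding SSF DF[OF tI] e P_def by (simp add: algebra_simps)
    ultimately have "0 \<le> c\<^sup>2 * r2 u t - 2 * c\<^sup>2" using P by (simp add: zero_le_mult_iff)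
    then have "0 \<le> c\<^sup>2 * (r2 u t - 2)" by (simp add: algebra_simps)
    moreover have "c\<^sup>2 > 0" using cpos by simp
    ultimately show False using r2_le[OF tI, of u] by (simp add: zero_le_mult_iff)
  qed
  have L1: "L t * cosh (c * \<xi>) < 1" if "t \<in> {t0..t1}" for t
  proof -
    have "exp (2 * c\<^sup>2 * (t - t0)) \<le> exp (2 * c\<^sup>2 * (t1 - t0))" using that by (simp add: mult_left_mono)
    then have "\<Lambda>0 * (cosh (c * \<xi>) * exp (2 * c\<^sup>2 * (t - t0))) \<le> \<Lambda>0 * E"
      unfolding E_def using L0 by (intro mult_left_mono) auto
    then show ?thesis using L0(3) by (simp add: L_def algebra_simps)
  qed
  have "(x0 + \<xi>, y0) \<in> interior (K t1)"
  proof (rule stays_inside[OF t])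
    have "cosh (c * \<xi>) * 1 \<le> cosh (c * \<xi>) * exp (2 * c\<^sup>2 * (t1 - t0))"
      using t by (intro mult_left_mono) auto
    from le_less_trans[OF this small] have "cosh \<bar>c * \<xi>\<bar> < cosh (c * l)" by simp
    then have "\<bar>c * \<xi>\<bar> < c * l"
      using cosh_real_nonneg_le_iff[of "c * l" "\<bar>c * \<xi>\<bar>"] cpos l by (simp add: not_le[symmetric])
    then show "(x0 + \<xi>, y0) \<in> K t0" using rect[of "x0 + \<xi>" y0] k cpos by (simp add: abs_mult)
  next
    fix u t assume tt: "t \<in> {t0..t1}"
    show "pt u t \<noteq> (x0 + \<xi>, y0)"
    proof
      assume "pt u t = (x0 + \<xi>, y0)"
      then have "f u t = c * \<xi>" "g u t = 0" by (auto simp: pt_def f_def g_def)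
      then show False using neg[OF tt, of u] L1[OF tt] by (simp add: F_def G_def)
    qed
  qed
  then show ?thesis using interior_subset by blast
qed

end

section \<open>Triangles and chords in the hull\<close>

lemma triangle_mem:
  fixes C :: "(real \<times> real) set"
  assumes C: "convex C" "(0, 0) \<in> C" "(D, 0) \<in> C" "(a, b) \<in> C" and D: "D > 0"
    and \<tau>: "0 \<le> \<tau>" "\<tau> \<le> 1" "\<tau> * a \<le> X" "\<tau> * (D - a) \<le> D - X"
  shows "(X, \<tau> * b) \<in> C"
proof -
  define l where "l = (X - \<tau> * a) / D"
  have ll: "0 \<le> l" "l + \<tau> \<le> 1" "l * D = X - \<tau> * a"
    using \<tau> D by (simp_all add: l_def field_simps)
  have "(X, \<tau> * b) = (1 - l - \<tau>) *\<^sub>R (0, 0) + l *\<^sub>R (D, 0) + \<tau> *\<^sub>R (a, b)"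
    using ll(3) by simp
  also have "\<dots> \<in> convex hull {(0, 0), (D, 0), (a, b)}"
    unfolding convex_hull_3 using ll \<tau>
    by (intro CollectI exI[of _ "1 - l - \<tau>"] exI[of _ l] exI[of _ \<tau>]) auto
  also have "\<dots> \<subseteq> C" by (rule hull_minimal) (use C in auto)
  finally show ?thesis .
qed

context planar_flow
begin

lemma K_functional: "t \<in> I \<Longrightarrow> z \<in> K t \<Longrightarrow> \<exists>u. a * fst z + b * snd z \<le> lin a b u t"
proof -
  assume t: "t \<in> I" and z: "z \<in> K t"
  obtain u where u: "\<And>v. lin a b v t \<le> lin a b u t" using lin_max[OF t] by blast
  have "(a, b) \<bullet> z \<le> lin a b u t" by (rule K_le[OF z u])
  then show ?thesis by (cases z) auto
qed

text \<open>By nesting, the chord lies inside the region at all earlier times, so the curve above it is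
  bounded below by any subsolution of the heat equation that starts below the tent
  \<open>h (1 - \<bar>\<xi>\<bar>)\<close>, \<open>\<xi> = (x - xc) / d\<close>. The subsolution is \<open>h (3/4 - \<xi>\<^sup>2 - 2 (t - t0) / d\<^sup>2)\<close>.\<close>

lemma height_above_chord_persists:
  assumes t: "0 < t0" "t0 < t1" "t1 < T" and nd: "\<And>t. t \<in> {t0..<t1} \<Longrightarrow> nondegenerate t"
    and p: "p \<in> K t1" and q: "p2 \<in> K t1" and pq: "fst p < fst p2"
    and d: "d > 0" "fst p + d \<le> xc" "xc \<le> fst p2 - d"
    and sl: "sl = (snd p2 - snd p) / (fst p2 - fst p)" and yc: "yc = snd p + sl * (xc - fst p)"
    and \<sigma>: "\<sigma> \<in> {1, -1 :: real}" and h: "h > 0" and m: "(xc, yc + \<sigma> * h) \<in> K t0"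
    and time: "8 * (t1 - t0) \<le> d\<^sup>2"
  shows "(xc, yc + \<sigma> * (h / 2)) \<in> K t1"
proof -
  define line where "line X0 = snd p + sl * (X0 - fst p)" for X0
  have chord: "(X0, line X0) \<in> K t1" if X0: "fst p \<le> X0" "X0 \<le> fst p2" for X0
  proof -
    define \<theta> where "\<theta> = (X0 - fst p) / (fst p2 - fst p)"
    have \<theta>: "0 \<le> \<theta>" "\<theta> \<le> 1" "\<theta> * (fst p2 - fst p) = X0 - fst p"
      using X0 pq by (simp_all add: \<theta>_def)
    have "(1 - \<theta>) *\<^sub>R p + \<theta> *\<^sub>R p2 \<in> K t1" by (rule convexD_alt[OF convex_K p q \<theta>(1,2)])
    moreover have "(1 - \<theta>) *\<^sub>R p + \<theta> *\<^sub>R p2 = (X0, line X0)"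
    proof (rule prod_eqI)
      show "fst ((1 - \<theta>) *\<^sub>R p + \<theta> *\<^sub>R p2) = fst (X0, line X0)"
        using \<theta>(3) by (simp add: algebra_simps)
      have "sl * (X0 - fst p) = \<theta> * (snd p2 - snd p)"
        unfolding \<theta>(3)[symmetric] sl using pq by simp
      then show "snd ((1 - \<theta>) *\<^sub>R p + \<theta> *\<^sub>R p2) = snd (X0, line X0)"
        by (simp add: line_def algebra_simps)
    qed
    ultimately show ?thesis by simp
  qed
  have ycl: "yc = line xc" by (simp add: yc line_def)
  define n where "n = (\<lambda>u t. \<sigma> * (y u t - (snd p + sl * (x u t - fst p))))"
  have ncal: "caloric n"
    unfolding n_def by (intro caloric_intros caloric_x caloric_y)
  have nJ: "n \<in> J" by (rule caloric_J[OF ncal])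
  have n_line: "n u t = \<sigma> * (y u t - line (x u t))" for u t by (simp add: n_def line_def)
  have ptn: "pt u t = (x u t, line (x u t) + \<sigma> * n u t)" for u t
    using \<sigma> by (auto simp: pt_def n_line)
  define A where "A = h / d\<^sup>2"
  have A: "A > 0" using h d by (simp add: A_def)
  define g where "g = (\<lambda>t. 2 * A * (t - t0))"
  define e where "e = (\<lambda>u t. A * (x u t - xc)\<^sup>2)"
  have gJ: "(\<lambda>u t. g t) \<in> J" unfolding g_def using time_J by simp
  have eJ: "e \<in> J" by (simp add: e_def)
  define F where "F = (\<lambda>u t. 3 / 4 * h - e u t - g t - n u t)"
  have FJ: "F \<in> J" unfolding F_def using gJ eJ nJ by simp
  have SSe: "S (S e) = (\<lambda>u t. 2 * A * ((x u t - xc) * S (S x) u t + (S x u t)\<^sup>2))"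
    unfolding e_def by (simp add: S_simps S_cmult fun_eq_iff power2_eq_square algebra_simps)
  have De: "Dt e = (\<lambda>u t. 2 * A * ((x u t - xc) * S (S x) u t))"
    unfolding e_def by (simp add: Dt_simps Dt_cmult Dt_x fun_eq_iff algebra_simps)
  have SSF: "S (S F) = (\<lambda>u t. - S (S e) u t - S (S n) u t)"
    unfolding F_def using gJ eJ nJ by (simp add: S_simps S_time fun_eq_iff)
  have DF: "Dt F u t = - Dt e u t - 2 * A - S (S n) u t" if tI: "t \<in> I" for u t
  proof -
    have "Dt (\<lambda>u t. g t) u t = 2 * A"
      by (rule dt_time[OF _ tI]) (auto simp: g_def intro!: derivative_eq_intros)
    then show ?thesis unfolding F_def using gJ eJ nJ ncal by (simp add: Dt_simps caloric_def)
  qed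
  have tent: "\<bar>x u t - xc\<bar> < d \<and> n u t < h * (1 - \<bar>(x u t - xc) / d\<bar>)"
    if F: "F u t > 0" and n: "n u t \<ge> 0" and tt: "t \<ge> t0" for u t
  proof -
    define \<xi> where "\<xi> = \<bar>(x u t - xc) / d\<bar>"
    have "e u t = h * \<xi>\<^sup>2" using d by (simp add: e_def A_def \<xi>_def power_divide)
    moreover have "g t \<ge> 0" using A tt by (simp add: g_def)
    ultimately have 1: "n u t < h * (3 / 4 - \<xi>\<^sup>2)" using F by (simp add: F_def algebra_simps)
    \<comment> \<open>The parabola touches the tent from below at \<open>\<xi> = 1 / 2\<close>; this
      is the origin of 3/4.\<close>
    have "3 / 4 - \<xi>\<^sup>2 \<le> 1 - \<xi>" using zero_le_power2[of "\<xi> - 1 / 2"] by (simp add: power2_eq_square algebra_simps)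
    then have "h * (3 / 4 - \<xi>\<^sup>2) \<le> h * (1 - \<xi>)" using h by (intro mult_left_mono) auto
    then have 2: "n u t < h * (1 - \<xi>)" using 1 by linarith
    then have "h * (1 - \<xi>) > 0" using n by linarith
    then have "\<xi> < 1" using h by (simp add: zero_less_mult_iff)
    then show ?thesis using 2 d(1) by (simp add: \<xi>_def)
  qed
  have range: "fst p \<le> X0 \<and> X0 \<le> fst p2" if "\<bar>X0 - xc\<bar> \<le> d" for X0
    using that d by (auto simp: abs_le_iff)
  have FF: "F u t \<le> 0" if tt: "t \<in> {t0..<t1}" and nn: "n u t \<ge> 0" for u t
  proof (rule max_principle[OF FJ nJ t(1), of t])
    have t0I: "t0 \<in> I" using t by auto
    fix u assume n0: "n u t0 \<ge> 0"
    show "F u t0 \<le> 0"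
    proof (rule ccontr)
      assume "\<not> F u t0 \<le> 0"
      then have te: "\<bar>x u t0 - xc\<bar> < d" "n u t0 < h * (1 - \<bar>(x u t0 - xc) / d\<bar>)"
        using tent[of u t0] n0 by auto
      define X0 where "X0 = x u t0"
      define \<xi> where "\<xi> = (X0 - xc) / d"
      have \<xi>: "\<bar>\<xi>\<bar> < 1" "\<xi> * d = X0 - xc" using te(1) d(1) by (simp_all add: \<xi>_def X0_def)
      define H where "H = h * (1 - \<bar>\<xi>\<bar>)"
      have H: "H > 0" "n u t0 < H" using h \<xi> te(2) by (simp_all add: H_def \<xi>_def X0_def)
      \<comment> \<open>A curve point below the tent would lie strictly between an interior point on
        the chord and the point \<open>top\<close> of the hull, hence in the interior of the
        hull.\<close>
      have fint: "(X0, line X0) \<in> interior (K t0)"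
        using chord[of X0] range[of X0] te(1) K_subset_interior[OF t nd] t by (auto simp: X0_def)
      define E where "E = xc + sgn \<xi> * d"
      have E: "(E, line E) \<in> K t0"
      proof -
        have "\<bar>E - xc\<bar> \<le> d" using d(1) by (simp add: E_def abs_mult abs_sgn_eq)
        then show ?thesis using chord[of E] range[of E] K_antimono[of t0 t1] t by auto
      qed
      have top: "(X0, line X0 + \<sigma> * H) \<in> K t0"
      proof -
        have "(1 - \<bar>\<xi>\<bar>) *\<^sub>R (xc, yc + \<sigma> * h) + \<bar>\<xi>\<bar> *\<^sub>R (E, line E) \<in> K t0"
          by (rule convexD_alt[OF convex_K m E]) (use \<xi> in auto)
        moreover have EX: "(1 - \<bar>\<xi>\<bar>) * xc + \<bar>\<xi>\<bar> * E = X0"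
        proof -
          have "\<bar>\<xi>\<bar> * sgn \<xi> = \<xi>" by (simp add: abs_sgn)
          then have "\<bar>\<xi>\<bar> * (sgn \<xi> * d) = \<xi> * d" by (simp add: mult.assoc[symmetric])
          then show ?thesis using \<xi>(2) by (simp add: E_def algebra_simps)
        qed
        moreover have "(1 - \<bar>\<xi>\<bar>) * (yc + \<sigma> * h) + \<bar>\<xi>\<bar> * line E = line X0 + \<sigma> * H"
          unfolding EX[symmetric] by (simp add: line_def ycl H_def algebra_simps)
        ultimately show ?thesis by simp
      qed
      define \<theta> where "\<theta> = n u t0 / H"
      have \<theta>: "0 \<le> \<theta>" "\<theta> < 1" "\<theta> * H = n u t0" using H n0 by (simp_all add: \<theta>_def)
      have "(X0, line X0 + \<sigma> * H) - (1 - \<theta>) *\<^sub>R ((X0, line X0 + \<sigma> * H) - (X0, line X0)) \<in> interior (K t0)"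
        by (rule mem_interior_closure_convex_shrink[OF convex_K fint subsetD[OF closure_subset top]])
          (use \<theta> in auto)
      moreover have "(X0, line X0 + \<sigma> * H) - (1 - \<theta>) *\<^sub>R ((X0, line X0 + \<sigma> * H) - (X0, line X0)) = pt u t0"
        using \<theta>(3) by (simp add: ptn X0_def algebra_simps)
      ultimately show False using curve_not_interior[OF t0I nd] t by auto
    qed
  next
    fix u s' assume s': "s' \<in> {t0..t}" "n u s' = 0"
    have s'I: "s' \<in> I" "s' < t1" "t0 \<le> s'" using s' tt t by auto
    show "F u s' \<le> 0"
    proof (rule ccontr)
      assume "\<not> F u s' \<le> 0"
      then have "\<bar>x u s' - xc\<bar> < d" using tent[of u s'] s' by auto
      then have "(x u s', line (x u s')) \<in> K t1" using chord range by auto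
      then have "pt u s' \<in> K t1" using s'(2) by (simp add: ptn)
      then have "pt u s' \<in> interior (K s')"
        using K_subset_interior[of s' t1] nd[of s'] s'I t by auto
      then show False using curve_not_interior[OF s'I(1)] nd[of s'] s'I by auto
    qed
  next
    fix u s' assume a: "t0 < s'" "s' \<le> t" "S (S F) u s' \<le> 0" "0 < Dt F u s'"
    have sI: "s' \<in> I" using a tt t by auto
    have "2 * A * (S x u s')\<^sup>2 \<le> 2 * A * 1" using A Sx_le[OF sI, of u] by (intro mult_left_mono) auto
    then show False using a(3,4) unfolding SSF DF[OF sI] SSe De by (simp add: algebra_simps)
  qed (use tt nn t in auto)
  define m' where "m' = (xc, yc + \<sigma> * (h / 2))"
  \<comment> \<open>Otherwise the vertical segment from the chord to \<open>m'\<close> meets the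
    curve below height \<open>h / 2\<close>, whereas the subsolution at \<open>xc\<close> has height
    at least \<open>3 / 4 * h - h / 4\<close>; the loss \<open>h / 4\<close> is what
    \<open>time\<close> allows.\<close>
  have inK: "m' \<in> K t" if tt: "t \<in> {t0..<t1}" for t
  proof (rule ccontr)
    assume nm: "m' \<notin> K t"
    have tI: "t \<in> I" using tt t by auto
    have c: "(xc, yc) \<in> K t"
      using chord[of xc] range[of xc] d K_antimono[of t t1] tt t by (auto simp: ycl)
    have "closed_segment (xc, yc) m' \<inter> frontier (K t) \<noteq> {}"
      by (rule connected_Int_frontier) (use c nm in auto)
    then obtain z where z: "z \<in> closed_segment (xc, yc) m'" "z \<in> frontier (K t)" by blast
    then have zK: "z \<in> K t" "z \<notin> interior (K t)"
      using closed_K[OF tI] by (auto simp: frontier_def)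
    obtain \<theta> where \<theta>: "0 \<le> \<theta>" "\<theta> \<le> 1" "z = (1 - \<theta>) *\<^sub>R (xc, yc) + \<theta> *\<^sub>R m'"
      using z(1) unfolding in_segment by blast
    have z': "z = (xc, yc + \<sigma> * (\<theta> * (h / 2)))" unfolding \<theta>(3) m'_def by (simp add: algebra_simps)
    have "\<theta> < 1"
    proof (rule ccontr)
      assume "\<not> \<theta> < 1"
      then have "z = m'" using \<theta> by (simp add: z' m'_def)
      then show False using nm zK by simp
    qed
    obtain u where u: "pt u t = z" using frontier_K_curve[OF tI zK] by blast
    then have xu: "x u t = xc" by (simp add: pt_def z')
    have "\<sigma> * n u t = \<sigma> * (\<theta> * (h / 2))" using u xu by (simp add: ptn z' ycl)
    then have nu: "n u t = \<theta> * (h / 2)" using \<sigma> by auto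
    have "F u t \<le> 0" by (rule FF[OF tt]) (unfold nu, use \<theta>(1) h in auto)
    moreover have "g t \<le> h / 4"
    proof -
      have "8 * (t - t0) \<le> d\<^sup>2" using time tt by auto
      then have "A * (8 * (t - t0)) \<le> A * d\<^sup>2" using A by (intro mult_left_mono) auto
      also have "A * d\<^sup>2 = h" using d by (simp add: A_def)
      finally show ?thesis by (simp add: g_def algebra_simps)
    qed
    moreover have "\<theta> * (h / 2) < h / 2" using \<open>\<theta> < 1\<close> h by simp
    ultimately show False using nu by (simp add: F_def e_def xu)
  qed
  \<comment> \<open>At time \<open>t1\<close> the chord need not be interior to the hull, so this is
    a limit: a point outside the closed hull would be outside slightly earlier.\<close>
  have "m' \<in> K t1"
  proof (rule ccontr)
    assume nm: "m' \<notin> K t1"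
    have "t1 \<in> I" using t by auto
    then obtain \<delta> where \<delta>: "\<delta> > 0" "\<And>sl. \<bar>sl - t1\<bar> < \<delta> \<Longrightarrow> sl \<in> I \<and> m' \<notin> K sl"
      using not_K_open[OF _ nm] by metis
    define s' where "s' = max t0 (t1 - \<delta> / 2)"
    have "s' \<in> {t0..<t1}" "\<bar>s' - t1\<bar> < \<delta>" using \<delta>(1) t by (auto simp: s'_def)
    then show False using inK \<delta>(2) by blast
  qed
  then show ?thesis by (simp add: m'_def)
qed

section \<open>Thin curves become fatter\<close>

text \<open>Twice the signed area of a triangle inscribed in the curve.\<close>

definition area :: "real \<Rightarrow> real \<Rightarrow> real \<Rightarrow> real \<Rightarrow> real" where
  "area u v w t = (x v t - x u t) * (y w t - y u t) - (y v t - y u t) * (x w t - x u t)"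

lemma strip_persists:
  assumes "\<And>u. \<bar>y u t0\<bar> \<le> h" "0 < t0" "t0 \<le> t" "t < T"
  shows "\<bar>y u t\<bar> \<le> h"
  using caloric_max_decreasing[OF caloric_y assms(2-4), of h u]
    caloric_max_decreasing[OF caloric_minus[OF caloric_y] assms(2-4), of h u] assms(1)
  by (auto simp: abs_le_iff)

text \<open>The chord between the extreme points at \<open>t1\<close> cannot be close to both
  \<open>(xc, 0)\<close> and \<open>(xc, \<tau> * b)\<close>, so one of these two points of the
  older hull has height at least \<open>\<tau> * h / 2\<close> relative to the chord, and half of
  its height persists. The parameter \<open>\<alpha>\<close> records how far the ends have receded;
  it raises \<open>\<tau>\<close> and with it the area.\<close>

lemma thin_triangle:
  assumes t: "0 < t0" "t0 < t1" "t1 < T" and nd: "\<And>t. t \<in> {t0..<t1} \<Longrightarrow> nondegenerate t"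
    and tri: "(0, 0) \<in> K t0" "(L, 0) \<in> K t0" "(a, b) \<in> K t0" "\<bar>b\<bar> = h" "h > 0" "L > 0"
    and a: "0 \<le> a" "a \<le> L" and strip: "\<And>u. \<bar>y u t0\<bar> \<le> h"
    and ext: "\<And>u. x u1 t1 \<le> x u t1" "\<And>u. x u t1 \<le> x u2 t1" "Xw = x u2 t1 - x u1 t1" "2 * h \<le> Xw"
    and time: "128 * (t1 - t0) \<le> Xw\<^sup>2"
    and \<alpha>: "0 \<le> \<alpha>" "\<alpha> \<le> x u1 t1" "\<alpha> \<le> L - x u2 t1"
  shows "\<exists>u v w. \<forall>c d. (3 / 4 * Xw + \<alpha>) * h / (8 * Xw * L) * (dist (pt c t1) (pt d t1))\<^sup>2 \<le> \<bar>area u v w t1\<bar>"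
proof -
  define px py qx qy where "px = x u1 t1" and "py = y u1 t1" and "qx = x u2 t1" and "qy = y u2 t1"
  note pq = px_def[symmetric] py_def[symmetric] qx_def[symmetric] qy_def[symmetric]
  have X: "Xw > 0" "Xw = qx - px" using ext(3,4) tri(5) by (simp_all add: pq)
  have \<alpha>': "\<alpha> \<le> px" "\<alpha> \<le> L - qx" using \<alpha> by (simp_all add: pq)
  \<comment> \<open>The apex position clamped to the middle half of the chord: far enough from its
    ends for the heat barrier, and as close to the apex as that permits.\<close>
  define xc where "xc = max (px + Xw / 4) (min (qx - Xw / 4) a)"
  have xc: "px + Xw / 4 \<le> xc" "xc \<le> qx - Xw / 4" using X(1,2) unfolding xc_def by linarith+
  \<comment> \<open>If \<open>xc\<close> is not below the apex, the end of the base on the far side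
    of \<open>xc\<close> is at least \<open>3 / 4 * Xw + \<alpha>\<close> away, so the old triangle
    has at least the fraction \<open>\<tau>\<close> of its height over \<open>xc\<close>.\<close>
  define \<tau> where "\<tau> = (3 / 4 * Xw + \<alpha>) / L"
  have \<tau>L: "\<tau> * L = 3 / 4 * Xw + \<alpha>" using tri by (simp add: \<tau>_def)
  have \<tau>0: "\<tau> \<ge> 0" using tri X \<alpha> by (simp add: \<tau>_def)
  have "3 / 4 * Xw + \<alpha> \<le> L" using X \<alpha>' \<alpha>(1) tri(6) by linarith
  then have \<tau>1: "\<tau> \<le> 1" using tri by (simp add: \<tau>_def)
  have \<tau>a: "\<tau> * a \<le> a" "\<tau> * a \<le> \<tau> * L" "\<tau> * (L - a) \<le> L - a" "\<tau> * (L - a) \<le> \<tau> * L"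
    using a \<tau>0 \<tau>1 by (auto intro: mult_left_le_one_le mult_left_mono)
  have "\<tau> * a \<le> xc \<and> \<tau> * (L - a) \<le> L - xc"
  proof (cases "a < px + Xw / 4 \<or> qx - Xw / 4 < a")
    case False
    then have "xc = a" unfolding xc_def by linarith
    then show ?thesis using \<tau>a by simp
  next
    case True
    then show ?thesis
    proof
      assume l: "a < px + Xw / 4"
      then have "xc = px + Xw / 4" using X unfolding xc_def by linarith
      then show ?thesis using \<tau>a \<tau>L X \<alpha>' l by linarith
    next
      assume l: "qx - Xw / 4 < a"
      then have "xc = qx - Xw / 4" using X unfolding xc_def by linarith
      then show ?thesis using \<tau>a \<tau>L X \<alpha>' l by linarith
    qed
  qed
  then have mid: "(xc, \<tau> * b) \<in> K t0"
    using triangle_mem[OF convex_K tri(1-3) tri(6) \<tau>0 \<tau>1] by blast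
  have base: "(xc, 0) \<in> K t0"
    using triangle_mem[OF convex_K tri(1-3) tri(6), of 0 xc] xc X \<alpha>' \<alpha> by auto
  define sl where "sl = (qy - py) / (qx - px)"
  define yc where "yc = py + sl * (xc - px)"
  obtain m where m: "(xc, m) \<in> K t0" "\<bar>m - yc\<bar> \<ge> \<tau> * h / 2"
  proof (cases "\<bar>\<tau> * b - yc\<bar> \<ge> \<tau> * h / 2")
    case True
    then show ?thesis using mid by (intro that[of "\<tau> * b"])
  next
    case False
    have "\<bar>\<tau> * b\<bar> = \<tau> * h" using tri(4) \<tau>0 by (simp add: abs_mult)
    then have "\<bar>0 - yc\<bar> \<ge> \<tau> * h / 2" using False by linarith
    then show ?thesis using base by (intro that[of 0])
  qed
  define h' where "h' = \<bar>m - yc\<bar>"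
  define \<sigma> :: real where "\<sigma> = (if m \<ge> yc then 1 else - 1)"
  have \<sigma>: "\<sigma> \<in> {1, - 1}" "\<sigma> * \<sigma> = 1" "yc + \<sigma> * h' = m" by (auto simp: \<sigma>_def h'_def)
  have \<tau>pos: "\<tau> > 0" using tri X \<alpha> by (simp add: \<tau>_def add_pos_nonneg)
  have h': "h' \<ge> \<tau> * h / 2" "h' > 0"
  proof -
    show 1: "h' \<ge> \<tau> * h / 2" using m(2) by (simp add: h'_def)
    have "\<tau> * h > 0" using \<tau>pos tri(5) by simp
    then show "h' > 0" using 1 by linarith
  qed
  have z: "(xc, yc + \<sigma> * (h' / 2)) \<in> K t1"
  proof (rule height_above_chord_persists[OF t nd pt_K[of u1 t1] pt_K[of u2 t1], of "Xw / 4" xc sl yc \<sigma> h'])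
    show "8 * (t1 - t0) \<le> (Xw / 4)\<^sup>2" using time by (simp add: power_divide)
    show "(xc, yc + \<sigma> * h') \<in> K t0" using \<sigma>(3) m(1) by simp
  qed (use X xc h' \<sigma> in \<open>auto simp: pt_def pq sl_def yc_def\<close>)
  obtain w where w: "- \<sigma> * (qy - py) * xc + \<sigma> * Xw * (yc + \<sigma> * (h' / 2)) \<le> lin (- \<sigma> * (qy - py)) (\<sigma> * Xw) w t1"
    using K_functional[OF _ z, of "- \<sigma> * (qy - py)" "\<sigma> * Xw"] t by auto
  have sl: "Xw * (yc - py) = (qy - py) * (xc - px)" using X by (simp add: sl_def yc_def)
  have "Xw * (h' / 2) = \<sigma> * Xw * (\<sigma> * (h' / 2)) + \<sigma> * (Xw * (yc - py) - (qy - py) * (xc - px))"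
    unfolding sl using \<sigma>(2) by (simp add: mult.left_commute mult.assoc[symmetric])
  also have "\<dots> = - \<sigma> * (qy - py) * xc + \<sigma> * Xw * (yc + \<sigma> * (h' / 2)) - (- \<sigma> * (qy - py) * px + \<sigma> * Xw * py)"
    by (simp add: algebra_simps)
  also have "\<dots> \<le> lin (- \<sigma> * (qy - py)) (\<sigma> * Xw) w t1 - (- \<sigma> * (qy - py) * px + \<sigma> * Xw * py)"
    using w by simp
  also have "\<dots> = \<sigma> * area u1 u2 w t1" unfolding area_def pq X(2) by (simp add: algebra_simps)
  also have "\<dots> \<le> \<bar>area u1 u2 w t1\<bar>" using \<sigma>(1) by auto
  finally have ar: "Xw * (h' / 2) \<le> \<bar>area u1 u2 w t1\<bar>" .
  have "(3 / 4 * Xw + \<alpha>) * h / (8 * Xw * L) * (dist (pt c t1) (pt d t1))\<^sup>2 \<le> \<bar>area u1 u2 w t1\<bar>" for c d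
  proof -
    have "\<bar>x c t1 - x d t1\<bar> \<le> Xw"
      using ext(1)[of c] ext(1)[of d] ext(2)[of c] ext(2)[of d] ext(3) by (auto simp: abs_le_iff)
    then have 1: "(x c t1 - x d t1)\<^sup>2 \<le> Xw\<^sup>2" using X by (simp add: abs_le_square_iff[symmetric])
    have "\<bar>y c t1\<bar> \<le> h" "\<bar>y d t1\<bar> \<le> h" by (rule strip_persists[OF strip]; use t in simp)+
    then have "\<bar>y c t1 - y d t1\<bar> \<le> Xw" using ext(4) by (auto simp: abs_le_iff)
    then have 2: "(y c t1 - y d t1)\<^sup>2 \<le> Xw\<^sup>2" using X by (simp add: abs_le_square_iff[symmetric])
    have "(dist (pt c t1) (pt d t1))\<^sup>2 \<le> 2 * Xw\<^sup>2"
      using 1 2 by (simp add: pt_def dist_Pair_Pair dist_real_def)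
    then have "(3 / 4 * Xw + \<alpha>) * h / (8 * Xw * L) * (dist (pt c t1) (pt d t1))\<^sup>2
        \<le> (3 / 4 * Xw + \<alpha>) * h / (8 * Xw * L) * (2 * Xw\<^sup>2)"
      using X \<alpha> tri by (intro mult_left_mono) auto
    also have "\<dots> = Xw * (\<tau> * h / 2 / 2)"
      using X tri by (simp add: \<tau>_def field_simps power2_eq_square)
    also have "\<dots> \<le> Xw * (h' / 2)" using X h' by (intro mult_left_mono) auto
    finally show ?thesis using ar by linarith
  qed
  then show ?thesis by blast
qed

definition width :: "real \<Rightarrow> real" where
  "width t = (SUP u. x u t) - (INF u. x u t)"

lemma width_attained:
  assumes t: "t \<in> I"
  obtains u1 u2 where "\<And>u. x u1 t \<le> x u t" "\<And>u. x u t \<le> x u2 t" "width t = x u2 t - x u1 t"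
proof -
  obtain u2 where 2: "\<And>u. x u t \<le> x u2 t" using lin_max[OF t, of 1 0] by auto
  obtain u1 where 1: "\<And>u. x u1 t \<le> x u t" using lin_max[OF t, of "- 1" 0] by auto
  have "(SUP u. x u t) = x u2 t" by (rule cSup_eq_maximum) (use 2 in auto)
  moreover have "(INF u. x u t) = x u1 t" by (rule cInf_eq_minimum) (use 1 in auto)
  ultimately show ?thesis using 1 2 by (intro that) (auto simp: width_def)
qed

lemma width_continuous: "continuous_on I width"
  unfolding continuous_on_iff
proof (intro ballI allI impI)
  fix t e :: real assume t: "t \<in> I" and e: "e > 0"
  have e2: "e / 2 > 0" using e by simp
  obtain \<delta> where \<delta>: "\<delta> > 0" "\<And>s u. \<bar>s - t\<bar> < \<delta> \<Longrightarrow> s \<in> I \<and> \<bar>x u s - x u t\<bar> < e / 2"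
    by (rule J_uniform[OF x_J t e2]) (rule that)
  obtain u1 u2 where u: "\<And>u. x u1 t \<le> x u t" "\<And>u. x u t \<le> x u2 t" "width t = x u2 t - x u1 t"
    by (rule width_attained[OF t]) (rule that)
  show "\<exists>d>0. \<forall>s\<in>I. dist s t < d \<longrightarrow> dist (width s) (width t) < e"
  proof (intro exI conjI ballI impI)
    fix s assume s: "s \<in> I" "dist s t < \<delta>"
    obtain v1 v2 where v: "\<And>u. x v1 s \<le> x u s" "\<And>u. x u s \<le> x v2 s" "width s = x v2 s - x v1 s"
      by (rule width_attained[OF s(1)]) (rule that)
    have d: "\<bar>x u s - x u t\<bar> < e / 2" for u using \<delta>(2) s(2) by (auto simp: dist_real_def)
    show "dist (width s) (width t) < e"
      using d[of u1] d[of u2] d[of v1] d[of v2] u(1)[of v1] u(2)[of v2] v(1)[of u1] v(2)[of u2]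
      unfolding u(3) v(3) dist_real_def by linarith
  qed (rule \<delta>(1))
qed

text \<open>The triangle contains a rectangle about \<open>(L / 2, b / 8)\<close> of half-length
  \<open>L / 4\<close> and half-height \<open>h / 8\<close>. An oval of height comparable to
  \<open>h\<close> loses length at a rate of order \<open>1 / h\<close>, so the one inscribed there
  stays long for a time of order \<open>h * L\<close>.\<close>

lemma long_rectangle_persists:
  assumes t: "0 < t0" "t0 \<le> t1" "t1 < T" and nd: "nondegenerate t0"
    and tri: "(0, 0) \<in> K t0" "(L, 0) \<in> K t0" "(a, b) \<in> K t0" "\<bar>b\<bar> = h" "h > 0" "h \<le> L" "0 \<le> a" "a \<le> L"
    and \<xi>: "\<bar>\<xi>\<bar> = L / 8" and time: "2000 * (t1 - t0) \<le> h * L"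
  shows "(L / 2 + \<xi>, b / 8) \<in> K t1"
proof (rule inscribed_oval[OF t nd, of "h / 8" "L / 2" "L / 4" "b / 8" "4 * pi / h"])
  have L: "L > 0" using tri by simp
  show "L / 4 > 0" using L by simp
  show "h / 8 > 0" using tri by simp
  show "4 * pi / h = pi / (2 * (h / 8))" by simp
  show "(X0, Y0) \<in> K t0" if X: "\<bar>X0 - L / 2\<bar> \<le> L / 4" and Y: "\<bar>Y0 - b / 8\<bar> \<le> h / 8" for X0 Y0
  proof -
    define \<tau> where "\<tau> = Y0 / b"
    have b: "b \<noteq> 0" "b / \<bar>b\<bar> = sgn b" using tri by (auto simp: sgn_if)
    have \<tau>b: "\<tau> * b = Y0" using b by (simp add: \<tau>_def)
    have "\<bar>b\<bar> * \<bar>\<tau> - 1 / 8\<bar> = \<bar>Y0 - b / 8\<bar>"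
      unfolding \<tau>b[symmetric] abs_mult[symmetric] by (simp add: algebra_simps)
    also have "\<dots> \<le> \<bar>b\<bar> * (1 / 8)" using Y tri by simp
    finally have "\<bar>\<tau> - 1 / 8\<bar> \<le> 1 / 8" using b(1) by (simp add: mult_le_cancel_left)
    then have \<tau>: "0 \<le> \<tau>" "\<tau> \<le> 1 / 4" by linarith+
    have "\<tau> * a \<le> 1 / 4 * L" "\<tau> * (L - a) \<le> 1 / 4 * L" using \<tau> tri by (intro mult_mono; simp)+
    then have "\<tau> * a \<le> X0" "\<tau> * (L - a) \<le> L - X0" using X by linarith+
    then show ?thesis using triangle_mem[OF convex_K tri(1-3) L \<tau>(1)] \<tau>(2) \<tau>b by fastforce
  qed
  \<comment> \<open>In the units of the oval the point \<open>\<xi>\<close> is at distance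
    \<open>z\<close> and the end of the rectangle at \<open>2 * z\<close>. The constant 2000 makes
    the exponent \<open>w\<close> at most \<open>z / 4\<close>, whence
    \<open>exp w < cosh z\<close>, and this suffices since
    \<open>(cosh z)\<^sup>2 \<le> cosh (2 * z)\<close>.\<close>
  define z where "z = pi / 2 * (L / h)"
  have Lh: "L / h \<ge> 1" using tri by (simp add: field_simps)
  have z0: "z \<ge> pi / 2 * 1" unfolding z_def using Lh by (intro mult_left_mono) auto
  define w where "w = 2 * (4 * pi / h)\<^sup>2 * (t1 - t0)"
  have w: "w \<le> z / 4"
  proof -
    have "w = 32 * pi\<^sup>2 / h\<^sup>2 * (t1 - t0)" using tri by (simp add: w_def power_divide power_mult_distrib)
    also have "\<dots> \<le> 32 * pi\<^sup>2 / h\<^sup>2 * (h * L / 2000)" using time by (intro mult_left_mono) auto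
    also have "\<dots> = (pi * (L / h)) * (32 * pi / 2000)" using tri by (simp add: field_simps power2_eq_square)
    also have "\<dots> \<le> (pi * (L / h)) * (1 / 8)" using tri L pi_less_4 by (intro mult_left_mono) auto
    finally show ?thesis by (simp add: z_def)
  qed
  have ez: "exp (- z) \<ge> 0" "exp (z - w) \<ge> 2"
  proof -
    have "exp (z - w) \<ge> 1 + (z - w)" by (rule exp_ge_add_one_self)
    then show "exp (z - w) \<ge> 2" using w z0 pi_gt3 by linarith
  qed simp
  have c: "cosh z > exp w"
  proof -
    have "exp w * 2 \<le> exp w * exp (z - w)" using ez by (intro mult_left_mono) auto
    also have "\<dots> = exp z" by (simp add: exp_add[symmetric])
    also have "exp z < 2 * cosh z" by (simp add: cosh_def)
    finally show ?thesis by simp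
  qed
  have "cosh (4 * pi / h * \<xi>) = cosh z"
  proof -
    have "\<bar>4 * pi / h * \<xi>\<bar> = 4 * pi / h * (L / 8)" unfolding \<xi>[symmetric] using tri by (simp add: abs_mult)
    also have "\<dots> = z" by (simp add: z_def)
    finally have "\<bar>4 * pi / h * \<xi>\<bar> = z" .
    then show ?thesis by (metis cosh_real_abs)
  qed
  moreover have "cosh (4 * pi / h * (L / 4)) = cosh (2 * z)" by (simp add: z_def)
  moreover have "cosh z * exp w < cosh (2 * z)"
  proof -
    have "cosh z * exp w < cosh z * cosh z" using c by (intro mult_strict_left_mono) auto
    also have "\<dots> \<le> cosh (2 * z)" using cosh_real_ge_1[of z] mult_mono[of 1 "cosh z" 1 "cosh z"]
      by (simp add: cosh_double_cosh power2_eq_square)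
    finally show ?thesis .
  qed
  ultimately show "cosh (4 * pi / h * \<xi>) * exp (2 * (4 * pi / h)\<^sup>2 * (t1 - t0)) < cosh (4 * pi / h * (L / 4))"
    unfolding w_def by (simp only:)
qed

text \<open>While the width is a fixed fraction of \<open>L\<close>, the ratio of area to squared
  diameter has lost only a bounded factor. Otherwise stop when the width is
  \<open>\<epsilon> * L\<close>: this took long enough for the tips to recede by much more than the
  width that remains, so what is left sits well inside the old base, where the old triangle is at
  least \<open>32 * \<epsilon> * h\<close> high, and the ratio has improved.\<close>

lemma area_or_improved_area:
  assumes t: "0 < t0" "t0 < t" "t < T" and \<rho>: "0 < \<rho>" "\<rho> \<le> 1"
    and r: "\<And>u s. t0 \<le> s \<Longrightarrow> s < T \<Longrightarrow> \<rho> \<le> r2 u s"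
    and nd: "\<And>s. t0 \<le> s \<Longrightarrow> s < T \<Longrightarrow> nondegenerate s"
    and tri: "(0, 0) \<in> K t0" "(L, 0) \<in> K t0" "(a, b) \<in> K t0" "\<bar>b\<bar> = h" "h > 0" "0 \<le> a" "a \<le> L"
    and box: "\<And>u. 0 \<le> x u t0" "\<And>u. x u t0 \<le> L" "\<And>u. \<bar>y u t0\<bar> \<le> h"
    and \<epsilon>: "\<epsilon> = \<rho> / 128000" and thin: "128 * h \<le> \<epsilon>\<^sup>2 * \<rho> * L"
  shows "(\<exists>u v w. \<forall>c d. 3 * h / (32 * L) * (dist (pt c t) (pt d t))\<^sup>2 \<le> \<bar>area u v w t\<bar>) \<or>
    (\<exists>t1\<in>{t0<..t}. \<exists>u v w. \<forall>c d. 4 * h / L * (dist (pt c t1) (pt d t1))\<^sup>2 \<le> \<bar>area u v w t1\<bar>)"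
proof -
  have \<epsilon>0: "\<epsilon> > 0" "\<epsilon> \<le> 1 / 128000" using \<rho> by (simp_all add: \<epsilon>)
  have L: "L > 0" 
  proof (rule ccontr)
    assume "\<not> L > 0"
    then have "\<epsilon>\<^sup>2 * \<rho> * L \<le> 0" using \<rho> by (intro mult_nonneg_nonpos) auto
    then show False using thin tri(5) by simp
  qed
  have small: "h \<le> \<epsilon> * L / 128" "128 * (h * L) \<le> \<rho> * (\<epsilon> * L)\<^sup>2"
  proof -
    have "\<epsilon> * \<rho> \<le> 1 * 1" using \<epsilon>0 \<rho> by (intro mult_mono) auto
    then have "\<epsilon> * L * (\<epsilon> * \<rho>) \<le> \<epsilon> * L * 1" using \<epsilon>0 L by (intro mult_left_mono) auto
    then show "h \<le> \<epsilon> * L / 128" using thin by (simp add: power2_eq_square algebra_simps)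
    have "128 * h * L \<le> \<epsilon>\<^sup>2 * \<rho> * L * L" using thin L by (intro mult_right_mono) auto
    then show "128 * (h * L) \<le> \<rho> * (\<epsilon> * L)\<^sup>2" by (simp add: power2_eq_square algebra_simps)
  qed
  have \<epsilon>L: "\<epsilon> * L \<le> L / 128000" using \<epsilon>0 L by (simp add: mult_right_mono[of \<epsilon> "1/128000" L, simplified])
  have hL: "h \<le> L / 2" using small(1) \<epsilon>L L by linarith
  have tips: "x u s \<le> L + h - \<rho> * (s - t0) / h" "- x u s \<le> h - \<rho> * (s - t0) / h"
    if s: "s \<in> {t0..t}" for u s
    using tip_recession[OF t(1) t(3) tri(5), of 1 0 L \<rho> s u] tip_recession[OF t(1) t(3) tri(5), of "- 1" 0 0 \<rho> s u]
      box r s t by auto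
  \<comment> \<open>Both tips recede at rate \<open>\<rho> / h\<close> and cannot pass each other.
    This bounds the elapsed time by \<open>h * L / \<rho>\<close>, which thinness makes negligible
    against \<open>(\<epsilon> * L)\<^sup>2\<close>.\<close>
  have time: "128 * (s - t0) \<le> (\<epsilon> * L)\<^sup>2" if s: "s \<in> {t0..t}" for s
  proof -
    have "2 * (\<rho> * (s - t0) / h) \<le> L + 2 * h" using tips[OF s, of 0] by linarith
    also have "\<dots> \<le> 2 * L" using hL by simp
    finally have "\<rho> * (s - t0) \<le> h * L" using tri(5) by (simp add: field_simps)
    then have "\<rho> * (128 * (s - t0)) \<le> \<rho> * (\<epsilon> * L)\<^sup>2" using small(2) by linarith
    then show ?thesis using \<rho> by (simp only: mult_le_cancel_left_pos)
  qed
  have inside: "0 \<le> x u s" "x u s \<le> L" if s: "s \<in> {t0..t}" for u s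
    using caloric_max_decreasing[OF caloric_x t(1), of s L u]
      caloric_max_decreasing[OF caloric_minus[OF caloric_x] t(1), of s 0 u] box s t by auto
  have contact: "\<exists>u v w. \<forall>c d. (3 / 4 * width s + \<alpha>) * h / (8 * width s * L) * (dist (pt c s) (pt d s))\<^sup>2 \<le> \<bar>area u v w s\<bar>"
    if s: "s \<in> {t0<..t}" and W: "\<epsilon> * L \<le> width s" and \<alpha>: "\<alpha> \<ge> 0" "\<And>u. \<alpha> \<le> x u s" "\<And>u. \<alpha> \<le> L - x u s" for s \<alpha>
  proof -
    have sI: "s \<in> I" using s t by auto
    obtain u1 u2 where u: "\<And>u. x u1 s \<le> x u s" "\<And>u. x u s \<le> x u2 s" "width s = x u2 s - x u1 s"
      by (rule width_attained[OF sI]) (rule that)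
    have "(\<epsilon> * L)\<^sup>2 \<le> (width s)\<^sup>2" using W \<epsilon>0 L by (intro power_mono) auto
    then have "128 * (s - t0) \<le> (width s)\<^sup>2" using time[of s] s by auto
    moreover have "2 * h \<le> width s" using small(1) W tri(5) by linarith
    ultimately show ?thesis
      using W \<alpha> s t \<epsilon>0 L
      by (intro thin_triangle[OF t(1) _ _ nd tri(1-5) L tri(6,7) box(3) u(1,2,3)]) auto
  qed
  show ?thesis
  proof (cases "\<epsilon> * L \<le> width t")
    case True
    have W: "width t > 0" using True mult_pos_pos[OF \<epsilon>0(1) L] by linarith
    have "\<exists>u v w. \<forall>c d. (3 / 4 * width t + 0) * h / (8 * width t * L) * (dist (pt c t) (pt d t))\<^sup>2 \<le> \<bar>area u v w t\<bar>"
      by (rule contact) (use True t inside[of t] in auto)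
    moreover have "(3 / 4 * width t + 0) * h / (8 * width t * L) = 3 * h / (32 * L)"
      using W L by (simp add: field_simps)
    ultimately show ?thesis by simp
  next
    case False
    have t0I: "t0 \<in> I" using t by auto
    have w0: "width t0 \<ge> \<epsilon> * L"
    proof -
      obtain u1 u2 where u: "\<And>u. x u1 t0 \<le> x u t0" "\<And>u. x u t0 \<le> x u2 t0" "width t0 = x u2 t0 - x u1 t0"
        by (rule width_attained[OF t0I]) (rule that)
      obtain v1 where "0 \<le> - x v1 t0" using K_functional[OF t0I tri(1), of "- 1" 0] by auto
      moreover obtain v2 where "L \<le> x v2 t0" using K_functional[OF t0I tri(2), of 1 0] by auto
      ultimately have "width t0 \<ge> L" using u(1)[of v1] u(2)[of v2] u(3) by linarith
      then show ?thesis using \<epsilon>L L by linarith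
    qed
    have "\<exists>t1. t0 \<le> t1 \<and> t1 \<le> t \<and> width t1 = \<epsilon> * L"
      by (rule IVT2') (use False w0 t in \<open>auto intro!: continuous_on_subset[OF width_continuous]\<close>)
    then obtain t1 where t1: "t0 \<le> t1" "t1 \<le> t" "width t1 = \<epsilon> * L" by blast
    have t1I: "t1 \<in> I" "t1 < T" using t1 t by auto
    \<comment> \<open>Until that time the inscribed oval keeps the width above
      \<open>L / 4\<close>.\<close>
    have long: "2000 * (t1 - t0) > h * L"
    proof (rule ccontr)
      assume "\<not> ?thesis"
      then have tm: "2000 * (t1 - t0) \<le> h * L" by simp
      have p: "(L / 2 + \<xi>, b / 8) \<in> K t1" if "\<bar>\<xi>\<bar> = L / 8" for \<xi>
        by (rule long_rectangle_persists[OF t(1) t1(1) t1I(2) nd tri(1-5) _ tri(6,7) that tm]) (use hL L t in auto)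
      obtain v1 where v1: "- (L / 2 + - (L / 8)) \<le> - x v1 t1"
        using K_functional[OF t1I(1) p[of "- (L / 8)"], of "- 1" 0] L by auto
      obtain v2 where v2: "L / 2 + L / 8 \<le> x v2 t1" using K_functional[OF t1I(1) p[of "L / 8"], of 1 0] L by auto
      obtain u1 u2 where u: "\<And>u. x u1 t1 \<le> x u t1" "\<And>u. x u t1 \<le> x u2 t1" "width t1 = x u2 t1 - x u1 t1"
        by (rule width_attained[OF t1I(1)]) (rule that)
      have "width t1 \<ge> L / 4" using v1 v2 u(1)[of v1] u(2)[of v2] u(3) by linarith
      then show False using t1(3) \<epsilon>L L by linarith
    qed
    \<comment> \<open>Meanwhile each tip has receded by at least
      \<open>\<rho> * L / 2000 = 64 * \<epsilon> * L\<close>, up to an error \<open>h\<close>; half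
      of it is kept as \<open>\<alpha>\<close>. Hence 128000 = 64 * 2000.\<close>
    have gap: "h - \<rho> * (t1 - t0) / h \<le> - (32 * \<epsilon> * L)"
    proof -
      have "h * (64 * \<epsilon> * L) = \<rho> / 2000 * (h * L)" by (simp add: \<epsilon>)
      also have "\<dots> \<le> \<rho> / 2000 * (2000 * (t1 - t0))" using long \<rho> by (intro mult_left_mono) auto
      finally have "64 * \<epsilon> * L \<le> \<rho> * (t1 - t0) / h" using tri(5) by (simp add: field_simps)
      moreover have "\<epsilon> * L > 0" using \<epsilon>0 L by simp
      ultimately show ?thesis using small(1) by simp
    qed
    have "h * L > 0" using tri(5) L by simp
    then have t01: "t0 < t1" using long by simp
    have "\<exists>u v w. \<forall>c d. (3 / 4 * width t1 + 32 * \<epsilon> * L) * h / (8 * width t1 * L) * (dist (pt c t1) (pt d t1))\<^sup>2 \<le> \<bar>area u v w t1\<bar>"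
    proof (rule contact)
      show "0 \<le> 32 * \<epsilon> * L" using \<epsilon>0 L by simp
      show "32 * \<epsilon> * L \<le> x u t1" "32 * \<epsilon> * L \<le> L - x u t1" for u
        using tips[of t1 u] gap t1 by auto
    qed (use t01 t1 in auto)
    then obtain u v w where uvw: "\<And>c d. (3 / 4 * width t1 + 32 * \<epsilon> * L) * h / (8 * width t1 * L) * (dist (pt c t1) (pt d t1))\<^sup>2 \<le> \<bar>area u v w t1\<bar>"
      by blast
    \<comment> \<open>Here \<open>(3 / 4 + 32) / 8 > 4\<close>.\<close>
    have "4 * h / L \<le> (3 / 4 * width t1 + 32 * \<epsilon> * L) * h / (8 * width t1 * L)"
      unfolding t1(3) using \<epsilon>0 L tri(5) by (simp add: field_simps)
    then have "4 * h / L * (dist (pt c t1) (pt d t1))\<^sup>2 \<le> \<bar>area u v w t1\<bar>" for c d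
      using uvw[of c d] by (meson mult_right_mono order_trans zero_le_power2)
    then show ?thesis using t01 t1(2) by (intro disjI2 bexI[of _ t1]) auto
  qed
qed

section \<open>Coordinates along a diameter and a uniform lower bound for the area ratio\<close>

lemma tame_add_const: "tame w \<Longrightarrow> tame (\<lambda>u t. w u t + k)"
proof -
  assume w: "tame w"
  then have "\<not> alternates \<epsilon> (\<lambda>u. w u t + k + c)" if "t \<in> I" "\<epsilon> > 0" for \<epsilon> t c
    using that by (auto simp: tame_def add.assoc)
  moreover have "caloric (\<lambda>u t. w u t + k)" using w by (intro caloric_intros) (simp add: tame_def)
  ultimately show ?thesis by (simp add: tame_def)
qed

lemma rotated_flow:
  assumes r: "p\<^sup>2 + s\<^sup>2 = 1"
  shows "planar_flow \<gamma> T D (\<lambda>u t. lin p s u t - c1) (\<lambda>u t. lin (- s) p u t - c2)"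
proof
  show "caloric (\<lambda>u t. lin p s u t - c1)" "caloric (\<lambda>u t. lin (- s) p u t - c2)"
    by (intro caloric_diff caloric_lin caloric_const)+
  show "tame (\<lambda>u t. a * (lin p s u t - c1) + b * (lin (- s) p u t - c2))" for a b
  proof -
    have "tame (\<lambda>u t. lin (a * p - b * s) (a * s + b * p) u t + (- a * c1 - b * c2))"
      by (rule tame_add_const[OF tame_lin])
    then show ?thesis by (simp add: algebra_simps)
  qed
  fix u t assume t: "t \<in> I"
  have 1: "S (\<lambda>u t. lin p s u t - c1) u t = p * S x u t + s * S y u t"
    "S (\<lambda>u t. lin (- s) p u t - c2) u t = - s * S x u t + p * S y u t"
    by (simp_all add: S_simps)
  have "(S (\<lambda>u t. lin p s u t - c1) u t)\<^sup>2 + (S (\<lambda>u t. lin (- s) p u t - c2) u t)\<^sup>2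
      = (p\<^sup>2 + s\<^sup>2) * ((S x u t)\<^sup>2 + (S y u t)\<^sup>2)"
    unfolding 1 by (simp add: power2_eq_square algebra_simps)
  then show "(S (\<lambda>u t. lin p s u t - c1) u t)\<^sup>2 + (S (\<lambda>u t. lin (- s) p u t - c2) u t)\<^sup>2 \<le> 1"
    using proj_le[OF t] r by simp
qed

text \<open>In the direction \<open>w\<close> of the later chord the extent of the curve does not
  grow, and at the earlier time it is at most \<open>norm w * L\<close>.\<close>

lemma diameter_decreasing:
  assumes t: "0 < t0" "t0 \<le> t" "t < T" and le: "\<And>u v. dist (pt u t0) (pt v t0) \<le> L"
  shows "dist (pt c t) (pt d t) \<le> L"
proof -
  define w where "w = pt c t - pt d t"
  have w: "w = (fst w, snd w)" by simp
  have t0: "t0 \<in> I" using t by auto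
  obtain u where u: "\<And>v. lin (fst w) (snd w) v t0 \<le> lin (fst w) (snd w) u t0"
    using lin_max[OF t0, of "fst w" "snd w"] by blast
  obtain v where v: "\<And>u. lin (- fst w) (- snd w) u t0 \<le> lin (- fst w) (- snd w) v t0"
    using lin_max[OF t0, of "- fst w" "- snd w"] by blast
  have wl: "w \<bullet> pt u s = lin (fst w) (snd w) u s" for u s by (simp add: pt_def inner_prod_def)
  have "w \<bullet> pt c t \<le> w \<bullet> pt u t0" unfolding wl by (rule caloric_max_decreasing[OF caloric_lin t u])
  moreover have "lin (- fst w) (- snd w) d t \<le> lin (- fst w) (- snd w) v t0"
    by (rule caloric_max_decreasing[OF caloric_lin t v])
  then have "w \<bullet> pt v t0 \<le> w \<bullet> pt d t" unfolding wl by simp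
  ultimately have "w \<bullet> w \<le> w \<bullet> (pt u t0 - pt v t0)" unfolding w_def inner_diff_right by linarith
  also have "\<dots> \<le> norm w * norm (pt u t0 - pt v t0)" by (rule norm_cauchy_schwarz)
  also have "\<dots> \<le> norm w * L" using le[of u v] by (intro mult_left_mono) (auto simp: dist_norm)
  finally have "norm w * norm w \<le> norm w * L" by (simp add: power2_norm_eq_inner[symmetric] power2_eq_square)
  moreover have "0 \<le> L" using le[of u u] by simp
  ultimately have "norm w \<le> L" using mult_left_le_imp_le[of "norm w" "norm w" L]
    by (cases "norm w = 0") auto
  then show ?thesis by (simp add: w_def dist_norm)
qed

text \<open>A scale-invariant ratio of area to squared diameter. Quantifying over all chords in
  place of the diameter keeps the condition closed in time.\<close>

definition fat :: "real \<Rightarrow> real \<Rightarrow> bool" where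
  "fat \<eta> t \<longleftrightarrow> (\<exists>u v w. \<forall>c d. \<eta> * (dist (pt c t) (pt d t))\<^sup>2 \<le> \<bar>area u v w t\<bar>)"

lemma fat_mono: "fat \<eta> t \<Longrightarrow> \<eta>' \<le> \<eta> \<Longrightarrow> fat \<eta>' t"
proof -
  assume f: "fat \<eta> t" and le: "\<eta>' \<le> \<eta>"
  obtain u v w where u: "\<And>c d. \<eta> * (dist (pt c t) (pt d t))\<^sup>2 \<le> \<bar>area u v w t\<bar>" using f by (auto simp: fat_def)
  have "\<eta>' * (dist (pt c t) (pt d t))\<^sup>2 \<le> \<bar>area u v w t\<bar>" for c d
    using u[of c d] mult_right_mono[OF le, of "(dist (pt c t) (pt d t))\<^sup>2"] by simp
  then show ?thesis unfolding fat_def by blast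
qed

lemma distance_attained:
  assumes t: "t \<in> I"
  obtains u v where "\<And>c d. dist (pt c t) (pt d t) \<le> dist (pt u t) (pt v t)"
proof -
  let ?C = "range (\<lambda>u. pt u t)"
  obtain z w where "z \<in> ?C" "w \<in> ?C" and zw: "dist z w = diameter ?C"
    using diameter_compact_attained[OF compact_curve[OF t]] by blast
  then obtain u v where uv: "z = pt u t" "w = pt v t" by blast
  show ?thesis
  proof (rule that)
    show "dist (pt c t) (pt d t) \<le> dist (pt u t) (pt v t)" for c d
      using diameter_bounded_bound[OF compact_imp_bounded[OF compact_curve[OF t]], of "pt c t" "pt d t"] zw
      by (simp add: uv)
  qed
qed

text \<open>A diameter is put on the first axis. Its maximality confines the first coordinate to
  \<open>[0, L]\<close>, since a point beyond one end would be farther than \<open>L\<close> from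
  the other; \<open>w0\<close> is a point farthest from the axis.\<close>

lemma diameter_frame:
  assumes t: "t \<in> I" and nd: "nondegenerate t"
  obtains p s c1 c2 L h u0 v0 w0 where "p\<^sup>2 + s\<^sup>2 = 1" "L > 0" "h > 0"
    "lin p s u0 t - c1 = 0" "lin (- s) p u0 t - c2 = 0" "lin p s v0 t - c1 = L" "lin (- s) p v0 t - c2 = 0"
    "\<bar>lin (- s) p w0 t - c2\<bar> = h" "\<And>u. 0 \<le> lin p s u t - c1" "\<And>u. lin p s u t - c1 \<le> L"
    "\<And>u. \<bar>lin (- s) p u t - c2\<bar> \<le> h" "\<And>u v. dist (pt u t) (pt v t) \<le> L" "\<bar>area u0 v0 w0 t\<bar> = L * h"
    "\<And>u v w. \<bar>area u v w t\<bar> \<le> 2 * (L * h)"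
proof -
  obtain u0 v0 where uv: "\<And>c d. dist (pt c t) (pt d t) \<le> dist (pt u0 t) (pt v0 t)"
    by (rule distance_attained[OF t]) (rule that)
  define L where "L = dist (pt u0 t) (pt v0 t)"
  have d2: "(dist (pt c t) (pt d t))\<^sup>2 = (x c t - x d t)\<^sup>2 + (y c t - y d t)\<^sup>2" for c d
    by (simp add: pt_def dist_Pair_Pair dist_real_def)
  have L: "L > 0"
  proof -
    have "\<exists>c d. lin 1 0 c t \<noteq> lin 1 0 d t"
      by (rule nd[unfolded nondegenerate_def, rule_format]) simp
    then obtain c d where "lin 1 0 c t \<noteq> lin 1 0 d t" by blast
    then have "pt c t \<noteq> pt d t" by (auto simp: pt_def)
    then have "0 < dist (pt c t) (pt d t)" by simp
    then show ?thesis using uv[of c d] unfolding L_def by (rule less_le_trans)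
  qed
  define p where "p = (x v0 t - x u0 t) / L"
  define s where "s = (y v0 t - y u0 t) / L"
  have L2: "L\<^sup>2 = (x v0 t - x u0 t)\<^sup>2 + (y v0 t - y u0 t)\<^sup>2"
    unfolding L_def d2 by (simp add: power2_commute)
  have pL: "x v0 t - x u0 t = p * L" "y v0 t - y u0 t = s * L" using L by (simp_all add: p_def s_def)
  have ps: "p\<^sup>2 + s\<^sup>2 = 1"
  proof -
    have "(p\<^sup>2 + s\<^sup>2) * L\<^sup>2 = 1 * L\<^sup>2" using L2 unfolding pL by (simp add: power_mult_distrib algebra_simps)
    then show ?thesis using L mult_right_cancel[of "L\<^sup>2" "p\<^sup>2 + s\<^sup>2" 1] by simp
  qed
  define c1 where "c1 = lin p s u0 t"
  define c2 where "c2 = lin (- s) p u0 t"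
  define X' where "X' u = lin p s u t - c1" for u
  define Y' where "Y' u = lin (- s) p u t - c2" for u
  have X0: "X' u0 = 0" "Y' u0 = 0" by (simp_all add: X'_def Y'_def c1_def c2_def)
  have "X' v0 = p * (x v0 t - x u0 t) + s * (y v0 t - y u0 t)" "Y' v0 = - s * (x v0 t - x u0 t) + p * (y v0 t - y u0 t)"
    by (simp_all add: X'_def Y'_def c1_def c2_def algebra_simps)
  then have "X' v0 = (p\<^sup>2 + s\<^sup>2) * L" "Y' v0 = 0" unfolding pL by (simp_all add: power2_eq_square algebra_simps)
  then have V0: "X' v0 = L" "Y' v0 = 0" using ps by simp_all
  have dd: "(X' c - X' d)\<^sup>2 + (Y' c - Y' d)\<^sup>2 \<le> L\<^sup>2" for c d
  proof -
    have "(X' c - X' d)\<^sup>2 + (Y' c - Y' d)\<^sup>2 = (p\<^sup>2 + s\<^sup>2) * ((x c t - x d t)\<^sup>2 + (y c t - y d t)\<^sup>2)"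
      by (simp add: X'_def Y'_def power2_eq_square algebra_simps)
    also have "\<dots> = (dist (pt c t) (pt d t))\<^sup>2" using ps by (simp add: d2)
    also have "\<dots> \<le> L\<^sup>2" using uv[of c d] by (intro power_mono) (auto simp: L_def)
    finally show ?thesis .
  qed
  have Xle: "X' u \<le> L" for u
  proof -
    have "(X' u)\<^sup>2 \<le> L\<^sup>2" using dd[of u u0] zero_le_power2[of "Y' u"] unfolding X0 diff_zero by linarith
    then show ?thesis using L by (simp add: abs_le_square_iff[symmetric])
  qed
  have Xge: "0 \<le> X' u" for u
  proof -
    have "(L - X' u)\<^sup>2 \<le> L\<^sup>2" using dd[of v0 u] zero_le_power2[of "Y' u"] unfolding V0 diff_0 power2_minus by linarith
    then show ?thesis using L by (simp add: abs_le_square_iff[symmetric])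
  qed
  obtain w1 where w1: "\<And>u. Y' u \<le> Y' w1" using lin_max[OF t, of "- s" p] by (auto simp: Y'_def)
  obtain w2 where w2: "\<And>u. - Y' u \<le> - Y' w2" using lin_max[OF t, of s "- p"] by (auto simp: Y'_def)
  have W: "\<bar>Y' u\<bar> \<le> max \<bar>Y' w1\<bar> \<bar>Y' w2\<bar>" for u using w1[of u] w2[of u] by linarith
  obtain w0 where w0: "\<And>u. \<bar>Y' u\<bar> \<le> \<bar>Y' w0\<bar>"
  proof (cases "\<bar>Y' w2\<bar> \<le> \<bar>Y' w1\<bar>")
    case True
    show thesis by (rule that[of w1]) (use W True in auto)
  next
    case False
    show thesis by (rule that[of w2]) (use W False in auto)
  qed
  define h where "h = \<bar>Y' w0\<bar>"
  have Yh: "\<bar>Y' u\<bar> \<le> h" for u using w0 by (simp add: h_def)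
  have h: "h > 0"
  proof -
    have "(- s, p) \<noteq> (0, 0)" using ps by auto
    then obtain c d where "lin (- s) p c t \<noteq> lin (- s) p d t" using nd unfolding nondegenerate_def by blast
    then have "Y' c \<noteq> Y' d" by (simp add: Y'_def)
    then show ?thesis using Yh[of c] Yh[of d] by linarith
  qed
  have ar: "area u v w t = (X' v - X' u) * (Y' w - Y' u) - (Y' v - Y' u) * (X' w - X' u)" for u v w
  proof -
    have "(X' v - X' u) * (Y' w - Y' u) - (Y' v - Y' u) * (X' w - X' u) = (p\<^sup>2 + s\<^sup>2) * area u v w t"
      by (simp add: area_def X'_def Y'_def power2_eq_square algebra_simps)
    then show ?thesis using ps by simp
  qed
  show ?thesis 
  proof (rule that[OF ps L h, of u0 c1 c2 v0 w0])
    show "\<bar>area u0 v0 w0 t\<bar> = L * h" unfolding ar X0 V0 using L by (simp add: abs_mult h_def)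
    show "\<bar>area u v w t\<bar> \<le> 2 * (L * h)" for u v w
    proof -
      have pos: "X' u * A \<le> L * max A 0" and neg: "L * min A 0 \<le> X' u * A" for u A
        using mult_right_mono[OF Xle[of u], of A] mult_right_mono_neg[OF Xle[of u], of A]
          mult_nonneg_nonneg[OF Xge[of u], of A] mult_nonneg_nonpos[OF Xge[of u], of A]
        by (auto simp: max_def min_def)
      \<comment> \<open>The doubled area is a combination of first coordinates in
        \<open>[0, L]\<close>; the positive parts of the coefficients add up to at most
        \<open>2 * h\<close>, and so do the negative parts in absolute value.\<close>
      define A B C where "A = Y' v - Y' w" and "B = Y' w - Y' u" and "C = Y' u - Y' v"
      have e: "area u v w t = X' u * A + X' v * B + X' w * C"
        unfolding ar A_def B_def C_def by (simp add: algebra_simps)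
      have "max A 0 + max B 0 + max C 0 \<le> 2 * h" "- (2 * h) \<le> min A 0 + min B 0 + min C 0"
        using Yh[of u] Yh[of v] Yh[of w] unfolding A_def B_def C_def by linarith+
      then have "L * (max A 0 + max B 0 + max C 0) \<le> L * (2 * h)"
        "L * (- (2 * h)) \<le> L * (min A 0 + min B 0 + min C 0)"
        using L by (intro mult_left_mono; simp)+
      then show ?thesis
        using pos[of u A] pos[of v B] pos[of w C] neg[of A u] neg[of B v] neg[of C w]
        unfolding e distrib_left by (simp add: abs_le_iff)
    qed
  qed (use X0 V0 Xle Xge Yh uv in \<open>simp_all only: X'_def Y'_def h_def L_def\<close>)
qed

text \<open>Along a diameter the curve lies in a box of length \<open>L\<close> and height
  \<open>2 * h\<close>, where doubled triangle areas are at most \<open>2 * L * h\<close>; hence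
  \<open>\<eta> * L \<le> 2 * h\<close>. This turns the ratios \<open>3 * h / (32 * L)\<close> and
  \<open>4 * h / L\<close> into multiples of \<open>\<eta>\<close>, and failing the threshold means
  that \<open>h / L\<close> is small.\<close>

lemma fat_step:
  assumes t: "0 < t0" "t0 < t" "t < T" and \<rho>: "0 < \<rho>" "\<rho> \<le> 1"
    and r: "\<And>u s. t0 \<le> s \<Longrightarrow> s < T \<Longrightarrow> \<rho> \<le> r2 u s"
    and nd: "\<And>s. t0 \<le> s \<Longrightarrow> s < T \<Longrightarrow> nondegenerate s"
    and \<epsilon>: "\<epsilon> = \<rho> / 128000" and thin: "\<not> fat (\<epsilon>\<^sup>2 * \<rho> / 128) t0" and f: "fat \<eta> t0"
  shows "fat (3 / 64 * \<eta>) t \<or> (\<exists>t1\<in>{t0<..t}. fat (2 * \<eta>) t1)"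
proof -
  have t0: "t0 \<in> I" using t by auto
  have nd0: "nondegenerate t0" by (rule nd) (use t in auto)
  obtain p s c1 c2 L h u0 v0 w0 where ps: "p\<^sup>2 + s\<^sup>2 = 1" and Lh: "L > 0" "h > 0"
    and F: "lin p s u0 t0 - c1 = 0" "lin (- s) p u0 t0 - c2 = 0" "lin p s v0 t0 - c1 = L" "lin (- s) p v0 t0 - c2 = 0"
      "\<bar>lin (- s) p w0 t0 - c2\<bar> = h" 
    and box: "\<And>u. 0 \<le> lin p s u t0 - c1" "\<And>u. lin p s u t0 - c1 \<le> L" "\<And>u. \<bar>lin (- s) p u t0 - c2\<bar> \<le> h"
    and dm: "\<And>u v. dist (pt u t0) (pt v t0) \<le> L" and a0: "\<bar>area u0 v0 w0 t0\<bar> = L * h" 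
    and a2: "\<And>u v w. \<bar>area u v w t0\<bar> \<le> 2 * (L * h)"
    by (rule diameter_frame[OF t0 nd0]) (rule that)
  define x' where "x' = (\<lambda>u t. lin p s u t - c1)"
  define y' where "y' = (\<lambda>u t. lin (- s) p u t - c2)"
  interpret R: planar_flow \<gamma> T D x' y' unfolding x'_def y'_def by (rule rotated_flow[OF ps])
  have L2: "(dist (pt c t0) (pt d t0))\<^sup>2 \<le> L\<^sup>2" for c d using dm[of c d] Lh by (intro power_mono) auto
  have thin': "128 * h \<le> \<epsilon>\<^sup>2 * \<rho> * L"
  proof (rule ccontr)
    assume "\<not> ?thesis"
    then have "\<epsilon>\<^sup>2 * \<rho> / 128 * L \<le> h" by simp
    then have "\<epsilon>\<^sup>2 * \<rho> / 128 * L * L \<le> h * L" using Lh by (intro mult_right_mono) auto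
    then have 1: "\<epsilon>\<^sup>2 * \<rho> / 128 * L\<^sup>2 \<le> L * h" by (simp add: power2_eq_square mult.commute)
    have "\<epsilon>\<^sup>2 * \<rho> / 128 * (dist (pt c t0) (pt d t0))\<^sup>2 \<le> \<bar>area u0 v0 w0 t0\<bar>" for c d
      unfolding a0 by (rule order_trans[OF mult_left_mono[OF L2] 1]) (use \<rho> in simp)
    then show False using thin unfolding fat_def by blast
  qed
  have r2': "R.r2 u t = r2 u t" for u t
  proof -
    have 1: "S x' u t = p * S x u t + s * S y u t" "S y' u t = - s * S x u t + p * S y u t"
      by (simp_all add: x'_def y'_def S_simps)
    have "R.r2 u t = (p\<^sup>2 + s\<^sup>2) * r2 u t" unfolding R.r2_def r2_def 1 by (simp add: power2_eq_square algebra_simps)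
    then show ?thesis using ps by simp
  qed
  have nd': "R.nondegenerate t" if n: "nondegenerate t" for t
    unfolding R.nondegenerate_def
  proof (intro allI impI)
    fix a b :: real assume ab: "(a, b) \<noteq> (0, 0)"
    have "(a * p - b * s)\<^sup>2 + (a * s + b * p)\<^sup>2 = (p\<^sup>2 + s\<^sup>2) * (a\<^sup>2 + b\<^sup>2)"
      by (simp add: power2_eq_square algebra_simps)
    also have "\<dots> \<noteq> 0" using ab ps by (auto simp: sum_power2_eq_zero_iff)
    finally have "(a * p - b * s, a * s + b * p) \<noteq> (0, 0)" by auto
    then obtain u v where "lin (a * p - b * s) (a * s + b * p) u t \<noteq> lin (a * p - b * s) (a * s + b * p) v t"
      using n unfolding nondegenerate_def by blast
    then have "R.lin a b u t \<noteq> R.lin a b v t" by (auto simp: x'_def y'_def algebra_simps)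
    then show "\<exists>u v. R.lin a b u t \<noteq> R.lin a b v t" by blast
  qed
  have d': "dist (R.pt c t) (R.pt d t) = dist (pt c t) (pt d t)" for c d t
  proof -
    have "(x' c t - x' d t)\<^sup>2 + (y' c t - y' d t)\<^sup>2 = (p\<^sup>2 + s\<^sup>2) * ((x c t - x d t)\<^sup>2 + (y c t - y d t)\<^sup>2)"
      by (simp add: x'_def y'_def power2_eq_square algebra_simps)
    then show ?thesis using ps unfolding R.pt_def pt_def by (simp add: dist_Pair_Pair dist_real_def)
  qed
  have area': "R.area u v w t = area u v w t" for u v w t
  proof -
    have "R.area u v w t = (p\<^sup>2 + s\<^sup>2) * area u v w t"
      unfolding R.area_def area_def by (simp add: x'_def y'_def power2_eq_square algebra_simps)
    then show ?thesis using ps by simp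
  qed
  have m: "R.pt u0 t0 = (0, 0)" "R.pt v0 t0 = (L, 0)" "R.pt w0 t0 = (x' w0 t0, y' w0 t0)"
    using F unfolding R.pt_def by (simp_all add: x'_def y'_def)
  have tri: "(0, 0) \<in> R.K t0" "(L, 0) \<in> R.K t0" "(x' w0 t0, y' w0 t0) \<in> R.K t0"
    using R.pt_K[of u0 t0] R.pt_K[of v0 t0] R.pt_K[of w0 t0] unfolding m by blast+
  have box': "\<And>u. 0 \<le> x' u t0" "\<And>u. x' u t0 \<le> L" "\<And>u. \<bar>y' u t0\<bar> \<le> h"
    unfolding x'_def y'_def by (rule box)+
  have \<eta>: "\<eta> * L \<le> 2 * h"
  proof -
    have "dist (R.pt u0 t0) (R.pt v0 t0) = L" unfolding m using Lh by (simp add: dist_Pair_Pair dist_real_def)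
    then have "\<eta> * L\<^sup>2 \<le> 2 * (L * h)" using f a2 unfolding fat_def d' by (metis order_trans)
    then have "L * (\<eta> * L) \<le> L * (2 * h)" by (simp add: power2_eq_square algebra_simps)
    then show ?thesis using Lh by simp
  qed
  have "(\<exists>u v w. \<forall>c d. 3 * h / (32 * L) * (dist (R.pt c t) (R.pt d t))\<^sup>2 \<le> \<bar>R.area u v w t\<bar>) \<or>
    (\<exists>t1\<in>{t0<..t}. \<exists>u v w. \<forall>c d. 4 * h / L * (dist (R.pt c t1) (R.pt d t1))\<^sup>2 \<le> \<bar>R.area u v w t1\<bar>)"
  proof (rule R.area_or_improved_area[OF t \<rho> _ _ tri _ Lh(2) box'(1,2) box' \<epsilon> thin'])
    show "\<bar>y' w0 t0\<bar> = h" using F(5) by (simp only: y'_def)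
    show "\<rho> \<le> R.r2 u s" if "t0 \<le> s" "s < T" for u s unfolding r2' by (rule r[OF that])
    show "R.nondegenerate s" if "t0 \<le> s" "s < T" for s by (rule nd'[OF nd[OF that]])
  qed
  then have "fat (3 * h / (32 * L)) t \<or> (\<exists>t1\<in>{t0<..t}. fat (4 * h / L) t1)"
    unfolding d' area' fat_def .
  moreover have "3 / 64 * \<eta> \<le> 3 * h / (32 * L)" "2 * \<eta> \<le> 4 * h / L" using \<eta> Lh by (simp_all add: field_simps)
  ultimately show ?thesis using fat_mono by blast
qed

text \<open>The diameter does not grow, so forward in time the continuity of a single triangle's
  area is enough.\<close>

lemma fat_open_right:
  assumes t: "t \<in> I" and nd: "nondegenerate t" and f: "fat \<eta> t" and \<eta>: "0 < \<eta>'" "\<eta>' < \<eta>"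
  obtains \<delta> where "\<delta> > 0" "\<And>s. t \<le> s \<Longrightarrow> s < t + \<delta> \<Longrightarrow> fat \<eta>' s"
proof -
  obtain u v w where uvw: "\<And>c d. \<eta> * (dist (pt c t) (pt d t))\<^sup>2 \<le> \<bar>area u v w t\<bar>"
    using f by (auto simp: fat_def)
  obtain c0 d0 where cd: "\<And>c d. dist (pt c t) (pt d t) \<le> dist (pt c0 t) (pt d0 t)"
    by (rule distance_attained[OF t]) (rule that)
  define L where "L = dist (pt c0 t) (pt d0 t)"
  have L: "L > 0"
  proof -
    have "\<exists>c d. lin 1 0 c t \<noteq> lin 1 0 d t"
      by (rule nd[unfolded nondegenerate_def, rule_format]) simp
    then obtain c d where "lin 1 0 c t \<noteq> lin 1 0 d t" by blast
    then have "pt c t \<noteq> pt d t" by (auto simp: pt_def)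
    then have "0 < dist (pt c t) (pt d t)" by simp
    then show ?thesis using cd[of c d] unfolding L_def by (rule less_le_trans)
  qed
  have big: "\<eta> * L\<^sup>2 \<le> \<bar>area u v w t\<bar>" using uvw by (simp add: L_def)
  have cont: "isCont (\<lambda>s. z c s) t" if "z \<in> J" for z c
    using J_dt[OF that t, of c] by (rule DERIV_isCont)
  have "isCont (\<lambda>s. \<bar>area u v w s\<bar>) t"
    unfolding area_def by (intro continuous_intros cont x_J y_J)
  moreover have at: "\<eta>' * L\<^sup>2 < \<bar>area u v w t\<bar>"
  proof -
    have "\<eta>' * L\<^sup>2 < \<eta> * L\<^sup>2" using L \<eta>(2) by (intro mult_strict_right_mono) auto
    then show ?thesis using big by linarith
  qed
  ultimately have "\<forall>\<^sub>F s in at t. \<eta>' * L\<^sup>2 < \<bar>area u v w s\<bar>"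
    unfolding isCont_def by (rule order_tendstoD(1))
  then obtain d where d: "d > 0" "\<And>s. s \<noteq> t \<Longrightarrow> dist s t < d \<Longrightarrow> \<eta>' * L\<^sup>2 < \<bar>area u v w s\<bar>"
    unfolding eventually_at by auto
  show ?thesis
  proof (rule that[of "min d (T - t)"])
    show "min d (T - t) > 0" using d t by simp
    fix s assume s: "t \<le> s" "s < t + min d (T - t)"
    have 1: "\<eta>' * L\<^sup>2 \<le> \<bar>area u v w s\<bar>"
    proof (cases "s = t")
      case True
      then show ?thesis using at by simp
    next
      case False
      moreover have "dist s t < d" using s unfolding dist_real_def by linarith
      ultimately show ?thesis using d(2)[of s] by simp
    qed
    have "\<eta>' * (dist (pt c s) (pt d s))\<^sup>2 \<le> \<bar>area u v w s\<bar>" for c d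
    proof -
      have "dist (pt c s) (pt d s) \<le> L"
        by (rule diameter_decreasing[of t s]) (use s t cd in \<open>auto simp: L_def\<close>)
      then have "\<eta>' * (dist (pt c s) (pt d s))\<^sup>2 \<le> \<eta>' * L\<^sup>2"
        using \<eta> by (intro mult_left_mono power_mono) auto
      then show ?thesis using 1 by simp
    qed
    then show "fat \<eta>' s" unfolding fat_def by blast
  qed
qed

text \<open>With vertices reduced modulo the period, pairs of a time and a witnessing triangle form
  a compact set, whose projection to time has a maximum.\<close>

lemma last_fat_time:
  assumes t: "0 < t0" "t0 \<le> t1" "t1 < T" and f: "fat \<eta> t0"
  obtains s where "s \<in> {t0..t1}" "fat \<eta> s" "\<And>s'. s' \<in> {s<..t1} \<Longrightarrow> \<not> fat \<eta> s'"
proof -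
  define Q where "Q = {t0..t1} \<times> {0..2*pi} \<times> {0..2*pi} \<times> {0..2*pi::real}"
  define P where "P = Q \<inter> (\<Inter>c. \<Inter>d. {z\<in>Q. \<eta> * (dist (pt c (fst z)) (pt d (fst z)))\<^sup>2
      \<le> \<bar>area (fst (snd z)) (fst (snd (snd z))) (snd (snd (snd z))) (fst z)\<bar>})"
  have cQ: "compact Q" unfolding Q_def by (intro compact_Times compact_Icc)
  have cont: "continuous_on Q (\<lambda>z. f (g z) (fst z))" if "f \<in> J" "continuous_on Q g" for f and g :: "real \<times> real \<times> real \<times> real \<Rightarrow> real"
  proof -
    have "{t0..t1} \<subseteq> I" using t by auto
    then have "continuous_on Q (\<lambda>z. (\<lambda>(u, t). f u t) (g z, fst z))"
    proof (rule continuous_on_compose2[OF J_cont_on[OF that(1)]])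
      show "continuous_on Q (\<lambda>z. (g z, fst z))"
        by (rule continuous_on_Pair[OF that(2) continuous_on_fst[OF continuous_on_id]])
      show "(\<lambda>z. (g z, fst z)) ` Q \<subseteq> UNIV \<times> {t0..t1}" by (auto simp: Q_def)
    qed
    then show ?thesis by simp
  qed
  have "closed (\<Inter>c. \<Inter>d. {z\<in>Q. \<eta> * (dist (pt c (fst z)) (pt d (fst z)))\<^sup>2
      \<le> \<bar>area (fst (snd z)) (fst (snd (snd z))) (snd (snd (snd z))) (fst z)\<bar>})"
  proof (intro closed_INT ballI continuous_on_closed_Collect_le compact_imp_closed[OF cQ])
    note cxy = cont[OF x_J] cont[OF y_J]
    show "continuous_on Q (\<lambda>z. \<eta> * (dist (pt c (fst z)) (pt d (fst z)))\<^sup>2)" for c d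
      unfolding pt_def by (intro continuous_intros cxy)
    show "continuous_on Q (\<lambda>z. \<bar>area (fst (snd z)) (fst (snd (snd z))) (snd (snd (snd z))) (fst z)\<bar>)"
      unfolding area_def by (intro continuous_intros cxy)
  qed
  then have cP: "compact P" unfolding P_def by (intro compact_Int_closed cQ)
  have A: "s \<in> fst ` P \<longleftrightarrow> s \<in> {t0..t1} \<and> fat \<eta> s" for s
  proof
    assume "s \<in> {t0..t1} \<and> fat \<eta> s"
    then have s: "s \<in> {t0..t1}" "s \<in> I" and "fat \<eta> s" using t by auto
    then obtain u v w where uvw: "\<And>c d. \<eta> * (dist (pt c s) (pt d s))\<^sup>2 \<le> \<bar>area u v w s\<bar>"
      by (auto simp: fat_def)
    have red: "\<exists>u'\<in>{0..2*pi}. pt u' s = pt u s" for u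
    proof -
      obtain n :: int where "0 \<le> u + of_int n * (2 * pi)" "u + of_int n * (2 * pi) < 0 + 2 * pi"
        using periodic_reduce[of "2 * pi" 0 u] by auto
      then show ?thesis using pt_periodic[OF s(2), of u n] by (intro bexI[of _ "u + of_int n * (2 * pi)"]) auto
    qed
    obtain u' v' w' where r: "u' \<in> {0..2*pi}" "v' \<in> {0..2*pi}" "w' \<in> {0..2*pi}"
      "pt u' s = pt u s" "pt v' s = pt v s" "pt w' s = pt w s"
      using red[of u] red[of v] red[of w] by blast
    then have "area u' v' w' s = area u v w s" by (simp add: area_def pt_def)
    then have "(s, u', v', w') \<in> P" using r(1-3) s(1) uvw by (simp add: P_def Q_def)
    then show "s \<in> fst ` P" by (intro image_eqI[of _ fst]) auto
  next
    assume "s \<in> fst ` P"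
    then obtain u v w where "(s, u, v, w) \<in> P" by auto
    then show "s \<in> {t0..t1} \<and> fat \<eta> s" unfolding P_def Q_def fat_def by auto
  qed
  have "compact (fst ` P)" by (intro compact_continuous_image cP continuous_intros)
  moreover have "fst ` P \<noteq> {}" using A[of t0] f t by auto
  ultimately obtain s where s: "s \<in> fst ` P" "\<And>s'. s' \<in> fst ` P \<Longrightarrow> s' \<le> s"
    using compact_attains_sup by metis
  show ?thesis
  proof (rule that[of s])
    show "s \<in> {t0..t1}" "fat \<eta> s" using s(1) A by blast+
    show "\<not> fat \<eta> s'" if s': "s' \<in> {s<..t1}" for s'
    proof
      assume "fat \<eta> s'"
      then have "s' \<le> s" using s(2) A[of s'] s' \<open>s \<in> {t0..t1}\<close> by auto
      then show False using s' by simp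
    qed
  qed
qed

text \<open>Beyond the last time with ratio \<open>\<eta>\<close>, the doubling alternative of
  \<open>fat_step\<close> is excluded, so the ratio keeps a fixed fraction of
  \<open>\<eta>\<close>.\<close>

lemma uniformly_fat:
  assumes t: "0 < ts" "ts < T" and \<rho>: "0 < \<rho>" "\<rho> \<le> 1"
    and r: "\<And>u s. ts \<le> s \<Longrightarrow> s < T \<Longrightarrow> \<rho> \<le> r2 u s"
    and nd: "\<And>s. ts \<le> s \<Longrightarrow> s < T \<Longrightarrow> nondegenerate s"
  obtains \<eta> where "\<eta> > 0" "\<And>t. ts \<le> t \<Longrightarrow> t < T \<Longrightarrow> fat \<eta> t"
proof -
  define \<epsilon> where "\<epsilon> = \<rho> / 128000"
  have tsI: "ts \<in> I" using t by simp
  obtain \<eta>0 where \<eta>0: "\<eta>0 > 0" "fat \<eta>0 ts"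
  proof -
    obtain p s c1 c2 L h u0 v0 w0 where Lh: "L > (0::real)" "h > 0"
      and dm: "\<And>u v. dist (pt u ts) (pt v ts) \<le> L" and a0: "\<bar>area u0 v0 w0 ts\<bar> = L * h" 
      by (rule diameter_frame[OF tsI nd]) (use t in auto)
    have "h / L * (dist (pt c ts) (pt d ts))\<^sup>2 \<le> \<bar>area u0 v0 w0 ts\<bar>" for c d
    proof -
      have "h / L * (dist (pt c ts) (pt d ts))\<^sup>2 \<le> h / L * L\<^sup>2"
        using Lh dm[of c d] by (intro mult_left_mono power_mono) auto
      also have "\<dots> = L * h" using Lh by (simp add: power2_eq_square)
      finally show ?thesis by (simp add: a0)
    qed
    then have "fat (h / L) ts" unfolding fat_def by blast
    then show thesis using Lh by (intro that[of "h / L"]) auto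
  qed
  define \<eta> where "\<eta> = min \<eta>0 (\<epsilon>\<^sup>2 * \<rho> / 128)"
  have \<eta>: "\<eta> > 0" "\<eta> \<le> \<epsilon>\<^sup>2 * \<rho> / 128" using \<rho> \<eta>0 by (auto simp: \<eta>_def \<epsilon>_def)
  have fts: "fat \<eta> ts" using \<eta>0 fat_mono by (auto simp: \<eta>_def)
  have "fat (3 / 128 * \<eta>) t" if tt: "ts \<le> t" "t < T" for t
  proof -
    obtain s where s: "s \<in> {ts..t}" "fat \<eta> s" "\<And>s'. s' \<in> {s<..t} \<Longrightarrow> \<not> fat \<eta> s'"
      by (rule last_fat_time[OF t(1) tt fts]) (rule that)
    show ?thesis
    proof (cases "s = t")
      case True
      then show ?thesis using s(2) \<eta> by (intro fat_mono[OF s(2)[unfolded True]]) auto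
    next
      case False
      then have st: "s < t" using s(1) by simp
      have "s \<in> I" using s(1) t tt by auto
      then obtain \<delta> where \<delta>: "\<delta> > 0" "\<And>s'. s \<le> s' \<Longrightarrow> s' < s + \<delta> \<Longrightarrow> fat (\<eta> / 2) s'"
        by (rule fat_open_right[OF _ nd s(2), of "\<eta> / 2"]) (use s(1) st tt \<eta> in auto)
      \<comment> \<open>Slightly after \<open>s\<close> the curve is still fat for
        \<open>\<eta> / 2\<close> but already below the threshold of \<open>fat_step\<close>.
        Doubling \<open>\<eta> / 2\<close> would restore \<open>\<eta>\<close> after its last
        time.\<close>
      define s' where "s' = s + min (\<delta> / 2) ((t - s) / 2)"
      have "min (\<delta> / 2) ((t - s) / 2) > 0" "min (\<delta> / 2) ((t - s) / 2) < \<delta>" "min (\<delta> / 2) ((t - s) / 2) < t - s"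
        using \<delta>(1) st unfolding min_def by (cases "\<delta> / 2 \<le> (t - s) / 2"; simp)+
      then have s': "s < s'" "s' < s + \<delta>" "s' < t" by (auto simp: s'_def)
      have thin: "\<not> fat (\<epsilon>\<^sup>2 * \<rho> / 128) s'" using s(3)[of s'] s' fat_mono \<eta>(2) by auto
      have "fat (3 / 64 * (\<eta> / 2)) t \<or> (\<exists>t1\<in>{s'<..t}. fat (2 * (\<eta> / 2)) t1)"
        by (rule fat_step[OF _ s'(3) tt(2) \<rho> _ _ \<epsilon>_def thin])
          (use s(1) s' t r nd \<delta>(2)[of s'] in auto)
      then show ?thesis using s(3) s' by auto
    qed
  qed
  then show ?thesis using \<eta>(1) by (intro that[of "3 / 128 * \<eta>"]) auto
qed

end

section \<open>The initial curve\<close>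

text \<open>The segment from \<open>c u1\<close> to \<open>c u3\<close>, projected radially from an
  interior point \<open>p\<close> below level \<open>k\<close>, gives a connected piece
  \<open>Z\<close> of the frontier above level \<open>k\<close>. The arcs over
  \<open>[u2, u4]\<close> and \<open>[u4, u2 + 2 * pi]\<close> cover the frontier and share only
  their end points, which lie below \<open>k\<close>, so they would separate
  \<open>Z\<close>.\<close>

lemma convex_curve_no_alternation:
  fixes c :: "real \<Rightarrow> 'a::euclidean_space"
  assumes C: "compact C" "convex C" "interior C \<noteq> {}" "range c = frontier C"
    and cont: "continuous_on UNIV c" and per: "\<And>u. c (u + 2 * pi) = c u"
    and inj: "\<And>u v. c u = c v \<Longrightarrow> [u = v] (rmod (2 * pi))"
    and u: "u1 < u2" "u2 < u3" "u3 < u4" "u4 < u1 + 2 * pi"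
    and w: "k < w \<bullet> c u1" "w \<bullet> c u2 < k" "k < w \<bullet> c u3" "w \<bullet> c u4 < k"
  shows False
proof -
  have FC: "frontier C \<subseteq> C" using compact_imp_closed[OF C(1)] by (simp add: frontier_subset_closed)
  have cC: "c v \<in> C" for v using FC C(4) by blast
  obtain p where p: "p \<in> interior C" "w \<bullet> p < k"
  proof -
    have "c u2 \<in> closure (interior C)"
      using convex_closure_interior[OF C(2,3)] cC closure_subset by fastforce
    moreover have "open {z. w \<bullet> z < k}" by (rule open_halfspace_lt)
    ultimately have "interior C \<inter> {z. w \<bullet> z < k} \<noteq> {}"
      using w(2) by (auto simp: closure_iff_nhds_not_empty)
    then show thesis using that by blast
  qed
  define Fr where "Fr = (\<lambda>z. z - p) ` frontier C"
  have mem_Fr: "z \<in> Fr \<longleftrightarrow> p + z \<in> frontier C" for z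
    by (auto simp: Fr_def image_iff algebra_simps)
  have inter: "p + j *\<^sub>R z \<in> interior C" if "z \<in> Fr" "0 \<le> j" "j < 1" for z j
  proof -
    have "p + z \<in> closure C" using that(1) unfolding mem_Fr by (simp add: frontier_def)
    then have "(p + z) - (1 - j) *\<^sub>R ((p + z) - p) \<in> interior C"
      using that by (intro mem_interior_closure_convex_shrink[OF C(2) p(1)]) auto
    then show ?thesis by (simp add: algebra_simps)
  qed
  have uniq: "j = 1" if z: "z \<in> Fr" "j *\<^sub>R z \<in> Fr" "j > 0" for z j
  proof (rule ccontr)
    assume "j \<noteq> 1"
    then have "j < 1 \<or> inverse j < 1" using z(3) by (auto simp: field_simps)
    then show False
      using inter[OF z(1), of j] inter[OF z(2), of "inverse j"] z unfolding mem_Fr frontier_def by auto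
  qed
  \<comment> \<open>The factor that carries \<open>z\<close> to the frontier as seen from
    \<open>p\<close>; its uniqueness and the compactness of the frontier make the radial projection
    continuous.\<close>
  define d where "d z = (THE j. 0 < j \<and> j *\<^sub>R z \<in> Fr)" for z
  have ex1: "\<exists>!j. 0 < j \<and> j *\<^sub>R z \<in> Fr" if z: "z \<noteq> 0" for z
  proof -
    obtain j where j: "0 < j" "p + j *\<^sub>R z \<in> frontier C"
      using ray_to_frontier[OF compact_imp_bounded[OF C(1)] p(1) z] by metis
    show ?thesis
    proof (rule ex1I[of _ j])
      show "0 < j \<and> j *\<^sub>R z \<in> Fr" using j by (simp add: mem_Fr)
      fix i assume i: "0 < i \<and> i *\<^sub>R z \<in> Fr"
      have "(i / j) *\<^sub>R (j *\<^sub>R z) \<in> Fr" using i j by simp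
      then have "i / j = 1" using i j by (intro uniq[of "j *\<^sub>R z"]) (auto simp: mem_Fr)
      then show "i = j" using j by simp
    qed
  qed
  have d_iff: "0 < j \<and> j *\<^sub>R z \<in> Fr \<longleftrightarrow> d z = j" if "z \<in> UNIV - {0}" for z j
    unfolding d_def using ex1[of z] that the1_equality[OF ex1] by (metis (no_types, lifting) DiffD2 insertI1 theI')
  have d: "d z > 0" "p + d z *\<^sub>R z \<in> frontier C" if "z \<noteq> 0" for z
    using d_iff[of z "d z"] that by (simp_all add: mem_Fr)
  have "compact Fr" unfolding Fr_def
    by (intro compact_continuous_image continuous_intros compact_frontier C)
  moreover have "Fr \<subseteq> UNIV - {0}" using p(1) by (auto simp: mem_Fr frontier_def)
  moreover have "cone (UNIV :: 'a set)" by (simp add: cone_def)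
  ultimately have cd: "continuous_on (UNIV - {0}) (\<lambda>z. d z *\<^sub>R z)"
    using d_iff by (rule continuous_on_compact_surface_projection)
  define \<pi> where "\<pi> z = p + d (z - p) *\<^sub>R (z - p)" for z
  define Z where "Z = \<pi> ` closed_segment (c u1) (c u3)"
  have seg: "z \<in> C" "k < w \<bullet> z" if "z \<in> closed_segment (c u1) (c u3)" for z
  proof -
    have "closed_segment (c u1) (c u3) \<subseteq> C" by (rule closed_segment_subset[OF cC cC C(2)])
    then show "z \<in> C" using that by blast
    have "closed_segment (c u1) (c u3) \<subseteq> {z. w \<bullet> z > k}"
      by (rule closed_segment_subset) (use w in \<open>auto intro: convex_halfspace_gt\<close>)
    then show "k < w \<bullet> z" using that by blast
  qed
  have connZ: "connected Z"
  proof -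
    have "continuous_on (closed_segment (c u1) (c u3)) (\<lambda>z. (\<lambda>z. d z *\<^sub>R z) (z - p))"
      by (rule continuous_on_compose2[OF cd]) (use seg(2)[of p] p(2) in \<open>auto intro!: continuous_intros\<close>)
    then show ?thesis unfolding Z_def \<pi>_def
      by (intro connected_continuous_image continuous_on_add[OF continuous_on_const]) auto
  qed
  have proj: "\<pi> z = z" if "z \<in> frontier C" "z \<noteq> p" for z
  proof -
    have "d (z - p) = 1" using d_iff[of "z - p" 1] that by (simp add: mem_Fr)
    then show ?thesis by (simp add: \<pi>_def)
  qed
  have c13: "c u1 \<in> Z" "c u3 \<in> Z"
    unfolding Z_def using proj[of "c u1"] proj[of "c u3"] C(4) w p(2) by (force intro!: image_eqI)+
  have Zw: "z \<in> frontier C" "k < w \<bullet> z" if zZ: "z \<in> Z" for z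
  proof -
    obtain y where y: "y \<in> closed_segment (c u1) (c u3)" "z = \<pi> y" using zZ by (auto simp: Z_def)
    have yp: "y - p \<noteq> 0" using seg(2)[OF y(1)] p(2) by auto
    then show "z \<in> frontier C" using d(2)[of "y - p"] y(2) by (simp add: \<pi>_def)
    \<comment> \<open>Points of the segment are moved outwards, away from a point below level
      \<open>k\<close>, which only raises their value under \<open>w\<close>.\<close>
    have "d (y - p) \<ge> 1"
    proof (rule ccontr)
      define e where "e = d (y - p)"
      assume "\<not> d (y - p) \<ge> 1"
      then have e: "e < 1" "0 < e" using d(1)[OF yp] by (simp_all add: e_def)
      have "y \<in> closure C" using seg(1)[OF y(1)] closure_subset by blast
      then have "y - (1 - e) *\<^sub>R (y - p) \<in> interior C"
        using e by (intro mem_interior_closure_convex_shrink[OF C(2) p(1)]) auto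
      then have "p + e *\<^sub>R (y - p) \<in> interior C" by (simp add: algebra_simps)
      then show False using d(2)[OF yp] by (simp add: e_def frontier_def)
    qed
    moreover have "w \<bullet> (y - p) > 0" using seg(2)[OF y(1)] p(2) by (simp add: inner_diff_right)
    ultimately have "1 * (w \<bullet> (y - p)) \<le> d (y - p) * (w \<bullet> (y - p))" by (intro mult_right_mono) auto
    then have "w \<bullet> y \<le> w \<bullet> z" by (simp add: y(2) \<pi>_def inner_add_right inner_diff_right)
    then show "k < w \<bullet> z" using seg(2)[OF y(1)] by simp
  qed
  define A where "A = c ` {u2..u4}"
  define B where "B = c ` {u4..u2 + 2 * pi}"
  have closed: "closed A" "closed B" unfolding A_def B_def
    by (intro compact_imp_closed compact_continuous_image continuous_on_subset[OF cont]; simp)+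
  have shift: "c (v + of_int n * (2 * pi)) = c v" for v n
    by (rule periodic_int) (rule per)
  have "Z \<subseteq> A \<union> B"
  proof
    fix z assume "z \<in> Z"
    then obtain v where v: "z = c v" using Zw(1) C(4) by blast
    obtain n :: int where n: "u2 \<le> v + of_int n * (2 * pi)" "v + of_int n * (2 * pi) < u2 + 2 * pi"
      using periodic_reduce[of "2 * pi" u2 v] by auto
    then have "v + of_int n * (2 * pi) \<in> {u2..u4} \<or> v + of_int n * (2 * pi) \<in> {u4..u2 + 2 * pi}" by auto
    then show "z \<in> A \<union> B" using shift[of v n] unfolding v A_def B_def by (metis UnI1 UnI2 imageI)
  qed
  moreover have "A \<inter> B \<inter> Z = {}"
  proof -
    have False if z: "z \<in> A" "z \<in> B" "z \<in> Z" for z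
    proof -
      obtain s s' where s: "s \<in> {u2..u4}" "s' \<in> {u4..u2 + 2 * pi}" "z = c s" "z = c s'"
        using z by (auto simp: A_def B_def)
      then have "[s = s'] (rmod (2 * pi))" by (intro inj) simp
      then obtain n :: int where n: "s' = s + of_int n * (2 * pi)"
        unfolding rcong_altdef by (auto simp: mult.commute)
      have "of_int n * (2 * pi) \<ge> 0" "of_int n * (2 * pi) \<le> 1 * (2 * pi)"
        using s(1,2) unfolding n atLeastAtMost_iff by linarith+
      then have "0 \<le> n" "n \<le> 1" using pi_gt_zero by (simp_all add: zero_le_mult_iff del: pi_gt_zero)
      then have "n = 0 \<or> n = 1" by auto
      then have "s = u4 \<or> s = u2" using n s by auto
      then show False using Zw(2)[OF z(3)] s(3) w by auto
    qed
    then show ?thesis by blast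
  qed
  moreover have "c u3 \<in> A \<inter> Z" using c13 u by (auto simp: A_def)
  moreover have "c u1 \<in> B \<inter> Z"
    using c13 u per[of u1] by (auto simp: B_def intro!: image_eqI[of _ c "u1 + 2 * pi"])
  ultimately show False
    using connZ closed unfolding connected_closed by blast
qed

text \<open>Rays from an interior point in the directions \<open>w\<close> and \<open>- w\<close>
  hit the frontier at different levels.\<close>

lemma convex_curve_not_straight:
  fixes c :: "real \<Rightarrow> 'a::euclidean_space"
  assumes C: "bounded C" "interior C \<noteq> {}" "range c = frontier C" and w: "w \<noteq> 0"
  shows "\<exists>u v. w \<bullet> c u \<noteq> w \<bullet> c v"
proof -
  obtain p where p: "p \<in> interior C" using C(2) by blast
  have mw: "- w \<noteq> 0" using w by simp
  obtain d where d: "0 < d" "p + d *\<^sub>R w \<in> frontier C" using ray_to_frontier[OF C(1) p w] by metis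
  obtain e where e: "0 < e" "p + e *\<^sub>R - w \<in> frontier C" using ray_to_frontier[OF C(1) p mw] by metis
  obtain u v where uv: "c u = p + d *\<^sub>R w" "c v = p - e *\<^sub>R w"
    using d(2) e(2) unfolding C(3)[symmetric] by auto
  have "w \<bullet> w > 0" using w by simp
  then have "d * (w \<bullet> w) > 0" "e * (w \<bullet> w) > 0" using d e by simp_all
  moreover have "w \<bullet> c u - w \<bullet> c v = d * (w \<bullet> w) + e * (w \<bullet> w)"
    unfolding uv by (simp add: inner_add_right inner_diff_right)
  ultimately have "w \<bullet> c u - w \<bullet> c v > 0" by linarith
  then have "w \<bullet> c u \<noteq> w \<bullet> c v" by auto
  then show ?thesis by blast
qed

context csf_flow
begin

lemma X_cont: "continuous_on (UNIV \<times> {0..<T}) (\<lambda>(u, t). X i u t)"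
proof -
  have "continuous_on (UNIV \<times> {0..<T}) (\<lambda>z. (\<lambda>(u, t). D 0 0 u t) z $ i)"
    by (intro continuous_intros D_cont)
  then show ?thesis by (rule continuous_on_eq) (auto simp: X_def D0)
qed

lemma X_cont_t: "continuous_on {0..<T} (\<lambda>t. X i u t)"
proof -
  have "continuous_on {0..<T} (\<lambda>t. (\<lambda>(u, t). X i u t) (u, t))"
    by (rule continuous_on_compose2[OF X_cont]) (auto intro!: continuous_intros)
  then show ?thesis by simp
qed

text \<open>The equation holds at positive times. An alternation at \<open>t1\<close> is carried
  back to each of them with a margin bounded below, and closedness of the alternating times in
  \<open>[0, t1]\<close> passes it on to the initial curve.\<close>

lemma tame_of_initial:
  assumes w: "caloric w" "continuous_on (UNIV \<times> {0..<T}) (\<lambda>(u, t). w u t)" "\<And>u. w (u + 2 * pi) 0 = w u 0"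
    and init: "\<And>c \<epsilon>. \<epsilon> > 0 \<Longrightarrow> \<not> alternates \<epsilon> (\<lambda>u. w u 0 + c)"
  shows "tame w"
proof -
  have False if \<epsilon>: "\<epsilon> > 0" and t1: "t1 \<in> I" and alt: "alternates \<epsilon> (\<lambda>u. w u t1 + c)" for c \<epsilon> t1
  proof -
    define f where "f = (\<lambda>u t. w u t + c)"
    have fcal: "caloric f" unfolding f_def by (intro caloric_intros w)
    have fJ: "f \<in> J" by (rule caloric_J[OF fcal])
    define l where "l t = \<epsilon> * exp (t - t1)" for t
    have per: "f (u + 2 * pi) t = f u t" if "t \<in> {0..t1}" for u t
      using periodic[OF fJ, of t u] w(3)[of u] that t1 by (cases "t = 0") (auto simp: f_def)
    have cl: "closed {t \<in> {0..t1}. alternates (l t) (\<lambda>u. f u t)}"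
    proof (rule alternates_closed)
      have "continuous_on (UNIV \<times> {0..<T}) (\<lambda>z. (\<lambda>(u, t). w u t) z + c)"
        by (intro continuous_intros w(2))
      then have "continuous_on (UNIV \<times> {0..<T}) (\<lambda>(u, t). f u t)"
        by (simp add: f_def case_prod_unfold)
      then show "continuous_on (UNIV \<times> {0..t1}) (\<lambda>(u, t). f u t)"
        by (rule continuous_on_subset) (use t1 in auto)
      show "continuous_on {0..t1} l" unfolding l_def by (intro continuous_intros)
    qed (use \<epsilon> per in \<open>simp_all add: l_def\<close>)
    have "{0<..t1} \<subseteq> {t \<in> {0..t1}. alternates (l t) (\<lambda>u. f u t)}"
    proof
      fix t assume t: "t \<in> {0<..t1}"
      have "alternates (\<epsilon> * exp ((0 + 1) * (t - t1))) (\<lambda>u. f u t)"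
        by (rule alternates_backward[OF fJ _ _ _ _ \<epsilon>]) (use t t1 alt fcal in \<open>auto simp: f_def caloric_def\<close>)
      then show "t \<in> {t \<in> {0..t1}. alternates (l t) (\<lambda>u. f u t)}" using t by (simp add: l_def)
    qed
    then have "closure {0<..t1} \<subseteq> {t \<in> {0..t1}. alternates (l t) (\<lambda>u. f u t)}"
      by (rule closure_minimal[OF _ cl])
    moreover have "0 \<in> closure {0<..t1}" using t1 by simp
    ultimately have "alternates (l 0) (\<lambda>u. w u 0 + c)" by (auto simp: f_def)
    then show False using init[of "l 0" c] \<epsilon> by (simp add: l_def)
  qed
  then show ?thesis using w(1) unfolding tame_def by blast
qed

lemma planar_flow_of_initial:
  assumes ij: "ix \<noteq> iy" and init: "one_to_one_convex_projection ix iy (\<lambda>u. \<gamma> u 0)"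
  shows "planar_flow \<gamma> T D (X ix) (X iy)"
    and "\<exists>\<delta>>0. \<delta> < T \<and> (\<forall>t. 0 < t \<longrightarrow> t \<le> \<delta> \<longrightarrow> (\<forall>a b. (a, b) \<noteq> (0, 0) \<longrightarrow>
      (\<exists>u v. a * X ix u t + b * X iy u t \<noteq> a * X ix v t + b * X iy v t)))"
proof -
  obtain C where C: "compact C" "convex C" "interior C \<noteq> {}" "range (\<lambda>u. Pxy ix iy (\<gamma> u 0)) = frontier C"
    and inj: "\<And>u v. Pxy ix iy (\<gamma> u 0) = Pxy ix iy (\<gamma> v 0) \<Longrightarrow> [u = v] (rmod (2 * pi))"
    using init unfolding one_to_one_convex_projection_def by blast
  define c where "c u = Pxy ix iy (\<gamma> u 0)" for u
  note C' = C[folded c_def] and inj' = inj[folded c_def]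
  have wc: "vector [a, b] \<bullet> c u = a * X ix u 0 + b * X iy u 0" for a b :: real and u
    by (simp add: c_def Pxy_def X_def inner_vec_def sum_2)
  have per: "X i (u + 2 * pi) 0 = X i u 0" for i u
    using csf T_pos unfolding csf_def X_def by auto
  have cont0: "continuous_on UNIV (\<lambda>u. X i u 0)" for i
  proof -
    have "continuous_on UNIV (\<lambda>u. (\<lambda>(u, t). X i u t) (u, 0))"
      by (rule continuous_on_compose2[OF X_cont]) (use T_pos in \<open>auto intro!: continuous_intros\<close>)
    then show ?thesis by simp
  qed
  have cc: "continuous_on UNIV c"
  proof -
    have "c = (\<lambda>u. \<chi> i. if i = 1 then X ix u 0 else X iy u 0)"
      by (simp add: c_def Pxy_def X_def fun_eq_iff vec_eq_iff forall_2)
    moreover have "continuous_on UNIV (\<lambda>u. \<chi> i::2. if i = 1 then X ix u 0 else X iy u 0)"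
    proof (rule continuous_on_vec_lambda)
      show "continuous_on UNIV (\<lambda>u. if i = 1 then X ix u 0 else X iy u 0)" for i :: 2
        by (cases "i = 1") (simp_all add: cont0)
    qed
    ultimately show ?thesis by simp
  qed
  have cper: "c (u + 2 * pi) = c u" for u
    using per[of ix u] per[of iy u] by (simp add: c_def Pxy_def X_def)
  show "planar_flow \<gamma> T D (X ix) (X iy)"
  proof
    show "caloric (X ix)" "caloric (X iy)" by (rule caloric_X)+
    show "tame (\<lambda>u t. a * X ix u t + b * X iy u t)" for a b
    proof (rule tame_of_initial)
      show "caloric (\<lambda>u t. a * X ix u t + b * X iy u t)"
        by (intro caloric_add caloric_cmult caloric_X)
      have "continuous_on (UNIV \<times> {0..<T}) (\<lambda>z. a * (\<lambda>(u, t). X ix u t) z + b * (\<lambda>(u, t). X iy u t) z)"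
        by (intro continuous_intros X_cont)
      then show "continuous_on (UNIV \<times> {0..<T}) (\<lambda>(u, t). a * X ix u t + b * X iy u t)"
        by (simp add: case_prod_unfold)
      show "a * X ix (u + 2 * pi) 0 + b * X iy (u + 2 * pi) 0 = a * X ix u 0 + b * X iy u 0" for u
        by (simp add: per)
      show "\<not> alternates \<epsilon> (\<lambda>u. a * X ix u 0 + b * X iy u 0 + k)" if \<epsilon>: "\<epsilon> > 0" for k \<epsilon>
      proof
        assume "alternates \<epsilon> (\<lambda>u. a * X ix u 0 + b * X iy u 0 + k)"
        then obtain u1 u2 u3 u4 where "u1 < u2" "u2 < u3" "u3 < u4" "u4 < u1 + 2 * pi"
          "\<epsilon> \<le> vector [a, b] \<bullet> c u1 + k" "vector [a, b] \<bullet> c u2 + k \<le> - \<epsilon>"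
          "\<epsilon> \<le> vector [a, b] \<bullet> c u3 + k" "vector [a, b] \<bullet> c u4 + k \<le> - \<epsilon>"
          unfolding alternates_def wc by blast
        then show False
          using \<epsilon> by (intro convex_curve_no_alternation[OF C' cc cper inj', of u1 u2 u3 u4 "- k" "vector [a, b]"]) auto
      qed
    qed
    fix u t assume "t \<in> I"
    then have "(\<Sum>i\<in>UNIV. (S (X i) u t)\<^sup>2) = 1" by (rule unit_tangent)
    moreover have "(\<Sum>i\<in>{ix, iy}. (S (X i) u t)\<^sup>2) \<le> (\<Sum>i\<in>UNIV. (S (X i) u t)\<^sup>2)"
      by (intro sum_mono2) auto
    ultimately show "(S (X ix) u t)\<^sup>2 + (S (X iy) u t)\<^sup>2 \<le> 1" using ij by simp
  qed
  have nd: "\<exists>u v. a * X ix u 0 + b * X iy u 0 \<noteq> a * X ix v 0 + b * X iy v 0" if ab: "(a, b) \<noteq> (0, 0)" for a b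
  proof -
    have "vector [a, b] \<noteq> (0 :: real^2)" using ab by (simp add: vec_eq_iff forall_2)
    then have "\<exists>u v. vector [a, b] \<bullet> c u \<noteq> vector [a, b] \<bullet> c v"
      by (rule convex_curve_not_straight[OF compact_imp_bounded[OF C'(1)] C'(3,4)])
    then show ?thesis unfolding wc .
  qed
  \<comment> \<open>Twice the area of an inscribed triangle: nonzero at time 0 for some triangle and
    continuous in time, hence nonzero for a while, which keeps the projection off every
    line.\<close>
  define \<Delta> where "\<Delta> u v w t = (X ix v t - X ix u t) * (X iy w t - X iy u t) - (X iy v t - X iy u t) * (X ix w t - X ix u t)" for u v w t
  obtain u v w where uvw: "\<Delta> u v w 0 \<noteq> 0"
  proof -
    obtain u v where uv: "X ix u 0 \<noteq> X ix v 0" using nd[of 1 0] by auto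
    define a b where "a = - (X iy v 0 - X iy u 0)" and "b = X ix v 0 - X ix u 0"
    have "(a, b) \<noteq> (0, 0)" using uv by (simp add: b_def)
    then obtain w w' where "a * X ix w 0 + b * X iy w 0 \<noteq> a * X ix w' 0 + b * X iy w' 0" using nd by blast
    then have "\<Delta> u v w 0 \<noteq> \<Delta> u v w' 0" by (simp add: \<Delta>_def a_def b_def algebra_simps)
    then show thesis using that[of u v w] that[of u v w'] by (cases "\<Delta> u v w 0 = 0") simp_all
  qed
  have "continuous_on {0..<T} (\<lambda>t. \<Delta> u v w t)" unfolding \<Delta>_def by (intro continuous_intros X_cont_t)
  then have "(\<Delta> u v w \<longlongrightarrow> \<Delta> u v w 0) (at 0 within {0..<T})"
    using T_pos by (auto simp: continuous_on_def)
  then have "\<forall>\<^sub>F t in at 0 within {0..<T}. \<Delta> u v w t \<noteq> 0"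
    using uvw by (rule tendsto_imp_eventually_ne)
  then obtain d where d: "d > 0" "\<And>t. t \<in> {0..<T} \<Longrightarrow> t \<noteq> 0 \<Longrightarrow> dist t 0 < d \<Longrightarrow> \<Delta> u v w t \<noteq> 0"
    unfolding eventually_at by auto
  define \<delta> where "\<delta> = min d T / 2"
  have \<delta>: "\<delta> > 0" "\<delta> < T" "\<delta> < d" using d(1) T_pos by (auto simp: \<delta>_def min_def)
  have "\<exists>u v. a * X ix u t + b * X iy u t \<noteq> a * X ix v t + b * X iy v t"
    if t: "0 < t" "t \<le> \<delta>" and ab: "(a, b) \<noteq> (0, 0)" for t a b
  proof (rule ccontr)
    assume n: "\<not> ?thesis"
    have 1: "a * (X ix v t - X ix u t) = - b * (X iy v t - X iy u t)"
    proof -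
      have "a * X ix v t + b * X iy v t = a * X ix u t + b * X iy u t" using n by blast
      then show ?thesis by (simp add: algebra_simps)
    qed
    have 2: "a * (X ix w t - X ix u t) = - b * (X iy w t - X iy u t)"
    proof -
      have "a * X ix w t + b * X iy w t = a * X ix u t + b * X iy u t" using n by blast
      then show ?thesis by (simp add: algebra_simps)
    qed
    have "a * \<Delta> u v w t = 0" "b * \<Delta> u v w t = 0" using 1 2 unfolding \<Delta>_def by algebra+
    moreover have "\<Delta> u v w t \<noteq> 0" using d(2)[of t] t \<delta> by auto
    ultimately show False using ab by simp
  qed
  then show "\<exists>\<delta>>0. \<delta> < T \<and> (\<forall>t. 0 < t \<longrightarrow> t \<le> \<delta> \<longrightarrow> (\<forall>a b. (a, b) \<noteq> (0, 0) \<longrightarrow>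
      (\<exists>u v. a * X ix u t + b * X iy u t \<noteq> a * X ix v t + b * X iy v t)))" using \<delta> by blast
qed

end

context planar_flow
begin

text \<open>If a linear function were constant, all tangents would be orthogonal to its gradient;
  where the perpendicular function is maximal the projected tangent would then vanish.\<close>

lemma nondegenerate_of_speed:
  assumes t: "t \<in> I" and r: "\<And>u. 0 < r2 u t"
  shows "nondegenerate t"
  unfolding nondegenerate_def
proof (intro allI impI, rule ccontr)
  fix a b :: real assume ab: "(a, b) \<noteq> (0, 0)" and n: "\<not> (\<exists>u v. lin a b u t \<noteq> lin a b v t)"
  have "lin a b v t \<le> lin a b u t" for u v using n by (metis order_refl)
  then have 1: "a * S x u t + b * S y u t = 0" for u
    using local_max_conditions(1)[OF lin_J t zero_less_one, of u a b] unfolding S_lin by auto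
  obtain u where u: "\<And>v. lin (- b) a v t \<le> lin (- b) a u t" using lin_max[OF t] by blast
  then have 2: "- b * S x u t + a * S y u t = 0"
    using local_max_conditions(1)[OF lin_J t zero_less_one, of u "- b" a] unfolding S_lin by auto
  have "(a\<^sup>2 + b\<^sup>2) * r2 u t = (a * S x u t + b * S y u t)\<^sup>2 + (- b * S x u t + a * S y u t)\<^sup>2"
    unfolding r2_def by algebra
  also have "\<dots> = 0" unfolding 1 2 by simp
  finally show False using ab r[of u] by (auto simp: sum_power2_eq_zero_iff)
qed

end

section \<open>The curvature bound\<close>

context csf_flow
begin

lemma normal_derivative: "(\<Sum>i\<in>UNIV. S (S (X i)) u t * S (S (S (X i))) u t) = S q u t / 2"
  unfolding q_def[abs_def] by (simp add: S_simps J_intros sum_distrib_left[symmetric] mult.assoc)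

text \<open>The commutator is applied twice; the terms with \<open>S q\<close> drop out because
  tangent and curvature vector are orthogonal.\<close>

lemma q_evolution:
  "Dt q u t = S (S q) u t - 2 * (\<Sum>i\<in>UNIV. (S (S (S (X i))) u t)\<^sup>2) + 4 * (q u t)\<^sup>2"
proof -
  have 1: "Dt (S (S (X i))) u t = S (S (S (S (X i)))) u t + S q u t * S (X i) u t + 2 * q u t * S (S (X i)) u t" for i
    by (simp add: Dt_S heat S_simps J_intros q_J algebra_simps)
  have "Dt q u t = (\<Sum>i\<in>UNIV. 2 * S (S (X i)) u t * Dt (S (S (X i))) u t)"
    unfolding q_def[abs_def] by (simp add: Dt_simps J_intros)
  also have "\<dots> = (\<Sum>i\<in>UNIV. 2 * (S (S (X i)) u t * S (S (S (S (X i)))) u t)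
      + 2 * S q u t * (S (X i) u t * S (S (X i)) u t) + 4 * q u t * (S (S (X i)) u t)\<^sup>2)"
    unfolding 1 by (intro sum.cong) (auto simp: algebra_simps power2_eq_square)
  also have "\<dots> = 2 * (\<Sum>i\<in>UNIV. S (S (X i)) u t * S (S (S (S (X i)))) u t) + 4 * (q u t)\<^sup>2"
    by (simp add: sum.distrib sum_distrib_left[symmetric] tangent_normal q_def[symmetric])
      (simp add: power2_eq_square)
  finally have 2: "Dt q u t = 2 * (\<Sum>i\<in>UNIV. S (S (X i)) u t * S (S (S (S (X i)))) u t) + 4 * (q u t)\<^sup>2" .
  have "S q = (\<lambda>u t. \<Sum>i\<in>UNIV. 2 * S (S (X i)) u t * S (S (S (X i))) u t)"
    unfolding q_def[abs_def] by (simp add: S_simps J_intros)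
  then have "S (S q) u t = (\<Sum>i\<in>UNIV. 2 * (S (S (X i)) u t * S (S (S (S (X i)))) u t) + 2 * (S (S (S (X i))) u t)\<^sup>2)"
    by (simp add: S_simps J_intros power2_eq_square algebra_simps)
  then have "S (S q) u t = 2 * (\<Sum>i\<in>UNIV. S (S (X i)) u t * S (S (S (S (X i)))) u t) + 2 * (\<Sum>i\<in>UNIV. (S (S (S (X i))) u t)\<^sup>2)"
    by (simp add: sum.distrib sum_distrib_left[symmetric])
  then show ?thesis using 2 by simp
qed

text \<open>Bessel's inequality for the third derivative in the directions of tangent and normal.\<close>

lemma third_derivative_bound:
  assumes t: "t \<in> I"
  shows "(q u t)\<^sup>2 + c * S q u t - c\<^sup>2 * q u t \<le> (\<Sum>i\<in>UNIV. (S (S (S (X i))) u t)\<^sup>2)"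
proof -
  define k where "k = q u t"
  have "0 \<le> (\<Sum>i\<in>UNIV. (S (S (S (X i))) u t + k * S (X i) u t - c * S (S (X i)) u t)\<^sup>2)"
    by (intro sum_nonneg) simp
  also have "\<dots> = (\<Sum>i\<in>UNIV. (S (S (S (X i))) u t)\<^sup>2 + k\<^sup>2 * (S (X i) u t)\<^sup>2 + c\<^sup>2 * (S (S (X i)) u t)\<^sup>2
      + 2 * k * (S (X i) u t * S (S (S (X i))) u t) - 2 * c * (S (S (X i)) u t * S (S (S (X i))) u t)
      - 2 * c * k * (S (X i) u t * S (S (X i)) u t))"
    by (intro sum.cong) (auto simp: power2_eq_square algebra_simps)
  also have "\<dots> = (\<Sum>i\<in>UNIV. (S (S (S (X i))) u t)\<^sup>2) + k\<^sup>2 + c\<^sup>2 * k + 2 * k * (- k) - 2 * c * (S q u t / 2)"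
    by (simp add: sum.distrib sum_subtractf sum_distrib_left[symmetric] unit_tangent[OF t] tangent_normal
        tangent_third normal_derivative q_def[symmetric] k_def)
  finally show ?thesis by (simp add: k_def power2_eq_square algebra_simps)
qed

end

context planar_flow
begin

lemma cross_K:
  assumes s: "\<And>v. \<sigma> * cross c v t \<ge> 0" and m: "m \<in> K t"
  shows "\<sigma> * (S x c t * (snd m - y c t) - S y c t * (fst m - x c t)) \<ge> 0"
proof -
  have "(\<sigma> * S y c t, - \<sigma> * S x c t) \<bullet> m \<le> \<sigma> * S y c t * x c t + - \<sigma> * S x c t * y c t"
    by (rule K_le[OF m]) (use s in \<open>simp add: cross_def algebra_simps\<close>)
  then show ?thesis by (cases m) (simp add: algebra_simps)
qed

text \<open>Leaving the hull on a segment from \<open>G\<close> to \<open>m\<close> would meet the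
  curve, which fills the frontier, inside the disc.\<close>

lemma disc_in_K:
  assumes t: "t \<in> I" and G: "G \<in> K t" and d: "\<And>c. r < dist (pt c t) G" and m: "dist m G \<le> r"
  shows "m \<in> K t"
proof (rule ccontr)
  assume nm: "m \<notin> K t"
  have "closed_segment G m \<inter> frontier (K t) \<noteq> {}"
    by (rule connected_Int_frontier) (use G nm in auto)
  then obtain z where z: "z \<in> closed_segment G m" "z \<in> frontier (K t)" by blast
  then have zK: "z \<in> K t" "z \<notin> interior (K t)"
    using closed_K[OF t] by (auto simp: frontier_def)
  obtain u where u: "pt u t = z" by (rule frontier_K_curve[OF t zK])
  have "dist z G \<le> dist m G" using segment_bound(1)[OF z(1)] by (simp add: dist_norm norm_minus_commute)
  then show False using d[of u] m u by simp
qed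

text \<open>The distance of the centroid from a tangent line is the mean of the distances of the
  three vertices, all on the same side. A triangle of given area and bounded diameter cannot have
  all vertices close to one line, so the centroid stays away from every tangent line and thereby
  from the curve.\<close>

lemma fat_centroid:
  assumes t: "t \<in> I" and f: "fat \<eta> t" and L: "L > 0" "\<And>u v. dist (pt u t) (pt v t) \<le> L"
    "dist (pt a t) (pt b t) = L" and r: "\<And>u. 0 < r2 u t" and \<eta>: "\<eta> > 0"
  obtains G where "G \<in> K t" "\<And>c. \<eta> * L / 6 \<le> dist (pt c t) G" "\<And>c. dist (pt c t) G \<le> L"
proof -
  obtain u v w where f: "\<And>c d. \<eta> * (dist (pt c t) (pt d t))\<^sup>2 \<le> \<bar>area u v w t\<bar>" using f by (auto simp: fat_def)
  have ar: "\<eta> * L\<^sup>2 \<le> \<bar>area u v w t\<bar>" using f[of a b] L(3) by simp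
  define G where "G = (1/3) *\<^sub>R pt u t + (1/3) *\<^sub>R pt v t + (1/3) *\<^sub>R pt w t"
  show ?thesis
  proof (rule that[of G])
    have "G \<in> convex hull {pt u t, pt v t, pt w t}"
      unfolding convex_hull_3 G_def
      by (intro CollectI exI[of _ "1/3 :: real"] conjI) simp_all
    also have "\<dots> \<subseteq> K t" by (rule hull_minimal) (auto simp: pt_K convex_K)
    finally show "G \<in> K t" .
    fix c
    have eG: "pt c t - G = (1/3) *\<^sub>R (pt c t - pt u t) + ((1/3) *\<^sub>R (pt c t - pt v t) + (1/3) *\<^sub>R (pt c t - pt w t))"
    proof -
      have "pt c t = (1/3) *\<^sub>R pt c t + ((1/3) *\<^sub>R pt c t + (1/3) *\<^sub>R pt c t)"
        by (simp add: scaleR_add_left[symmetric])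
      then show ?thesis unfolding G_def by (simp add: algebra_simps)
    qed
    have "dist (pt c t) G \<le> 1/3 * dist (pt c t) (pt u t) + (1/3 * dist (pt c t) (pt v t) + 1/3 * dist (pt c t) (pt w t))"
      unfolding dist_norm eG by (intro norm_triangle_mono) auto
    then show "dist (pt c t) G \<le> L" using L(2)[of c u] L(2)[of c v] L(2)[of c w] by linarith
    define p where "p = S x c t"
    define s where "s = S y c t"
    define R where "R = r2 c t"
    have R: "R > 0" "R = p\<^sup>2 + s\<^sup>2" using r[of c] by (simp_all add: R_def r2_def p_def s_def)
    have cr: "cross c k t = p * (y k t - y c t) - s * (x k t - x c t)" for k by (simp add: cross_def p_def s_def)
    define \<tau> where "\<tau> k = p * (x k t - x u t) + s * (y k t - y u t)" for k
    define M where "M = sqrt R * L"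
    have M: "M \<ge> 0" using L(1) R(1) by (simp add: M_def)
    have \<tau>: "\<bar>\<tau> k\<bar> \<le> M" for k
    proof -
      have "\<tau> k = (p, s) \<bullet> (pt k t - pt u t)" by (simp add: \<tau>_def pt_def)
      also have "\<bar>\<dots>\<bar> \<le> norm (p, s) * norm (pt k t - pt u t)" by (rule Cauchy_Schwarz_ineq2)
      also have "\<dots> \<le> M"
        unfolding M_def using L(2)[of k u] by (intro mult_mono) (auto simp: norm_Pair R(2) dist_norm)
      finally show ?thesis .
    qed
    define \<zeta> where "\<zeta> k = \<bar>cross c k t\<bar>" for k
    have \<zeta>: "\<zeta> k \<ge> 0" for k by (simp add: \<zeta>_def)
    \<comment> \<open>The curve lies on one side of its tangent line at \<open>c\<close>, so the
      three terms do not cancel.\<close>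
    have sg: "\<bar>cross c u t + cross c v t + cross c w t\<bar> = \<zeta> u + \<zeta> v + \<zeta> w"
      using cross_sign[OF t, of c] unfolding \<zeta>_def by (smt (verit))
    \<comment> \<open>The area in the frame of tangent and normal at \<open>c\<close>:
      \<open>\<tau>\<close> is the tangential and \<open>cross\<close> the normal coordinate, both
      scaled by the projected speed.\<close>
    have e: "R * area u v w t = \<tau> v * (cross c w t - cross c u t) - (cross c v t - cross c u t) * \<tau> w"
      unfolding R(2) cr \<tau>_def area_def by algebra
    have "\<bar>R * area u v w t\<bar> \<le> \<bar>\<tau> v\<bar> * \<bar>cross c w t - cross c u t\<bar> + \<bar>cross c v t - cross c u t\<bar> * \<bar>\<tau> w\<bar>"
      unfolding e abs_mult[symmetric] by (rule abs_triangle_ineq4)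
    also have "\<dots> \<le> M * (2 * (\<zeta> u + \<zeta> v + \<zeta> w))"
    proof -
      have "\<bar>cross c w t - cross c u t\<bar> \<le> \<zeta> w + \<zeta> u" "\<bar>cross c v t - cross c u t\<bar> \<le> \<zeta> v + \<zeta> u"
        unfolding \<zeta>_def by linarith+
      then have "\<bar>\<tau> v\<bar> * \<bar>cross c w t - cross c u t\<bar> \<le> M * (\<zeta> w + \<zeta> u)"
        "\<bar>cross c v t - cross c u t\<bar> * \<bar>\<tau> w\<bar> \<le> (\<zeta> v + \<zeta> u) * M"
        using \<tau>[of v] \<tau>[of w] M \<zeta> by (intro mult_mono; simp)+
      moreover have "M * \<zeta> v \<ge> 0" "M * \<zeta> w \<ge> 0" using M \<zeta> by simp_all
      ultimately show ?thesis by (simp add: algebra_simps)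
    qed
    finally have 1: "R * \<bar>area u v w t\<bar> \<le> M * (2 * (\<zeta> u + \<zeta> v + \<zeta> w))" using R(1) by (simp add: abs_mult)
    have "\<zeta> u + \<zeta> v + \<zeta> w = \<bar>3 * ((- s, p) \<bullet> (G - pt c t))\<bar>"
      unfolding sg[symmetric] cr by (simp add: G_def pt_def algebra_simps)
    also have "\<dots> \<le> 3 * (norm (- s, p) * norm (G - pt c t))" using Cauchy_Schwarz_ineq2[of "(- s, p)" "G - pt c t"] by simp
    also have "\<dots> = 3 * sqrt R * dist (pt c t) G"
      by (simp add: norm_Pair R(2) dist_norm norm_minus_commute add.commute)
    finally have 2: "\<zeta> u + \<zeta> v + \<zeta> w \<le> 3 * sqrt R * dist (pt c t) G" .
    have "R * (\<eta> * L\<^sup>2) \<le> R * \<bar>area u v w t\<bar>" using ar R(1) by simp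
    also note 1
    also have "M * (2 * (\<zeta> u + \<zeta> v + \<zeta> w)) \<le> M * (2 * (3 * sqrt R * dist (pt c t) G))"
      using 2 M by (intro mult_left_mono) auto
    also have "\<dots> = R * L * (6 * dist (pt c t) G)" using R(1) by (simp add: M_def)
    finally have "(R * L) * (\<eta> * L) \<le> (R * L) * (6 * dist (pt c t) G)" by (simp add: power2_eq_square algebra_simps)
    then show "\<eta> * L / 6 \<le> dist (pt c t) G" using R(1) L(1) by simp
  qed
qed

text \<open>Tso's estimate: the curvature is compared with the support function about an interior point.\<close>

lemma curvature_support_bound:
  assumes t: "0 < t0" "t0 < t1" "t1 < T"
    and acc: "\<And>u t. t \<in> I \<Longrightarrow> (S (S x) u t)\<^sup>2 + (S (S y) u t)\<^sup>2 \<le> q u t"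
    and \<sigma>: "\<sigma> \<in> {1, - 1}" "\<And>u v t. t \<in> {t0..t1} \<Longrightarrow> \<sigma> * cross u v t \<ge> 0"
    and P: "P = (\<lambda>u t. \<sigma> * (S x u t * (g2 - y u t) - S y u t * (g1 - x u t)))"
    and lower: "\<And>u t. t \<in> {t0..t1} \<Longrightarrow> 2 * c \<le> P u t" and c: "c > 0"
    and time: "t1 - t0 \<le> c\<^sup>2"
  shows "(t1 - t0) * q u t1 \<le> 9 / c\<^sup>2 * (P u t1 - c)\<^sup>2"
proof -
  \<comment> \<open>With \<open>X = A * W * c * r\<close>, the value 9 gives
    \<open>9 * r \<le> X\<close> and \<open>3 * (A * W) \<le> X\<close>, so
    \<open>r + 4 * (A * W) \<le> 13 / 9 * X < 2 * X\<close>, which is the final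
    contradiction.\<close>
  define A where "A = 9 / c\<^sup>2"
  have A: "A > 0" "A * c\<^sup>2 = 9" using c by (simp_all add: A_def)
  have PJ: "P \<in> J" unfolding P by simp
  have SSP: "S (S P) u t = \<sigma> * (S (S (S x)) u t * (g2 - y u t) - S (S (S y)) u t * (g1 - x u t)) + \<sigma> * \<beta> u t" for u t
    unfolding P \<beta>_def by (simp add: S_simps S_cmult algebra_simps)
  have DP: "Dt P u t = S (S P) u t + q u t * P u t - 2 * (\<sigma> * \<beta> u t)" for u t
    unfolding SSP unfolding P \<beta>_def by (simp add: Dt_simps Dt_cmult Dt_S Dt_x Dt_y S_simps algebra_simps)
  \<comment> \<open>\<open>P\<close> is the support function times the projected speed. Subtracting
    \<open>c\<close> leaves the term \<open>c * q\<close> in the evolution of \<open>w\<close>: the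
    main quadratic terms cancel against those of \<open>q\<close>, and this one absorbs the
    rest.\<close>
  define w where "w = (\<lambda>u t. P u t - c)"
  have wJ: "w \<in> J" using PJ by (simp add: w_def)
  have Sw: "S w = S P" and Dw: "Dt w = Dt P" using PJ by (simp_all add: w_def S_simps Dt_simps)
  define z where "z = (\<lambda>(u::real) t. t - t0)"
  have zJ: "z \<in> J" unfolding z_def using time_J by simp
  define F where "F = (\<lambda>u t. z u t * q u t - A * (w u t)\<^sup>2)"
  have FJ: "F \<in> J" unfolding F_def using zJ q_J wJ by simp
  have Sz: "S z = (\<lambda>u t. 0)" unfolding z_def by (rule S_time)
  have SF: "S F = (\<lambda>u t. z u t * S q u t - 2 * A * (w u t * S w u t))"
    unfolding F_def using zJ q_J wJ by (simp add: S_simps S_cmult Sz fun_eq_iff)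
  have SSF: "S (S F) = (\<lambda>u t. z u t * S (S q) u t - 2 * A * ((S w u t)\<^sup>2 + w u t * S (S w) u t))"
    unfolding SF using zJ q_J wJ by (simp add: S_simps S_cmult Sz fun_eq_iff power2_eq_square)
  have DF: "Dt F u t = q u t + z u t * Dt q u t - 2 * A * (w u t * Dt w u t)" if tI: "t \<in> I" for u t
  proof -
    have "Dt z u t = 1" unfolding z_def by (rule dt_time[OF _ tI]) (auto intro!: derivative_eq_intros)
    then show ?thesis unfolding F_def using zJ q_J wJ by (simp add: Dt_simps Dt_cmult)
  qed
  have "F u t1 < 0"
  proof (rule max_principle_strict[OF FJ _ t(1,3), where G = "\<lambda>u t. 1"])
    show "(\<lambda>u t. 1) \<in> J" by simp
    show "F u t0 < 0" for u
      using lower[of t0 u] t c A by (auto simp: F_def z_def w_def)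
    fix u t assume tt: "t0 < t" "t \<le> t1" and F0: "F u t = 0" and S0: "S F u t = 0"
      and SS0: "S (S F) u t \<le> 0" and D0: "0 \<le> Dt F u t"
    have tI: "t \<in> I" using tt t by auto
    define \<tau> where "\<tau> = t - t0"
    have \<tau>: "\<tau> > 0" "\<tau> \<le> c\<^sup>2" "z u t = \<tau>" using tt time by (auto simp: \<tau>_def z_def)
    define Q W b where "Q = q u t" and "W = w u t" and "b = \<sigma> * \<beta> u t"
    define W1 W2 Q1 Q2 where "W1 = S w u t" and "W2 = S (S w) u t" and "Q1 = S q u t" and "Q2 = S (S q) u t"
    have W: "W \<ge> c" "P u t = W + c" using lower[of t u] tt by (auto simp: W_def w_def)
    have Wpos: "W > 0" using W c by simp
    have e0: "\<tau> * Q = A * W\<^sup>2" using F0 by (simp add: F_def \<tau>(3) Q_def W_def)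
    have Qpos: "Q > 0"
    proof -
      have "\<tau> * Q > 0" unfolding e0 using A Wpos by simp
      then show ?thesis using \<tau>(1) by (simp add: zero_less_mult_iff)
    qed
    have e1: "\<tau> * Q1 = 2 * A * (W * W1)" using S0 unfolding SF by (simp add: \<tau>(3) Q1_def W_def W1_def)
    have e2: "\<tau> * Q2 \<le> 2 * A * (W1\<^sup>2 + W * W2)" using SS0 unfolding SSF by (simp add: \<tau>(3) Q2_def W_def W1_def W2_def)
    have e3: "2 * A * (W * Dt w u t) \<le> Q + \<tau> * Dt q u t"
      using D0 unfolding DF[OF tI] by (simp add: \<tau>(3) Q_def W_def)
    \<comment> \<open>The logarithmic derivative of \<open>W\<close>: with this direction in
      \<open>third_derivative_bound\<close> all gradient terms cancel at the critical point of
      \<open>F\<close>.\<close>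
    define k where "k = W1 / W"
    have kW: "k * W = W1" using Wpos by (simp add: k_def)
    have "Dt q u t \<le> Q2 - 2 * (Q\<^sup>2 + k * Q1 - k\<^sup>2 * Q) + 4 * Q\<^sup>2"
      using q_evolution[of u t] third_derivative_bound[OF tI, of u k] by (simp add: Q_def Q1_def Q2_def)
    then have "\<tau> * Dt q u t \<le> \<tau> * (Q2 - 2 * (Q\<^sup>2 + k * Q1 - k\<^sup>2 * Q) + 4 * Q\<^sup>2)"
      using \<tau>(1) by (intro mult_left_mono) auto
    also have "\<dots> = \<tau> * Q2 + 2 * Q * (\<tau> * Q) - 2 * k * (\<tau> * Q1) + 2 * k\<^sup>2 * (\<tau> * Q)"
      by (simp add: power2_eq_square algebra_simps)
    also have "\<dots> = \<tau> * Q2 + 2 * Q * (A * W\<^sup>2) - 4 * A * ((k * W) * W1) + 2 * A * (k * W)\<^sup>2"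
      unfolding e0 e1 by (simp add: power2_eq_square algebra_simps)
    also have "\<dots> \<le> 2 * A * (W * W2) + 2 * Q * (A * W\<^sup>2)"
      using e2 unfolding kW by (simp add: power2_eq_square algebra_simps)
    finally have e4: "\<tau> * Dt q u t \<le> 2 * A * (W * W2) + 2 * Q * (A * W\<^sup>2)" .
    have Dw': "Dt w u t = W2 + Q * (W + c) - 2 * b"
      unfolding Dw DP by (simp add: W2_def Sw Q_def W(2) b_def)
    have "2 * A * (W * Dt w u t) = 2 * A * (W * W2) + 2 * Q * (A * W\<^sup>2) + 2 * A * W * c * Q - 4 * A * W * b"
      unfolding Dw' by (simp add: power2_eq_square algebra_simps)
    then have e5: "2 * A * W * c * Q \<le> Q + 4 * A * W * b" using e3 e4 by linarith
    define r where "r = sqrt Q"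
    have r: "r > 0" "r\<^sup>2 = Q" using Qpos by (simp_all add: r_def)
    \<comment> \<open>By Lagrange's identity a cross product is at most the product of the lengths;
      the projected tangent has length at most 1 and the projected curvature vector at most
      \<open>sqrt Q\<close>.\<close>
    have br: "b \<le> r"
    proof -
      have "b \<le> \<bar>\<beta> u t\<bar>" using \<sigma>(1) by (auto simp: b_def)
      moreover have "(\<beta> u t)\<^sup>2 \<le> ((S x u t)\<^sup>2 + (S y u t)\<^sup>2) * ((S (S x) u t)\<^sup>2 + (S (S y) u t)\<^sup>2)"
      proof -
        have "((S x u t)\<^sup>2 + (S y u t)\<^sup>2) * ((S (S x) u t)\<^sup>2 + (S (S y) u t)\<^sup>2) - (\<beta> u t)\<^sup>2
            = (S x u t * S (S x) u t + S y u t * S (S y) u t)\<^sup>2"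
          unfolding \<beta>_def by algebra
        then show ?thesis using zero_le_power2[of "S x u t * S (S x) u t + S y u t * S (S y) u t"] by linarith
      qed
      moreover have "((S x u t)\<^sup>2 + (S y u t)\<^sup>2) * ((S (S x) u t)\<^sup>2 + (S (S y) u t)\<^sup>2) \<le> 1 * Q"
        unfolding Q_def by (intro mult_mono proj_le acc tI) auto
      ultimately have "(\<beta> u t)\<^sup>2 \<le> r\<^sup>2" and bb: "b \<le> \<bar>\<beta> u t\<bar>" using r by simp_all
      then have "\<bar>\<beta> u t\<bar> \<le> r" using r abs_le_square_iff[of "\<beta> u t" r] by simp
      then show ?thesis using bb by linarith
    qed
    have AWc: "A * W * c \<ge> 9"
    proof -
      have "A * c\<^sup>2 \<le> A * (W * c)" using A W c by (intro mult_left_mono) (auto simp: power2_eq_square)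
      then show ?thesis unfolding A(2) by (simp add: mult.assoc)
    qed
    have rc: "3 \<le> r * c"
    proof -
      have "A * c\<^sup>2 \<le> A * W\<^sup>2" using A W c by (intro mult_left_mono power_mono) auto
      also have "\<dots> = \<tau> * Q" by (rule e0[symmetric])
      also have "\<dots> \<le> c\<^sup>2 * Q" using \<tau> Qpos by (intro mult_right_mono) auto
      also have "\<dots> = (r * c)\<^sup>2" using r by (simp add: power_mult_distrib mult.commute)
      finally have "3\<^sup>2 \<le> (r * c)\<^sup>2" using A by simp
      then show ?thesis by (rule power2_le_imp_le) (use r c in simp)
    qed
    have "A * W * b \<le> A * W * r" using br A Wpos by (intro mult_left_mono) auto
    then have "2 * A * W * c * r\<^sup>2 \<le> r\<^sup>2 + 4 * (A * W * r)" using e5 unfolding r(2) by linarith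
    then have "r * (2 * (A * W * c) * r) \<le> r * (r + 4 * (A * W))" by (simp add: power2_eq_square algebra_simps)
    then have 1: "2 * (A * W * c) * r \<le> r + 4 * (A * W)" using r by (simp only: mult_le_cancel_left_pos)
    have "A * W > 0" using A Wpos by simp
    have "A * W * 3 \<le> A * W * (r * c)" using rc \<open>A * W > 0\<close> by (intro mult_left_mono) auto
    moreover have "9 * r \<le> A * W * c * r" using AWc r by (intro mult_right_mono) auto
    ultimately show False using 1 \<open>A * W > 0\<close> r(1) by (simp add: algebra_simps)
  qed (use t in auto)
  then show ?thesis by (simp add: F_def z_def w_def A_def)
qed

text \<open>The support estimate is applied on an interval before \<open>t1\<close> proportional to
  the remaining time, about the centroid of a fat triangle at its start. The disc about the centroid
  survives because its radius is comparable to the diameter, and hence at least to the square root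
  of the remaining time.\<close>

lemma type_one_bound:
  assumes t: "0 < ts" "ts < T" and \<rho>: "0 < \<rho>" "\<rho> \<le> 1"
    and acc: "\<And>u t. t \<in> I \<Longrightarrow> (S (S x) u t)\<^sup>2 + (S (S y) u t)\<^sup>2 \<le> q u t"
    and r: "\<And>u s. ts \<le> s \<Longrightarrow> s < T \<Longrightarrow> \<rho> \<le> r2 u s"
    and f: "\<And>s. ts \<le> s \<Longrightarrow> s < T \<Longrightarrow> fat \<eta> s" and \<eta>: "0 < \<eta>" "\<eta> \<le> 1"
  obtains C t2 where "t2 < T" "\<And>u t. t2 < t \<Longrightarrow> t < T \<Longrightarrow> q u t * (T - t) \<le> C"
proof -
  have nd: "nondegenerate s" if "ts \<le> s" "s < T" for s
    by (rule nondegenerate_of_speed) (use that t \<rho> r less_le_trans in \<open>auto, fastforce\<close>)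
  have sub: "{ts..<T} \<subseteq> I" using t by auto
  obtain \<sigma> :: real where \<sigma>: "\<sigma> \<in> {1, -1}" "\<And>u v t. t \<in> {ts..<T} \<Longrightarrow> \<sigma> * cross u v t \<ge> 0"
    by (rule cross_orientation[OF sub]) (use nd in auto)
  \<comment> \<open>Chosen so that \<open>t1 - t0 \<le> c\<^sup>2\<close> holds below, where
    \<open>c\<^sup>2 = \<rho> * \<eta>\<^sup>2 * L\<^sup>2 / 576\<close> and
    \<open>L\<^sup>2 \<ge> 2 * \<rho> * (T - t0)\<close>.\<close>
  define a where "a = \<rho>\<^sup>2 * \<eta>\<^sup>2 / 288"
  have a: "a > 0" using \<rho> \<eta> by (simp add: a_def)
  \<comment> \<open>After \<open>t2\<close>, looking back from \<open>t1\<close> by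
    \<open>a * (T - t1)\<close> does not reach \<open>ts\<close>.\<close>
  define t2 where "t2 = (ts + a * T) / (1 + a)"
  have "q u t1 * (T - t1) \<le> 5184 / (\<rho> * \<eta>\<^sup>2 * a)" if t1: "t2 < t1" "t1 < T" for u t1
  proof -
    define t0 where "t0 = t1 - a * (T - t1)"
    have t0: "ts < t0" "t0 < t1" "t1 - t0 = a * (T - t1)"
    proof -
      have "ts + a * T < t1 * (1 + a)" using t1(1) a by (simp add: t2_def field_simps)
      then show "ts < t0" by (simp add: t0_def algebra_simps)
      show "t0 < t1" "t1 - t0 = a * (T - t1)" using a t1 by (simp_all add: t0_def)
    qed
    have t0I: "t0 \<in> I" using t0 t1 t by auto
    obtain u0 v0 where uv: "\<And>c d. dist (pt c t0) (pt d t0) \<le> dist (pt u0 t0) (pt v0 t0)"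
      by (rule distance_attained[OF t0I]) (rule that)
    define L where "L = dist (pt u0 t0) (pt v0 t0)"
    \<comment> \<open>The upper bound for squared distances drops at rate \<open>2 * \<rho>\<close>
      and stays nonnegative up to \<open>T\<close>, so the diameter at \<open>t0\<close> bounds the
      remaining lifetime.\<close>
    have shrink: "2 * \<rho> * (T - t0) \<le> L\<^sup>2"
    proof (rule field_le_epsilon)
      fix e :: real assume e: "e > 0"
      define s where "s = max t1 (T - e / (2 * \<rho>))"
      have s: "t0 \<le> s" "s < T" "T - s \<le> e / (2 * \<rho>)" using e \<rho> t0 t1 by (auto simp: s_def)
      have "(dist (pt u0 s) (pt u0 t0))\<^sup>2 \<le> L\<^sup>2 - 2 * \<rho> * (s - t0)"
        by (rule pt_distance_shrink[of t0 s]) (use t0 t s r uv in \<open>auto simp: L_def\<close>)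
      then have "2 * \<rho> * (s - t0) \<le> L\<^sup>2" using zero_le_power2[of "dist (pt u0 s) (pt u0 t0)"] by linarith
      moreover have "2 * \<rho> * (T - s) \<le> e" using s(3) \<rho> by (simp add: field_simps)
      ultimately show "2 * \<rho> * (T - t0) \<le> L\<^sup>2 + e" by (simp add: algebra_simps)
    qed
    have L: "L > 0"
    proof -
      have "L\<^sup>2 > 0" using less_le_trans[OF _ shrink, of 0] \<rho> t0 t1 by simp
      then show ?thesis by (simp add: L_def)
    qed
    have "fat \<eta> t0" by (rule f) (use t0 t1 in auto)
    moreover have "0 < r2 u t0" for u using less_le_trans[OF \<rho>(1) r[of t0 u]] t0 t1 by simp
    ultimately obtain G where G: "G \<in> K t0" "\<And>c. \<eta> * L / 6 \<le> dist (pt c t0) G" "\<And>c. dist (pt c t0) G \<le> L"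
      using fat_centroid[OF t0I _ L uv[folded L_def] L_def[symmetric] _ \<eta>(1)] by metis
    define R where "R = \<eta> * L / 6"
    have R: "R > 0" using \<eta> L by (simp add: R_def)
    define c where "c = sqrt \<rho> * R / 4"
    have c: "c > 0" using \<rho> R by (simp add: c_def)
    have c2: "c\<^sup>2 = \<rho> * \<eta>\<^sup>2 * L\<^sup>2 / 576" using \<rho> by (simp add: c_def R_def power_mult_distrib power_divide)
    have tc: "t1 - t0 \<le> c\<^sup>2"
    proof -
      have "t1 - t0 \<le> a * (T - t0)" using a t0 by simp
      also have "\<dots> = \<rho> * \<eta>\<^sup>2 / 576 * (2 * \<rho> * (T - t0))" by (simp add: a_def power2_eq_square)
      also have "\<dots> \<le> \<rho> * \<eta>\<^sup>2 / 576 * L\<^sup>2" using shrink \<rho> \<eta> by (intro mult_left_mono) auto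
      finally show ?thesis by (simp add: c2)
    qed
    have cR: "c\<^sup>2 \<le> R\<^sup>2 / 16"
      using \<rho> by (simp add: c_def power_mult_distrib power_divide mult_right_mono[of \<rho> 1 "R\<^sup>2", simplified])
    have far: "R / 2 < dist (pt k s) G" if s: "s \<in> {t0..t1}" for k s
    proof -
      have "(dist (pt k s) G)\<^sup>2 \<ge> R\<^sup>2 - 2 * (s - t0)"
        by (rule pt_distance_decay[of t0 t1]) (use t0 t t1 G R s in \<open>auto simp: R_def\<close>)
      moreover have "2 * (s - t0) \<le> R\<^sup>2 / 8" using cR tc s by auto
      moreover have "R\<^sup>2 > 0" using R by simp
      moreover have "(R / 2)\<^sup>2 = R\<^sup>2 / 4" by (simp add: power_divide)
      ultimately have "(R / 2)\<^sup>2 < (dist (pt k s) G)\<^sup>2" by linarith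
      then show ?thesis by (rule power2_less_imp_less) simp
    qed
    define P where "P = (\<lambda>u t. \<sigma> * (S x u t * (snd G - y u t) - S y u t * (fst G - x u t)))"
    have lower: "2 * c \<le> P k s" if s: "s \<in> {t0..t1}" for k s
    proof -
      have sI: "s \<in> I" using s t0 t1 t by auto
      have GK: "G \<in> K s"
      proof -
        have "G \<in> interior (K s)"
        proof (rule stays_inside[of t0 s])
          show "pt u t \<noteq> G" if "t \<in> {t0..s}" for u t
            using far[of t u] that s R by auto
        qed (use G t0 t t1 s in auto)
        then show ?thesis using interior_subset by blast
      qed
      define D1 where "D1 = sqrt (r2 k s)"
      have D1: "D1 > 0" "D1\<^sup>2 = r2 k s" "sqrt \<rho> \<le> D1"
        using r[of s k] s t0 t1 \<rho> by (auto simp: D1_def)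
      define j where "j = R / 2 / D1"
      \<comment> \<open>The point of the disc of radius \<open>R / 2\<close> about \<open>G\<close>
        that is nearest to the tangent line at \<open>k\<close>. It lies in the hull, so
        \<open>P\<close> is at least \<open>R / 2\<close> times the projected speed.\<close>
      define m where "m = (fst G + \<sigma> * j * S y k s, snd G - \<sigma> * j * S x k s)"
      have "(dist m G)\<^sup>2 = (\<sigma> * j * S y k s)\<^sup>2 + (\<sigma> * j * S x k s)\<^sup>2"
        by (cases G) (simp add: m_def dist_Pair_Pair dist_real_def)
      also have "\<dots> = \<sigma>\<^sup>2 * j\<^sup>2 * r2 k s" by (simp add: r2_def power_mult_distrib algebra_simps)
      also have "\<sigma>\<^sup>2 = 1" using \<sigma>(1) by auto
      also have "1 * j\<^sup>2 * r2 k s = (R / 2)\<^sup>2" using D1 by (simp add: j_def power_divide D1(2)[symmetric])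
      finally have "dist m G = R / 2" using R by (simp add: power2_eq_iff_nonneg)
      then have mK: "m \<in> K s" by (intro disc_in_K[OF sI GK far[OF s]]) auto
      have "0 \<le> \<sigma> * (S x k s * (snd m - y k s) - S y k s * (fst m - x k s))"
        by (rule cross_K[OF _ mK]) (use \<sigma>(2) s t0 t1 in auto)
      also have "\<dots> = P k s - (\<sigma> * \<sigma>) * j * r2 k s"
        unfolding P_def m_def r2_def by (simp add: power2_eq_square algebra_simps)
      also have "\<sigma> * \<sigma> = 1" using \<sigma>(1) by auto
      also have "1 * j * r2 k s = R / 2 * D1" using D1(1) unfolding D1(2)[symmetric] by (simp add: j_def power2_eq_square)
      finally have "R / 2 * D1 \<le> P k s" by simp
      moreover have "R / 2 * sqrt \<rho> \<le> R / 2 * D1" using D1 R by (intro mult_left_mono) auto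
      ultimately show ?thesis by (simp add: c_def)
    qed
    have "(t1 - t0) * q u t1 \<le> 9 / c\<^sup>2 * (P u t1 - c)\<^sup>2"
      by (rule curvature_support_bound[OF _ t0(2) t1(2) acc \<sigma>(1) _ P_def lower c tc]) (use t0 t t1 \<sigma>(2) in auto)
    also have "\<dots> \<le> 9 / c\<^sup>2 * L\<^sup>2"
    proof -
      have t1I: "t1 \<in> I" using t0I t0 t1 by auto
      have "(dist (pt u t1) G)\<^sup>2 \<le> L\<^sup>2 - 2 * \<rho> * (t1 - t0)"
        by (rule pt_distance_shrink[of t0 t1]) (use t0 t t1 r G in auto)
      moreover have "2 * \<rho> * (t1 - t0) \<ge> 0" using \<rho> t0 by simp
      ultimately have 1: "(dist (pt u t1) G)\<^sup>2 \<le> L\<^sup>2" by linarith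
      have d2: "(dist (pt u t1) G)\<^sup>2 = (fst G - x u t1)\<^sup>2 + (snd G - y u t1)\<^sup>2"
        by (cases G) (simp add: pt_def dist_Pair_Pair dist_real_def power2_commute)
      have "(P u t1)\<^sup>2 = \<sigma>\<^sup>2 * (S x u t1 * (snd G - y u t1) - S y u t1 * (fst G - x u t1))\<^sup>2"
        by (simp add: P_def power_mult_distrib)
      also have "\<sigma>\<^sup>2 = 1" using \<sigma>(1) by auto
      also have "1 * (S x u t1 * (snd G - y u t1) - S y u t1 * (fst G - x u t1))\<^sup>2
        = r2 u t1 * (dist (pt u t1) G)\<^sup>2 - (S x u t1 * (fst G - x u t1) + S y u t1 * (snd G - y u t1))\<^sup>2"
        unfolding d2 r2_def by algebra
      also have "\<dots> \<le> r2 u t1 * (dist (pt u t1) G)\<^sup>2" by simp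
      also have "\<dots> \<le> 1 * L\<^sup>2" using 1 r2_le[OF t1I] by (intro mult_mono) auto
      finally have 2: "(P u t1)\<^sup>2 \<le> L\<^sup>2" by simp
      have "0 \<le> P u t1 - c" "P u t1 - c \<le> P u t1" using lower[of t1 u] c t0 by auto
      then have "(P u t1 - c)\<^sup>2 \<le> (P u t1)\<^sup>2" by (rule power_mono[rotated])
      then show ?thesis using 2 c by (intro mult_left_mono) auto
    qed
    also have "\<dots> = 5184 / (\<rho> * \<eta>\<^sup>2)" using L \<rho> \<eta> by (simp add: c2)
    finally have "a * (q u t1 * (T - t1)) \<le> 5184 / (\<rho> * \<eta>\<^sup>2)" unfolding t0(3) by (simp add: mult.commute mult.left_commute)
    then have "a * (q u t1 * (T - t1)) / a \<le> 5184 / (\<rho> * \<eta>\<^sup>2) / a" using a by (intro divide_right_mono) auto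
    then show ?thesis using a by simp
  qed
  moreover have "t2 < T" using a t by (simp add: t2_def field_simps)
  ultimately show ?thesis using that by blast
qed

end

text \<open>After \<open>ts\<close> the constants are found in turn: \<open>\<rho>\<close> for the
  projected speed, \<open>\<eta>\<close> for the shape, and from both the bound for the curvature.
  The cuts at 1 meet the normalization of these estimates.\<close>

theorem convex_projection_type_I:
  fixes \<gamma> :: "real \<Rightarrow> real \<Rightarrow> real^'n::finite"
  assumes ij: "ix \<noteq> iy" and csf: "csf \<gamma> T"
    and init: "one_to_one_convex_projection ix iy (\<lambda>u. \<gamma> u 0)"
  shows "type_I \<gamma> T"
proof -
  obtain D where D: "partials_on UNIV {0..<T} \<gamma> D"
    using csf unfolding csf_def smooth_on2_def by blast
  interpret csf_flow \<gamma> T D by (rule csf_flow.intro[OF csf D])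
  interpret planar_flow \<gamma> T D "X ix" "X iy" by (rule planar_flow_of_initial(1)[OF ij init])
  obtain ts where ts: "0 < ts" "ts < T" and nd: "\<And>t. 0 < t \<Longrightarrow> t \<le> ts \<Longrightarrow> nondegenerate t"
    using planar_flow_of_initial(2)[OF ij init] unfolding nondegenerate_def by blast
  obtain \<rho>0 where \<rho>0: "\<rho>0 > 0" "\<And>u t. ts \<le> t \<Longrightarrow> t < T \<Longrightarrow> \<rho>0 \<le> r2 u t"
    by (rule projection_speed_bound[OF ts], erule (1) nd, rule that)
  define \<rho> where "\<rho> = min \<rho>0 1"
  have \<rho>: "0 < \<rho>" "\<rho> \<le> 1" using \<rho>0(1) by (simp_all add: \<rho>_def)
  have r: "\<rho> \<le> r2 u t" if "ts \<le> t" "t < T" for u t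
    using \<rho>0(2)[OF that, of u] by (simp add: \<rho>_def)
  have nd': "nondegenerate t" if "ts \<le> t" "t < T" for t
    by (rule nondegenerate_of_speed) (use that ts less_le_trans[OF \<rho>(1) r] in auto)
  obtain \<eta>0 where \<eta>0: "\<eta>0 > 0" "\<And>t. ts \<le> t \<Longrightarrow> t < T \<Longrightarrow> fat \<eta>0 t"
    by (rule uniformly_fat[OF ts \<rho>], erule (1) r, erule (1) nd', rule that)
  define \<eta> where "\<eta> = min \<eta>0 1"
  have \<eta>: "0 < \<eta>" "\<eta> \<le> 1" using \<eta>0(1) by (simp_all add: \<eta>_def)
  have f: "fat \<eta> t" if "ts \<le> t" "t < T" for t
    by (rule fat_mono[OF \<eta>0(2)[OF that]]) (simp add: \<eta>_def)
  have acc: "(S (S (X ix)) u t)\<^sup>2 + (S (S (X iy)) u t)\<^sup>2 \<le> q u t" for u t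
  proof -
    have "(\<Sum>i\<in>{ix, iy}. (S (S (X i)) u t)\<^sup>2) \<le> q u t"
      unfolding q_def by (intro sum_mono2) auto
    then show ?thesis using ij by simp
  qed
  obtain C t2 where C: "t2 < T" "\<And>u t. t2 < t \<Longrightarrow> t < T \<Longrightarrow> q u t * (T - t) \<le> C"
    by (rule type_one_bound[OF ts \<rho> acc], erule (1) r, erule (1) f, rule \<eta>(1), rule \<eta>(2), rule that)
  have "\<forall>\<^sub>F t in at_left T. (SUP u. ereal ((curvature \<gamma> u t)\<^sup>2 * (T - t))) \<le> ereal C"
    unfolding eventually_at_left_field
  proof (intro exI[of _ "max t2 0"] conjI allI impI)
    show "max t2 0 < T" using C(1) ts by simp
    fix t assume "max t2 0 < t" "t < T"
    then show "(SUP u. ereal ((curvature \<gamma> u t)\<^sup>2 * (T - t))) \<le> ereal C"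
      by (intro SUP_least) (use C(2)[of t] curvature_sq[of t] in auto)
  qed
  then have "Limsup (at_left T) (\<lambda>t. SUP u. ereal ((curvature \<gamma> u t)\<^sup>2 * (T - t))) \<le> ereal C"
    by (rule Limsup_bounded)
  then show ?thesis unfolding type_I_def by (auto simp: le_less_trans)
qed

theorem theorem1p16:
  fixes \<gamma> :: "real \<Rightarrow> real \<Rightarrow> real^'n::finite" and T :: real and ix iy :: 'n
  assumes "ix \<noteq> iy"
    and "maximal_csf \<gamma> T"
    and "one_to_one_convex_projection ix iy (\<lambda>u. \<gamma> u 0)"
    and "uniform_limit UNIV (\<lambda>t u. \<gamma> u t) (\<lambda>_. 0) (at_left T)"
    and "type_II \<gamma> T"
  shows "(\<forall>L\<^sub>1. limit_line ix iy \<gamma> T L\<^sub>1 \<longrightarrow>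
            (\<exists>L\<^sub>2. limit_line ix iy \<gamma> T L\<^sub>2 \<and> L\<^sub>2 \<noteq> L\<^sub>1 \<and>
               (\<forall>x\<in>Pxy ix iy ` L\<^sub>1. \<forall>y\<in>Pxy ix iy ` L\<^sub>2. orthogonal x y)))
         \<and> tangent_flows_nonunique \<gamma> T"
proof -
  have "csf \<gamma> T" using assms(2) by (simp add: maximal_csf_def)
  from convex_projection_type_I[OF assms(1) this assms(3)] have "type_I \<gamma> T" .
  then show ?thesis using assms(5) by (simp add: type_II_def)
qed

end
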